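(* Let $\Psi=(T,\phi,r,\chi)$ be a $D^\times$-datum and $s=r/2$. If $T$ is unramified, then $$\mathrm{Res}_{\mathcal O_D^\times}\pi(\Psi)\cong\mathrm{Ind}_{T_0D^\times_s}^{\mathcal O_D^\times}\rho(\Psi)\oplus\mathrm{Ind}_{T_0D^\times_s}^{\mathcal O_D^\times}\rho(\overline{\Psi})$$ is a decomposition into irreducible inequivalent representations of $\mathcal O_D^\times$, whereas if $T$ is ramified, then $$\mathrm{Res}_{\mathcal O_D^\times}\pi(\Psi)\cong\mathrm{Ind}_{T_0D^\times_s}^{\mathcal O_D^\times}\rho(\Psi)$$ is irreducible. (Here $\rho(\Psi)$, $\rho(\overline\Psi)$ are restricted to $T_0D_s^\times$ before inducing.)
   Context: Quaternion algebra. $F$ is a non-archimedean local field with integer ring $\mathcal O_F$, uniformizer $\varpi$, maximal ideal $\mathcal P_F$, valuation $\mathrm{val}$ with $\mathrm{val}(\varpi)=1$, residual characteristic $p\ne2$. $\varepsilon\in\mathcal O_F^\times$ is a fixed nonsquare, and $D=\langle 1,i,j,k\mid i^2=\varepsilon,\ j^2=\varpi,\ k^2=-\varepsilon\varpi,\ ij=k=-ji\rangle$ is the quaternion division algebra over $F$. $z\mapsto\bar z$ is the canonical anti-involution, $\mathrm{nrd}(z)=z\bar z$, $\mathcal O_D=\{z:\mathrm{nrd}(z)\in\mathcal O_F\}$, and $\mathrm{val}_D$ extends $\mathrm{val}$. Filtrations: $D^\times_0=\mathcal O_D^\times$ and, for $r>0$, $D^\times_r=\{g:\mathrm{val}_D(g-1)\ge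 r\}$, $D^\times_{r+}=\{g:\mathrm{val}_D(g-1)>r\}$. The reduced building of $D^\times$ is a single point $y$. Maximal tori of $D^\times$ are $T=E^\times$ with $E\subset D$ quadratic over $F$; $T$ is called (un)ramified if $E/F$ is. $T_0=T\cap\mathcal O_D^\times$, $T_r=T\cap D^\times_r$. For each $T=E^\times$ there is $\sigma\in D^\times$ with $\sigma z\sigma^{-1}=\bar z$ for all $z\in E$. Data. Fix an additive character $\psi$ of $F$, trivial on $\mathcal P_F$ and nontrivial on $\mathcal O_F$, with extensions $\psi_E$ to extensions $E/F$, trivial on the maximal ideal. For $r>0$ there is the Moy–Prasad isomorphism $e:\mathfrak t_r/\mathfrak t_{r+}\to T_r/T_{r+}$; a quasi-character $\phi$ of $T$ of depth $r>0$ satisfies $\phi(e(X))=\psi(\langle X^*,X\rangle)$ on $T_r$ for some $X^*\in\mathfrak t^*_{-r}$; $\phi$ is $D^\times$-generic of depth $r$ if $\mathrm{val}_E(\langle X^*,d\alpha^\vee(1)\rangle)=-r$ for every root $\alpha$ of $T$ over the splitting field $E$. A $D^\times$-datum is $\Psi=(T,\phi,r,\chi)$ with $T$ a maximal torus of $D^\times$, $\phi$ a $D^\times$-generic quasi-character of $T$ of depth $r>0$, and $\chi$ a quasi-character of $D^\times$ (i.e. of $F^\times$ via $\mathrm{nrd}$), trivial or of depth $\ge r$. $\overline\Psi={}^\sigma\Psi=(T,\bar\phi,r,\chi)$, with $\bar\phi(z)=\phi(\bar z)$. Heisenberg–Weil lift. Fix an isomorphism $\kappa:\mu_p\subset\mathbb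 C^\times\to\mathbb F_p$. For a symplectic $\mathbb F_p$-space $W$, $W^\sharp=W\times\mathbb F_p$ has product $(w,z)(w',z')=(w+w',z+z'+\frac12\langle w,w'\rangle)$. An irreducible representation $\tau$ of $W^\sharp$ with nontrivial central character extends to a representation $(\tau_S,\tau)$ of $\mathrm{Sp}(W)\ltimes W^\sharp$, the Heisenberg–Weil lift; it is unique except when $p=3$, $\dim W=2$, in which case one takes the designated extension attached to the central character (the standard Schrödinger-model Weil representation). Construction of the representation $\widetilde\rho$ of $TG_s$ from $(T,\phi,r)$, where $G=D^\times=\mathbb G(F)$, $G_s=D^\times_s$. Let $E$ be a splitting field of $T=\mathbb T(F)$, $\Phi=\Phi(\mathbb G,\mathbb T,E)$, $J(E)=\langle\mathbb T(E)_r,\mathbb G_\alpha(E)_{y,s}:\alpha\in\Phi\rangle$, $J_+(E)=\langle\mathbb T(E)_r,\mathbb G_\alpha(E)_{y,s+}:\alpha\in\Phi\rangle$. With $X^*$ realizing $\phi$, extension of scalars and $\psi_E\circ e$ give a character $\phi_E$ of $\mathbb T(E)_r/\mathbb T(E)_{r+}$ restricting to $\phi$ on $T_r$; extend it trivially across the $\mathbb G_\alpha(E)_{y,s+}$ to a character $\widehat{\phi_E}$ of $J_+(E)$. Let $N(E)=\ker\widehat{\phi_E}$, and let $J,J_+,N$ be the intersections with $G$ of $J(E),J_+(E),N(E)$; $\widehat\phi=\mathrm{Res}_{J_+}\widehat{\phi_E}$. One has $TJ=TG_s$. If $J(E)=J_+(E)$, $\widetilde\rho$ is the unique character of $TJ$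 extending $\phi$ and $\widehat\phi$. Otherwise $H=J/N$ is a Heisenberg group with centre $Z_H=J_+/N$, and $W=J/J_+$ is symplectic via $\langle hZ_H,h'Z_H\rangle=\kappa(\widehat\phi([h,h']))$. A special isomorphism $\nu:H\to W^\sharp$, $\nu(h)=(hZ_H,\mu(h))$, is obtained by restricting to $H$ the map on $J(E)/N(E)$ given by $\mu(g)=\kappa(\widehat{\phi_E}(g_0))+\frac12\langle g_+,g_-\rangle$, where $g=g_+g_-g_0$ with $g_\pm$ in the subgroups lifting the spans of the positive/negative root spaces and $g_0$ central. Let $f:T\to\mathrm{Sp}(W)$ be the conjugation action, $\tau$ a Heisenberg representation of $H$ with central character $\widehat\phi$, $(\tau_S,\tau)$ its Heisenberg–Weil lift via $\nu$, $\omega(t,h)=\tau_S(f(t))\tau(h)$, and $\widetilde\rho(th)=\phi(t)\omega(t,h)$ for $t\in T,h\in J$. Set $\rho(\Psi)=\chi\widetilde\rho$, a representation of $TD^\times_s$, and $\pi(\Psi)=\text{c-Ind}_{TD^\times_s}^{D^\times}\rho(\Psi)$, an irreducible representation of $D^\times$. *)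

theory Defs
  imports
    "HOL-Analysis.Analysis"
    "HOL-Algebra.Bij"
    "HOL-Algebra.Elementary_Groups"
    "HOL-Number_Theory.Residues"
    "HOL-Library.Function_Algebras"
begin

section \<open>The local field and the quaternion division algebra\<close>

text \<open>The valuation is normalised, with value \<open>\<infinity>\<close> at \<open>0\<close>.\<close>

locale local_field =
  fixes val :: "'f::field \<Rightarrow> ereal"
  assumes val_eq_infinity: "\<And>x. val x = \<infinity> \<longleftrightarrow> x = 0"
    and val_int: "\<And>x. x \<noteq> 0 \<Longrightarrow> \<exists>n::int. val x = ereal (of_int n)"
    and val_mult: "\<And>x y. val (x * y) = val x + val y"
    and val_add: "\<And>x y. min (val x) (val y) \<le> val (x + y)"
    and val_surj: "\<exists>x. val x = 1"
    and complete: "\<And>(X :: nat \<Rightarrow> 'f).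
          (\<forall>n::nat. \<exists>N. \<forall>k\<ge>N. \<forall>l\<ge>N. ereal (real n) \<le> val (X k - X l)) \<Longrightarrow>
          \<exists>L. \<forall>n::nat. \<exists>N. \<forall>k\<ge>N. ereal (real n) \<le> val (X k - L)"
    and finite_residue_field:
          "finite ({x. 0 \<le> val x} // {(x, y). 0 \<le> val x \<and> 0 \<le> val y \<and> 0 < val (x - y)})"

text \<open>
  A record of this type presents the type \<open>'d\<close> as the quaternion algebra over the field \<open>'f\<close>
  (embedded by \<open>emb\<close>) with generators \<open>qi\<close>, \<open>qj\<close>, where
  \<open>qi\<^sup>2 = eps\<close>, \<open>qj\<^sup>2 = unif\<close> and \<open>k = qi qj = - qj qi\<close>.
\<close>

record ('f, 'd) quat_alg =
  fval :: "'f \<Rightarrow> ereal"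
  emb :: "'f \<Rightarrow> 'd"
  eps :: 'f
  unif :: 'f
  qi :: 'd
  qj :: 'd

definition quat :: "('f, 'd::division_ring) quat_alg \<Rightarrow> 'f \<Rightarrow> 'f \<Rightarrow> 'f \<Rightarrow> 'f \<Rightarrow> 'd" where
  "quat Q a b c d = emb Q a + emb Q b * qi Q + emb Q c * qj Q + emb Q d * (qi Q * qj Q)"

locale quaternion_division_algebra =
  fixes Q :: "('f::field, 'd::division_ring) quat_alg"
  assumes local_field: "local_field (fval Q)"
    and eps_unit: "fval Q (eps Q) = 0"
    and eps_nonsquare: "\<nexists>x. x ^ 2 = eps Q"
    and unif_val: "fval Q (unif Q) = 1"
    and emb_one: "emb Q 1 = 1"
    and emb_add: "\<And>x y. emb Q (x + y) = emb Q x + emb Q y"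
    and emb_mult: "\<And>x y. emb Q (x * y) = emb Q x * emb Q y"
    and emb_central: "\<And>x z. emb Q x * z = z * emb Q x"
    and qi_square: "qi Q * qi Q = emb Q (eps Q)"
    and qj_square: "qj Q * qj Q = emb Q (unif Q)"
    and anticommute: "qi Q * qj Q = - (qj Q * qi Q)"
    and coordinates: "\<And>z. \<exists>!(a, b, c, d). z = quat Q a b c d"

definition qconj :: "('f::field, 'd::division_ring) quat_alg \<Rightarrow> 'd \<Rightarrow> 'd" where
  "qconj Q z = (THE w. \<exists>a b c d. z = quat Q a b c d \<and> w = quat Q a (- b) (- c) (- d))"

definition nrd :: "('f::field, 'd::division_ring) quat_alg \<Rightarrow> 'd \<Rightarrow> 'f" where
  "nrd Q z = (THE n. emb Q n = z * qconj Q z)"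

text \<open>The factor \<open>1/2\<close> makes \<open>valD\<close> extend the valuation of the base field.\<close>

definition valD :: "('f::field, 'd::division_ring) quat_alg \<Rightarrow> 'd \<Rightarrow> ereal" where
  "valD Q z = fval Q (nrd Q z) / 2"

definition mult_grp :: "'a::division_ring monoid" where
  "mult_grp = \<lparr>carrier = {x. x \<noteq> 0}, mult = (*), one = 1\<rparr>"

abbreviation Dgrp :: "'d::division_ring set \<Rightarrow> 'd monoid" where
  "Dgrp H \<equiv> mult_grp\<lparr>carrier := H\<rparr>"

abbreviation Dunits :: "'d::division_ring set" where
  "Dunits \<equiv> carrier mult_grp"

definition OD :: "('f::field, 'd::division_ring) quat_alg \<Rightarrow> 'd set" where
  "OD Q = {z. 0 \<le> fval Q (nrd Q z)}"

definition OD_units :: "('f::field, 'd::division_ring) quat_alg \<Rightarrow> 'd set" where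
  "OD_units Q = {z \<in> OD Q. \<exists>w \<in> OD Q. z * w = 1 \<and> w * z = 1}"

text \<open>Both filtration groups are only used for positive depth.\<close>

definition Dfil :: "('f::field, 'd::division_ring) quat_alg \<Rightarrow> real \<Rightarrow> 'd set" where
  "Dfil Q r = {g. ereal r \<le> valD Q (g - 1)}"

definition Dfil_plus :: "('f::field, 'd::division_ring) quat_alg \<Rightarrow> real \<Rightarrow> 'd set" where
  "Dfil_plus Q r = {g. ereal r < valD Q (g - 1)}"

definition Dtop :: "('f::field, 'd::division_ring) quat_alg \<Rightarrow> 'd topology" where
  "Dtop Q = topology (\<lambda>U. \<forall>x\<in>U. \<exists>n::nat. {y. ereal (real n) \<le> valD Q (y - x)} \<subseteq> U)"

lemma openin_Dtop:
  fixes Q :: "('f::field, 'd::division_ring) quat_alg"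
  shows "openin (Dtop Q) U \<longleftrightarrow> (\<forall>x\<in>U. \<exists>n::nat. {y. ereal (real n) \<le> valD Q (y - x)} \<subseteq> U)"
proof -
  let ?L = "\<lambda>U. \<forall>x\<in>U. \<exists>n::nat. {y. ereal (real n) \<le> valD Q (y - x)} \<subseteq> U"
  have mono: "{y. ereal (real (max m n)) \<le> v y} \<subseteq> {y. ereal (real m) \<le> v y}
      \<and> {y. ereal (real (max m n)) \<le> v y} \<subseteq> {y. ereal (real n) \<le> v y}"
    for m n :: nat and v :: "'d \<Rightarrow> ereal"
    by (auto intro: order_trans[rotated])
  have "?L (S \<inter> T)" if S: "?L S" and T: "?L T" for S T
  proof
    fix x assume "x \<in> S \<inter> T"
    then obtain m n where mn:
      "{y. ereal (real m) \<le> valD Q (y - x)} \<subseteq> S" "{y. ereal (real n) \<le> valD Q (y - x)} \<subseteq> T"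
      using S T by (meson IntD1 IntD2)
    have "{y. ereal (real (max m n)) \<le> valD Q (y - x)} \<subseteq> S \<inter> T"
      using mono[of m n "\<lambda>y. valD Q (y - x)"] mn by blast
    then show "\<exists>n::nat. {y. ereal (real n) \<le> valD Q (y - x)} \<subseteq> S \<inter> T" ..
  qed
  moreover have "?L (\<Union>\<K>)" if "\<forall>K\<in>\<K>. ?L K" for \<K>
    using that by (meson Union_iff Sup_upper subset_trans)
  ultimately have "istopology ?L"
    unfolding istopology_def by blast
  then show ?thesis
    unfolding Dtop_def by (simp add: topology_inverse')
qed


section \<open>Complex representations\<close>

text \<open>
  The group is kept out of the record: the restriction of a representation to a subgroup
  is the same record considered over the smaller group.
\<close>

record ('g, 'v) rep =
  rscale :: "complex \<Rightarrow> 'v \<Rightarrow> 'v"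
  rspace :: "'v set"
  ract :: "'g \<Rightarrow> 'v \<Rightarrow> 'v"

definition is_rep :: "('g, 'm) monoid_scheme \<Rightarrow> ('g, 'v::ab_group_add) rep \<Rightarrow> bool" where
  "is_rep G R \<longleftrightarrow>
     vector_space (rscale R) \<and> module.subspace (rscale R) (rspace R) \<and>
     (\<forall>g\<in>carrier G. \<forall>v\<in>rspace R. ract R g v \<in> rspace R) \<and>
     (\<forall>g\<in>carrier G. \<forall>v\<in>rspace R. \<forall>w\<in>rspace R. ract R g (v + w) = ract R g v + ract R g w) \<and>
     (\<forall>g\<in>carrier G. \<forall>c. \<forall>v\<in>rspace R. ract R g (rscale R c v) = rscale R c (ract R g v)) \<and>
     (\<forall>v\<in>rspace R. ract R \<one>\<^bsub>G\<^esub> v = v) \<and>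
     (\<forall>g\<in>carrier G. \<forall>h\<in>carrier G. \<forall>v\<in>rspace R. ract R (g \<otimes>\<^bsub>G\<^esub> h) v = ract R g (ract R h v))"

definition irreducible_rep :: "('g, 'm) monoid_scheme \<Rightarrow> ('g, 'v::ab_group_add) rep \<Rightarrow> bool" where
  "irreducible_rep G R \<longleftrightarrow>
     is_rep G R \<and> rspace R \<noteq> {0} \<and>
     (\<forall>U. module.subspace (rscale R) U \<and> U \<subseteq> rspace R \<and> (\<forall>g\<in>carrier G. ract R g ` U \<subseteq> U)
          \<longrightarrow> U = {0} \<or> U = rspace R)"

definition rep_iso ::
  "('g, 'm) monoid_scheme \<Rightarrow> ('g, 'v::ab_group_add) rep \<Rightarrow> ('g, 'w::ab_group_add) rep \<Rightarrow> bool" where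
  "rep_iso G R S \<longleftrightarrow>
     is_rep G R \<and> is_rep G S \<and>
     (\<exists>f. bij_betw f (rspace R) (rspace S) \<and>
          (\<forall>v\<in>rspace R. \<forall>w\<in>rspace R. f (v + w) = f v + f w) \<and>
          (\<forall>c. \<forall>v\<in>rspace R. f (rscale R c v) = rscale S c (f v)) \<and>
          (\<forall>g\<in>carrier G. \<forall>v\<in>rspace R. f (ract R g v) = ract S g (f v)))"

definition rep_sum :: "('g, 'v) rep \<Rightarrow> ('g, 'w) rep \<Rightarrow> ('g, 'v \<times> 'w) rep" where
  "rep_sum R S =
     \<lparr>rscale = (\<lambda>c (v, w). (rscale R c v, rscale S c w)),
      rspace = rspace R \<times> rspace S,
      ract = (\<lambda>g (v, w). (ract R g v, ract S g w))\<rparr>"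

definition twist :: "('g \<Rightarrow> complex) \<Rightarrow> ('g, 'v) rep \<Rightarrow> ('g, 'v) rep" where
  "twist \<eta> R = R\<lparr>ract := (\<lambda>g v. rscale R (\<eta> g) (ract R g v))\<rparr>"

text \<open>
  Smooth induction between subgroups \<open>H \<subseteq> G\<close> of the multiplicative group; functions on \<open>G\<close> are
  extended by zero, and \<open>G\<close> acts by right translation.  The groups \<open>Dfil Q n\<close>, \<open>n > 0\<close>, are a
  base of neighbourhoods of 1.
\<close>

definition ind ::
  "('f::field, 'd::division_ring) quat_alg \<Rightarrow> 'd set \<Rightarrow> 'd set \<Rightarrow>
   ('d, 'v::ab_group_add) rep \<Rightarrow> ('d, 'd \<Rightarrow> 'v) rep" where
  "ind Q G H R =
     \<lparr>rscale = (\<lambda>c f x. rscale R c (f x)),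
      rspace = {f. (\<forall>g. g \<notin> G \<longrightarrow> f g = 0) \<and> (\<forall>g\<in>G. f g \<in> rspace R) \<and>
                   (\<forall>h\<in>H. \<forall>g\<in>G. f (h * g) = ract R h (f g)) \<and>
                   (\<exists>n::nat. 0 < n \<and> (\<forall>g\<in>G. \<forall>k\<in>G \<inter> Dfil Q (real n). f (g * k) = f g))},
      ract = (\<lambda>g f x. f (x * g))\<rparr>"

definition cind ::
  "('f::field, 'd::division_ring) quat_alg \<Rightarrow> 'd set \<Rightarrow> 'd set \<Rightarrow>
   ('d, 'v::ab_group_add) rep \<Rightarrow> ('d, 'd \<Rightarrow> 'v) rep" where
  "cind Q G H R = (ind Q G H R)
     \<lparr>rspace := {f \<in> rspace (ind Q G H R).
        \<exists>C. compactin (Dtop Q) C \<and> C \<subseteq> G \<and> {g. f g \<noteq> 0} \<subseteq> H <#>\<^bsub>mult_grp\<^esub> C}\<rparr>"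


section \<open>Characters, tori and data\<close>

text \<open>
  A homomorphism into the nonzero complex numbers is continuous iff it is trivial near 1, since the
  groups \<open>Dfil Q n\<close> are a base of neighbourhoods of 1 and the target has no small subgroups.
\<close>

definition quasi_character ::
  "('f::field, 'd::division_ring) quat_alg \<Rightarrow> 'd set \<Rightarrow> ('d \<Rightarrow> complex) \<Rightarrow> bool" where
  "quasi_character Q H \<phi> \<longleftrightarrow>
     \<phi> \<in> hom (Dgrp H) mult_grp \<and> (\<exists>n::nat. 0 < n \<and> (\<forall>g\<in>H \<inter> Dfil Q (real n). \<phi> g = 1))"

definition has_depth ::
  "('f::field, 'd::division_ring) quat_alg \<Rightarrow> 'd set \<Rightarrow> ('d \<Rightarrow> complex) \<Rightarrow> real \<Rightarrow> bool" where
  "has_depth Q H \<phi> r \<longleftrightarrow>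
     (\<forall>g\<in>H \<inter> Dfil_plus Q r. \<phi> g = 1) \<and> (\<exists>g\<in>H \<inter> Dfil Q r. \<phi> g \<noteq> 1)"

definition quadratic_subfield :: "('f::field, 'd::division_ring) quat_alg \<Rightarrow> 'd set \<Rightarrow> bool" where
  "quadratic_subfield Q E \<longleftrightarrow>
     range (emb Q) \<subseteq> E \<and>
     (\<forall>x\<in>E. \<forall>y\<in>E. x - y \<in> E \<and> x * y \<in> E \<and> x * y = y * x) \<and>
     (\<forall>x\<in>E. inverse x \<in> E) \<and>
     vector_space.dim (\<lambda>a z. emb Q a * z) E = 2"

definition maximal_torus :: "('f::field, 'd::division_ring) quat_alg \<Rightarrow> 'd set \<Rightarrow> bool" where
  "maximal_torus Q T \<longleftrightarrow> (\<exists>E. quadratic_subfield Q E \<and> T = E - {0})"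

definition torus_field :: "'d::division_ring set \<Rightarrow> 'd set" where
  "torus_field T = insert 0 T"

text \<open>
  Ramification index one; the residue field extension is separable since residue fields are finite.
\<close>

definition unramified :: "('f::field, 'd::division_ring) quat_alg \<Rightarrow> 'd set \<Rightarrow> bool" where
  "unramified Q T \<longleftrightarrow> valD Q ` T = fval Q ` (UNIV - {0})"

abbreviation ramified :: "('f::field, 'd::division_ring) quat_alg \<Rightarrow> 'd set \<Rightarrow> bool" where
  "ramified Q T \<equiv> \<not> unramified Q T"

text \<open>The conditions imply that \<open>\<psi>\<close> is continuous, and likewise for its extensions.\<close>

definition additive_character ::
  "('f::field, 'd::division_ring) quat_alg \<Rightarrow> ('f \<Rightarrow> complex) \<Rightarrow> bool" where
  "additive_character Q \<psi> \<longleftrightarrow>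
     (\<forall>x. \<psi> x \<noteq> 0) \<and> (\<forall>x y. \<psi> (x + y) = \<psi> x * \<psi> y) \<and>
     (\<forall>x. 0 < fval Q x \<longrightarrow> \<psi> x = 1) \<and> (\<exists>x. 0 \<le> fval Q x \<and> \<psi> x \<noteq> 1)"

definition extends_character ::
  "('f::field, 'd::division_ring) quat_alg \<Rightarrow> ('f \<Rightarrow> complex) \<Rightarrow> 'd set \<Rightarrow> ('d \<Rightarrow> complex) \<Rightarrow> bool" where
  "extends_character Q \<psi> E \<psi>E \<longleftrightarrow>
     (\<forall>x\<in>E. \<psi>E x \<noteq> 0) \<and> (\<forall>x\<in>E. \<forall>y\<in>E. \<psi>E (x + y) = \<psi>E x * \<psi>E y) \<and>
     (\<forall>a. \<psi>E (emb Q a) = \<psi> a) \<and> (\<forall>x\<in>E. 0 < valD Q x \<longrightarrow> \<psi>E x = 1)"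

text \<open>
  The Lie algebra of \<open>T = E\<^sup>\<times>\<close> is \<open>E\<close>, with \<open>\<tt>\<^sub>r\<close> the elements of valuation at least \<open>r\<close>, and the
  Moy--Prasad isomorphism is \<open>x \<mapsto> 1 + x\<close>.  An element of the dual of depth at least \<open>-r\<close> is a
  linear functional mapping \<open>\<tt>\<^sub>r\<^sub>+\<close> to the maximal ideal.
\<close>

definition realizes ::
  "('f::field, 'd::division_ring) quat_alg \<Rightarrow> ('f \<Rightarrow> complex) \<Rightarrow> 'd set \<Rightarrow> ('d \<Rightarrow> complex) \<Rightarrow>
   real \<Rightarrow> ('d \<Rightarrow> 'f) \<Rightarrow> bool" where
  "realizes Q \<psi> E \<phi> r X \<longleftrightarrow>
     (\<forall>x\<in>E. \<forall>y\<in>E. X (x + y) = X x + X y) \<and>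
     (\<forall>a. \<forall>x\<in>E. X (emb Q a * x) = a * X x) \<and>
     (\<forall>x\<in>E. ereal r < valD Q x \<longrightarrow> 0 < fval Q (X x)) \<and>
     (\<forall>x\<in>E. ereal r \<le> valD Q x \<longrightarrow> \<phi> (1 + x) = \<psi> (X x))"

definition mat2 :: "'d \<Rightarrow> 'd \<Rightarrow> 'd \<Rightarrow> 'd \<Rightarrow> 'd::zero^2^2" where
  "mat2 a b c d = vector [vector [a, b], vector [c, d]]"

text \<open>
  The field \<open>E\<close> itself splits \<open>T = E\<^sup>\<times>\<close>.  Let \<open>\<sigma>\<close> be a nonzero element with
  \<open>\<sigma> z \<sigma>\<^sup>-\<^sup>1 = qconj z\<close> on \<open>E\<close>.  Then \<open>D\<close> is a right \<open>E\<close>-vector space with basis \<open>1, \<sigma>\<close>, and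
  left multiplication identifies \<open>D \<otimes> E\<close> with the \<open>2 \<times> 2\<close> matrices over \<open>E\<close>; \<open>iota\<close> is the
  resulting embedding of \<open>D\<close>.  It maps \<open>z \<in> E\<close> to the diagonal matrix with entries \<open>z, qconj z\<close>.
  Hence over \<open>E\<close> the torus becomes the diagonal torus, and its Lie algebra the diagonal matrices.
\<close>

definition conj_element ::
  "('f::field, 'd::division_ring) quat_alg \<Rightarrow> 'd set \<Rightarrow> 'd \<Rightarrow> bool" where
  "conj_element Q E \<sigma> \<longleftrightarrow> \<sigma> \<noteq> 0 \<and> (\<forall>z\<in>E. \<sigma> * z * inverse \<sigma> = qconj Q z)"

definition iota :: "'d::division_ring set \<Rightarrow> 'd \<Rightarrow> 'd \<Rightarrow> 'd^2^2" where
  "iota E \<sigma> z =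
     (THE A. \<exists>a\<in>E. \<exists>b\<in>E. \<exists>c\<in>E. \<exists>d\<in>E. A = mat2 a b c d \<and> z = a + \<sigma> * c \<and> z * \<sigma> = b + \<sigma> * d)"

text \<open>The \<open>E\<close>-linear extension of a functional on \<open>E\<close> to \<open>E \<otimes> E\<close>, seen as diagonal matrices.\<close>

definition extends_scalars ::
  "('f::field, 'd::division_ring) quat_alg \<Rightarrow> 'd set \<Rightarrow> ('d \<Rightarrow> 'f) \<Rightarrow> ('d^2^2 \<Rightarrow> 'd) \<Rightarrow> bool" where
  "extends_scalars Q E X XE \<longleftrightarrow>
     (\<forall>a\<in>E. \<forall>d\<in>E. XE (mat2 a 0 0 d) \<in> E) \<and>
     (\<forall>a\<in>E. \<forall>d\<in>E. \<forall>a'\<in>E. \<forall>d'\<in>E.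
        XE (mat2 (a + a') 0 0 (d + d')) = XE (mat2 a 0 0 d) + XE (mat2 a' 0 0 d')) \<and>
     (\<forall>c\<in>E. \<forall>a\<in>E. \<forall>d\<in>E. XE (mat2 (c * a) 0 0 (c * d)) = c * XE (mat2 a 0 0 d)) \<and>
     (\<forall>z\<in>E. XE (mat2 z 0 0 (qconj Q z)) = emb Q (X z))"

text \<open>The elements \<open>d\<alpha>\<^sup>\<or>(1)\<close> for the two roots are the diagonal matrices with entries \<open>\<plusminus>(1, -1)\<close>.\<close>

definition generic_character ::
  "('f::field, 'd::division_ring) quat_alg \<Rightarrow> ('f \<Rightarrow> complex) \<Rightarrow> 'd set \<Rightarrow> ('d \<Rightarrow> complex) \<Rightarrow>
   real \<Rightarrow> bool" where
  "generic_character Q \<psi> T \<phi> r \<longleftrightarrow>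
     (\<exists>X XE. realizes Q \<psi> (torus_field T) \<phi> r X \<and> extends_scalars Q (torus_field T) X XE \<and>
        valD Q (XE (mat2 1 0 0 (- 1))) = ereal (- r) \<and>
        valD Q (XE (mat2 (- 1) 0 0 1)) = ereal (- r))"

record 'd datum =
  torus :: "'d set"
  qchar :: "'d \<Rightarrow> complex"
  depth :: real
  twisting :: "'d \<Rightarrow> complex"

definition is_datum ::
  "('f::field, 'd::division_ring) quat_alg \<Rightarrow> ('f \<Rightarrow> complex) \<Rightarrow> 'd datum \<Rightarrow> bool" where
  "is_datum Q \<psi> \<Psi> \<longleftrightarrow>
     maximal_torus Q (torus \<Psi>) \<and> 0 < depth \<Psi> \<and>
     quasi_character Q (torus \<Psi>) (qchar \<Psi>) \<and>
     has_depth Q (torus \<Psi>) (qchar \<Psi>) (depth \<Psi>) \<and>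
     generic_character Q \<psi> (torus \<Psi>) (qchar \<Psi>) (depth \<Psi>) \<and>
     quasi_character Q Dunits (twisting \<Psi>) \<and>
     ((\<forall>g\<in>Dunits. twisting \<Psi> g = 1) \<or>
      (\<exists>d\<ge>depth \<Psi>. has_depth Q Dunits (twisting \<Psi>) d))"

definition conj_datum ::
  "('f::field, 'd::division_ring) quat_alg \<Rightarrow> 'd datum \<Rightarrow> 'd datum" where
  "conj_datum Q \<Psi> = \<Psi>\<lparr>qchar := (\<lambda>z. qchar \<Psi> (qconj Q z))\<rparr>"


section \<open>Heisenberg--Weil lifts\<close>

text \<open>The field with \<open>p\<close> elements is the set \<open>{0..<p}\<close> of integers with arithmetic modulo \<open>p\<close>.\<close>

definition mu_group :: "nat \<Rightarrow> complex monoid" where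
  "mu_group p = \<lparr>carrier = {z. z ^ p = 1}, mult = (*), one = 1\<rparr>"

definition half_mod :: "nat \<Rightarrow> int" where
  "half_mod p = (int p + 1) div 2"

definition sharp :: "nat \<Rightarrow> 'w monoid \<Rightarrow> ('w \<Rightarrow> 'w \<Rightarrow> int) \<Rightarrow> ('w \<times> int) monoid" where
  "sharp p W B =
     \<lparr>carrier = carrier W \<times> {0..<int p},
      mult = (\<lambda>(w, z) (w', z'). (w \<otimes>\<^bsub>W\<^esub> w', (z + z' + half_mod p * B w w') mod int p)),
      one = (\<one>\<^bsub>W\<^esub>, 0)\<rparr>"

text \<open>For \<open>W\<close> of exponent \<open>p\<close>, group automorphisms are the linear ones.\<close>

definition Sp_group :: "'w monoid \<Rightarrow> ('w \<Rightarrow> 'w \<Rightarrow> int) \<Rightarrow> ('w \<Rightarrow> 'w) monoid" where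
  "Sp_group W B =
     (AutoGroup W)\<lparr>carrier := {g \<in> auto W. \<forall>w\<in>carrier W. \<forall>w'\<in>carrier W. B (g w) (g w') = B w w'}\<rparr>"

text \<open>
  The standard Schroedinger--Weil model for a symplectic plane with symplectic basis \<open>e, f\<close> and
  central character \<open>\<zeta>\<close>, acting on functions on the field with \<open>p\<close> elements.  In terms of functions,
  \<open>(x e + y f, z)\<close> acts by \<open>h(u) \<mapsto> \<zeta>(z + y u + x y / 2) h(u + x)\<close>, and the generators of the
  symplectic group act by multiplication by \<open>\<zeta>(-c u\<^sup>2 / 2)\<close>, by \<open>h(u) \<mapsto> (a/p) h(u / a)\<close> and by
  the Fourier transform normalised by a Gauss sum.  The formulas below are for the basis
  \<open>b v\<close> corresponding to the point masses.
\<close>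

definition schroedinger_weil ::
  "nat \<Rightarrow> 'w monoid \<Rightarrow> ('w \<Rightarrow> 'w \<Rightarrow> int) \<Rightarrow> ('w \<times> int, 'v::ab_group_add) rep \<Rightarrow>
   (('w \<Rightarrow> 'w) \<Rightarrow> 'v \<Rightarrow> 'v) \<Rightarrow> bool" where
  "schroedinger_weil p W B \<tau> \<tau>S \<longleftrightarrow>
     (\<exists>e\<in>carrier W. \<exists>f\<in>carrier W. \<exists>(b :: int \<Rightarrow> 'v) (\<zeta> :: int \<Rightarrow> complex).
        B e f = 1 \<and> B f e = int p - 1 \<and>
        (\<forall>z. \<zeta> z = \<zeta> (z mod int p)) \<and>
        inj_on b {0..<int p} \<and> \<not> module.dependent (rscale \<tau>) (b ` {0..<int p}) \<and>
        module.span (rscale \<tau>) (b ` {0..<int p}) = rspace \<tau> \<and>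
        (\<forall>x\<in>{0..<int p}. \<forall>y\<in>{0..<int p}. \<forall>z\<in>{0..<int p}. \<forall>v\<in>{0..<int p}.
           ract \<tau> (e [^]\<^bsub>W\<^esub> x \<otimes>\<^bsub>W\<^esub> f [^]\<^bsub>W\<^esub> y, z) (b v) =
           rscale \<tau> (\<zeta> (z + y * v - half_mod p * x * y)) (b ((v - x) mod int p))) \<and>
        (\<forall>g\<in>carrier (Sp_group W B). \<forall>c. g e = e \<otimes>\<^bsub>W\<^esub> f [^]\<^bsub>W\<^esub> c \<and> g f = f \<longrightarrow>
           (\<forall>v\<in>{0..<int p}. \<tau>S g (b v) = rscale \<tau> (\<zeta> (- half_mod p * c * v ^ 2)) (b v))) \<and>
        (\<forall>g\<in>carrier (Sp_group W B). \<forall>a a' :: int.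
           [a * a' = 1] (mod int p) \<and> g e = e [^]\<^bsub>W\<^esub> a \<and> g f = f [^]\<^bsub>W\<^esub> a' \<longrightarrow>
           (\<forall>v\<in>{0..<int p}. \<tau>S g (b v) = rscale \<tau> (of_int (Legendre a (int p))) (b ((a * v) mod int p)))) \<and>
        (\<forall>g\<in>carrier (Sp_group W B). g e = inv\<^bsub>W\<^esub> f \<and> g f = e \<longrightarrow>
           (\<forall>v\<in>{0..<int p}. \<tau>S g (b v) =
              (\<Sum>u\<in>{0..<int p}.
                 rscale \<tau> (\<zeta> (u * v) / (\<Sum>t\<in>{0..<int p}. \<zeta> (- half_mod p * t ^ 2))) (b u)))))"

text \<open>
  \<open>(w, z), g \<mapsto> \<tau>S g \<circ> \<tau> (w, z)\<close> is a representation of the semidirect product extending \<open>\<tau>\<close>.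
  The last condition selects the designated extension in the only case where it is not unique;
  there, \<open>W\<close> being of dimension 2 means that it has \<open>p\<^sup>2\<close> elements.
\<close>

definition heisenberg_weil_lift ::
  "nat \<Rightarrow> 'w monoid \<Rightarrow> ('w \<Rightarrow> 'w \<Rightarrow> int) \<Rightarrow> ('w \<times> int, 'v::ab_group_add) rep \<Rightarrow>
   (('w \<Rightarrow> 'w) \<Rightarrow> 'v \<Rightarrow> 'v) \<Rightarrow> bool" where
  "heisenberg_weil_lift p W B \<tau> \<tau>S \<longleftrightarrow>
     is_rep (sharp p W B) \<tau> \<and>
     is_rep (Sp_group W B) \<lparr>rscale = rscale \<tau>, rspace = rspace \<tau>, ract = \<tau>S\<rparr> \<and>
     (\<forall>g\<in>carrier (Sp_group W B). \<forall>(w, z)\<in>carrier (sharp p W B). \<forall>v\<in>rspace \<tau>.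
        \<tau>S g (ract \<tau> (w, z) v) = ract \<tau> (g w, z) (\<tau>S g v)) \<and>
     (p = 3 \<and> card (carrier W) = p ^ 2 \<longrightarrow> schroedinger_weil p W B \<tau> \<tau>S)"


section \<open>The groups \<open>J\<close>, \<open>J\<^sub>+\<close>, \<open>N\<close>\<close>

definition GL2 :: "'d::division_ring set \<Rightarrow> ('d^2^2) monoid" where
  "GL2 E =
     \<lparr>carrier = {A. (\<forall>i j. A $ i $ j \<in> E) \<and>
                    (\<exists>B. (\<forall>i j. B $ i $ j \<in> E) \<and> A ** B = mat 1 \<and> B ** A = mat 1)},
      mult = (**), one = mat 1\<rparr>"

definition torusE ::
  "('f::field, 'd::division_ring) quat_alg \<Rightarrow> 'd set \<Rightarrow> real \<Rightarrow> ('d^2^2) set" where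
  "torusE Q E r =
     {mat2 a 0 0 d | a d. a \<in> E \<and> d \<in> E \<and> ereal r \<le> valD Q (a - 1) \<and> ereal r \<le> valD Q (d - 1)}"

text \<open>
  In the building over \<open>E\<close>, the point \<open>y\<close> is the norm on the right \<open>E\<close>-space \<open>D\<close> given by \<open>valD\<close>,
  which is the minimum of \<open>valD a\<close> and \<open>valD b + valD \<sigma>\<close> at \<open>a + \<sigma> b\<close>.  A root element \<open>u\<close> has depth
  at least \<open>t\<close> at \<open>y\<close> iff \<open>u - 1\<close> raises this norm by at least \<open>t\<close>.
\<close>

definition root_pos ::
  "('f::field, 'd::division_ring) quat_alg \<Rightarrow> 'd set \<Rightarrow> 'd \<Rightarrow> real \<Rightarrow> ('d^2^2) set" where
  "root_pos Q E \<sigma> t = {mat2 1 c 0 1 | c. c \<in> E \<and> ereal t + valD Q \<sigma> \<le> valD Q c}"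

definition root_neg ::
  "('f::field, 'd::division_ring) quat_alg \<Rightarrow> 'd set \<Rightarrow> 'd \<Rightarrow> real \<Rightarrow> ('d^2^2) set" where
  "root_neg Q E \<sigma> t = {mat2 1 0 c 1 | c. c \<in> E \<and> ereal t \<le> valD Q c + valD Q \<sigma>}"

definition JE ::
  "('f::field, 'd::division_ring) quat_alg \<Rightarrow> 'd set \<Rightarrow> 'd \<Rightarrow> real \<Rightarrow> ('d^2^2) set" where
  "JE Q E \<sigma> r =
     generate (GL2 E) (torusE Q E r \<union> root_pos Q E \<sigma> (r / 2) \<union> root_neg Q E \<sigma> (r / 2))"

definition JE_plus ::
  "('f::field, 'd::division_ring) quat_alg \<Rightarrow> 'd set \<Rightarrow> 'd \<Rightarrow> real \<Rightarrow> ('d^2^2) set" where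
  "JE_plus Q E \<sigma> r =
     generate (GL2 E)
       (torusE Q E r \<union> (\<Union>t\<in>{r / 2<..}. root_pos Q E \<sigma> t) \<union> (\<Union>t\<in>{r / 2<..}. root_neg Q E \<sigma> t))"

text \<open>\<open>\<theta>\<close> is the character of \<open>JE_plus\<close> obtained from the functional \<open>X\<close> realizing \<open>\<phi>\<close>.\<close>

definition phiE_hat ::
  "('f::field, 'd::division_ring) quat_alg \<Rightarrow> ('d \<Rightarrow> complex) \<Rightarrow> 'd set \<Rightarrow> 'd \<Rightarrow> real \<Rightarrow>
   ('d \<Rightarrow> 'f) \<Rightarrow> ('d^2^2 \<Rightarrow> complex) \<Rightarrow> bool" where
  "phiE_hat Q \<psi>E E \<sigma> r X \<theta> \<longleftrightarrow>
     \<theta> \<in> hom ((GL2 E)\<lparr>carrier := JE_plus Q E \<sigma> r\<rparr>) mult_grp \<and>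
     (\<exists>XE. extends_scalars Q E X XE \<and>
        (\<forall>a d. mat2 a 0 0 d \<in> torusE Q E r \<longrightarrow>
           \<theta> (mat2 a 0 0 d) = \<psi>E (XE (mat2 (a - 1) 0 0 (d - 1))))) \<and>
     (\<forall>t>r / 2. \<forall>u\<in>root_pos Q E \<sigma> t \<union> root_neg Q E \<sigma> t. \<theta> u = 1)"

definition J_grp ::
  "('f::field, 'd::division_ring) quat_alg \<Rightarrow> 'd set \<Rightarrow> 'd \<Rightarrow> real \<Rightarrow> 'd set" where
  "J_grp Q E \<sigma> r = {g \<in> Dunits. iota E \<sigma> g \<in> JE Q E \<sigma> r}"

definition J_plus ::
  "('f::field, 'd::division_ring) quat_alg \<Rightarrow> 'd set \<Rightarrow> 'd \<Rightarrow> real \<Rightarrow> 'd set" where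
  "J_plus Q E \<sigma> r = {g \<in> Dunits. iota E \<sigma> g \<in> JE_plus Q E \<sigma> r}"

definition N_grp ::
  "('f::field, 'd::division_ring) quat_alg \<Rightarrow> 'd set \<Rightarrow> 'd \<Rightarrow> real \<Rightarrow> ('d^2^2 \<Rightarrow> complex) \<Rightarrow> 'd set" where
  "N_grp Q E \<sigma> r \<theta> = {g \<in> J_plus Q E \<sigma> r. \<theta> (iota E \<sigma> g) = 1}"

definition H_grp ::
  "('f::field, 'd::division_ring) quat_alg \<Rightarrow> 'd set \<Rightarrow> 'd \<Rightarrow> real \<Rightarrow> ('d^2^2 \<Rightarrow> complex) \<Rightarrow> 'd set monoid" where
  "H_grp Q E \<sigma> r \<theta> = Dgrp (J_grp Q E \<sigma> r) Mod N_grp Q E \<sigma> r \<theta>"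

definition W_grp ::
  "('f::field, 'd::division_ring) quat_alg \<Rightarrow> 'd set \<Rightarrow> 'd \<Rightarrow> real \<Rightarrow> 'd set monoid" where
  "W_grp Q E \<sigma> r = Dgrp (J_grp Q E \<sigma> r) Mod J_plus Q E \<sigma> r"

definition comm :: "('g, 'm) monoid_scheme \<Rightarrow> 'g \<Rightarrow> 'g \<Rightarrow> 'g" where
  "comm G g h = g \<otimes>\<^bsub>G\<^esub> h \<otimes>\<^bsub>G\<^esub> inv\<^bsub>G\<^esub> g \<otimes>\<^bsub>G\<^esub> inv\<^bsub>G\<^esub> h"

text \<open>The form does not depend on the chosen representatives.\<close>

definition W_form ::
  "(complex \<Rightarrow> int) \<Rightarrow> 'd::division_ring set \<Rightarrow> 'd \<Rightarrow> ('d^2^2 \<Rightarrow> complex) \<Rightarrow> 'd set \<Rightarrow> 'd set \<Rightarrow> int" where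
  "W_form \<kappa> E \<sigma> \<theta> w w' = \<kappa> (\<theta> (iota E \<sigma> (comm mult_grp (SOME h. h \<in> w) (SOME h. h \<in> w'))))"

text \<open>
  The decomposition is required in \<open>JE\<close> itself rather than modulo the kernel of \<open>\<theta>\<close>,
  which is contained in \<open>JE_plus\<close> and so can be absorbed in \<open>g\<^sub>0\<close>.
\<close>

definition mu ::
  "('f::field, 'd::division_ring) quat_alg \<Rightarrow> nat \<Rightarrow> (complex \<Rightarrow> int) \<Rightarrow> 'd set \<Rightarrow> 'd \<Rightarrow> real \<Rightarrow>
   ('d^2^2 \<Rightarrow> complex) \<Rightarrow> 'd^2^2 \<Rightarrow> int" where
  "mu Q p \<kappa> E \<sigma> r \<theta> g =
     (THE m. \<exists>g\<^sub>p\<in>root_pos Q E \<sigma> (r / 2). \<exists>g\<^sub>n\<in>root_neg Q E \<sigma> (r / 2). \<exists>g\<^sub>0\<in>JE_plus Q E \<sigma> r.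
        g = g\<^sub>p ** g\<^sub>n ** g\<^sub>0 \<and>
        m = (\<kappa> (\<theta> g\<^sub>0) + half_mod p * \<kappa> (\<theta> (comm (GL2 E) g\<^sub>p g\<^sub>n))) mod int p)"

definition special_iso ::
  "('f::field, 'd::division_ring) quat_alg \<Rightarrow> nat \<Rightarrow> (complex \<Rightarrow> int) \<Rightarrow> 'd set \<Rightarrow> 'd \<Rightarrow> real \<Rightarrow>
   ('d^2^2 \<Rightarrow> complex) \<Rightarrow> 'd set \<Rightarrow> 'd set \<times> int" where
  "special_iso Q p \<kappa> E \<sigma> r \<theta> x =
     (let h = (SOME h. h \<in> x) in
      (J_plus Q E \<sigma> r #>\<^bsub>mult_grp\<^esub> h, mu Q p \<kappa> E \<sigma> r \<theta> (iota E \<sigma> h)))"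

definition conj_action ::
  "('f::field, 'd::division_ring) quat_alg \<Rightarrow> 'd set \<Rightarrow> 'd \<Rightarrow> real \<Rightarrow> 'd \<Rightarrow> 'd set \<Rightarrow> 'd set" where
  "conj_action Q E \<sigma> r t = (\<lambda>w\<in>carrier (W_grp Q E \<sigma> r). (\<lambda>h. t * h * inverse t) ` w)"

definition heisenberg_rep ::
  "('f::field, 'd::division_ring) quat_alg \<Rightarrow> 'd set \<Rightarrow> 'd \<Rightarrow> real \<Rightarrow> ('d^2^2 \<Rightarrow> complex) \<Rightarrow>
   ('d set, 'v::ab_group_add) rep \<Rightarrow> bool" where
  "heisenberg_rep Q E \<sigma> r \<theta> \<tau> \<longleftrightarrow>
     irreducible_rep (H_grp Q E \<sigma> r \<theta>) \<tau> \<and>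
     (\<forall>h\<in>J_plus Q E \<sigma> r. \<forall>v\<in>rspace \<tau>.
        ract \<tau> (N_grp Q E \<sigma> r \<theta> #>\<^bsub>mult_grp\<^esub> h) v = rscale \<tau> (\<theta> (iota E \<sigma> h)) v)"

text \<open>
  \<open>R\<close> is a representation obtained by the construction from \<open>(T, \<phi>, r)\<close>; it depends on choices
  (of \<open>\<sigma>\<close>, \<open>X\<close>, and \<open>\<tau>\<close> within its isomorphism class) only up to isomorphism.
\<close>

definition is_rho_tilde ::
  "('f::field, 'd::division_ring) quat_alg \<Rightarrow> nat \<Rightarrow> (complex \<Rightarrow> int) \<Rightarrow> ('f \<Rightarrow> complex) \<Rightarrow>
   ('d set \<Rightarrow> 'd \<Rightarrow> complex) \<Rightarrow> 'd set \<Rightarrow> ('d \<Rightarrow> complex) \<Rightarrow> real \<Rightarrow>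
   ('d, 'v::ab_group_add) rep \<Rightarrow> bool" where
  "is_rho_tilde Q p \<kappa> \<psi> \<psi>ext T \<phi> r R \<longleftrightarrow>
     (let E = torus_field T in
      \<exists>\<sigma> X \<theta>. conj_element Q E \<sigma> \<and> realizes Q \<psi> E \<phi> r X \<and> phiE_hat Q (\<psi>ext E) E \<sigma> r X \<theta> \<and>
        is_rep (Dgrp (T <#>\<^bsub>mult_grp\<^esub> J_grp Q E \<sigma> r)) R \<and>
        (if JE Q E \<sigma> r = JE_plus Q E \<sigma> r then
           vector_space.dim (rscale R) (rspace R) = 1 \<and>
           (\<forall>t\<in>T. \<forall>v\<in>rspace R. ract R t v = rscale R (\<phi> t) v) \<and>
           (\<forall>h\<in>J_grp Q E \<sigma> r. \<forall>v\<in>rspace R. ract R h v = rscale R (\<theta> (iota E \<sigma> h)) v)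
         else
           \<exists>\<tau> \<tau>S.
             rscale \<tau> = rscale R \<and> rspace \<tau> = rspace R \<and>
             heisenberg_rep Q E \<sigma> r \<theta> \<tau> \<and>
             heisenberg_weil_lift p (W_grp Q E \<sigma> r) (W_form \<kappa> E \<sigma> \<theta>)
               \<lparr>rscale = rscale \<tau>, rspace = rspace \<tau>,
                ract = (\<lambda>y. ract \<tau>
                  (inv_into (carrier (H_grp Q E \<sigma> r \<theta>)) (special_iso Q p \<kappa> E \<sigma> r \<theta>) y))\<rparr> \<tau>S \<and>
             (\<forall>t\<in>T. \<forall>h\<in>J_grp Q E \<sigma> r. \<forall>v\<in>rspace R.
                ract R (t * h) v =
                rscale R (\<phi> t)
                  (\<tau>S (conj_action Q E \<sigma> r t) (ract \<tau> (N_grp Q E \<sigma> r \<theta> #>\<^bsub>mult_grp\<^esub> h) v)))))"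

definition is_rho ::
  "('f::field, 'd::division_ring) quat_alg \<Rightarrow> nat \<Rightarrow> (complex \<Rightarrow> int) \<Rightarrow> ('f \<Rightarrow> complex) \<Rightarrow>
   ('d set \<Rightarrow> 'd \<Rightarrow> complex) \<Rightarrow> 'd datum \<Rightarrow> ('d, 'v::ab_group_add) rep \<Rightarrow> bool" where
  "is_rho Q p \<kappa> \<psi> \<psi>ext \<Psi> R \<longleftrightarrow>
     (\<exists>R\<^sub>0. is_rho_tilde Q p \<kappa> \<psi> \<psi>ext (torus \<Psi>) (qchar \<Psi>) (depth \<Psi>) R\<^sub>0 \<and>
           R = twist (twisting \<Psi>) R\<^sub>0)"

definition TDs :: "('f::field, 'd::division_ring) quat_alg \<Rightarrow> 'd datum \<Rightarrow> 'd set" where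
  "TDs Q \<Psi> = torus \<Psi> <#>\<^bsub>mult_grp\<^esub> Dfil Q (depth \<Psi> / 2)"

definition T0Ds :: "('f::field, 'd::division_ring) quat_alg \<Rightarrow> 'd datum \<Rightarrow> 'd set" where
  "T0Ds Q \<Psi> = (torus \<Psi> \<inter> OD_units Q) <#>\<^bsub>mult_grp\<^esub> Dfil Q (depth \<Psi> / 2)"

text \<open>The representation \<open>\<pi>(\<Psi>)\<close> obtained from \<open>R = \<rho>(\<Psi>)\<close>.\<close>

definition pi_rep ::
  "('f::field, 'd::division_ring) quat_alg \<Rightarrow> 'd datum \<Rightarrow> ('d, 'v::ab_group_add) rep \<Rightarrow>
   ('d, 'd \<Rightarrow> 'v) rep" where
  "pi_rep Q \<Psi> R = cind Q Dunits (TDs Q \<Psi>) R"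

end

theory Submission
  imports Defs "HOL-Computational_Algebra.Fundamental_Theorem_Algebra"
begin

text \<open>
  Write \<open>D = E + E \<sigma>\<close>, where \<open>perp = E \<sigma>\<close> consists of the \<open>y\<close> with \<open>y z = qconj z y\<close> for \<open>z\<close> in \<open>E\<close>.  On \<open>J\<^sub>+\<close> the representation \<open>\<rho>(\<Psi>)\<close> is the scalar \<open>\<phi>\<close> of the component in \<open>E\<close>, and genericity
  shows that any \<open>g\<close> outside \<open>T D\<^sub>s\<close> conjugates some element of \<open>J\<^sub>+\<close> into \<open>J\<^sub>+\<close> changing this scalar.
  This gives irreducibility of the induced representations and, applied to \<open>\<sigma> g\<close>, their inequivalence.
  The restriction is governed by the double cosets \<open>T \ D / O\<^sub>D\<close>: one if \<open>E\<close> is ramified, and two, represented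
  by \<open>1\<close> and \<open>\<sigma>\<^sup>-\<^sup>1\<close>, if it is not.  In the second case the \<open>\<sigma>\<close>-conjugate of \<open>\<rho>(\<Psi>)\<close> has to be identified
  with \<open>\<rho>\<close> of the conjugate datum.  Both restrict to isomorphic irreducible representations of \<open>J\<close>; the
  isomorphism commutes with the Weil operators of all isometries of the complement up to a character, which
  is trivial on the isometries coming from \<open>T\<close> since these satisfy \<open>x\<^bsup>q\<^esup> = x\<close> for a power \<open>q\<close> of \<open>p\<close> whereas
  the character has values of order dividing \<open>p\<close>.
\<close>

section \<open>Valuations and square roots\<close>

text \<open>The statement does not single out \<rho>(\<Psi>) and \<rho> of the conjugate datum: each
  comes with its own \<sigma>, functional, Heisenberg representation and Weil lift, and nothing ties
  these choices together. The obstacle is to compare two arbitrary lifts. It is met by leaving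
  Sp(W), whose form depends on those choices, for maps of the complement that preserve
  \<open>x * y - y * x\<close>; these are common to all choices. For h = a + y the central
  coordinate of the special isomorphism becomes an explicit function of
  \<open>a - 1 - y^2 / 2\<close>, and lifting a map to J so that this quantity is kept turns it into
  an automorphism of J modulo the kernel. That the comparison character has values of order dividing
  p rests on SL_2 over the integers of F being generated by unipotent matrices, whose p-th powers
  act trivially on W; the argument is the same for p = 3. Isomorphisms over J come from averaging a
  rank one map over J / J+. Finite dimension of the Heisenberg representation is not presupposed: it
  follows from J+ acting by scalars and J / J+ being finite.\<close>

locale valuation =
  fixes val :: "'a::division_ring \<Rightarrow> ereal"
  assumes val_infinity: "val x = \<infinity> \<longleftrightarrow> x = 0"
    and val_not_MInfty: "val x \<noteq> - \<infinity>"
    and val_mult: "val (x * y) = val x + val y"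
    and val_add: "min (val x) (val y) \<le> val (x + y)"
begin

lemma val_zero [simp]: "val 0 = \<infinity>"
  using val_infinity by blast

lemma val_real:
  assumes "x \<noteq> 0"
  obtains a where "val x = ereal a"
  using assms val_infinity[of x] val_not_MInfty[of x] by (cases "val x") auto

lemma val_one [simp]: "val 1 = 0"
proof -
  obtain a where a: "val 1 = ereal a"
    using val_real[of 1] zero_neq_one by metis
  have "val 1 = val 1 + val 1"
    using val_mult[of 1 1] by simp
  then show ?thesis
    using a by (simp add: zero_ereal_def)
qed

lemma val_minus [simp]: "val (- x) = val x"
proof -
  obtain a where a: "val (- 1) = ereal a"
    using val_real[of "- 1"] by (metis neg_equal_0_iff_equal zero_neq_one)
  have "val (- 1) + val (- 1) = 0"
    using val_mult[of "- 1" "- 1"] by simp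
  then have "val (- 1) = 0"
    using a by (simp add: zero_ereal_def)
  then show ?thesis
    using val_mult[of "- 1" x] by simp
qed

lemma val_add_ge: "t \<le> val x \<Longrightarrow> t \<le> val y \<Longrightarrow> t \<le> val (x + y)"
  using val_add[of x y] by (meson min.boundedI order_trans)

lemma val_add_gt: "t < val x \<Longrightarrow> t < val y \<Longrightarrow> t < val (x + y)"
  using val_add[of x y] by (meson less_le_trans min_less_iff_conj)

lemma val_diff_ge: "t \<le> val x \<Longrightarrow> t \<le> val y \<Longrightarrow> t \<le> val (x - y)"
  using val_add_ge[of t x "- y"] by simp

lemma val_diff_gt: "t < val x \<Longrightarrow> t < val y \<Longrightarrow> t < val (x - y)"
  using val_add_gt[of t x "- y"] by simp

lemma val_mult_ge: "t \<le> val x \<Longrightarrow> u \<le> val y \<Longrightarrow> t + u \<le> val (x * y)"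
  by (simp add: val_mult add_mono)

lemma val_mult_gt:
  assumes "ereal t < val x" and "ereal u \<le> val y"
  shows "ereal (t + u) < val (x * y)" "ereal (t + u) < val (y * x)"
  using assms by (cases "val x"; cases "val y"; simp add: val_mult)+

lemma val_minus_commute: "val (x - y) = val (y - x)"
  using val_minus[of "x - y"] by simp

text \<open>If \<open>val (x + y)\<close> exceeded \<open>val x\<close>, then
  \<open>x = (x + y) - y\<close> would be a sum of two terms of larger valuation.\<close>

lemma val_add_eq: "val x < val y \<Longrightarrow> val (x + y) = val x"
  using val_add[of x y] val_add[of "x + y" "- y"] by (auto simp: min_def split: if_splits)

lemma val_inverse:
  assumes "x \<noteq> 0"
  shows "val (inverse x) = - val x"
proof -
  obtain a b where "val x = ereal a" "val (inverse x) = ereal b"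
    using val_real[OF assms] val_real[of "inverse x"] assms by (metis nonzero_imp_inverse_nonzero)
  moreover have "val x + val (inverse x) = 0"
    using val_mult[of x "inverse x"] assms by simp
  ultimately show ?thesis
    by (simp add: zero_ereal_def)
qed

lemma val_power: "val x = ereal a \<Longrightarrow> val (x ^ n) = ereal (of_nat n * a)"
  by (induction n) (auto simp: val_mult zero_ereal_def algebra_simps)

lemma val_power_unit: "val x = 0 \<Longrightarrow> val (x ^ n) = 0"
  by (induction n) (auto simp: val_mult)

lemma val_of_nat_nonneg: "0 \<le> val (of_nat n)"
  by (induction n) (auto intro!: val_add_ge)

lemma val_sub_one_pos_imp_val_zero: "0 < val (x - 1) \<Longrightarrow> val x = 0"
  using val_add_eq[of 1 "x - 1"] by simp

lemma val_conjugate: "g \<noteq> 0 \<Longrightarrow> val (g * x * inverse g) = val x"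
  using val_infinity[of g] val_not_MInfty[of g]
  by (cases "val g"; cases "val x") (auto simp: val_mult val_inverse)

end

text \<open>\<open>valuation\<close> is stated over division rings so that the same facts serve F
  here and D later.\<close>

sublocale local_field \<subseteq> valuation val
proof
  show "val x \<noteq> - \<infinity>" for x
    using val_int[of x] val_eq_infinity[of x] by (cases "x = 0") auto
qed (use val_eq_infinity val_mult val_add in auto)

context local_field
begin

lemma val_int_cases:
  assumes "x \<noteq> 0"
  obtains n :: int where "val x = ereal (of_int n)"
  using val_int[OF assms] by blast

lemma val_pos_imp_ge_one: "0 < val x \<Longrightarrow> 1 \<le> val x"
  by (cases "x = 0", simp, erule val_int_cases) (auto simp: one_ereal_def)

text \<open>For odd p the element 1 is p minus a multiple of 2, so 2 and p cannot both lie in the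
  maximal ideal.\<close>

lemma val_two:
  assumes "prime p" and "p \<noteq> 2" and "0 < val (of_nat p)"
  shows "val 2 = 0"
proof -
  have "odd p"
    using assms prime_odd_nat prime_ge_2_nat[of p] by force
  then obtain k where k: "p = 2 * k + 1"
    by (elim oddE)
  have "\<not> 0 < val 2"
  proof
    assume "0 < val 2"
    then have "0 < val (2 * of_nat k)"
      using val_of_nat_nonneg[of k] by (simp add: val_mult add_pos_nonneg)
    then have "0 < val (of_nat p - 2 * of_nat k)"
      using assms(3) by (rule val_diff_gt[rotated])
    then show False
      by (simp add: k)
  qed
  then show ?thesis
    using val_of_nat_nonneg[of 2] by simp
qed

lemma val_all_ints: "\<exists>x. x \<noteq> 0 \<and> val x = ereal (of_int k)"
proof -
  obtain u where u: "val u = ereal 1"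
    using val_surj by (auto simp: one_ereal_def)
  then have u0: "u ^ n \<noteq> 0" for n
    by auto
  show ?thesis
  proof (cases "0 \<le> k")
    case True
    then show ?thesis
      using u0[of "nat k"] val_power[OF u, of "nat k"] by (intro exI[of _ "u ^ nat k"]) simp
  next
    case False
    then show ?thesis
      using u0[of "nat (- k)"] val_power[OF u, of "nat (- k)"] val_inverse[OF u0[of "nat (- k)"]]
      by (intro exI[of _ "inverse (u ^ nat (- k))"]) (simp del: power_inverse)
  qed
qed

text \<open>Hensel's lemma by a simplified Newton iteration that divides by 2 instead of
  \<open>2 * y\<close>. As y stays congruent to 1, each step still gains one unit of valuation,
  which is enough for completeness. Discreteness of the valuation turns the strict hypothesis into a
  first gain of 1.\<close>

lemma square_root:
  assumes two: "val 2 = 0" and x: "0 < val (x - 1)"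
  obtains y where "y * y = x"
proof -
  have two0: "(2::'f) \<noteq> 0"
    using two by auto
  have valh: "val (inverse 2) = 0"
    unfolding val_inverse[OF two0] two by simp
  define Y where "Y = rec_nat 1 (\<lambda>_ y. y - (y * y - x) / 2)"
  have Y0: "Y 0 = 1" and YS: "Y (Suc n) = Y n - (Y n * Y n - x) / 2" for n
    by (simp_all add: Y_def)
  have four: "(4::'f) = 2 * 2"
    by simp
  have four0: "(4::'f) \<noteq> 0"
    unfolding four mult_eq_0_iff using two0 by blast
  have val4: "val (inverse 4) = 0"
    unfolding val_inverse[OF four0] unfolding four val_mult two by simp
  have inv: "1 \<le> val (Y n - 1) \<and> ereal (real n + 1) \<le> val (Y n * Y n - x)" for n
  proof (induction n)
    case 0
    then show ?case
      using val_pos_imp_ge_one[OF x] val_minus_commute[of 1 x] by (simp add: Y0 one_ereal_def[symmetric])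
  next
    case (Suc n)
    define e where "e = Y n * Y n - x"
    have e: "ereal (real n + 1) \<le> val e" and y: "1 \<le> val (1 - Y n)"
      using Suc val_minus_commute[of 1 "Y n"] by (simp_all add: e_def)
    have e1: "1 \<le> val e"
      by (rule order_trans[OF _ e]) simp
    have he: "ereal (real n + 1) \<le> val (e / 2)" "1 \<le> val (e / 2)"
      using e e1 valh unfolding divide_inverse val_mult by simp_all
    have eq1: "Y (Suc n) - 1 = (Y n - 1) - e / 2"
      by (simp add: YS e_def)
    \<comment> \<open>The new error is a multiple of the old error e by \<open>1 - Y n\<close>, plus
      a quarter of its square; both terms gain at least 1.\<close>
    have eq2: "Y (Suc n) * Y (Suc n) - x = e * (1 - Y n) + e * e * inverse 4"
      using two0 four0 unfolding YS e_def by (simp add: field_simps)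
    have "ereal (real n + 1) + 1 \<le> val (e * (1 - Y n))"
      "ereal (real n + 1) + 1 \<le> val (e * e * inverse 4)"
      using val_mult_ge[OF e y] val_mult_ge[OF e e1] val4 unfolding val_mult by simp_all
    from val_add_ge[OF this] have "ereal (real (Suc n) + 1) \<le> val (Y (Suc n) * Y (Suc n) - x)"
      unfolding eq2 by (simp add: add.commute)
    moreover have "1 \<le> val (Y (Suc n) - 1)"
      unfolding eq1 using Suc he(2) by (blast intro: val_diff_ge)
    ultimately show ?case
      by blast
  qed
  have step: "ereal (real n + 1) \<le> val (Y (Suc n) - Y n)" for n
  proof -
    have "Y (Suc n) - Y n = - ((Y n * Y n - x) * inverse 2)"
      unfolding YS divide_inverse by simp
    then have "val (Y (Suc n) - Y n) = val (Y n * Y n - x)"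
      using valh unfolding val_minus val_mult by (metis add.right_neutral val_minus val_mult)
    then show ?thesis
      using inv[of n] by simp
  qed
  have near: "ereal (real N) \<le> val (Y (N + k) - Y N)" for N k
  proof (induction k)
    case (Suc k)
    have "ereal (real N) \<le> val (Y (Suc (N + k)) - Y (N + k))"
      using step[of "N + k"] by (rule order_trans[rotated]) simp
    from val_add_ge[OF this Suc] show ?case
      by simp
  qed simp
  have "\<forall>n::nat. \<exists>N. \<forall>k\<ge>N. \<forall>l\<ge>N. ereal (real n) \<le> val (Y k - Y l)"
  proof (intro allI exI impI)
    fix n k l :: nat
    assume "n \<le> k" "n \<le> l"
    then have "ereal (real n) \<le> val (Y k - Y n)" "ereal (real n) \<le> val (Y l - Y n)"
      using near[of n "k - n"] near[of n "l - n"] by auto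
    from val_diff_ge[OF this] show "ereal (real n) \<le> val (Y k - Y l)"
      by simp
  qed
  then obtain L where L: "\<And>n::nat. \<exists>N. \<forall>k\<ge>N. ereal (real n) \<le> val (Y k - L)"
    using complete[of Y] by blast
  have "ereal (real n) \<le> val (L * L - x)" for n :: nat
  proof -
    obtain N where N: "\<And>k. k \<ge> N \<Longrightarrow> ereal (real n) \<le> val (Y k - L)"
      using L[of n] by blast
    \<comment> \<open>Beyond N the iterate is close to L, beyond n its own error is small.\<close>
    define k where "k = max N n"
    have yk: "0 \<le> val (Y k)"
      using inv[of k] val_add_ge[of 0 "Y k - 1" 1] by (simp add: order_trans[of 0 1])
    have d: "ereal (real n) \<le> val (L - Y k)"
      using N[of k] val_minus_commute[of L "Y k"] by (simp add: k_def)
    have d0: "0 \<le> val (L - Y k)"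
      by (rule order_trans[OF _ d]) simp
    have "0 \<le> val ((L - Y k) + (Y k + Y k))"
      using yk d0 by (intro val_add_ge) auto
    then have "ereal (real n) + 0 \<le> val ((L - Y k) * (L + Y k))"
      using d by (intro val_mult_ge) (auto simp: add.commute)
    moreover have "ereal (real n) \<le> val (Y k * Y k - x)"
      using inv[of k] by (auto intro: order_trans[of _ "ereal (real k + 1)"] simp: k_def)
    ultimately have "ereal (real n) \<le> val ((L - Y k) * (L + Y k) + (Y k * Y k - x))"
      by (intro val_add_ge) auto
    also have "(L - Y k) * (L + Y k) + (Y k * Y k - x) = L * L - x"
      by (simp add: algebra_simps)
    finally show ?thesis .
  qed
  then have "ereal B \<le> val (L * L - x)" for B
    using real_arch_simple[of B] by (meson ereal_less_eq(3) order_trans)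
  then have "val (L * L - x) = \<infinity>"
    by (rule ereal_top)
  then show ?thesis
    using that val_eq_infinity by simp
qed

section \<open>Finite residue systems\<close>

lemma finite_residues: "\<exists>S. finite S \<and> (\<forall>s\<in>S. 0 \<le> val s) \<and> (\<forall>x. 0 \<le> val x \<longrightarrow> (\<exists>s\<in>S. 0 < val (x - s)))"
proof -
  let ?O = "{x. 0 \<le> val x}" and ?r = "{(x, y). 0 \<le> val x \<and> 0 \<le> val y \<and> 0 < val (x - y)}"
  let ?S = "(\<lambda>c. SOME x. x \<in> c) ` (?O // ?r)"
  have "finite ?S"
    using finite_residue_field by simp
  moreover have "\<exists>s\<in>?S. 0 \<le> val s \<and> 0 < val (x - s)" if x: "0 \<le> val x" for x
  proof -
    have "x \<in> ?r `` {x}"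
      using x by simp
    then have "(SOME y. y \<in> ?r `` {x}) \<in> ?r `` {x}"
      by (rule someI)
    then show ?thesis
      using quotientI[of x ?O ?r] x by blast
  qed
  ultimately show ?thesis
    by (intro exI[of _ "{s \<in> ?S. 0 \<le> val s}"]) auto
qed

text \<open>Digit expansion: a residue to precision \<open>n + 1\<close> is one to precision n plus
  \<open>u ^ n\<close> times a residue to precision 1, where u is a uniformizer.\<close>

lemma finite_residues_power:
  "\<exists>S. finite S \<and> (\<forall>s\<in>S. 0 \<le> val s) \<and> (\<forall>x. 0 \<le> val x \<longrightarrow> (\<exists>s\<in>S. ereal (real n) \<le> val (x - s)))"
proof (induction n)
  case 0
  show ?case
    by (rule exI[of _ "{0}"]) (auto simp: zero_ereal_def)
next
  case (Suc n)
  obtain S where S: "finite S" "\<And>s. s \<in> S \<Longrightarrow> 0 \<le> val s"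
    "\<And>x. 0 \<le> val x \<Longrightarrow> \<exists>s\<in>S. ereal (real n) \<le> val (x - s)"
    using Suc by blast
  obtain S1 where S1: "finite S1" "\<And>s. s \<in> S1 \<Longrightarrow> 0 \<le> val s"
    "\<And>x. 0 \<le> val x \<Longrightarrow> \<exists>s\<in>S1. 0 < val (x - s)"
    using finite_residues by blast
  obtain u where u: "val u = 1"
    using val_surj by blast
  then have u0: "u ^ n \<noteq> 0"
    by auto
  have un: "val (u ^ n) = ereal (real n)"
    using val_power[of u 1 n] u by simp
  have "\<exists>z\<in>(\<lambda>(s, t). s + u ^ n * t) ` (S \<times> S1). ereal (real (Suc n)) \<le> val (x - z)"
    if x: "0 \<le> val x" for x
  proof -
    obtain s where s: "s \<in> S" "ereal (real n) \<le> val (x - s)"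
      using S(3)[OF x] by blast
    have "val ((x - s) / u ^ n) = val (x - s) - ereal (real n)"
      using un val_inverse[OF u0] by (simp add: divide_inverse val_mult minus_ereal_def)
    moreover have "0 \<le> val (x - s) - ereal (real n)"
      using s(2) by (cases "val (x - s)") auto
    ultimately obtain t where t: "t \<in> S1" "1 \<le> val ((x - s) / u ^ n - t)"
      using S1(3) val_pos_imp_ge_one by metis
    have "x - s = u ^ n * ((x - s) / u ^ n)"
      using nonzero_mult_div_cancel_left[OF u0] by (metis times_divide_eq_right)
    then have "x - (s + u ^ n * t) = u ^ n * ((x - s) / u ^ n - t)"
      by (metis diff_diff_eq right_diff_distrib)
    then have "ereal (real n) + 1 \<le> val (x - (s + u ^ n * t))"
      using val_mult_ge[of "ereal (real n)" "u ^ n" 1] t(2) un by simp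
    then show ?thesis
      using s(1) t(1) by (intro bexI[of _ "s + u ^ n * t"]) (auto simp: one_ereal_def[symmetric] add.commute)
  qed
  moreover have "0 \<le> val (s + u ^ n * t)" if "s \<in> S" "t \<in> S1" for s t
    using S(2)[OF that(1)] S1(2)[OF that(2)] un by (intro val_add_ge) (auto simp: val_mult)
  ultimately show ?case
    using S(1) S1(1) by (intro exI[of _ "(\<lambda>(s, t). s + u ^ n * t) ` (S \<times> S1)"]) auto
qed

end

section \<open>The quaternion algebra\<close>

text \<open>The prime p is the residue characteristic. Its being odd makes 2 a unit, which gives the
  splittings by halves and the square roots used throughout.\<close>

locale tame_quaternion_algebra = quaternion_division_algebra Q
  for Q :: "('f::field, 'd::division_ring) quat_alg" +
  fixes p :: nat
  assumes prime_p: "prime p" and p_odd: "p \<noteq> 2" and p_residue: "0 < fval Q (of_nat p)"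
begin

sublocale F: local_field "fval Q"
  by (rule local_field)

lemma fval_two: "fval Q 2 = 0"
  using F.val_two[OF prime_p p_odd p_residue] .

lemma two_neq_zero_F: "(2::'f) \<noteq> 0"
  using fval_two by auto

lemma emb_zero [simp]: "emb Q 0 = 0"
  using emb_add[of 0 0] by simp

lemma emb_minus [simp]: "emb Q (- x) = - emb Q x"
  using emb_add[of x "- x"] by (simp add: eq_neg_iff_add_eq_0 add.commute)

lemma emb_diff [simp]: "emb Q (x - y) = emb Q x - emb Q y"
  using emb_add[of x "- y"] by simp

lemma emb_eq_zero_iff [simp]: "emb Q x = 0 \<longleftrightarrow> x = 0"
  using emb_mult[of x "inverse x"] emb_one by (cases "x = 0") auto

lemma emb_eq_iff [simp]: "emb Q x = emb Q y \<longleftrightarrow> x = y"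
  using emb_eq_zero_iff[of "x - y"] by (simp del: emb_eq_zero_iff)

lemma emb_inverse: "emb Q (inverse x) = inverse (emb Q x)"
proof (cases "x = 0")
  case False
  then have "emb Q x * emb Q (inverse x) = 1"
    by (simp add: emb_mult[symmetric] emb_one)
  then show ?thesis
    by (rule inverse_unique[symmetric])
qed simp

lemma emb_two: "emb Q 2 = 2"
  using emb_add[of 1 1] emb_one by simp

lemma emb_of_nat: "emb Q (of_nat n) = of_nat n"
  by (induction n) (auto simp: emb_add emb_one)

lemma two_neq_zero [simp]: "(2::'d) \<noteq> 0"
  using two_neq_zero_F emb_eq_zero_iff[of 2] by (simp add: emb_two del: emb_eq_zero_iff)

lemma quat_eq_iff: "quat Q a b c d = quat Q a' b' c' d' \<longleftrightarrow> a = a' \<and> b = b' \<and> c = c' \<and> d = d'"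
proof
  assume eq: "quat Q a b c d = quat Q a' b' c' d'"
  obtain t where "\<And>u. (case u of (x, y, z, w) \<Rightarrow> quat Q a b c d = quat Q x y z w) \<Longrightarrow> u = t"
    using coordinates[of "quat Q a b c d"] by (elim ex1E) blast
  from this[of "(a, b, c, d)"] this[of "(a', b', c', d')"] eq
  show "a = a' \<and> b = b' \<and> c = c' \<and> d = d'"
    by simp
qed simp

lemma quat_cases:
  obtains a b c d where "z = quat Q a b c d"
  using coordinates[of z] by auto

lemma quat_add: "quat Q a b c d + quat Q a' b' c' d' = quat Q (a + a') (b + b') (c + c') (d + d')"
  by (simp add: quat_def emb_add distrib_right)

lemma quat_minus: "- quat Q a b c d = quat Q (- a) (- b) (- c) (- d)"
  by (simp add: quat_def)

lemma emb_quat: "emb Q x * quat Q a b c d = quat Q (x * a) (x * b) (x * c) (x * d)"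
  by (simp add: quat_def emb_mult distrib_left mult.assoc)

lemma emb_left_commute: "z * (emb Q x * w) = emb Q x * (z * w)"
  by (metis emb_central mult.assoc)

lemma qi_quat: "qi Q * quat Q a b c d = quat Q (eps Q * b) a (eps Q * d) c"
proof -
  have "qi Q * emb Q a = emb Q a * qi Q"
    by (rule emb_central[symmetric])
  moreover have "qi Q * (emb Q b * qi Q) = emb Q (eps Q * b)"
    by (simp only: emb_left_commute[of "qi Q" b] qi_square) (simp only: emb_mult[symmetric] mult.commute[of b])
  moreover have "qi Q * (emb Q d * (qi Q * qj Q)) = emb Q (eps Q * d) * qj Q"
    by (simp only: emb_left_commute[of "qi Q" d] mult.assoc[of "qi Q" "qi Q" "qj Q", symmetric] qi_square)
      (simp only: mult.assoc[symmetric] emb_mult[symmetric] mult.commute[of d])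
  ultimately show ?thesis
    unfolding quat_def distrib_left by (simp add: emb_left_commute[of "qi Q" c] add_ac)
qed

lemma qj_quat: "qj Q * quat Q a b c d = quat Q (unif Q * c) (- (unif Q * d)) a (- b)"
proof -
  have ji: "qj Q * qi Q = - (qi Q * qj Q)"
    by (simp add: anticommute)
  have jk: "qj Q * (qi Q * qj Q) = - (emb Q (unif Q) * qi Q)"
    by (simp only: mult.assoc[symmetric] ji mult_minus_left) (simp only: mult.assoc qj_square emb_central)
  have "qj Q * emb Q a = emb Q a * qj Q"
    by (rule emb_central[symmetric])
  moreover have "qj Q * (emb Q b * qi Q) = - (emb Q b * (qi Q * qj Q))"
    by (simp add: emb_left_commute[of "qj Q" b] ji)
  moreover have "qj Q * (emb Q c * qj Q) = emb Q (unif Q * c)"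
    by (simp only: emb_left_commute[of "qj Q" c] qj_square) (simp only: emb_mult[symmetric] mult.commute[of c])
  moreover have "qj Q * (emb Q d * (qi Q * qj Q)) = - (emb Q (unif Q * d) * qi Q)"
    by (simp add: emb_left_commute[of "qj Q" d] jk emb_mult mult.commute[of "unif Q"] mult.assoc)
  ultimately show ?thesis
    unfolding quat_def distrib_left by simp
qed

text \<open>With the multiplication table in coordinates, the laws of conjugation and of the norm
  become polynomial identities over F.\<close>

lemma quat_mult:
  "quat Q a b c d * quat Q a' b' c' d' =
   quat Q (a * a' + eps Q * b * b' + unif Q * c * c' - eps Q * unif Q * d * d')
     (a * b' + b * a' - unif Q * c * d' + unif Q * d * c')
     (a * c' + c * a' + eps Q * b * d' - eps Q * d * b')
     (a * d' + d * a' + b * c' - c * b')"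
proof -
  have "quat Q a b c d * w =
      emb Q a * w + emb Q b * (qi Q * w) + emb Q c * (qj Q * w) + emb Q d * (qi Q * (qj Q * w))" for w
    by (simp add: quat_def distrib_right mult.assoc)
  then show ?thesis
    by (simp add: qi_quat qj_quat emb_quat quat_add quat_eq_iff algebra_simps)
qed

lemma qconj_quat [simp]: "qconj Q (quat Q a b c d) = quat Q a (- b) (- c) (- d)"
  unfolding qconj_def by (rule the_equality) (auto simp: quat_eq_iff)

lemma emb_eq_quat: "emb Q a = quat Q a 0 0 0"
  by (simp add: quat_def)

lemma qconj_emb [simp]: "qconj Q (emb Q a) = emb Q a"
  by (simp add: emb_eq_quat)

lemma qconj_one [simp]: "qconj Q 1 = 1"
  using qconj_emb[of 1] by (simp add: emb_one)

lemma qconj_zero [simp]: "qconj Q 0 = 0"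
  using qconj_emb[of 0] by simp

lemma qconj_add: "qconj Q (x + y) = qconj Q x + qconj Q y"
  by (cases x rule: quat_cases; cases y rule: quat_cases) (simp add: quat_add)

lemma qconj_minus [simp]: "qconj Q (- x) = - qconj Q x"
  by (cases x rule: quat_cases) (simp add: quat_minus)

lemma qconj_diff: "qconj Q (x - y) = qconj Q x - qconj Q y"
  using qconj_add[of x "- y"] by simp

lemma qconj_qconj [simp]: "qconj Q (qconj Q x) = x"
  by (cases x rule: quat_cases) simp

lemma qconj_mult: "qconj Q (x * y) = qconj Q y * qconj Q x"
  by (cases x rule: quat_cases; cases y rule: quat_cases) (simp add: quat_mult quat_eq_iff algebra_simps)

lemma qconj_eq_zero_iff [simp]: "qconj Q x = 0 \<longleftrightarrow> x = 0"
  by (metis qconj_qconj qconj_zero)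

lemma trace_exists: "\<exists>t. x + qconj Q x = emb Q t"
  by (cases x rule: quat_cases) (auto simp: quat_add emb_eq_quat quat_eq_iff)

lemma qconj_fixed: "qconj Q x = x \<Longrightarrow> x \<in> range (emb Q)"
proof -
  assume "qconj Q x = x"
  moreover obtain a b c d where x: "x = quat Q a b c d"
    by (rule quat_cases)
  ultimately have "2 * b = 0" "2 * c = 0" "2 * d = 0"
    by (simp_all add: quat_eq_iff eq_neg_iff_add_eq_0 flip: mult_2)
  then show ?thesis
    using x two_neq_zero_F by (simp add: emb_eq_quat[symmetric])
qed

lemma nrd_quat: "nrd Q (quat Q a b c d) = (a * a - eps Q * (b * b)) - unif Q * (c * c - eps Q * (d * d))"
proof -
  have "emb Q ((a * a - eps Q * (b * b)) - unif Q * (c * c - eps Q * (d * d))) =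
      quat Q a b c d * qconj Q (quat Q a b c d)"
    by (simp add: quat_mult emb_eq_quat quat_eq_iff algebra_simps del: emb_diff)
  then show ?thesis
    unfolding nrd_def by (intro the_equality) (auto simp flip: emb_eq_iff simp del: emb_eq_iff)
qed

lemma nrd: "emb Q (nrd Q z) = z * qconj Q z"
  by (cases z rule: quat_cases) (simp add: nrd_quat quat_mult emb_eq_quat quat_eq_iff algebra_simps del: emb_diff)

lemma nrd': "emb Q (nrd Q z) = qconj Q z * z"
  by (cases z rule: quat_cases) (simp add: nrd_quat quat_mult emb_eq_quat quat_eq_iff algebra_simps del: emb_diff)

lemma nrd_mult: "nrd Q (x * y) = nrd Q x * nrd Q y"
proof -
  have "emb Q (nrd Q (x * y)) = x * (y * qconj Q y) * qconj Q x"
    by (simp add: nrd qconj_mult mult.assoc)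
  also have "\<dots> = x * qconj Q x * emb Q (nrd Q y)"
    unfolding nrd[of y, symmetric] by (simp only: mult.assoc emb_central[of "nrd Q y" "qconj Q x"])
  finally show ?thesis
    by (simp flip: nrd emb_mult)
qed

lemma nrd_eq_zero_iff [simp]: "nrd Q z = 0 \<longleftrightarrow> z = 0"
  using nrd[of z] by (metis emb_eq_zero_iff mult_eq_0_iff qconj_eq_zero_iff)

lemma nrd_emb [simp]: "nrd Q (emb Q a) = a * a"
  by (simp add: emb_eq_quat nrd_quat)

lemma square_unit:
  assumes "0 < fval Q (x - 1)"
  obtains y where "y * y = x"
  using F.square_root[OF fval_two assms] by blast

text \<open>As \<open>eps Q\<close> is a nonsquare unit, the form \<open>a\<^sup>2 - eps b\<^sup>2\<close> is anisotropic modulo the maximal ideal.\<close>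

lemma fval_norm_form:
  "fval Q (a * a - eps Q * (b * b)) = min (fval Q a + fval Q a) (fval Q b + fval Q b)"
proof -
  have e: "fval Q (eps Q * (b * b)) = fval Q b + fval Q b"
    by (simp add: F.val_mult eps_unit)
  consider "fval Q a + fval Q a < fval Q b + fval Q b" | "fval Q b + fval Q b < fval Q a + fval Q a"
    | "fval Q a + fval Q a = fval Q b + fval Q b"
    by (meson linorder_less_linear)
  then show ?thesis
  proof cases
    case 1
    then have "fval Q (a * a + - (eps Q * (b * b))) = fval Q (a * a)"
      by (intro F.val_add_eq) (simp add: eps_unit F.val_mult)
    with 1 show ?thesis
      by (simp add: F.val_mult min_def less_imp_le)
  next
    case 2
    then have "fval Q (- (eps Q * (b * b)) + a * a) = fval Q (eps Q * (b * b))"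
      by (subst F.val_add_eq) (simp_all add: eps_unit F.val_mult)
    with 2 show ?thesis
      by (auto simp: e min_def)
  next
    case 3
    show ?thesis
    proof (cases "b = 0")
      case True
      then show ?thesis
        by (simp add: F.val_mult)
    next
      case False
      obtain n where n: "fval Q b = ereal n"
        using False F.val_real by blast
      have a: "fval Q a = ereal n"
        using 3 n by (cases "fval Q a") auto
      define c where "c = a / b"
      have c: "fval Q c = 0"
        unfolding c_def divide_inverse F.val_mult F.val_inverse[OF False] a n by (simp add: zero_ereal_def)
      then have c0: "c \<noteq> 0"
        by auto
      \<comment> \<open>Otherwise \<open>eps Q / (c * c)\<close> would be congruent to 1, hence a
        square, and \<open>eps Q\<close> with it.\<close>
      have "\<not> 0 < fval Q (c * c - eps Q)"
      proof
        assume pos: "0 < fval Q (c * c - eps Q)"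
        have "fval Q (inverse (c * c)) = 0"
          using c0 F.val_inverse[of "c * c"] by (simp add: F.val_mult c)
        then have "0 < fval Q (inverse (c * c) * (eps Q - c * c))"
          using pos F.val_minus_commute[of "eps Q" "c * c"] by (simp add: F.val_mult)
        also have "inverse (c * c) * (eps Q - c * c) = eps Q / (c * c) - 1"
          using c0 by (simp add: field_simps)
        finally obtain y where "y * y = eps Q / (c * c)"
          by (rule square_unit)
        then have "(c * y)\<^sup>2 = eps Q"
          using c0 by (simp add: power2_eq_square field_simps)
        then show False
          using eps_nonsquare by blast
      qed
      moreover have "0 \<le> fval Q (c * c - eps Q)"
        by (intro F.val_diff_ge) (simp_all add: F.val_mult c eps_unit)
      ultimately have "fval Q (c * c - eps Q) = 0"
        by simp
      moreover have "a * a - eps Q * (b * b) = b * b * (c * c - eps Q)"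
        using False by (simp add: c_def field_simps)
      ultimately show ?thesis
        by (simp add: F.val_mult n a)
    qed
  qed
qed

text \<open>The norm is a difference of two values of the binary form, the second multiplied by the
  uniformizer. The form has even valuations, so one term is even and the other odd: they never
  cancel, and integrality can be read off coordinate by coordinate.\<close>

lemma nrd_integral_iff:
  "0 \<le> fval Q (nrd Q (quat Q a b c d)) \<longleftrightarrow>
   0 \<le> fval Q a \<and> 0 \<le> fval Q b \<and> 0 \<le> fval Q c \<and> 0 \<le> fval Q d"
proof -
  let ?m = "\<lambda>a b. min (fval Q a + fval Q a) (fval Q b + fval Q b)"
  have u: "fval Q (unif Q * (c * c - eps Q * (d * d))) = 1 + ?m c d"
    by (simp only: F.val_mult unif_val fval_norm_form)
  have double: "fval Q x + fval Q x = \<infinity> \<or> (\<exists>k::int. fval Q x + fval Q x = ereal (of_int (2 * k)))" for x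
  proof (cases "x = 0")
    case False
    then obtain n :: int where "fval Q x = ereal (of_int n)"
      using F.val_int by blast
    then show ?thesis
      by auto
  qed simp
  have even: "?m x y = \<infinity> \<or> (\<exists>k::int. ?m x y = ereal (of_int (2 * k)))" for x y
    unfolding min_def using double[of x] double[of y] by presburger
  have m0: "0 \<le> ?m x y \<longleftrightarrow> 0 \<le> fval Q x \<and> 0 \<le> fval Q y" for x y
  proof -
    have "0 \<le> t + t \<longleftrightarrow> 0 \<le> t" for t :: ereal
      by (cases t) auto
    then show ?thesis
      by simp
  qed
  \<comment> \<open>An even integer that is at least -1 is at least 0.\<close>
  have m1: "0 \<le> 1 + ?m c d \<longleftrightarrow> 0 \<le> ?m c d"
    using even[of c d]
  proof (elim disjE exE)
    fix k :: int
    assume k: "?m c d = ereal (of_int (2 * k))"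
    have "1 + ereal (of_int (2 * k)) = ereal (of_int (1 + 2 * k))"
      by (simp add: one_ereal_def)
    moreover have "0 \<le> ereal (of_int i) \<longleftrightarrow> 0 \<le> i" for i
      by simp
    ultimately show ?thesis
      unfolding k by presburger
  qed simp
  have "?m a b \<noteq> 1 + ?m c d \<or> (?m a b = \<infinity> \<and> 1 + ?m c d = \<infinity>)"
  proof -
    have "(2 * k :: int) \<noteq> 1 + 2 * l" for k l
      by presburger
    then have "ereal (of_int (2 * k)) \<noteq> 1 + ereal (of_int (2 * l))" for k l :: int
      by (metis ereal.inject of_int_1 of_int_add of_int_eq_iff one_ereal_def plus_ereal.simps(1))
    then show ?thesis
      using even[of a b] even[of c d] by (elim disjE exE) (simp_all only:, auto simp: one_ereal_def)
  qed
  then have "fval Q (nrd Q (quat Q a b c d)) = min (?m a b) (1 + ?m c d)"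
  proof (elim disjE)
    assume ne: "?m a b \<noteq> 1 + ?m c d"
    let ?x = "a * a - eps Q * (b * b)" and ?y = "unif Q * (c * c - eps Q * (d * d))"
    show ?thesis
      using ne F.val_add_eq[of ?x "- ?y"] F.val_add_eq[of "- ?y" ?x] u fval_norm_form[of a b]
      unfolding nrd_quat by (cases "?m a b" "1 + ?m c d" rule: linorder_cases) (simp_all add: min_def)
  next
    assume inf: "?m a b = \<infinity> \<and> 1 + ?m c d = \<infinity>"
    then have "fval Q (a * a - eps Q * (b * b)) = \<infinity>" "fval Q (unif Q * (c * c - eps Q * (d * d))) = \<infinity>"
      by (simp_all only: u fval_norm_form)
    then have z: "a * a - eps Q * (b * b) = 0" "unif Q * (c * c - eps Q * (d * d)) = 0"
      by (simp_all only: F.val_infinity)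
    show ?thesis
      unfolding nrd_quat z inf[THEN conjunct1] inf[THEN conjunct2] by simp
  qed
  then show ?thesis
    using m0[of a b] m0[of c d] m1 by (simp add: min_le_iff_disj conj_assoc)
qed

section \<open>The valuation of D\<close>

lemma valD_nonneg_iff: "0 \<le> valD Q z \<longleftrightarrow> 0 \<le> fval Q (nrd Q z)"
  unfolding valD_def by (cases "fval Q (nrd Q z)") auto

lemma valD_mult: "valD Q (x * y) = valD Q x + valD Q y"
  using F.val_not_MInfty[of "nrd Q x"] F.val_not_MInfty[of "nrd Q y"]
  by (cases "fval Q (nrd Q x)"; cases "fval Q (nrd Q y)")
    (auto simp: valD_def nrd_mult F.val_mult add_divide_distrib)

lemma valD_infinity: "valD Q z = \<infinity> \<longleftrightarrow> z = 0"
  using F.val_infinity[of "nrd Q z"] unfolding valD_def by (cases "fval Q (nrd Q z)") auto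

lemma valD_not_MInfty: "valD Q z \<noteq> - \<infinity>"
  using F.val_not_MInfty[of "nrd Q z"] unfolding valD_def by (cases "fval Q (nrd Q z)") auto

lemma valD_one: "valD Q 1 = 0"
  unfolding valD_def using nrd_emb[of 1] by (simp add: emb_one)

text \<open>Integrality is a condition on coordinates, so adding 1 preserves it. The ultrametric
  inequality for D then follows by scaling.\<close>

lemma valD_one_plus: "0 \<le> valD Q z \<Longrightarrow> 0 \<le> valD Q (1 + z)"
proof (cases z rule: quat_cases)
  fix a b c d
  assume "0 \<le> valD Q z" and z: "z = quat Q a b c d"
  then have "0 \<le> fval Q a \<and> 0 \<le> fval Q b \<and> 0 \<le> fval Q c \<and> 0 \<le> fval Q d"
    by (simp add: valD_nonneg_iff nrd_integral_iff)
  moreover have "1 + z = quat Q (1 + a) b c d"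
    using quat_add[of 1 0 0 0 a b c d] emb_eq_quat[of 1] by (simp add: z emb_one)
  ultimately show ?thesis
    by (simp add: valD_nonneg_iff nrd_integral_iff F.val_add_ge)
qed

lemma valD_add: "min (valD Q x) (valD Q y) \<le> valD Q (x + y)"
proof -
  have *: "valD Q x \<le> valD Q (x + y)" if "valD Q x \<le> valD Q y" and x: "x \<noteq> 0" for x y
  proof -
    have "valD Q y = valD Q x + valD Q (inverse x * y)"
      using x by (simp flip: valD_mult mult.assoc)
    then have "0 \<le> valD Q (inverse x * y)"
      using that valD_infinity[of x] valD_not_MInfty[of x]
      by (cases "valD Q x"; cases "valD Q (inverse x * y)") auto
    then have "0 \<le> valD Q (1 + inverse x * y)"
      by (rule valD_one_plus)
    moreover have "x + y = x * (1 + inverse x * y)"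
      using x by (simp add: distrib_left flip: mult.assoc)
    ultimately show ?thesis
      by (simp add: valD_mult add_increasing2)
  qed
  show ?thesis
    using *[of x y] *[of y x] by (cases "x = 0"; cases "y = 0") (auto simp: min_def add.commute)
qed

sublocale D: valuation "valD Q"
  by unfold_locales (use valD_infinity valD_not_MInfty valD_mult valD_add in auto)

lemma valD_half_int:
  assumes "z \<noteq> 0"
  obtains n :: int where "valD Q z = ereal (of_int n / 2)"
  using F.val_int[of "nrd Q z"] assms unfolding valD_def by auto

lemma valD_emb [simp]: "valD Q (emb Q a) = fval Q a"
  using F.val_not_MInfty[of a] by (cases "fval Q a") (auto simp: valD_def F.val_mult)

lemma valD_qconj [simp]: "valD Q (qconj Q z) = valD Q z"
proof -
  have "nrd Q (qconj Q z) = nrd Q z"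
    using nrd[of "qconj Q z"] nrd'[of z] by (simp flip: emb_eq_iff)
  then show ?thesis
    by (simp add: valD_def)
qed

lemma valD_two [simp]: "valD Q 2 = 0"
  using valD_emb[of 2] by (simp add: emb_two fval_two)

text \<open>A witness that half-integral values occur; it later shows that the complement of an
  unramified E cannot have integral valuations.\<close>

lemma valD_qj: "valD Q (qj Q) = ereal (1 / 2)"
proof -
  have "valD Q (qj Q) + valD Q (qj Q) = 1"
    using valD_mult[of "qj Q" "qj Q"] by (simp add: qj_square unif_val)
  then show ?thesis
    by (cases "valD Q (qj Q)") (auto simp: one_ereal_def)
qed

text \<open>Matches a strict bound on valuations with the unions over depths above
  \<open>r / 2\<close> in \<open>JE_plus\<close>.\<close>

lemma valD_gt_real:
  assumes "ereal t < valD Q z" obtains u where "t < u" "ereal u \<le> valD Q z"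
proof (cases "valD Q z")
  case (real v)
  with assms that[of v] show ?thesis by auto
next
  case PInf
  with that[of "t + 1"] show ?thesis by auto
qed (use D.val_not_MInfty in auto)

text \<open>Integral elements are those with integral coordinates, so residues of F in each of the
  four coordinates suffice.\<close>

lemma finite_residues_D:
  "\<exists>S. finite S \<and> (\<forall>x. 0 \<le> valD Q x \<longrightarrow> (\<exists>s\<in>S. 0 \<le> valD Q s \<and> ereal (real n) \<le> valD Q (x - s)))"
proof -
  obtain S where S: "finite S" "\<And>s. s \<in> S \<Longrightarrow> 0 \<le> fval Q s"
    "\<And>x. 0 \<le> fval Q x \<Longrightarrow> \<exists>s\<in>S. ereal (real n) \<le> fval Q (x - s)"
    using F.finite_residues_power[of n] by blast
  let ?S = "(\<lambda>(a, b, c, d). quat Q a b c d) ` (S \<times> S \<times> S \<times> S)"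
  have "\<exists>s\<in>?S. 0 \<le> valD Q s \<and> ereal (real n) \<le> valD Q (x - s)" if x: "0 \<le> valD Q x" for x
  proof (cases x rule: quat_cases)
    fix a b c d
    assume q: "x = quat Q a b c d"
    then have "0 \<le> fval Q a" "0 \<le> fval Q b" "0 \<le> fval Q c" "0 \<le> fval Q d"
      using x by (simp_all add: valD_nonneg_iff nrd_integral_iff)
    then obtain a' b' c' d' where s: "a' \<in> S" "b' \<in> S" "c' \<in> S" "d' \<in> S" and
      n: "ereal (real n) \<le> fval Q (a - a')" "ereal (real n) \<le> fval Q (b - b')"
      "ereal (real n) \<le> fval Q (c - c')" "ereal (real n) \<le> fval Q (d - d')"
      using S(3) by meson
    have u: "valD Q (emb Q (unif Q ^ n)) = ereal (real n)"
      using F.val_power[of "unif Q" 1 n] by (simp add: unif_val one_ereal_def)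
    have u0: "unif Q ^ n \<noteq> 0"
      using unif_val by (intro power_not_zero) auto
    have pos: "0 \<le> fval Q (t / unif Q ^ n)" if "ereal (real n) \<le> fval Q t" for t
      using that u F.val_inverse[OF u0] unfolding divide_inverse F.val_mult
      by (cases "fval Q t") auto
    have "x - quat Q a' b' c' d' = quat Q (a - a') (b - b') (c - c') (d - d')"
      using quat_add[of a b c d "- a'" "- b'" "- c'" "- d'"] by (simp add: q flip: quat_minus)
    also have "\<dots> = emb Q (unif Q ^ n) * quat Q ((a - a') / unif Q ^ n) ((b - b') / unif Q ^ n)
        ((c - c') / unif Q ^ n) ((d - d') / unif Q ^ n)"
      unfolding emb_quat using u0 by (simp add: quat_eq_iff)
    finally have "valD Q (x - quat Q a' b' c' d') = ereal (real n) + valD Q (quat Q ((a - a') / unif Q ^ n)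
        ((b - b') / unif Q ^ n) ((c - c') / unif Q ^ n) ((d - d') / unif Q ^ n))"
      by (simp only: valD_mult u)
    moreover have "0 \<le> valD Q (quat Q ((a - a') / unif Q ^ n)
        ((b - b') / unif Q ^ n) ((c - c') / unif Q ^ n) ((d - d') / unif Q ^ n))"
      unfolding valD_nonneg_iff nrd_integral_iff using n pos by blast
    ultimately have "ereal (real n) \<le> valD Q (x - quat Q a' b' c' d')"
      by (simp add: add_increasing2)
    moreover have "0 \<le> valD Q (quat Q a' b' c' d')"
      using S(2) s by (simp add: valD_nonneg_iff nrd_integral_iff)
    moreover have "quat Q a' b' c' d' \<in> ?S"
      using s by (intro image_eqI[where x = "(a', b', c', d')"]) auto
    ultimately show ?thesis
      by blast
  qed
  then show ?thesis
    using S(1) by (intro exI[of _ ?S]) auto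
qed

end

section \<open>Quadratic subfields and their complements\<close>

context tame_quaternion_algebra
begin

lemma emb_vector_space: "vector_space (\<lambda>a z. emb Q a * z)"
  by unfold_locales (simp_all add: distrib_left distrib_right emb_add emb_mult mult.assoc emb_one)

lemma half_half [simp]: "emb Q (1 / 2) * x + emb Q (1 / 2) * x = x"
proof -
  have "emb Q (1 / 2) + emb Q (1 / 2) = 1"
    using two_neq_zero_F by (simp add: emb_one flip: emb_add)
  then show ?thesis
    by (metis distrib_right mult_1)
qed

lemma quadratic_subfield_closed:
  assumes "quadratic_subfield Q E"
  shows "emb Q a \<in> E"
    and "x \<in> E \<Longrightarrow> y \<in> E \<Longrightarrow> x - y \<in> E"
    and "x \<in> E \<Longrightarrow> y \<in> E \<Longrightarrow> x * y \<in> E"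
    and "x \<in> E \<Longrightarrow> inverse x \<in> E"
    and "x \<in> E \<Longrightarrow> y \<in> E \<Longrightarrow> x * y = y * x"
  using assms by (auto simp: quadratic_subfield_def)

text \<open>The dimension forces an element x outside F, and subtracting half its trace leaves a
  nonzero element of trace 0.\<close>

lemma quadratic_subfield_pure:
  assumes E: "quadratic_subfield Q E"
  obtains e where "e \<in> E" "e \<noteq> 0" "qconj Q e = - e"
proof -
  interpret V: vector_space "\<lambda>a z. emb Q a * z"
    by (rule emb_vector_space)
  have "\<not> E \<subseteq> range (emb Q)"
  proof
    assume "E \<subseteq> range (emb Q)"
    moreover have "emb Q a \<in> V.span {1}" for a
      using V.span_scale[OF V.span_base[of 1 "{1}"], of a] by simp
    ultimately have "V.dim E \<le> card {1::'d}"
      by (intro V.dim_le_card) auto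
    then show False
      using E by (simp add: quadratic_subfield_def)
  qed
  then obtain x where x: "x \<in> E" "x \<notin> range (emb Q)"
    by blast
  obtain t where t: "x + qconj Q x = emb Q t"
    using trace_exists by blast
  have c: "qconj Q x = emb Q t - x"
    by (simp flip: t)
  have "emb Q t = emb Q (t / 2) + emb Q (t / 2)"
    using two_neq_zero_F by (simp add: field_simps flip: emb_add)
  then have "qconj Q (x - emb Q (t / 2)) = - (x - emb Q (t / 2))"
    by (simp add: qconj_diff c)
  moreover have "x - emb Q (t / 2) \<in> E"
    using quadratic_subfield_closed[OF E] x(1) by blast
  moreover have "x - emb Q (t / 2) \<noteq> 0"
    using x(2) by auto
  ultimately show ?thesis
    using that by blast
qed

end

section \<open>The decomposition of D along E\<close>

locale quaternion_torus = tame_quaternion_algebra Q p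
  for Q :: "('f::field, 'd::division_ring) quat_alg" and p +
  fixes E :: "'d set" and e0 :: 'd and \<sigma> :: 'd
  assumes quadratic: "quadratic_subfield Q E"
    and e0_E: "e0 \<in> E" and e0_neq_zero: "e0 \<noteq> 0" and e0_pure: "qconj Q e0 = - e0"
    and conj_element: "conj_element Q E \<sigma>"
begin

lemmas emb_E [simp] = quadratic_subfield_closed(1)[OF quadratic]
lemmas diff_E = quadratic_subfield_closed(2)[OF quadratic]
lemmas mult_E = quadratic_subfield_closed(3)[OF quadratic]
lemmas inverse_E = quadratic_subfield_closed(4)[OF quadratic]
lemmas commute_E = quadratic_subfield_closed(5)[OF quadratic]

lemma zero_E [simp]: "0 \<in> E"
  using emb_E[of 0] by simp

lemma one_E [simp]: "1 \<in> E"
  using emb_E[of 1] by (simp add: emb_one)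

lemma minus_E: "x \<in> E \<Longrightarrow> - x \<in> E"
  using diff_E[of 0 x] by simp

lemma add_E: "x \<in> E \<Longrightarrow> y \<in> E \<Longrightarrow> x + y \<in> E"
  using diff_E[of x "- y"] minus_E[of y] by simp

lemma qconj_E: "x \<in> E \<Longrightarrow> qconj Q x \<in> E"
proof -
  assume "x \<in> E"
  moreover obtain t where "x + qconj Q x = emb Q t"
    using trace_exists by blast
  then have "qconj Q x = emb Q t - x"
    by (metis add_diff_cancel_left')
  ultimately show ?thesis
    using diff_E[of "emb Q t" x] by simp
qed

lemma power_E: "x \<in> E \<Longrightarrow> x ^ n \<in> E"
  by (induction n) (auto intro: mult_E)

lemmas E_closed = zero_E one_E emb_E e0_E diff_E add_E minus_E mult_E inverse_E qconj_E power_E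

definition disc :: 'f where "disc = - nrd Q e0"

lemma e0_square: "e0 * e0 = emb Q disc"
  using nrd[of e0] by (simp add: disc_def e0_pure)

lemma disc_neq_zero: "disc \<noteq> 0"
  using e0_neq_zero by (simp add: disc_def)

lemma inverse_e0: "inverse e0 = emb Q (inverse disc) * e0"
proof -
  have "emb Q (inverse disc) * e0 * e0 = emb Q (inverse disc * disc)"
    by (simp only: mult.assoc e0_square emb_mult)
  then have "emb Q (inverse disc) * e0 * e0 = 1"
    using disc_neq_zero by (simp add: emb_one)
  then have "inverse (emb Q (inverse disc) * e0) = e0"
    by (rule inverse_unique)
  then show ?thesis
    by (metis inverse_inverse_eq)
qed

lemma e0_not_scalar: "e0 \<noteq> emb Q a"
proof
  assume "e0 = emb Q a"
  then have "e0 + e0 = 0"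
    using e0_pure by (metis qconj_emb add.right_inverse)
  then show False
    using e0_neq_zero two_neq_zero by (metis mult_2 mult_eq_0_iff)
qed

lemma self_eq_minus: "(x::'d) = - x \<Longrightarrow> x = 0"
  using two_neq_zero by (metis add.right_inverse mult_2 mult_eq_0_iff)

text \<open>The product \<open>u * e0\<close> is self-conjugate, hence a scalar, and dividing by
  \<open>e0\<close> costs only another scalar because \<open>e0 * e0\<close> is one.\<close>

lemma commuting_pure:
  assumes u: "qconj Q u = - u" and c: "u * e0 = e0 * u"
  obtains b where "u = emb Q b * e0"
proof -
  have "qconj Q (u * e0) = u * e0"
    by (simp add: qconj_mult u e0_pure c)
  then obtain t where t: "u * e0 = emb Q t"
    using qconj_fixed by blast
  have "u = u * e0 * inverse e0"
    using e0_neq_zero by (simp add: mult.assoc)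
  also have "\<dots> = emb Q (t * inverse disc) * e0"
    by (simp add: t inverse_e0 emb_mult mult.assoc)
  finally show ?thesis
    by (rule that)
qed

lemma centralizer:
  assumes c: "z * e0 = e0 * z"
  obtains a b where "z = emb Q a + emb Q b * e0"
proof -
  obtain t where t: "z + qconj Q z = emb Q t"
    using trace_exists by blast
  define u where "u = z - emb Q (t / 2)"
  have "emb Q t = emb Q (t / 2) + emb Q (t / 2)"
    using two_neq_zero_F by (simp add: field_simps flip: emb_add)
  moreover have "qconj Q z = emb Q t - z"
    by (simp flip: t)
  ultimately have "qconj Q u = - u"
    by (simp add: u_def qconj_diff)
  moreover have "u * e0 = e0 * u"
    by (simp add: u_def left_diff_distrib right_diff_distrib c emb_central)
  ultimately obtain b where "u = emb Q b * e0"
    by (rule commuting_pure)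
  then have "z = emb Q (t / 2) + emb Q b * e0"
    by (simp add: u_def algebra_simps)
  then show ?thesis
    by (rule that)
qed

text \<open>E is its own centralizer. This trades the dimension hypothesis for a single equation
  with \<open>e0\<close>, so that membership in E can be computed.\<close>

lemma E_iff: "z \<in> E \<longleftrightarrow> z * e0 = e0 * z"
proof
  assume "z * e0 = e0 * z"
  then obtain a b where "z = emb Q a + emb Q b * e0"
    by (rule centralizer)
  then show "z \<in> E"
    by (simp add: add_E mult_E e0_E)
qed (simp add: commute_E e0_E)

lemma E_cases:
  assumes "z \<in> E"
  obtains a b where "z = emb Q a + emb Q b * e0"
  using assms centralizer E_iff by metis

lemma qconj_coords: "qconj Q (emb Q a + emb Q b * e0) = emb Q a - emb Q b * e0"
  by (simp add: qconj_add qconj_mult e0_pure emb_central)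

text \<open>The orthogonal complement of E for the norm form. Phrased through \<open>e0\<close>
  alone it does not depend on \<sigma>, which later lets constructions made with different \<sigma>
  be compared.\<close>

definition perp :: "'d set" where "perp = {y. y * e0 = - (e0 * y)}"

lemma perp_e0: "y \<in> perp \<Longrightarrow> y * e0 = - (e0 * y)"
  by (simp add: perp_def)

lemma perp_commute:
  assumes "y \<in> perp" "z \<in> E"
  shows "y * z = qconj Q z * y"
proof -
  obtain a b where z: "z = emb Q a + emb Q b * e0"
    using assms(2) by (rule E_cases)
  have "y * (emb Q b * e0) = - (emb Q b * (e0 * y))"
    unfolding emb_left_commute perp_e0[OF assms(1)] by simp
  then show ?thesis
    unfolding z qconj_coords by (simp add: distrib_left left_diff_distrib mult.assoc emb_central[of a])
qed

lemma perp_commute': "y \<in> perp \<Longrightarrow> z \<in> E \<Longrightarrow> z * y = y * qconj Q z"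
  using perp_commute[of y "qconj Q z"] by (simp add: qconj_E)

lemma zero_perp [simp]: "0 \<in> perp"
  by (simp add: perp_def)

lemma add_perp: "x \<in> perp \<Longrightarrow> y \<in> perp \<Longrightarrow> x + y \<in> perp"
  by (simp add: perp_def distrib_left distrib_right)

lemma minus_perp: "x \<in> perp \<Longrightarrow> - x \<in> perp"
  by (simp add: perp_def)

lemma diff_perp: "x \<in> perp \<Longrightarrow> y \<in> perp \<Longrightarrow> x - y \<in> perp"
  using add_perp[of x "- y"] minus_perp[of y] by simp

lemma E_mult_perp: "z \<in> E \<Longrightarrow> y \<in> perp \<Longrightarrow> z * y \<in> perp"
  using perp_e0[of y] commute_E[OF e0_E, of z]
  by (simp add: perp_def mult.assoc) (metis mult.assoc mult_minus_right)

lemma perp_mult_E: "y \<in> perp \<Longrightarrow> z \<in> E \<Longrightarrow> y * z \<in> perp"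
  by (subst perp_commute) (auto intro: E_mult_perp qconj_E)

lemma perp_mult_perp:
  assumes "y \<in> perp" "y' \<in> perp"
  shows "y * y' \<in> E"
proof -
  have "y * y' * e0 = - (y * e0 * y')"
    by (simp add: mult.assoc perp_e0[OF assms(2)])
  also have "\<dots> = e0 * (y * y')"
    by (simp add: mult.assoc perp_e0[OF assms(1)])
  finally show ?thesis
    by (simp add: E_iff)
qed

lemma inverse_perp: "y \<in> perp \<Longrightarrow> inverse y \<in> perp"
proof (cases "y = 0")
  case False
  assume "y \<in> perp"
  then have "inverse y * (y * e0) * inverse y = - (inverse y * (e0 * y) * inverse y)"
    by (simp add: perp_e0)
  then show ?thesis
    using False by (simp add: perp_def mult.assoc[symmetric]) (simp add: mult.assoc)
qed simp

lemmas perp_closed = zero_perp add_perp minus_perp diff_perp E_mult_perp perp_mult_E inverse_perp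

text \<open>The trace of y is a scalar that anticommutes with \<open>e0\<close>, hence it is
  0.\<close>

lemma qconj_perp:
  assumes y: "y \<in> perp"
  shows "qconj Q y = - y"
proof -
  obtain t where t: "y + qconj Q y = emb Q t"
    using trace_exists by blast
  have "qconj Q y * e0 = - (e0 * qconj Q y)"
    using arg_cong[OF perp_e0[OF y], of "qconj Q"] by (simp add: qconj_mult e0_pure)
  then have "(y + qconj Q y) * e0 = - (e0 * (y + qconj Q y))"
    using perp_e0[OF y] by (simp add: distrib_left distrib_right)
  then have "emb Q t * e0 = - (emb Q t * e0)"
    by (simp add: t emb_central)
  then have "emb Q t * e0 = 0"
    by (rule self_eq_minus)
  then show ?thesis
    using e0_neq_zero t by (simp add: eq_neg_iff_add_eq_0 add.commute)
qed

lemma perp_square: "y \<in> perp \<Longrightarrow> y * y = emb Q (- nrd Q y)"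
  using nrd[of y] by (simp add: qconj_perp)

lemma E_perp_disjoint: "z \<in> E \<Longrightarrow> z \<in> perp \<Longrightarrow> z = 0"
  using self_eq_minus[of "z * e0"] e0_neq_zero by (simp add: E_iff perp_def)

text \<open>The projection to the fixed space of conjugation by \<open>e0\<close>. This conjugation
  is an involution, since \<open>e0 * e0\<close> is central; its eigenspaces for 1 and -1 are E and
  \<open>perp\<close>.\<close>

definition pr0 :: "'d \<Rightarrow> 'd" where
  "pr0 z = emb Q (1 / 2) * (z + e0 * z * inverse e0)"

definition pr1 :: "'d \<Rightarrow> 'd" where
  "pr1 z = z - pr0 z"

lemma pr0_add: "pr0 (x + y) = pr0 x + pr0 y"
  by (simp add: pr0_def distrib_left distrib_right add_ac)

lemma pr0_E [simp]:
  assumes "z \<in> E"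
  shows "pr0 z = z"
proof -
  have "e0 * z * inverse e0 = z"
    using commute_E[OF e0_E assms] e0_neq_zero by (simp add: mult.assoc)
  then show ?thesis
    by (simp add: pr0_def distrib_left)
qed

lemma pr0_perp [simp]:
  assumes "y \<in> perp"
  shows "pr0 y = 0"
proof -
  have "e0 * y * inverse e0 = - y"
    using perp_e0[OF assms] e0_neq_zero by (metis minus_minus mult.assoc mult.right_neutral mult_minus_left right_inverse)
  then show ?thesis
    by (simp add: pr0_def)
qed

lemma pr0_in_E: "pr0 z \<in> E"
proof -
  have "(z + e0 * z * inverse e0) * e0 = z * e0 + e0 * z"
    using e0_neq_zero by (simp add: distrib_right mult.assoc)
  moreover have "e0 * (z + e0 * z * inverse e0) = e0 * z + z * e0"
  proof -
    have "e0 * (e0 * z * inverse e0) = (e0 * e0) * z * inverse e0"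
      by (simp add: mult.assoc)
    also have "\<dots> = z * (e0 * e0) * inverse e0"
      by (simp add: e0_square emb_central)
    also have "\<dots> = z * e0"
      using e0_neq_zero by (simp add: mult.assoc)
    finally show ?thesis
      by (simp add: distrib_left)
  qed
  ultimately have "z + e0 * z * inverse e0 \<in> E"
    by (simp add: E_iff add.commute)
  then show ?thesis
    by (simp add: pr0_def mult_E)
qed

lemma pr1_in_perp: "pr1 z \<in> perp"
proof -
  have "z - e0 * z * inverse e0 \<in> perp"
  proof -
    have "e0 * (e0 * z * inverse e0) = (e0 * e0) * z * inverse e0"
      by (simp add: mult.assoc)
    also have "\<dots> = z * (e0 * e0) * inverse e0"
      by (simp add: e0_square emb_central)
    also have "\<dots> = z * e0"
      using e0_neq_zero by (simp add: mult.assoc)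
    finally show ?thesis
      using e0_neq_zero by (simp add: perp_def left_diff_distrib right_diff_distrib mult.assoc)
  qed
  moreover have "pr1 z = emb Q (1 / 2) * (z - e0 * z * inverse e0)"
    using half_half[of z] by (simp add: pr1_def pr0_def distrib_left right_diff_distrib algebra_simps)
  ultimately show ?thesis
    by (simp add: E_mult_perp)
qed

lemma pr0_pr1 [simp]: "pr0 z + pr1 z = z"
  by (simp add: pr1_def)

lemma pr_unique:
  assumes "a \<in> E" "y \<in> perp"
  shows "pr0 (a + y) = a" "pr1 (a + y) = y"
proof -
  show "pr0 (a + y) = a"
    unfolding pr0_add pr0_E[OF assms(1)] pr0_perp[OF assms(2)] by simp
  then show "pr1 (a + y) = y"
    unfolding pr1_def by simp
qed

text \<open>In a division ring the factorization of \<open>w * w - g * g\<close> would put w into F,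
  and F meets the complement only in 0.\<close>

lemma perp_not_scalar_square:
  assumes "w \<in> perp" "w \<noteq> 0" "w * w = emb Q (g * g)"
  shows False
proof -
  have "(w - emb Q g) * (w + emb Q g) = 0"
    using assms(3) emb_central[of g w] by (simp add: distrib_left left_diff_distrib emb_mult)
  then have "w = emb Q g \<or> w = emb Q (- g)"
    by (auto simp: eq_neg_iff_add_eq_0)
  then have "w \<in> E"
    using emb_E by metis
  with assms show False
    using E_perp_disjoint by blast
qed

text \<open>The product of \<open>1 + w\<close> and \<open>1 - w\<close> is \<open>1 - f\<close>
  with f the scalar \<open>w * w\<close>. If \<open>1 + w\<close> had positive valuation, f would be
  congruent to 1 and so a square in F, which squares from the complement cannot be.\<close>

lemma valD_one_plus_perp:
  assumes w: "w \<in> perp" "valD Q w = 0"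
  shows "valD Q (1 + w) = 0"
proof -
  obtain f where f: "w * w = emb Q f"
    using perp_square w by blast
  have "0 \<le> valD Q (1 + w)"
    using w by (simp add: valD_one_plus)
  moreover have "\<not> 0 < valD Q (1 + w)"
  proof
    assume pos: "0 < valD Q (1 + w)"
    have "0 \<le> valD Q (1 + - w)"
      using w by (intro valD_one_plus) simp
    then have "0 < valD Q ((1 + w) * (1 + - w))"
      using pos by (simp add: valD_mult add_pos_nonneg)
    also have "(1 + w) * (1 + - w) = emb Q (1 - f)"
      using f by (simp add: algebra_simps emb_one)
    finally have "0 < fval Q (f - 1)"
      by (simp add: F.val_minus_commute[of f 1] del: emb_diff)
    then obtain g where "g * g = f"
      by (rule square_unit)
    then show False
      using perp_not_scalar_square[of w g] w f by (cases "w = 0") auto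
  qed
  ultimately show ?thesis
    by simp
qed

text \<open>Nothing cancels between E and its complement: for equal valuations, dividing by a leads
  back to \<open>1 + w\<close> with w a unit in the complement. From here on congruences in D split
  into two coordinates.\<close>

lemma valD_sum_perp:
  assumes "a \<in> E" "y \<in> perp"
  shows "valD Q (a + y) = min (valD Q a) (valD Q y)"
proof -
  consider "valD Q a < valD Q y" | "valD Q y < valD Q a" | "valD Q a = valD Q y"
    by (meson linorder_less_linear)
  then show ?thesis
  proof cases
    case 1
    then show ?thesis
      using D.val_add_eq[of a y] by (simp add: min_def less_imp_le)
  next
    case 2
    then show ?thesis
      using D.val_add_eq[of y a] by (auto simp: min_def add.commute)
  next
    case 3
    show ?thesis
    proof (cases "a = 0")
      case False
      then obtain t where t: "valD Q a = ereal t"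
        by (rule D.val_real)
      have "valD Q (inverse a * y) = 0"
        using False t 3 by (simp add: valD_mult D.val_inverse zero_ereal_def)
      then have "valD Q (1 + inverse a * y) = 0"
        using assms by (intro valD_one_plus_perp) (auto intro: perp_closed E_closed)
      moreover have "a + y = a * (1 + inverse a * y)"
        using False by (simp add: distrib_left flip: mult.assoc)
      ultimately show ?thesis
        using 3 by (simp add: valD_mult)
    qed simp
  qed
qed

lemma valD_eq_min: "valD Q z = min (valD Q (pr0 z)) (valD Q (pr1 z))"
  using valD_sum_perp[OF pr0_in_E pr1_in_perp, of z z] by simp

lemma sigma_neq_zero: "\<sigma> \<noteq> 0"
  using conj_element by (simp add: conj_element_def)

lemma sigma_perp: "\<sigma> \<in> perp"
proof -
  have "\<sigma> * e0 * inverse \<sigma> * \<sigma> = qconj Q e0 * \<sigma>"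
    using conj_element e0_E by (simp add: conj_element_def)
  then show ?thesis
    using sigma_neq_zero by (simp add: perp_def e0_pure mult.assoc)
qed

end

section \<open>The groups J and J+\<close>

lemma mat2_nth [simp]:
  "mat2 a b c d $ 1 $ 1 = a" "mat2 a b c d $ 1 $ 2 = b"
  "mat2 a b c d $ 2 $ 1 = c" "mat2 a b c d $ 2 $ 2 = d"
  by (simp_all add: mat2_def)

lemma mat2_eq_iff: "mat2 a b c d = mat2 a' b' c' d' \<longleftrightarrow> a = a' \<and> b = b' \<and> c = c' \<and> d = d'"
  by (auto simp: vec_eq_iff forall_2)

lemma mat2_mult:
  "mat2 a b c d ** mat2 a' b' c' d' =
   mat2 (a * a' + b * c') (a * b' + b * d') (c * a' + d * c') (c * b' + d * d')"
  by (simp add: vec_eq_iff forall_2 matrix_matrix_mult_def sum_2)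

lemma mat_one_eq_mat2: "mat 1 = mat2 1 0 0 1"
  by (simp add: vec_eq_iff forall_2 mat_def)

text \<open>Scaling by F brings the valuation of \<open>e0\<close> into this range. Dividing by
  \<open>e0\<close> then costs at most 1/2, less than the unit step of valuations in F.\<close>

locale torus_depth = quaternion_torus Q p E e0 \<sigma>
  for Q :: "('f::field, 'd::division_ring) quat_alg" and p E e0 \<sigma> +
  fixes r :: real
  assumes r_pos: "0 < r" and e0_val: "0 \<le> valD Q e0" "valD Q e0 \<le> ereal (1 / 2)"
begin

lemma valD_ge_mono: "ereal t \<le> valD Q x \<Longrightarrow> u \<le> t \<Longrightarrow> ereal u \<le> valD Q x"
  by (meson ereal_less_eq(3) order_trans)

lemma valD_gt_mono: "ereal t < valD Q x \<Longrightarrow> u \<le> t \<Longrightarrow> ereal u < valD Q x"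
  by (meson ereal_less_eq(3) le_less_trans)

lemma valD_ge_gt: "ereal t \<le> valD Q x \<Longrightarrow> u < t \<Longrightarrow> ereal u < valD Q x"
  by (meson ereal_less(2) less_ereal.simps(1) less_le_trans)

lemma valD_mult_ge: "ereal t \<le> valD Q x \<Longrightarrow> ereal u \<le> valD Q y \<Longrightarrow> ereal (t + u) \<le> valD Q (x * y)"
  using D.val_mult_ge[of "ereal t" x "ereal u" y] by simp

lemma valD_mult_ge_left: "ereal t \<le> valD Q x \<Longrightarrow> 0 \<le> valD Q y \<Longrightarrow> ereal t \<le> valD Q (x * y)"
  using valD_mult_ge[of t x 0 y] by (simp flip: zero_ereal_def)

lemma valD_mult_ge_right: "0 \<le> valD Q x \<Longrightarrow> ereal t \<le> valD Q y \<Longrightarrow> ereal t \<le> valD Q (x * y)"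
  using valD_mult_ge[of 0 x t y] by (simp flip: zero_ereal_def)

lemma valD_mult_gt_left: "ereal t < valD Q x \<Longrightarrow> 0 \<le> valD Q y \<Longrightarrow> ereal t < valD Q (x * y)"
  using D.val_mult_gt(1)[of t x 0 y] by (simp flip: zero_ereal_def)

lemma valD_mult_gt_right: "0 \<le> valD Q x \<Longrightarrow> ereal t < valD Q y \<Longrightarrow> ereal t < valD Q (x * y)"
  using D.val_mult_gt(2)[of t y 0 x] by (simp flip: zero_ereal_def)

lemma valD_near_one: "ereal t \<le> valD Q (a - 1) \<Longrightarrow> 0 < t \<Longrightarrow> valD Q a = 0"
  using D.val_sub_one_pos_imp_val_zero[of a] valD_ge_gt[of t "a - 1" 0]
  by (simp flip: zero_ereal_def)

lemma valD_pr0: "t \<le> valD Q z \<Longrightarrow> t \<le> valD Q (pr0 z)" "t < valD Q z \<Longrightarrow> t < valD Q (pr0 z)"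
  and valD_pr1: "t \<le> valD Q z \<Longrightarrow> t \<le> valD Q (pr1 z)" "t < valD Q z \<Longrightarrow> t < valD Q (pr1 z)"
  by (auto simp: valD_eq_min[of z])

text \<open>
  In these coordinates, with \<open>y\<close> and \<open>z\<close> in the complement of \<open>E\<close>, the embedding of \<open>D\<close> is
  \<open>a + y \<mapsto> Mx a y y a\<close>, and depths of root elements become valuations of \<open>y\<close> and \<open>z\<close>.
\<close>

definition Mx :: "'d \<Rightarrow> 'd \<Rightarrow> 'd \<Rightarrow> 'd \<Rightarrow> 'd^2^2" where
  "Mx a y z d = mat2 a (y * \<sigma>) (inverse \<sigma> * z) (qconj Q d)"

lemma sigma_commute: "x \<in> E \<Longrightarrow> \<sigma> * qconj Q x = x * \<sigma>"
  using perp_commute[OF sigma_perp qconj_E, of x] by simp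

lemma inverse_sigma_commute: "x \<in> E \<Longrightarrow> qconj Q x * inverse \<sigma> = inverse \<sigma> * x"
  using perp_commute[OF inverse_perp[OF sigma_perp], of x] by simp

lemma sigma_conjugate: "x \<in> E \<Longrightarrow> inverse \<sigma> * x * \<sigma> = qconj Q x"
  using sigma_neq_zero inverse_sigma_commute[of x] by (metis mult.assoc left_inverse mult.right_neutral)

text \<open>The conjugate on d absorbs moving \<sigma> past E, so the product follows the plain 2 by
  2 rule and \<sigma> drops out of later computations.\<close>

lemma Mx_mult:
  assumes "a \<in> E" "d \<in> E" "a' \<in> E" "d' \<in> E" "z \<in> perp" "y' \<in> perp"
  shows "Mx a y z d ** Mx a' y' z' d' = Mx (a * a' + y * z') (a * y' + y * d') (z * a' + d * z') (d * d' + z * y')"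
proof -
  have 1: "y * \<sigma> * (inverse \<sigma> * z') = y * z'"
    using sigma_neq_zero by (metis mult.assoc mult.right_neutral right_inverse)
  have 2: "y * \<sigma> * qconj Q d' = y * d' * \<sigma>"
    using sigma_commute[OF assms(4)] by (simp only: mult.assoc)
  have 3: "qconj Q d * (inverse \<sigma> * z') = inverse \<sigma> * (d * z')"
    using inverse_sigma_commute[OF assms(2)] by (simp only: mult.assoc[symmetric])
  have 4: "inverse \<sigma> * z * (y' * \<sigma>) = qconj Q (z * y')"
    using sigma_conjugate[OF perp_mult_perp[OF assms(5,6)]] by (simp only: mult.assoc)
  have 5: "qconj Q d * qconj Q d' = qconj Q (d * d')"
    using assms by (simp add: qconj_mult commute_E[OF qconj_E qconj_E])
  show ?thesis
    unfolding Mx_def mat2_mult mat2_eq_iff 1 2 3 4 5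
    by (simp add: distrib_left distrib_right qconj_add add.commute mult.assoc)
qed

lemma Mx_eq_iff: "Mx a y z d = Mx a' y' z' d' \<longleftrightarrow> a = a' \<and> y = y' \<and> z = z' \<and> d = d'"
proof -
  have "qconj Q d = qconj Q d' \<longleftrightarrow> d = d'"
    by (metis qconj_qconj)
  then show ?thesis
    using sigma_neq_zero by (simp add: Mx_def mat2_eq_iff)
qed

lemma mat_one_eq_Mx: "mat 1 = Mx 1 0 0 1"
  by (simp add: Mx_def mat_one_eq_mat2)

lemma sigma_right: "z * \<sigma> = pr1 z * \<sigma> + \<sigma> * qconj Q (pr0 z)"
proof -
  have "z * \<sigma> = (pr1 z + pr0 z) * \<sigma>"
    by (simp add: add.commute)
  then show ?thesis
    by (simp only: distrib_right sigma_commute[OF pr0_in_E])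
qed

text \<open>Both defining equations are decompositions along E and the complement, so
  \<open>pr_unique\<close> gives the uniqueness that the definite description requires.\<close>

lemma iota_eq: "iota E \<sigma> z = Mx (pr0 z) (pr1 z) (pr1 z) (pr0 z)"
  unfolding iota_def
proof (rule the_equality)
  let ?a = "pr0 z" and ?b = "pr1 z * \<sigma>" and ?c = "inverse \<sigma> * pr1 z" and ?d = "qconj Q (pr0 z)"
  have "z * \<sigma> = ?b + \<sigma> * ?d"
    by (rule sigma_right)
  moreover have "z = ?a + \<sigma> * ?c"
    using sigma_neq_zero by (simp flip: mult.assoc)
  ultimately show "\<exists>a\<in>E. \<exists>b\<in>E. \<exists>c\<in>E. \<exists>d\<in>E. Mx (pr0 z) (pr1 z) (pr1 z) (pr0 z) = mat2 a b c d \<and>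
      z = a + \<sigma> * c \<and> z * \<sigma> = b + \<sigma> * d"
    by (intro bexI[of _ ?a] bexI[of _ ?b] bexI[of _ ?c] bexI[of _ ?d])
      (simp_all add: Mx_def pr0_in_E qconj_E perp_mult_perp inverse_perp pr1_in_perp sigma_perp)
next
  fix A
  assume "\<exists>a\<in>E. \<exists>b\<in>E. \<exists>c\<in>E. \<exists>d\<in>E. A = mat2 a b c d \<and> z = a + \<sigma> * c \<and> z * \<sigma> = b + \<sigma> * d"
  then obtain a b c d where E: "a \<in> E" "b \<in> E" "c \<in> E" "d \<in> E" and A: "A = mat2 a b c d"
    and z: "z = a + \<sigma> * c" "z * \<sigma> = b + \<sigma> * d"
    by blast
  have p: "pr0 z = a" "pr1 z = \<sigma> * c"
    using pr_unique[OF E(1) perp_mult_E[OF sigma_perp E(3)]] z(1) by simp_all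
  have "z * \<sigma> = pr1 z * \<sigma> + \<sigma> * qconj Q (pr0 z)"
    by (rule sigma_right)
  then have eq: "b + \<sigma> * d = pr1 z * \<sigma> + \<sigma> * qconj Q (pr0 z)"
    using z(2) by simp
  have "b = pr1 z * \<sigma>" "\<sigma> * d = \<sigma> * qconj Q (pr0 z)"
    using pr_unique[OF E(2) perp_mult_E[OF sigma_perp E(4)]] eq
      pr_unique[OF perp_mult_perp[OF pr1_in_perp sigma_perp] perp_mult_E[OF sigma_perp qconj_E[OF pr0_in_E]], of z z]
    by simp_all
  then show "A = Mx (pr0 z) (pr1 z) (pr1 z) (pr0 z)"
    using sigma_neq_zero p unfolding A Mx_def by (simp flip: mult.assoc)
qed

lemma group_GL2: "group (GL2 E)"
proof (rule groupI)
  fix A B C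
  assume A: "A \<in> carrier (GL2 E)"
  show "\<one>\<^bsub>GL2 E\<^esub> \<otimes>\<^bsub>GL2 E\<^esub> A = A"
    by (simp add: GL2_def)
  show "\<exists>B\<in>carrier (GL2 E). B \<otimes>\<^bsub>GL2 E\<^esub> A = \<one>\<^bsub>GL2 E\<^esub>"
    using A by (auto simp: GL2_def)
  assume B: "B \<in> carrier (GL2 E)"
  obtain A' B' where A': "\<And>i j. A' $ i $ j \<in> E" "A ** A' = mat 1" "A' ** A = mat 1"
    and B': "\<And>i j. B' $ i $ j \<in> E" "B ** B' = mat 1" "B' ** B = mat 1"
    using A B by (auto simp: GL2_def)
  have "(\<forall>i j. (X ** Y) $ i $ j \<in> E)" if "\<And>i j. X $ i $ j \<in> E" "\<And>i j. Y $ i $ j \<in> E" for X Y :: "'d^2^2"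
    using that by (simp add: matrix_matrix_mult_def sum_2 add_E mult_E)
  moreover have "(A ** B) ** (B' ** A') = mat 1" "(B' ** A') ** (A ** B) = mat 1"
    by (metis A'(2,3) B'(2,3) matrix_mul_assoc matrix_mul_lid)+
  ultimately show "A \<otimes>\<^bsub>GL2 E\<^esub> B \<in> carrier (GL2 E)"
    using A B A'(1) B'(1) by (auto simp: GL2_def intro!: exI[of _ "B' ** A'"])
  show "A \<otimes>\<^bsub>GL2 E\<^esub> B \<otimes>\<^bsub>GL2 E\<^esub> C = A \<otimes>\<^bsub>GL2 E\<^esub> (B \<otimes>\<^bsub>GL2 E\<^esub> C)"
    by (simp add: GL2_def matrix_mul_assoc)
next
  show "\<one>\<^bsub>GL2 E\<^esub> \<in> carrier (GL2 E)"
  proof -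
    have "(mat 1 :: 'd^2^2) $ i $ j \<in> E" for i j
      by (simp add: mat_def)
    then show ?thesis
      unfolding GL2_def by (auto intro!: exI[of _ "mat 1"])
  qed
qed

lemma Mx_entries: "a \<in> E \<Longrightarrow> d \<in> E \<Longrightarrow> y \<in> perp \<Longrightarrow> z \<in> perp \<Longrightarrow> Mx a y z d $ i $ j \<in> E"
  using exhaust_2[of i] exhaust_2[of j]
  by (auto simp: Mx_def perp_mult_perp sigma_perp inverse_perp qconj_E)

lemma GL2_inverse_pair:
  assumes "\<And>i j. A $ i $ j \<in> E" "\<And>i j. B $ i $ j \<in> E" "A ** B = mat 1" "B ** A = mat 1"
  shows "A \<in> carrier (GL2 E)" "inv\<^bsub>GL2 E\<^esub> A = B"
proof -
  show "A \<in> carrier (GL2 E)"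
    using assms by (auto simp: GL2_def)
  moreover have "B \<in> carrier (GL2 E)"
    using assms by (auto simp: GL2_def)
  ultimately show "inv\<^bsub>GL2 E\<^esub> A = B"
    using assms(4) by (intro group.inv_equality[OF group_GL2]) (auto simp: GL2_def)
qed

lemma upper_inverse:
  assumes "y \<in> perp"
  shows "Mx 1 y 0 1 \<in> carrier (GL2 E)" "inv\<^bsub>GL2 E\<^esub> (Mx 1 y 0 1) = Mx 1 (- y) 0 1"
    and "Mx 1 y 0 1 ** Mx 1 (- y) 0 1 = mat 1"
proof -
  show *: "Mx 1 y 0 1 ** Mx 1 (- y) 0 1 = mat 1"
    using assms by (simp add: Mx_mult minus_perp mat_one_eq_Mx)
  have "Mx 1 (- y) 0 1 ** Mx 1 y 0 1 = mat 1"
    using assms by (simp add: Mx_mult minus_perp mat_one_eq_Mx)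
  with * show "Mx 1 y 0 1 \<in> carrier (GL2 E)" "inv\<^bsub>GL2 E\<^esub> (Mx 1 y 0 1) = Mx 1 (- y) 0 1"
    using assms by (auto intro!: GL2_inverse_pair Mx_entries minus_perp)
qed

lemma lower_inverse:
  assumes "y \<in> perp"
  shows "Mx 1 0 y 1 \<in> carrier (GL2 E)" "inv\<^bsub>GL2 E\<^esub> (Mx 1 0 y 1) = Mx 1 0 (- y) 1"
    and "Mx 1 0 y 1 ** Mx 1 0 (- y) 1 = mat 1"
proof -
  show *: "Mx 1 0 y 1 ** Mx 1 0 (- y) 1 = mat 1"
    using assms by (simp add: Mx_mult minus_perp mat_one_eq_Mx)
  have "Mx 1 0 (- y) 1 ** Mx 1 0 y 1 = mat 1"
    using assms by (simp add: Mx_mult minus_perp mat_one_eq_Mx)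
  with * show "Mx 1 0 y 1 \<in> carrier (GL2 E)" "inv\<^bsub>GL2 E\<^esub> (Mx 1 0 y 1) = Mx 1 0 (- y) 1"
    using assms by (auto intro!: GL2_inverse_pair Mx_entries minus_perp)
qed

lemma diagonal_inverse:
  assumes "a \<in> E" "d \<in> E" "a \<noteq> 0" "d \<noteq> 0"
  shows "Mx a 0 0 d \<in> carrier (GL2 E)" "inv\<^bsub>GL2 E\<^esub> (Mx a 0 0 d) = Mx (inverse a) 0 0 (inverse d)"
proof -
  have *: "Mx a 0 0 d ** Mx (inverse a) 0 0 (inverse d) = mat 1"
    "Mx (inverse a) 0 0 (inverse d) ** Mx a 0 0 d = mat 1"
    using assms by (simp_all add: Mx_mult inverse_E mat_one_eq_Mx)
  with assms show "Mx a 0 0 d \<in> carrier (GL2 E)" "inv\<^bsub>GL2 E\<^esub> (Mx a 0 0 d) = Mx (inverse a) 0 0 (inverse d)"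
    by (auto intro!: GL2_inverse_pair Mx_entries inverse_E)
qed

text \<open>Covers the two bounds, at least and more than \<open>r / 2\<close>, so that J and J+ are
  treated at once. R is the condition on off-diagonal entries: it cuts out a two-sided module over
  the integers of D inside depth \<open>r / 2\<close>.\<close>

definition depth_cond :: "('d \<Rightarrow> bool) \<Rightarrow> bool" where
  "depth_cond R \<longleftrightarrow> R 0 \<and> (\<forall>y. R y \<longrightarrow> ereal (r / 2) \<le> valD Q y \<and> R (- y)) \<and>
     (\<forall>x y. R x \<longrightarrow> R y \<longrightarrow> R (x + y)) \<and> (\<forall>x y. R y \<longrightarrow> 0 \<le> valD Q x \<longrightarrow> R (x * y) \<and> R (y * x))"

lemma depth_cond_ge: "depth_cond (\<lambda>y. ereal (r / 2) \<le> valD Q y)"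
  unfolding depth_cond_def by (auto intro: D.val_add_ge valD_mult_ge_left valD_mult_ge_right)

lemma depth_cond_gt: "depth_cond (\<lambda>y. ereal (r / 2) < valD Q y)"
  unfolding depth_cond_def by (auto intro: D.val_add_gt valD_mult_gt_left valD_mult_gt_right less_imp_le)

definition Kset :: "('d \<Rightarrow> bool) \<Rightarrow> ('d^2^2) set" where
  "Kset R = {Mx a y z d | a y z d. a \<in> E \<and> d \<in> E \<and> y \<in> perp \<and> z \<in> perp \<and>
     ereal r \<le> valD Q (a - 1) \<and> ereal r \<le> valD Q (d - 1) \<and> R y \<and> R z}"

lemma KsetI:
  "a \<in> E \<Longrightarrow> d \<in> E \<Longrightarrow> y \<in> perp \<Longrightarrow> z \<in> perp \<Longrightarrow> ereal r \<le> valD Q (a - 1) \<Longrightarrow>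
   ereal r \<le> valD Q (d - 1) \<Longrightarrow> R y \<Longrightarrow> R z \<Longrightarrow> Mx a y z d \<in> Kset R"
  unfolding Kset_def by blast

lemma Mx_in_Kset_iff:
  "Mx a y z d \<in> Kset R \<longleftrightarrow> a \<in> E \<and> d \<in> E \<and> y \<in> perp \<and> z \<in> perp \<and>
     ereal r \<le> valD Q (a - 1) \<and> ereal r \<le> valD Q (d - 1) \<and> R y \<and> R z"
  unfolding Kset_def by (auto simp: Mx_eq_iff)

lemma near_one_mult:
  assumes "ereal r \<le> valD Q (a - 1)" "ereal r \<le> valD Q (b - 1)"
  shows "ereal r \<le> valD Q (a * b - 1)"
proof -
  have "ereal r \<le> valD Q (a * (b - 1) + (a - 1))"
    using assms valD_near_one[OF assms(1) r_pos] by (intro D.val_add_ge valD_mult_ge_right) auto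
  then show ?thesis
    by (simp add: right_diff_distrib)
qed

lemma near_one_inverse:
  assumes "ereal r \<le> valD Q (a - 1)"
  shows "ereal r \<le> valD Q (inverse a - 1)"
proof -
  have a: "valD Q a = 0"
    by (rule valD_near_one[OF assms r_pos])
  then have a0: "a \<noteq> 0"
    by auto
  then have "inverse a - 1 = - (inverse a * (a - 1))"
    by (simp add: right_diff_distrib)
  then show ?thesis
    using assms a by (simp add: valD_mult D.val_inverse[OF a0])
qed

text \<open>Off-diagonal entries have depth at least \<open>r / 2\<close>, so their products reach
  depth r and are absorbed by the diagonal.\<close>

lemma Kset_mult:
  assumes R: "depth_cond R" and "A \<in> Kset R" "B \<in> Kset R"
  shows "A ** B \<in> Kset R"
proof -
  obtain a y z d where A: "A = Mx a y z d" "a \<in> E" "d \<in> E" "y \<in> perp" "z \<in> perp"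
    "ereal r \<le> valD Q (a - 1)" "ereal r \<le> valD Q (d - 1)" "R y" "R z"
    using assms(2) unfolding Kset_def by blast
  obtain a' y' z' d' where B: "B = Mx a' y' z' d'" "a' \<in> E" "d' \<in> E" "y' \<in> perp" "z' \<in> perp"
    "ereal r \<le> valD Q (a' - 1)" "ereal r \<le> valD Q (d' - 1)" "R y'" "R z'"
    using assms(3) unfolding Kset_def by blast
  have u: "valD Q a = 0" "valD Q a' = 0" "valD Q d = 0" "valD Q d' = 0"
    using A B by (auto intro: valD_near_one r_pos)
  have sq: "ereal r \<le> valD Q (v * w)" if "R v" "R w" for v w
    using valD_mult_ge[of "r / 2" v "r / 2" w] that R by (simp add: depth_cond_def)
  have "ereal r \<le> valD Q ((a * a' - 1) + y * z')" "ereal r \<le> valD Q ((d * d' - 1) + z * y')"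
    using A B by (auto intro!: D.val_add_ge near_one_mult sq)
  then have 1: "ereal r \<le> valD Q (a * a' + y * z' - 1)" "ereal r \<le> valD Q (d * d' + z * y' - 1)"
    by (simp_all add: algebra_simps)
  have "R (a * y' + y * d')" "R (z * a' + d * z')"
    using R A(8,9) B(8,9) u unfolding depth_cond_def by simp_all
  with 1 show ?thesis
    unfolding A(1) B(1) Mx_mult[OF A(2,3) B(2,3) A(5) B(4)]
    using A B by (intro KsetI) (blast intro: add_E mult_E add_perp perp_mult_perp perp_mult_E E_mult_perp)+
qed

text \<open>Gauss elimination from the lower right entry, as upper unipotent times diagonal times
  lower unipotent.\<close>

lemma Mx_decompose:
  assumes "a \<in> E" "d \<in> E" "y \<in> perp" "z \<in> perp" "d \<noteq> 0"
  shows "Mx a y z d = Mx 1 (y * inverse d) 0 1 ** Mx (a - y * inverse d * z) 0 0 d ** Mx 1 0 (inverse d * z) 1"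
proof -
  have E: "a - y * inverse d * z \<in> E" "y * inverse d \<in> perp" "inverse d * z \<in> perp"
    using assms by (blast intro: diff_E perp_mult_perp perp_mult_E E_mult_perp inverse_E)+
  have 1: "Mx 1 (y * inverse d) 0 1 ** Mx (a - y * inverse d * z) 0 0 d = Mx (a - y * inverse d * z) y 0 d"
    using assms E by (subst Mx_mult) (auto simp: mult.assoc)
  have 2: "d * (inverse d * z) = z"
    using assms(5) by (simp flip: mult.assoc)
  show ?thesis
    unfolding 1 using assms E 2 by (subst Mx_mult) (auto simp: mult.assoc)
qed

lemma Kset_factors:
  assumes R: "depth_cond R"
    and "a \<in> E" "d \<in> E" "y \<in> perp" "z \<in> perp" "ereal r \<le> valD Q (a - 1)" "ereal r \<le> valD Q (d - 1)" "R y" "R z"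
  shows "d \<noteq> 0" "y * inverse d \<in> perp" "R (y * inverse d)" "inverse d * z \<in> perp" "R (inverse d * z)"
    "a - y * inverse d * z \<in> E" "ereal r \<le> valD Q (a - y * inverse d * z - 1)"
proof -
  have v: "valD Q d = 0"
    by (rule valD_near_one[OF assms(7) r_pos])
  then show d: "d \<noteq> 0"
    by auto
  have i: "0 \<le> valD Q (inverse d)"
    unfolding D.val_inverse[OF d] v by simp
  show y: "y * inverse d \<in> perp" "R (y * inverse d)" and "inverse d * z \<in> perp" "R (inverse d * z)"
    using perp_mult_E[OF assms(4) inverse_E[OF assms(3)]] E_mult_perp[OF inverse_E[OF assms(3)] assms(5)] R assms(8,9) i
    unfolding depth_cond_def by simp_all
  then show "a - y * inverse d * z \<in> E"
    using assms by (auto intro!: diff_E perp_mult_perp)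
  have "ereal (r / 2 + r / 2) \<le> valD Q (y * inverse d * z)"
    using y(2) assms(9) R by (intro valD_mult_ge) (auto simp: depth_cond_def)
  then have "ereal r \<le> valD Q ((a - 1) - y * inverse d * z)"
    by (intro D.val_diff_ge[OF assms(6)]) simp
  then show "ereal r \<le> valD Q (a - y * inverse d * z - 1)"
    by (simp add: algebra_simps)
qed

text \<open>Closure under products and inverses of generators gives one inclusion, Gauss elimination
  the other, because \<open>Kset_factors\<close> keeps the three factors within the same
  bounds.\<close>

lemma generate_Kset:
  assumes R: "depth_cond R"
  shows "generate (GL2 E) ({Mx a 0 0 d | a d. a \<in> E \<and> d \<in> E \<and> ereal r \<le> valD Q (a - 1) \<and> ereal r \<le> valD Q (d - 1)}
    \<union> {Mx 1 y 0 1 | y. y \<in> perp \<and> R y} \<union> {Mx 1 0 y 1 | y. y \<in> perp \<and> R y}) = Kset R"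
    (is "generate _ (?T \<union> ?U \<union> ?L) = _")
proof (intro equalityI subsetI)
  have R0: "R 0" and Rm: "R y \<Longrightarrow> R (- y)" for y
    using R by (auto simp: depth_cond_def)
  have unit: "a \<noteq> 0" if "ereal r \<le> valD Q (a - 1)" for a
    using valD_near_one[OF that r_pos] by auto
  fix A
  assume "A \<in> generate (GL2 E) (?T \<union> ?U \<union> ?L)"
  then show "A \<in> Kset R"
  proof (induction rule: generate.induct)
    case one
    show ?case
      using R0 by (simp add: GL2_def mat_one_eq_Mx Mx_in_Kset_iff)
  next
    case (incl h)
    then show ?case
      using R0 by (auto simp: Mx_in_Kset_iff)
  next
    case (inv h)
    then show ?case
      using R0 Rm unit
      by (auto simp: Mx_in_Kset_iff diagonal_inverse upper_inverse lower_inverse inverse_E minus_perp near_one_inverse)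
  next
    case (eng h1 h2)
    then show ?case
      using Kset_mult[OF R] by (simp add: GL2_def)
  qed
next
  fix A
  assume "A \<in> Kset R"
  then obtain a y z d where A: "A = Mx a y z d" "a \<in> E" "d \<in> E" "y \<in> perp" "z \<in> perp"
    "ereal r \<le> valD Q (a - 1)" "ereal r \<le> valD Q (d - 1)" "R y" "R z"
    unfolding Kset_def by blast
  note f = Kset_factors[OF R A(2-9)]
  let ?G = "generate (GL2 E) (?T \<union> ?U \<union> ?L)"
  have "Mx 1 (y * inverse d) 0 1 \<in> ?G" "Mx (a - y * inverse d * z) 0 0 d \<in> ?G" "Mx 1 0 (inverse d * z) 1 \<in> ?G"
    using f A by (auto intro!: generate.incl)
  then have "Mx 1 (y * inverse d) 0 1 \<otimes>\<^bsub>GL2 E\<^esub> Mx (a - y * inverse d * z) 0 0 d \<otimes>\<^bsub>GL2 E\<^esub>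
      Mx 1 0 (inverse d * z) 1 \<in> ?G"
    by (intro generate.eng)
  then show "A \<in> ?G"
    unfolding A(1) Mx_decompose[OF A(2-5) f(1)] by (simp add: GL2_def)
qed

lemma torusE_eq:
  "torusE Q E r = {Mx a 0 0 d | a d. a \<in> E \<and> d \<in> E \<and> ereal r \<le> valD Q (a - 1) \<and> ereal r \<le> valD Q (d - 1)}"
proof -
  have "valD Q (qconj Q d - 1) = valD Q (d - 1)" for d
    using valD_qconj[of "d - 1"] by (simp add: qconj_diff)
  moreover have "mat2 a 0 0 d = Mx a 0 0 (qconj Q d)" for a d
    by (simp add: Mx_def)
  ultimately show ?thesis
    unfolding torusE_def by (metis (no_types, opaque_lifting) qconj_E qconj_qconj)
qed

lemma valD_sigma: obtains v where "valD Q \<sigma> = ereal v"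
  using D.val_real[OF sigma_neq_zero] by blast

text \<open>The shift by the valuation of \<sigma> in the depth of a root element cancels against
  the factor \<sigma> in the entry of \<open>Mx\<close>.\<close>

lemma root_pos_eq: "root_pos Q E \<sigma> t = {Mx 1 y 0 1 | y. y \<in> perp \<and> ereal t \<le> valD Q y}"
proof -
  obtain v where v: "valD Q \<sigma> = ereal v"
    by (rule valD_sigma)
  have *: "ereal t + valD Q \<sigma> \<le> valD Q (y * \<sigma>) \<longleftrightarrow> ereal t \<le> valD Q y" for y
    by (cases "valD Q y") (auto simp: valD_mult v)
  have 1: "mat2 1 c 0 1 = Mx 1 (c * inverse \<sigma>) 0 1" and 2: "c * inverse \<sigma> * \<sigma> = c" for c
    using sigma_neq_zero by (simp_all add: Mx_def mult.assoc)
  have 3: "c \<in> E \<Longrightarrow> c * inverse \<sigma> \<in> perp" and 4: "y \<in> perp \<Longrightarrow> y * \<sigma> \<in> E" for c y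
    by (auto intro!: E_mult_perp perp_mult_perp inverse_perp sigma_perp)
  show ?thesis
  proof (intro equalityI subsetI)
    fix A assume "A \<in> root_pos Q E \<sigma> t"
    then obtain c where c: "A = mat2 1 c 0 1" "c \<in> E" "ereal t + valD Q \<sigma> \<le> valD Q c"
      unfolding root_pos_def by blast
    then have "ereal t \<le> valD Q (c * inverse \<sigma>)"
      using *[of "c * inverse \<sigma>"] 2 by simp
    then show "A \<in> {Mx 1 y 0 1 | y. y \<in> perp \<and> ereal t \<le> valD Q y}"
      using c 1 3 by blast
  next
    fix A assume "A \<in> {Mx 1 y 0 1 | y. y \<in> perp \<and> ereal t \<le> valD Q y}"
    then show "A \<in> root_pos Q E \<sigma> t"
      unfolding root_pos_def using * 4 by (auto simp: Mx_def)
  qed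
qed

lemma root_neg_eq: "root_neg Q E \<sigma> t = {Mx 1 0 y 1 | y. y \<in> perp \<and> ereal t \<le> valD Q y}"
proof -
  have 2: "\<sigma> * (inverse \<sigma> * y) = y" "inverse \<sigma> * (\<sigma> * y) = y" for y
    using sigma_neq_zero by (simp_all flip: mult.assoc)
  have *: "valD Q c + valD Q \<sigma> = valD Q (\<sigma> * c)" for c
    by (simp add: valD_mult add.commute)
  have 1: "mat2 1 0 c 1 = Mx 1 0 (\<sigma> * c) 1" for c
    by (simp add: Mx_def 2)
  have 3: "c \<in> E \<Longrightarrow> \<sigma> * c \<in> perp" and 4: "y \<in> perp \<Longrightarrow> inverse \<sigma> * y \<in> E" for c y
    by (auto intro!: perp_mult_E perp_mult_perp inverse_perp sigma_perp)
  show ?thesis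
  proof (intro equalityI subsetI)
    fix A assume "A \<in> root_neg Q E \<sigma> t"
    then show "A \<in> {Mx 1 0 y 1 | y. y \<in> perp \<and> ereal t \<le> valD Q y}"
      unfolding root_neg_def * using 1 3 by blast
  next
    fix A assume "A \<in> {Mx 1 0 y 1 | y. y \<in> perp \<and> ereal t \<le> valD Q y}"
    then obtain y where y: "A = Mx 1 0 y 1" "y \<in> perp" "ereal t \<le> valD Q y"
      by blast
    then have "A = mat2 1 0 (inverse \<sigma> * y) 1"
      by (simp add: Mx_def)
    then show "A \<in> root_neg Q E \<sigma> t"
      unfolding root_neg_def * using y 2 4 by auto
  qed
qed

abbreviation Kge :: "('d^2^2) set" where
  "Kge \<equiv> Kset (\<lambda>y. ereal (r / 2) \<le> valD Q y)"

abbreviation Kgt :: "('d^2^2) set" where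
  "Kgt \<equiv> Kset (\<lambda>y. ereal (r / 2) < valD Q y)"

lemma JE_eq: "JE Q E \<sigma> r = Kge"
  unfolding JE_def torusE_eq root_pos_eq root_neg_eq by (rule generate_Kset[OF depth_cond_ge])

lemma root_union_eq:
  "(\<Union>t\<in>{r / 2<..}. root_pos Q E \<sigma> t) = {Mx 1 y 0 1 | y. y \<in> perp \<and> ereal (r / 2) < valD Q y}"
  "(\<Union>t\<in>{r / 2<..}. root_neg Q E \<sigma> t) = {Mx 1 0 y 1 | y. y \<in> perp \<and> ereal (r / 2) < valD Q y}"
proof -
  have "(\<exists>t>r / 2. ereal t \<le> valD Q y) \<longleftrightarrow> ereal (r / 2) < valD Q y" for y
  proof
    assume "\<exists>t>r / 2. ereal t \<le> valD Q y"
    then show "ereal (r / 2) < valD Q y"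
      using valD_ge_gt by blast
  next
    assume "ereal (r / 2) < valD Q y"
    then show "\<exists>t>r / 2. ereal t \<le> valD Q y"
      by (rule valD_gt_real) blast
  qed
  then show "(\<Union>t\<in>{r / 2<..}. root_pos Q E \<sigma> t) = {Mx 1 y 0 1 | y. y \<in> perp \<and> ereal (r / 2) < valD Q y}"
    "(\<Union>t\<in>{r / 2<..}. root_neg Q E \<sigma> t) = {Mx 1 0 y 1 | y. y \<in> perp \<and> ereal (r / 2) < valD Q y}"
    unfolding root_pos_eq root_neg_eq by (blast, blast)
qed

lemma JE_plus_eq: "JE_plus Q E \<sigma> r = Kgt"
  unfolding JE_plus_def torusE_eq root_union_eq by (rule generate_Kset[OF depth_cond_gt])

text \<open>A coordinate form of J in which \<sigma> no longer appears, so that constructions made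
  with different \<sigma> concern the same group.\<close>

definition Jset :: "'d set" where
  "Jset = {h. ereal r \<le> valD Q (pr0 h - 1) \<and> ereal (r / 2) \<le> valD Q (pr1 h)}"

definition Jset_plus :: "'d set" where
  "Jset_plus = {h. ereal r \<le> valD Q (pr0 h - 1) \<and> ereal (r / 2) < valD Q (pr1 h)}"

lemma Jset_plus_subset: "Jset_plus \<subseteq> Jset"
  unfolding Jset_plus_def Jset_def by (auto intro: less_imp_le)

lemma Jset_neq_zero: "h \<in> Jset \<Longrightarrow> h \<noteq> 0"
  using r_pos valD_near_one[of r 0] by (auto simp: Jset_def)

lemma J_grp_eq: "J_grp Q E \<sigma> r = Jset"
  using Jset_neq_zero unfolding J_grp_def JE_eq
  by (auto simp: iota_eq Mx_in_Kset_iff pr0_in_E pr1_in_perp Jset_def mult_grp_def)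

lemma J_plus_eq: "J_plus Q E \<sigma> r = Jset_plus"
  using Jset_neq_zero Jset_plus_subset unfolding J_plus_def JE_plus_eq
  by (auto simp: iota_eq Mx_in_Kset_iff pr0_in_E pr1_in_perp Jset_plus_def mult_grp_def)

end

section \<open>Inverses and commutators in J\<close>

context torus_depth
begin

lemma valD_half: "valD Q (emb Q (1 / 2)) = 0"
  unfolding valD_emb inverse_eq_divide[symmetric] F.val_inverse[OF two_neq_zero_F] fval_two by simp

lemma half_mult_ge: "ereal t \<le> valD Q x \<Longrightarrow> ereal t \<le> valD Q (emb Q (1 / 2) * x)"
  by (simp add: valD_mult valD_half del: valD_emb)

lemma half_mult_gt: "ereal t < valD Q x \<Longrightarrow> ereal t < valD Q (emb Q (1 / 2) * x)"
  by (simp add: valD_mult valD_half del: valD_emb)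

lemma GL2_mult: "A \<otimes>\<^bsub>GL2 E\<^esub> B = A ** B"
  by (simp add: GL2_def)

lemma pr0_mult: "pr0 (x * y) = pr0 x * pr0 y + pr1 x * pr1 y"
  and pr1_mult: "pr1 (x * y) = pr0 x * pr1 y + pr1 x * pr0 y"
proof -
  have eq: "x * y = (pr0 x * pr0 y + pr1 x * pr1 y) + (pr0 x * pr1 y + pr1 x * pr0 y)"
    using arg_cong2[OF pr0_pr1[of x, symmetric] pr0_pr1[of y, symmetric], of "(*)"]
    by (simp only: distrib_left distrib_right add_ac)
  have m: "pr0 x * pr0 y + pr1 x * pr1 y \<in> E" "pr0 x * pr1 y + pr1 x * pr0 y \<in> perp"
    using pr0_in_E pr1_in_perp by (blast intro: add_E mult_E perp_mult_perp add_perp perp_mult_E E_mult_perp)+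
  show "pr0 (x * y) = pr0 x * pr0 y + pr1 x * pr1 y" "pr1 (x * y) = pr0 x * pr1 y + pr1 x * pr0 y"
    using pr_unique[OF m] unfolding eq by blast+
qed

lemma pr1_add: "pr1 (x + y) = pr1 x + pr1 y"
  by (simp add: pr1_def pr0_add)

lemma pr0_minus [simp]: "pr0 (- x) = - pr0 x"
  using pr0_add[of x "- x"] by (simp add: eq_neg_iff_add_eq_0 add.commute)

lemma pr0_diff: "pr0 (x - y) = pr0 x - pr0 y"
  using pr0_add[of x "- y"] by simp

lemma pr1_diff: "pr1 (x - y) = pr1 x - pr1 y"
  by (simp add: pr1_def pr0_diff)

lemma pr1_E [simp]: "z \<in> E \<Longrightarrow> pr1 z = 0"
  by (simp add: pr1_def)

lemma pr1_perp [simp]: "y \<in> perp \<Longrightarrow> pr1 y = y"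
  by (simp add: pr1_def)

lemma pr0_one [simp]: "pr0 1 = 1" and pr1_one [simp]: "pr1 1 = 0"
  by simp_all

lemma iota_mult: "iota E \<sigma> (x * y) = iota E \<sigma> x ** iota E \<sigma> y"
  unfolding iota_eq by (subst Mx_mult) (simp_all add: pr0_in_E pr1_in_perp pr0_mult pr1_mult add.commute)

lemma Jset_iff: "h \<in> Jset \<longleftrightarrow> iota E \<sigma> h \<in> Kge"
  and Jset_plus_iff: "h \<in> Jset_plus \<longleftrightarrow> iota E \<sigma> h \<in> Kgt"
  by (simp_all add: iota_eq Mx_in_Kset_iff Jset_def Jset_plus_def pr0_in_E pr1_in_perp)

lemma Jset_mult: "x \<in> Jset \<Longrightarrow> y \<in> Jset \<Longrightarrow> x * y \<in> Jset"
  unfolding Jset_iff iota_mult by (rule Kset_mult[OF depth_cond_ge])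

lemma Jset_plus_mult: "x \<in> Jset_plus \<Longrightarrow> y \<in> Jset_plus \<Longrightarrow> x * y \<in> Jset_plus"
  unfolding Jset_plus_iff iota_mult by (rule Kset_mult[OF depth_cond_gt])

lemma Jset_one [simp]: "1 \<in> Jset" and Jset_plus_one [simp]: "1 \<in> Jset_plus"
  by (simp_all add: Jset_def Jset_plus_def)

lemma valD_Jset: "h \<in> Jset \<Longrightarrow> valD Q h = 0"
  using valD_near_one[OF _ r_pos, of "pr0 h"] valD_ge_gt[of "r / 2" "pr1 h" 0] r_pos
  by (auto simp: valD_eq_min[of h] Jset_def min_def zero_ereal_def[symmetric])

text \<open>The inverse is the conjugate divided by the norm, and the norm of an element of J is a
  scalar congruent to 1 to depth r. So inversion is \<open>(a, y)\<close> to
  \<open>(qconj a, - y)\<close> up to a harmless factor c.\<close>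

lemma inverse_coords:
  assumes h: "h \<in> Jset"
  obtains c where "c \<in> E" "ereal r \<le> valD Q (c - 1)"
    "pr0 (inverse h) = qconj Q (pr0 h) * c" "pr1 (inverse h) = - (pr1 h * c)"
proof -
  let ?a = "pr0 h" and ?y = "pr1 h"
  let ?n = "emb Q (nrd Q h)"
  have h0: "h \<noteq> 0"
    by (rule Jset_neq_zero[OF h])
  have eqh: "qconj Q h = qconj Q ?a - ?y"
    using qconj_add[of ?a ?y] by (simp add: qconj_perp pr1_in_perp)
  have p: "pr0 (qconj Q h) = qconj Q ?a" "pr1 (qconj Q h) = - ?y"
    using pr_unique[OF qconj_E[OF pr0_in_E] minus_perp[OF pr1_in_perp], of h h] by (simp_all add: eqh)
  have "?n = pr0 (h * qconj Q h)"
    using pr0_E[OF emb_E] by (simp flip: nrd)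
  then have n: "?n = ?a * qconj Q ?a - ?y * ?y"
    by (simp add: pr0_mult p)
  have "ereal r \<le> valD Q (qconj Q (?a - 1))"
    using h by (simp add: Jset_def del: qconj_minus)
  then have "ereal r \<le> valD Q (qconj Q ?a - 1)"
    by (simp add: qconj_diff)
  then have 1: "ereal r \<le> valD Q (?a * qconj Q ?a - 1)"
    using h by (intro near_one_mult) (auto simp: Jset_def)
  have 2: "ereal (r / 2 + r / 2) \<le> valD Q (?y * ?y)"
    using h by (intro valD_mult_ge) (auto simp: Jset_def)
  have "ereal r \<le> valD Q ((?a * qconj Q ?a - 1) - ?y * ?y)"
    using 2 by (intro D.val_diff_ge[OF 1]) simp
  then have n1: "ereal r \<le> valD Q (?n - 1)"
    unfolding n by (simp add: algebra_simps)
  have "h * (qconj Q h * inverse ?n) = 1"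
    using h0 by (simp add: mult.assoc[symmetric] nrd[symmetric])
  then have inv: "inverse h = qconj Q ?a * inverse ?n + - (?y * inverse ?n)"
    unfolding eqh by (metis add_uminus_conv_diff inverse_unique left_diff_distrib)
  have c: "inverse ?n \<in> E"
    by (simp add: inverse_E)
  show thesis
  proof (rule that[OF c near_one_inverse[OF n1]])
    show "pr0 (inverse h) = qconj Q ?a * inverse ?n" "pr1 (inverse h) = - (?y * inverse ?n)"
      unfolding inv by (rule pr_unique; blast intro: c mult_E qconj_E pr0_in_E minus_perp perp_mult_E pr1_in_perp)+
  qed
qed

lemma qconj_near_one: "valD Q (qconj Q a - 1) = valD Q (a - 1)"
  using valD_qconj[of "a - 1"] by (simp add: qconj_diff)

lemma Jset_inverse:
  assumes h: "h \<in> Jset"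
  shows "inverse h \<in> Jset"
proof -
  obtain c where c: "c \<in> E" "ereal r \<le> valD Q (c - 1)"
    "pr0 (inverse h) = qconj Q (pr0 h) * c" "pr1 (inverse h) = - (pr1 h * c)"
    using inverse_coords[OF h] .
  have "valD Q c = 0"
    by (rule valD_near_one[OF c(2) r_pos])
  then show ?thesis
    using h c near_one_mult[of "qconj Q (pr0 h)" c] by (simp add: Jset_def qconj_near_one valD_mult)
qed

lemma Jset_plus_inverse:
  assumes h: "h \<in> Jset_plus"
  shows "inverse h \<in> Jset_plus"
proof -
  obtain c where c: "c \<in> E" "ereal r \<le> valD Q (c - 1)"
    "pr0 (inverse h) = qconj Q (pr0 h) * c" "pr1 (inverse h) = - (pr1 h * c)"
    using inverse_coords h Jset_plus_subset by blast
  have "valD Q c = 0"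
    by (rule valD_near_one[OF c(2) r_pos])
  then show ?thesis
    using h c near_one_mult[of "qconj Q (pr0 h)" c] by (simp add: Jset_plus_def qconj_near_one valD_mult)
qed

lemma square_ge: "ereal (r / 2) \<le> valD Q x \<Longrightarrow> ereal (r / 2) \<le> valD Q y \<Longrightarrow> ereal r \<le> valD Q (x * y)"
  using valD_mult_ge[of "r / 2" x "r / 2" y] by simp

lemma square_gt:
  "ereal (r / 2) < valD Q x \<Longrightarrow> ereal (r / 2) \<le> valD Q y \<Longrightarrow> ereal r < valD Q (x * y)"
  "ereal (r / 2) < valD Q x \<Longrightarrow> ereal (r / 2) \<le> valD Q y \<Longrightarrow> ereal r < valD Q (y * x)"
  using D.val_mult_gt[of "r / 2" x "r / 2" y] by simp_all

lemma Jset_near_one: "h \<in> Jset \<Longrightarrow> ereal (r / 2) \<le> valD Q (h - 1)"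
proof -
  assume h: "h \<in> Jset"
  have "h - 1 = (pr0 h - 1) + pr1 h"
    by (simp add: pr1_def)
  moreover have "ereal (r / 2) \<le> valD Q ((pr0 h - 1) + pr1 h)"
    using h r_pos by (intro D.val_add_ge) (auto simp: Jset_def intro: valD_ge_mono)
  ultimately show ?thesis
    by (simp only:)
qed

text \<open>E is commutative, and moving the complement past E costs only
  \<open>a - qconj a\<close>, which has depth r; so to first order only the complement parts
  contribute. The group commutator minus 1 is the additive one times
  \<open>inverse (h' * h)\<close>, a factor close to 1.\<close>

lemma commutator_approx:
  assumes h: "h \<in> Jset" and h': "h' \<in> Jset"
  shows "ereal r < valD Q (h * h' * inverse h * inverse h' - 1 - (pr1 h * pr1 h' - pr1 h' * pr1 h))"
    and "ereal r < valD Q (h * h' - h' * h - (pr1 h * pr1 h' - pr1 h' * pr1 h))"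
proof -
  let ?a = "pr0 h" and ?y = "pr1 h" and ?a' = "pr0 h'" and ?y' = "pr1 h'"
  have h0: "h \<noteq> 0" "h' \<noteq> 0"
    using h h' Jset_neq_zero by auto
  define b where "b = ?y * ?y' - ?y' * ?y"
  define u where "u = inverse (h' * h)"
  \<comment> \<open>The error from carrying E past the complement, by \<open>perp_commute\<close>;
    its depth is at least \<open>r + r / 2\<close>.\<close>
  define q where "q = (?a - qconj Q ?a) * ?y' + ?y * (?a' - qconj Q ?a')"
  have u: "u \<in> Jset"
    unfolding u_def by (intro Jset_inverse Jset_mult h h')
  have b: "ereal r \<le> valD Q b"
    unfolding b_def using h h' by (intro D.val_diff_ge square_ge) (auto simp: Jset_def)
  have dq: "ereal r \<le> valD Q (pr0 g - qconj Q (pr0 g))" if "g \<in> Jset" for g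
    using D.val_diff_ge[of "ereal r" "pr0 g - 1" "qconj Q (pr0 g) - 1"] that
    by (simp add: Jset_def qconj_near_one)
  have q: "ereal r < valD Q q"
  proof -
    have "ereal (r + r / 2) \<le> valD Q q"
      unfolding q_def using dq[OF h] dq[OF h'] h h'
        valD_mult_ge[of r "?a - qconj Q ?a" "r / 2" ?y'] valD_mult_ge[of "r / 2" ?y r "?a' - qconj Q ?a'"]
      by (intro D.val_add_ge) (simp_all add: Jset_def add.commute)
    then show ?thesis
      using r_pos by (auto intro: valD_ge_gt)
  qed
  have "h * h' = (?a + ?y) * (?a' + ?y')" "h' * h = (?a' + ?y') * (?a + ?y)"
    by simp_all
  then have "h * h' - h' * h = (?a + ?y) * (?a' + ?y') - (?a' + ?y') * (?a + ?y)"
    by simp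
  also have "\<dots> = b + q"
    using commute_E[OF pr0_in_E pr0_in_E, of h h'] perp_commute[OF pr1_in_perp pr0_in_E, of h' h]
      perp_commute[OF pr1_in_perp pr0_in_E, of h h'] perp_commute[OF pr1_in_perp qconj_E[OF pr0_in_E], of h h']
    unfolding b_def q_def
    by (simp add: distrib_left distrib_right left_diff_distrib right_diff_distrib del: pr0_pr1)
  finally have c: "h * h' - h' * h = b + q" .
  then show "ereal r < valD Q (h * h' - h' * h - (?y * ?y' - ?y' * ?y))"
    using q by (simp add: b_def)
  have "inverse h * inverse h' = u"
    using h0 by (simp add: u_def nonzero_inverse_mult_distrib)
  then have "h * h' * inverse h * inverse h' - 1 = (h * h' - h' * h) * u"
    using h0 by (simp add: left_diff_distrib mult.assoc[symmetric] u_def) (simp add: mult.assoc)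
  then have eq: "h * h' * inverse h * inverse h' - 1 - b = b * (u - 1) + q * u"
    by (simp add: c distrib_right right_diff_distrib)
  have "ereal (r + r / 2) \<le> valD Q (b * (u - 1))"
    by (intro valD_mult_ge b Jset_near_one u)
  then have "ereal r < valD Q (b * (u - 1))"
    using r_pos by (auto intro: valD_ge_gt)
  moreover have "ereal r < valD Q (q * u)"
    using q valD_Jset[OF u] by (intro valD_mult_gt_left) auto
  ultimately show "ereal r < valD Q (h * h' * inverse h * inverse h' - 1 - (?y * ?y' - ?y' * ?y))"
    using eq unfolding b_def by (simp add: D.val_add_gt)
qed

lemma commutator_Jset_plus:
  assumes h: "h \<in> Jset" and h': "h' \<in> Jset"
  shows "h * h' * inverse h * inverse h' \<in> Jset_plus"
    and "ereal r < valD Q (pr0 (h * h' * inverse h * inverse h') - 1 - (pr1 h * pr1 h' - pr1 h' * pr1 h))"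
proof -
  let ?c = "h * h' * inverse h * inverse h'" and ?b = "pr1 h * pr1 h' - pr1 h' * pr1 h"
  have bE: "?b \<in> E"
    by (simp add: diff_E perp_mult_perp pr1_in_perp)
  show 0: "ereal r < valD Q (pr0 ?c - 1 - ?b)"
    using valD_pr0(2)[OF commutator_approx(1)[OF h h']]
    unfolding pr0_diff[of "?c - 1" ?b] pr0_diff[of ?c 1] pr0_E[OF bE] pr0_one .
  have "ereal r < valD Q (pr1 ?c)"
    using valD_pr1(2)[OF commutator_approx(1)[OF h h']]
    unfolding pr1_diff[of "?c - 1" ?b] pr1_diff[of ?c 1] pr1_E[OF bE] pr1_one by simp
  then have 1: "ereal (r / 2) < valD Q (pr1 ?c)"
    using r_pos by (auto intro: valD_gt_mono)
  have "ereal r \<le> valD Q ?b"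
    using h h' by (intro D.val_diff_ge square_ge) (auto simp: Jset_def)
  then have "ereal r \<le> valD Q ((pr0 ?c - 1 - ?b) + ?b)"
    using 0 by (intro D.val_add_ge) auto
  with 1 show "?c \<in> Jset_plus"
    by (simp add: Jset_plus_def)
qed

end

section \<open>The character of J+ and the special isomorphism\<close>

locale torus_character = torus_depth Q p E e0 \<sigma> r
  for Q :: "('f::field, 'd::division_ring) quat_alg" and p E e0 \<sigma> r +
  fixes \<kappa> :: "complex \<Rightarrow> int" and \<psi> :: "'f \<Rightarrow> complex" and \<psi>E :: "'d \<Rightarrow> complex"
    and X :: "'d \<Rightarrow> 'f" and XE :: "'d^2^2 \<Rightarrow> 'd" and \<theta> :: "'d^2^2 \<Rightarrow> complex"
  assumes kappa: "\<kappa> \<in> iso (mu_group p) (integer_mod_group p)"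
    and psi: "additive_character Q \<psi>" and psiE: "extends_character Q \<psi> E \<psi>E"
    and X_small: "\<And>x. x \<in> E \<Longrightarrow> ereal r < valD Q x \<Longrightarrow> 0 < fval Q (X x)"
    and theta_hom: "\<theta> \<in> hom ((GL2 E)\<lparr>carrier := JE_plus Q E \<sigma> r\<rparr>) mult_grp"
    and XE: "extends_scalars Q E X XE"
    and theta_torus: "\<And>a d. mat2 a 0 0 d \<in> torusE Q E r \<Longrightarrow>
           \<theta> (mat2 a 0 0 d) = \<psi>E (XE (mat2 (a - 1) 0 0 (d - 1)))"
    and theta_root: "\<And>t u. t > r / 2 \<Longrightarrow> u \<in> root_pos Q E \<sigma> t \<union> root_neg Q E \<sigma> t \<Longrightarrow> \<theta> u = 1"
begin

text \<open>The E-linear extension of X to E \<otimes> E in the coordinates of \<open>Mx\<close>,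
  whose lower entry is conjugated; on the diagonal it is X.\<close>

definition Y :: "'d \<Rightarrow> 'd \<Rightarrow> 'd" where "Y x w = XE (mat2 x 0 0 (qconj Q w))"

lemma Y_in_E: "x \<in> E \<Longrightarrow> w \<in> E \<Longrightarrow> Y x w \<in> E"
  using XE by (simp add: Y_def extends_scalars_def qconj_E)

lemma Y_add: "x \<in> E \<Longrightarrow> w \<in> E \<Longrightarrow> x' \<in> E \<Longrightarrow> w' \<in> E \<Longrightarrow> Y (x + x') (w + w') = Y x w + Y x' w'"
  using XE by (simp add: Y_def extends_scalars_def qconj_E qconj_add)

lemma Y_scale: "c \<in> E \<Longrightarrow> x \<in> E \<Longrightarrow> w \<in> E \<Longrightarrow> Y (c * x) (qconj Q c * w) = c * Y x w"
proof -
  assume c: "c \<in> E" "x \<in> E" "w \<in> E"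
  have "qconj Q (qconj Q c * w) = c * qconj Q w"
    using c by (simp add: qconj_mult commute_E qconj_E)
  then show ?thesis
    using XE c by (simp add: Y_def extends_scalars_def qconj_E)
qed

lemma Y_diag: "x \<in> E \<Longrightarrow> Y x x = emb Q (X x)"
  using XE by (simp add: Y_def extends_scalars_def)

text \<open>By E-linearity the value at \<open>(x, - x)\<close> is \<open>inverse e0\<close> times
  the value of X at \<open>e0 * x\<close>. The latter has valuation at least 1 by discreteness, and
  \<open>inverse e0\<close> loses at most 1/2.\<close>

lemma Y_anti_small:
  assumes x: "x \<in> E" "ereal r < valD Q x"
  shows "0 < valD Q (Y x (- x))"
proof -
  have i: "inverse e0 * (e0 * x) = x" "qconj Q (inverse e0) * (e0 * x) = - x"
    using e0_neq_zero by (simp_all add: inverse_e0 qconj_mult e0_pure emb_central[symmetric] flip: mult.assoc)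
      (simp_all add: mult.assoc e0_square flip: inverse_e0)
  have "Y x (- x) = inverse e0 * Y (e0 * x) (e0 * x)"
    using Y_scale[of "inverse e0" "e0 * x" "e0 * x"] x by (simp add: i inverse_E mult_E e0_E)
  also have "\<dots> = inverse e0 * emb Q (X (e0 * x))"
    using x by (simp add: Y_diag mult_E e0_E)
  finally have eq: "Y x (- x) = inverse e0 * emb Q (X (e0 * x))" .
  have "0 < fval Q (X (e0 * x))"
    using x e0_val by (intro X_small) (auto intro: mult_E e0_E valD_mult_gt_right)
  then have "ereal 1 \<le> valD Q (emb Q (X (e0 * x)))"
    using F.val_pos_imp_ge_one by (simp add: one_ereal_def)
  moreover have "ereal (- (1 / 2)) \<le> valD Q (inverse e0)"
    using e0_val unfolding D.val_inverse[OF e0_neq_zero] by (cases "valD Q e0") auto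
  ultimately have "ereal (- (1 / 2) + 1) \<le> valD Q (inverse e0 * emb Q (X (e0 * x)))"
    by (intro valD_mult_ge)
  then show ?thesis
    unfolding eq using valD_ge_gt[of "- (1 / 2) + 1" _ 0] by (simp flip: zero_ereal_def)
qed

text \<open>Twice \<open>(x, w)\<close> is the sum of a diagonal and an antidiagonal element, and 2
  is a unit.\<close>

lemma Y_small:
  assumes "x \<in> E" "w \<in> E" "ereal r < valD Q x" "ereal r < valD Q w"
  shows "0 < valD Q (Y x w)"
proof -
  have E: "x + w \<in> E" "x - w \<in> E" "- (x - w) \<in> E"
    using assms by (auto intro: add_E diff_E)
  have "Y (x + x) (w + w) = Y ((x + w) + (x - w)) ((x + w) + - (x - w))"
    by simp
  also have "\<dots> = Y (x + w) (x + w) + Y (x - w) (- (x - w))"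
    by (rule Y_add[OF E(1,1,2,3)])
  finally have eq: "2 * Y x w = emb Q (X (x + w)) + Y (x - w) (- (x - w))"
    using assms E by (simp only: Y_add Y_diag mult_2)
  have "0 < valD Q (emb Q (X (x + w)) + Y (x - w) (- (x - w)))"
    using assms E by (intro D.val_add_gt Y_anti_small) (auto intro: X_small D.val_add_gt D.val_diff_gt)
  then have "0 < valD Q (2 * Y x w)"
    by (simp only: eq)
  then show ?thesis
    by (simp add: valD_mult)
qed

definition Th :: "'d \<Rightarrow> 'd \<Rightarrow> complex" where "Th x w = \<psi>E (Y x w)"

lemma Th_add: "x \<in> E \<Longrightarrow> w \<in> E \<Longrightarrow> x' \<in> E \<Longrightarrow> w' \<in> E \<Longrightarrow> Th (x + x') (w + w') = Th x w * Th x' w'"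
  using psiE by (simp add: Th_def Y_add Y_in_E extends_character_def)

lemma Th_small: "x \<in> E \<Longrightarrow> w \<in> E \<Longrightarrow> ereal r < valD Q x \<Longrightarrow> ereal r < valD Q w \<Longrightarrow> Th x w = 1"
  using psiE by (simp add: Th_def Y_small Y_in_E extends_character_def)

lemma Th_cong:
  assumes "x \<in> E" "w \<in> E" "x' \<in> E" "w' \<in> E" "ereal r < valD Q (x - x')" "ereal r < valD Q (w - w')"
  shows "Th x w = Th x' w'"
  using Th_add[of x' w' "x - x'" "w - w'"] Th_small[of "x - x'" "w - w'"] assms by (simp add: diff_E)

lemma Th_diag: "x \<in> E \<Longrightarrow> Th x x = \<psi> (X x)"
  using psiE by (simp add: Th_def Y_diag extends_character_def)

text \<open>Multiplication by p pushes depth r beyond r, where the character dies. The values are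
  thus p-th roots of unity and lie in the domain of \<kappa>.\<close>

lemma Th_power:
  assumes "x \<in> E" "w \<in> E" "ereal r \<le> valD Q x" "ereal r \<le> valD Q w"
  shows "Th x w ^ p = 1"
proof -
  have "Th (of_nat n * x) (of_nat n * w) = Th x w ^ n" for n
  proof (induction n)
    case 0
    then show ?case
      by (simp add: Th_small)
  next
    case (Suc n)
    have "of_nat n \<in> E"
      using emb_E[of "of_nat n"] by (simp add: emb_of_nat)
    then show ?case
      using Suc assms by (simp add: distrib_right Th_add mult_E)
  qed
  moreover have "of_nat p \<in> E" and p: "0 < valD Q (of_nat p)"
    using emb_E[of "of_nat p"] p_residue valD_emb[of "of_nat p"] by (simp_all add: emb_of_nat)
  moreover have "ereal r < valD Q (of_nat p * x)" "ereal r < valD Q (of_nat p * w)"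
    using D.val_mult_gt(1)[of 0 "of_nat p" r] p assms by (simp_all flip: zero_ereal_def)
  ultimately show ?thesis
    using assms by (metis Th_small mult_E)
qed

lemma theta_mult: "A \<in> Kgt \<Longrightarrow> B \<in> Kgt \<Longrightarrow> \<theta> (A ** B) = \<theta> A * \<theta> B"
  using hom_mult[OF theta_hom, of A B] by (simp add: JE_plus_eq GL2_def mult_grp_def)

text \<open>The root factors of the Gauss decomposition contribute 1, and its diagonal entry differs
  from a by a product of two entries deeper than \<open>r / 2\<close>, hence by something deeper
  than r.\<close>

lemma theta_Kgt:
  assumes M: "Mx a y z d \<in> Kgt"
  shows "\<theta> (Mx a y z d) = Th (a - 1) (d - 1)"
proof -
  have A: "a \<in> E" "d \<in> E" "y \<in> perp" "z \<in> perp"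
    "ereal r \<le> valD Q (a - 1)" "ereal r \<le> valD Q (d - 1)" "ereal (r / 2) < valD Q y" "ereal (r / 2) < valD Q z"
    using M by (simp_all add: Mx_in_Kset_iff)
  note f = Kset_factors[OF depth_cond_gt A]
  let ?U = "Mx 1 (y * inverse d) 0 1" and ?D = "Mx (a - y * inverse d * z) 0 0 d" and ?L = "Mx 1 0 (inverse d * z) 1"
  have K: "?U \<in> Kgt" "?D \<in> Kgt" "?L \<in> Kgt"
    using f A by (simp_all add: Mx_in_Kset_iff)
  have u: "\<theta> ?U = 1"
  proof -
    have "?U \<in> (\<Union>t\<in>{r / 2<..}. root_pos Q E \<sigma> t)"
      unfolding root_union_eq using f by blast
    then show ?thesis
      using theta_root by blast
  qed
  have l: "\<theta> ?L = 1"
  proof -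
    have "?L \<in> (\<Union>t\<in>{r / 2<..}. root_neg Q E \<sigma> t)"
      unfolding root_union_eq using f by blast
    then show ?thesis
      using theta_root by blast
  qed
  have "?D \<in> torusE Q E r"
    unfolding torusE_eq using f A by blast
  then have d: "\<theta> ?D = Th (a - y * inverse d * z - 1) (d - 1)"
    using theta_torus[of "a - y * inverse d * z" "qconj Q d"] by (simp add: Mx_def Th_def Y_def qconj_diff)
  have "\<theta> (Mx a y z d) = \<theta> ?D"
    unfolding Mx_decompose[OF A(1-4) f(1)] by (simp add: theta_mult K Kset_mult[OF depth_cond_gt] u l)
  also have "\<dots> = Th (a - 1) (d - 1)"
  proof -
    have "ereal r < valD Q (y * inverse d * z)"
      using f A by (intro square_gt) auto
    moreover have "y * inverse d * z \<in> E"
      using f A by (blast intro: perp_mult_perp)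
    ultimately show ?thesis
      unfolding d using A by (intro Th_cong) (auto intro: diff_E)
  qed
  finally show ?thesis .
qed

lemma theta_iota:
  assumes "h \<in> Jset_plus"
  shows "\<theta> (iota E \<sigma> h) = \<psi> (X (pr0 h - 1))"
  using assms theta_Kgt[of "pr0 h" "pr1 h" "pr1 h" "pr0 h"] Th_diag[of "pr0 h - 1"]
  by (simp add: Jset_plus_iff iota_eq diff_E pr0_in_E)

text \<open>The central coordinate of the special isomorphism before \<kappa> is applied. The half
  square is what remains when half the commutator of the two root factors is added back.\<close>

definition xi :: "'d \<Rightarrow> complex" where
  "xi h = \<psi> (X (pr0 h - 1 - emb Q (1 / 2) * (pr1 h * pr1 h)))"

lemma kappa_mult: "z ^ p = 1 \<Longrightarrow> w ^ p = 1 \<Longrightarrow> \<kappa> (z * w) = (\<kappa> z + \<kappa> w) mod int p"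
  using kappa prime_gt_0_nat[OF prime_p]
  by (simp add: iso_def hom_def mu_group_def integer_mod_group_def)

lemma kappa_range: "z ^ p = 1 \<Longrightarrow> 0 \<le> \<kappa> z \<and> \<kappa> z < int p"
  using kappa prime_gt_0_nat[OF prime_p]
  by (auto simp: iso_def hom_def mu_group_def integer_mod_group_def Pi_def)

lemma two_half_mod: "2 * half_mod p = int p + 1"
  using prime_odd_nat[OF prime_p] p_odd prime_ge_2_nat[OF prime_p] by (force simp: half_mod_def elim!: oddE)

text \<open>\<open>half_mod p\<close> inverts 2 modulo p, so on a square it gives back \<kappa> of
  the root.\<close>

lemma kappa_half:
  assumes z: "z ^ p = 1" and w: "w ^ p = 1"
  shows "(\<kappa> z + half_mod p * \<kappa> (w * w)) mod int p = \<kappa> (z * w)"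
proof -
  have "(\<kappa> z + half_mod p * \<kappa> (w * w)) mod int p = (\<kappa> z + half_mod p * (2 * \<kappa> w)) mod int p"
    unfolding kappa_mult[OF w w] by (metis mod_add_right_eq mod_mult_right_eq mult_2)
  also have "half_mod p * (2 * \<kappa> w) = (int p + 1) * \<kappa> w"
    unfolding two_half_mod[symmetric] by simp
  also have "\<kappa> z + (int p + 1) * \<kappa> w = (\<kappa> z + \<kappa> w) + int p * \<kappa> w"
    by (simp add: algebra_simps)
  also have "\<dots> mod int p = (\<kappa> z + \<kappa> w) mod int p"
    by simp
  finally show ?thesis
    by (simp add: kappa_mult z w)
qed

text \<open>The factorization in \<open>mu\<close> is not unique. Comparing matrix entries shows
  that \<beta> and \<gamma> both agree with the complement part of h beyond depth
  \<open>r / 2\<close>, which leaves the value no freedom and makes the definite description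
  meaningful.\<close>

lemma mu_value:
  assumes h: "h \<in> Jset" and b: "\<beta> \<in> perp" "ereal (r / 2) \<le> valD Q \<beta>"
    and c: "\<gamma> \<in> perp" "ereal (r / 2) \<le> valD Q \<gamma>" and g: "g \<in> Kgt"
    and eq: "iota E \<sigma> h = Mx 1 \<beta> 0 1 ** Mx 1 0 \<gamma> 1 ** g"
  shows "(\<kappa> (\<theta> g) + half_mod p * \<kappa> (\<theta> (comm (GL2 E) (Mx 1 \<beta> 0 1) (Mx 1 0 \<gamma> 1)))) mod int p = \<kappa> (xi h)"
proof -
  let ?a = "pr0 h" and ?y = "pr1 h"
  have aE: "?a \<in> E" and yP: "?y \<in> perp" and av: "ereal r \<le> valD Q (?a - 1)" and yv: "ereal (r / 2) \<le> valD Q ?y"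
    using h by (auto simp: Jset_def pr0_in_E pr1_in_perp)
  obtain a y z d where G: "g = Mx a y z d" "a \<in> E" "d \<in> E" "y \<in> perp" "z \<in> perp"
    "ereal r \<le> valD Q (a - 1)" "ereal r \<le> valD Q (d - 1)" "ereal (r / 2) < valD Q y" "ereal (r / 2) < valD Q z"
    using g unfolding Kset_def by blast
  have bc: "\<beta> * \<gamma> \<in> E" "\<gamma> * \<beta> \<in> E" "ereal r \<le> valD Q (\<beta> * \<gamma>)" "ereal r \<le> valD Q (\<gamma> * \<beta>)"
    using b c by (auto intro: perp_mult_perp square_ge)
  have UL: "Mx 1 \<beta> 0 1 ** Mx 1 0 \<gamma> 1 = Mx (1 + \<beta> * \<gamma>) \<beta> \<gamma> 1"
    using b c by (subst Mx_mult) auto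
  have "Mx ?a ?y ?y ?a = Mx ((1 + \<beta> * \<gamma>) * a + \<beta> * z) ((1 + \<beta> * \<gamma>) * y + \<beta> * d) (\<gamma> * a + z) (d + \<gamma> * y)"
    using eq unfolding iota_eq UL G(1) using G b c bc by (subst (asm) Mx_mult) (auto intro: add_E)
  then have e: "?a = (1 + \<beta> * \<gamma>) * a + \<beta> * z" "?y = (1 + \<beta> * \<gamma>) * y + \<beta> * d" "?y = \<gamma> * a + z" "?a = d + \<gamma> * y"
    unfolding Mx_eq_iff by blast+
  have unit: "valD Q a = 0" "valD Q d = 0" "0 \<le> valD Q (1 + \<beta> * \<gamma>)"
    using G r_pos bc valD_ge_mono[of r "\<beta> * \<gamma>" 0]
    by (auto intro!: valD_near_one[OF _ r_pos] valD_one_plus simp flip: zero_ereal_def)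
  have r3: "ereal (r / 2) < valD Q (\<beta> * (d - 1))" "ereal (r / 2) < valD Q (\<gamma> * (a - 1))"
    using valD_mult_ge[OF b(2) G(7)] valD_mult_ge[OF c(2) G(6)] r_pos by (auto elim!: valD_ge_gt)
  have "ereal (r / 2) < valD Q ((1 + \<beta> * \<gamma>) * y + \<beta> * (d - 1))"
    by (rule D.val_add_gt[OF valD_mult_gt_right[OF unit(3) G(8)] r3(1)])
  also have "(1 + \<beta> * \<gamma>) * y + \<beta> * (d - 1) = ?y - \<beta>"
    by (subst e(2)) (simp add: right_diff_distrib)
  finally have yb: "ereal (r / 2) < valD Q (?y - \<beta>)" .
  have "ereal (r / 2) < valD Q (\<gamma> * (a - 1) + z)"
    using r3 G by (intro D.val_add_gt) auto
  also have "\<gamma> * (a - 1) + z = ?y - \<gamma>"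
    by (subst e(3)) (simp add: right_diff_distrib)
  finally have yc: "ereal (r / 2) < valD Q (?y - \<gamma>)" .
  have "ereal r < valD Q ((?y - \<beta>) * ?y + \<beta> * (?y - \<gamma>))"
    using yb yc b yv by (intro D.val_add_gt square_gt)
  then have sq: "ereal r < valD Q (?y * ?y - \<beta> * \<gamma>)"
    by (simp add: left_diff_distrib right_diff_distrib)
  have "ereal r < valD Q ((?y - \<gamma>) * ?y + \<gamma> * (?y - \<beta>))"
    using yb yc c yv by (intro D.val_add_gt square_gt)
  then have sq': "ereal r < valD Q (?y * ?y - \<gamma> * \<beta>)"
    by (simp add: left_diff_distrib right_diff_distrib)
  have y2: "?y * ?y \<in> E" "ereal r \<le> valD Q (?y * ?y)"
    using yP yv by (auto intro: perp_mult_perp square_ge)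
  have tg: "\<theta> g = Th (?a - 1 - ?y * ?y) (?a - 1)"
  proof -
    have "\<theta> g = Th (a - 1) (d - 1)"
      using g unfolding G(1) by (rule theta_Kgt)
    also have "\<dots> = Th (?a - 1 - ?y * ?y) (?a - 1)"
    proof (rule Th_cong)
      have "ereal (r + r) \<le> valD Q (\<beta> * \<gamma> * (a - 1))"
        by (rule valD_mult_ge[OF bc(3) G(6)])
      then have "ereal r < valD Q (\<beta> * \<gamma> * (a - 1))"
        using r_pos by (auto elim!: valD_ge_gt)
      moreover have "ereal r < valD Q (\<beta> * z)"
        using b G by (intro square_gt)
      ultimately have "ereal r < valD Q ((?y * ?y - \<beta> * \<gamma>) - \<beta> * \<gamma> * (a - 1) - \<beta> * z)"
        by (intro D.val_diff_gt[OF D.val_diff_gt[OF sq]])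
      also have "(?y * ?y - \<beta> * \<gamma>) - \<beta> * \<gamma> * (a - 1) - \<beta> * z = (a - 1) - (?a - 1 - ?y * ?y)"
        by (subst e(1)) (simp add: algebra_simps)
      finally show "ereal r < valD Q ((a - 1) - (?a - 1 - ?y * ?y))" .
      have "(d - 1) - (?a - 1) = - (\<gamma> * y)"
        by (subst e(4)) simp
      moreover have "ereal r < valD Q (\<gamma> * y)"
        using c G by (intro square_gt)
      ultimately show "ereal r < valD Q ((d - 1) - (?a - 1))"
        by simp
    qed (use G aE y2 in \<open>auto intro!: diff_E\<close>)
    finally show ?thesis .
  qed
  let ?h = "emb Q (1 / 2) * (?y * ?y)"
  have hE: "?h \<in> E" "- ?h \<in> E" "ereal r \<le> valD Q ?h"
    by (intro mult_E minus_E emb_E y2 half_mult_ge)+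
  have hh: "?h + ?h = ?y * ?y"
    by (rule half_half)
  have hm: "- ?h + - ?h = - (?y * ?y)"
    by (simp only: minus_add_distrib[symmetric] hh)
  \<comment> \<open>Beyond the relevant depths the commutator is diagonal with entries
    \<open>1 + y^2\<close> and \<open>1 - y^2\<close>. Its value is written as a square because
    \<open>kappa_half\<close> asks for the root.\<close>
  have tc: "\<theta> (comm (GL2 E) (Mx 1 \<beta> 0 1) (Mx 1 0 \<gamma> 1)) = Th ?h (- ?h) * Th ?h (- ?h)"
  proof -
    have "comm (GL2 E) (Mx 1 \<beta> 0 1) (Mx 1 0 \<gamma> 1) = Mx (1 + \<beta> * \<gamma>) \<beta> \<gamma> 1 ** Mx 1 (- \<beta>) 0 1 ** Mx 1 0 (- \<gamma>) 1"
      unfolding comm_def upper_inverse(2)[OF b(1)] lower_inverse(2)[OF c(1)] GL2_mult UL ..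
    also have "\<dots> = Mx (1 + \<beta> * \<gamma>) \<beta> \<gamma> 1 ** Mx (1 + \<beta> * \<gamma>) (- \<beta>) (- \<gamma>) 1"
      unfolding matrix_mul_assoc[symmetric] using b c by (subst Mx_mult[of 1 1 1 1]) (auto intro: minus_perp)
    also have "\<dots> = Mx ((1 + \<beta> * \<gamma>) * (1 + \<beta> * \<gamma>) - \<beta> * \<gamma>) (- ((1 + \<beta> * \<gamma>) * \<beta>) + \<beta>)
        (\<gamma> * (1 + \<beta> * \<gamma>) - \<gamma>) (1 - \<gamma> * \<beta>)"
      using b c bc by (subst Mx_mult) (auto intro: minus_perp add_E)
    finally have cm: "comm (GL2 E) (Mx 1 \<beta> 0 1) (Mx 1 0 \<gamma> 1) = Mx (1 + \<beta> * \<gamma> + \<beta> * \<gamma> * (\<beta> * \<gamma>)) (- (\<beta> * \<gamma> * \<beta>))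
        (\<gamma> * (\<beta> * \<gamma>)) (1 - \<gamma> * \<beta>)"
      by (simp add: algebra_simps)
    have bcbc: "ereal r < valD Q (\<beta> * \<gamma> * (\<beta> * \<gamma>))"
      using valD_mult_ge[OF bc(3,3)] r_pos by (auto elim!: valD_ge_gt)
    have s3: "ereal (r / 2) < valD Q (\<beta> * \<gamma> * \<beta>)" "ereal (r / 2) < valD Q (\<gamma> * (\<beta> * \<gamma>))"
      using valD_mult_ge[OF bc(3) b(2)] valD_mult_ge[OF c(2) bc(3)] r_pos by (auto elim!: valD_ge_gt)
    have "comm (GL2 E) (Mx 1 \<beta> 0 1) (Mx 1 0 \<gamma> 1) \<in> Kgt"
      unfolding cm Mx_in_Kset_iff
      using add_E[OF add_E[OF one_E bc(1)] mult_E[OF bc(1,1)]] diff_E[OF one_E bc(2)]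
        minus_perp[OF E_mult_perp[OF bc(1) b(1)]] perp_mult_E[OF c(1) bc(1)]
        D.val_add_ge[OF bc(3) less_imp_le[OF bcbc]] bc(4) s3 by (simp add: add.assoc)
    then have "\<theta> (comm (GL2 E) (Mx 1 \<beta> 0 1) (Mx 1 0 \<gamma> 1)) = Th (\<beta> * \<gamma> + \<beta> * \<gamma> * (\<beta> * \<gamma>)) (- (\<gamma> * \<beta>))"
      unfolding cm by (subst theta_Kgt) (auto simp: add.assoc)
    also have "\<dots> = Th (?y * ?y) (- (?y * ?y))"
    proof (rule Th_cong)
      have "ereal r < valD Q (\<beta> * \<gamma> * (\<beta> * \<gamma>) - (?y * ?y - \<beta> * \<gamma>))"
        by (rule D.val_diff_gt[OF bcbc sq])
      then show "ereal r < valD Q (\<beta> * \<gamma> + \<beta> * \<gamma> * (\<beta> * \<gamma>) - ?y * ?y)"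
        by (simp add: algebra_simps)
      show "ereal r < valD Q (- (\<gamma> * \<beta>) - - (?y * ?y))"
        using sq' by simp
    qed (use bc y2 in \<open>auto intro!: add_E minus_E intro: mult_E\<close>)
    also have "\<dots> = Th ?h (- ?h) * Th ?h (- ?h)"
      using Th_add[OF hE(1,2,1,2)] by (simp only: hh hm)
    finally show ?thesis .
  qed
  have x1: "?a - 1 - ?y * ?y \<in> E" "?a - 1 \<in> E" "ereal r \<le> valD Q (?a - 1 - ?y * ?y)"
    using diff_E[OF diff_E[OF aE one_E] y2(1)] diff_E[OF aE one_E] D.val_diff_ge[OF av y2(2)] by blast+
  \<comment> \<open>The first entry lost the whole square and regains half, the second loses half.
    Both become \<open>a - 1 - y^2 / 2\<close>, a point of the diagonal, where \<open>Th\<close> is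
    given by \<psi> and X.\<close>
  have "Th (?a - 1 - ?y * ?y) (?a - 1) * Th ?h (- ?h) = Th (?a - 1 - ?h) (?a - 1 - ?h)"
  proof -
    have "b - v + u = b - u" if "u + u = v" for b u v :: 'd
      unfolding that[symmetric] by (simp add: algebra_simps)
    note e3 = this[OF hh, of "?a - 1"]
    show ?thesis
      using Th_add[OF x1(1,2) hE(1,2)] unfolding e3 by simp
  qed
  also have "\<dots> = xi h"
    using hE x1 by (simp add: Th_diag xi_def diff_E)
  finally show ?thesis
    unfolding tg tc using kappa_half Th_power x1 hE av by simp
qed

lemma xi_power: 
  assumes "h \<in> Jset"
  shows "xi h ^ p = 1"
proof -
  have y2: "pr1 h * pr1 h \<in> E" "ereal r \<le> valD Q (pr1 h * pr1 h)"
    using assms by (auto intro: perp_mult_perp square_ge pr1_in_perp simp: Jset_def)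
  then have h: "emb Q (1 / 2) * (pr1 h * pr1 h) \<in> E" "ereal r \<le> valD Q (emb Q (1 / 2) * (pr1 h * pr1 h))"
    by (auto intro: mult_E half_mult_ge)
  have a: "pr0 h - 1 \<in> E" "ereal r \<le> valD Q (pr0 h - 1)"
    using assms by (auto simp: Jset_def intro: diff_E pr0_in_E)
  note x = diff_E[OF a(1) h(1)] D.val_diff_ge[OF a(2) h(2)]
  show ?thesis
    using Th_power[OF x(1,1,2,2)] x(1) by (simp add: xi_def Th_diag)
qed

lemma mu_iota:
  assumes h: "h \<in> Jset"
  shows "mu Q p \<kappa> E \<sigma> r \<theta> (iota E \<sigma> h) = \<kappa> (xi h)"
  unfolding mu_def root_pos_eq root_neg_eq JE_plus_eq
proof (rule the_equality)
  let ?a = "pr0 h" and ?y = "pr1 h"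
  have aE: "?a \<in> E" and yP: "?y \<in> perp" and av: "ereal r \<le> valD Q (?a - 1)" and yv: "ereal (r / 2) \<le> valD Q ?y"
    using h by (auto simp: Jset_def pr0_in_E pr1_in_perp)
  let ?U = "Mx 1 ?y 0 1" and ?L = "Mx 1 0 ?y 1"
  \<comment> \<open>Both root factors are taken equal to the complement part of h, and the equation
    is solved for the remaining factor.\<close>
  let ?g = "Mx 1 0 (- ?y) 1 ** (Mx 1 (- ?y) 0 1 ** iota E \<sigma> h)"
  have "?U ** ?L ** ?g = ?U ** ((?L ** Mx 1 0 (- ?y) 1) ** (Mx 1 (- ?y) 0 1 ** iota E \<sigma> h))"
    by (simp add: matrix_mul_assoc)
  also have "\<dots> = (?U ** Mx 1 (- ?y) 0 1) ** iota E \<sigma> h"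
    by (simp add: lower_inverse yP matrix_mul_assoc)
  also have "\<dots> = iota E \<sigma> h"
    by (simp add: upper_inverse yP)
  finally have eq: "iota E \<sigma> h = ?U ** ?L ** ?g" by simp
  have y2: "?y * ?y \<in> E" "ereal r \<le> valD Q (?y * ?y)"
    using yP yv by (auto intro: perp_mult_perp square_ge)
  have g1: "Mx 1 (- ?y) 0 1 ** iota E \<sigma> h = Mx (?a - ?y * ?y) (?y - ?y * ?a) ?y ?a"
    unfolding iota_eq using aE yP by (subst Mx_mult) auto
  have m: "?a - ?y * ?y \<in> E" "?y - ?y * ?a \<in> perp"
    using aE yP y2 by (auto intro: diff_E diff_perp perp_mult_E)
  have g2: "?g = Mx (?a - ?y * ?y) (?y - ?y * ?a) (?y - ?y * (?a - ?y * ?y)) (?a - ?y * (?y - ?y * ?a))"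
    unfolding g1 using aE yP m by (subst Mx_mult) (auto intro: minus_perp)
  have ya: "ereal (r / 2) < valD Q (?y * (?a - 1))" "ereal (r / 2) < valD Q (?y * (?y * ?y))"
    using valD_mult_ge[OF yv av] valD_mult_ge[OF yv y2(2)] r_pos by (auto elim!: valD_ge_gt)
  have v1: "ereal (r / 2) < valD Q (?y - ?y * ?a)"
    using ya(1) D.val_minus_commute[of ?y "?y * ?a"] by (simp add: right_diff_distrib)
  have "ereal (r / 2) < valD Q (?y * (?y * ?y) - ?y * (?a - 1))"
    using ya by (intro D.val_diff_gt)
  then have v2: "ereal (r / 2) < valD Q (?y - ?y * (?a - ?y * ?y))"
    by (simp add: algebra_simps)
  have "ereal r \<le> valD Q ((?a - 1) - ?y * ?y)"
    by (intro D.val_diff_ge av y2)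
  then have v3: "ereal r \<le> valD Q (?a - ?y * ?y - 1)"
    by (simp add: algebra_simps)
  have "ereal r \<le> valD Q ((?a - 1) - ?y * (?y - ?y * ?a))"
    by (intro D.val_diff_ge[OF av] less_imp_le square_gt(2)[OF v1 yv])
  then have v4: "ereal r \<le> valD Q (?a - ?y * (?y - ?y * ?a) - 1)"
    by (simp add: algebra_simps)
  have gK: "?g \<in> Kgt"
    unfolding g2 using m aE yP v1 v2 v3 v4
    by (intro KsetI) (auto intro: diff_perp perp_mult_E diff_E perp_mult_perp)
  show "\<exists>g\<^sub>p\<in>{Mx 1 y 0 1 |y. y \<in> perp \<and> ereal (r / 2) \<le> valD Q y}.
       \<exists>g\<^sub>n\<in>{Mx 1 0 y 1 |y. y \<in> perp \<and> ereal (r / 2) \<le> valD Q y}.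
          \<exists>g\<^sub>0\<in>Kgt. iota E \<sigma> h = g\<^sub>p ** g\<^sub>n ** g\<^sub>0 \<and>
             \<kappa> (xi h) = (\<kappa> (\<theta> g\<^sub>0) + half_mod p * \<kappa> (\<theta> (comm (GL2 E) g\<^sub>p g\<^sub>n))) mod int p"
    using mu_value[OF h yP yv yP yv gK eq] eq gK yP yv
    by (intro bexI[of _ ?U] bexI[of _ ?L] bexI[of _ ?g]) auto
qed (use mu_value[OF h] in auto)

end

section \<open>Isometries of the complement\<close>

lemma group_mult_grp: "group (mult_grp :: 'a::division_ring monoid)"
proof (rule groupI)
  show "\<exists>y\<in>carrier mult_grp. y \<otimes>\<^bsub>mult_grp\<^esub> x = \<one>\<^bsub>mult_grp\<^esub>" if "x \<in> carrier mult_grp" for x :: 'a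
    using that by (intro bexI[of _ "inverse x"]) (auto simp: mult_grp_def)
qed (auto simp: mult_grp_def mult.assoc)

lemma mult_grp_simps [simp]:
  "carrier mult_grp = {x. x \<noteq> 0}" "x \<otimes>\<^bsub>mult_grp\<^esub> y = x * y" "\<one>\<^bsub>mult_grp\<^esub> = 1"
  by (simp_all add: mult_grp_def)

lemma inv_mult_grp: "x \<noteq> 0 \<Longrightarrow> inv\<^bsub>mult_grp\<^esub> x = inverse (x::'a::division_ring)"
  by (rule group.inv_equality[OF group_mult_grp]) auto

lemma subgroup_mult_grpI:
  fixes H :: "'a::division_ring set"
  assumes "1 \<in> H" "0 \<notin> H" "\<And>x y. x \<in> H \<Longrightarrow> y \<in> H \<Longrightarrow> x * y \<in> H" "\<And>x. x \<in> H \<Longrightarrow> inverse x \<in> H"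
  shows "subgroup H mult_grp"
proof
  show "inv\<^bsub>mult_grp\<^esub> x \<in> H" if "x \<in> H" for x
    using that assms(2,4) inv_mult_grp[of x] by (cases "x = 0") auto
qed (use assms in \<open>auto intro: gr0I\<close>)

lemma r_coset_mult_grp: "S #>\<^bsub>mult_grp\<^esub> h = (\<lambda>x. x * h) ` S"
  and r_coset_Dgrp: "S #>\<^bsub>Dgrp H\<^esub> h = (\<lambda>x. x * h) ` S"
  by (auto simp: r_coset_def)

lemma set_mult_mult_grp: "A <#>\<^bsub>mult_grp\<^esub> B = {a * b | a b. a \<in> A \<and> b \<in> B}"
  by (auto simp: set_mult_def)

context torus_depth
begin

text \<open>Stand-ins for Sp(W) on the complement itself, preserving the bracket exactly. The
  symplectic form on W depends on \<sigma> and \<theta>, but these maps are shared by all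
  choices.\<close>

definition perp_isometry :: "('d \<Rightarrow> 'd) \<Rightarrow> bool" where
  "perp_isometry M \<longleftrightarrow>
     (\<forall>y\<in>perp. M y \<in> perp \<and> valD Q (M y) = valD Q y) \<and> (\<forall>y\<in>perp. \<exists>x\<in>perp. M x = y) \<and>
     (\<forall>x\<in>perp. \<forall>y\<in>perp. M (x + y) = M x + M y \<and> M x * M y - M y * M x = x * y - y * x)"

text \<open>The correction by half the difference of squares keeps \<open>xi\<close> unchanged, so
  that in the coordinates of the special isomorphism this is \<open>(w, z)\<close> to
  \<open>(g w, z)\<close>, the automorphism in the definition of the Weil lift.\<close>

definition lift_isometry :: "('d \<Rightarrow> 'd) \<Rightarrow> 'd \<Rightarrow> 'd" where
  "lift_isometry M h = pr0 h + emb Q (1 / 2) * (M (pr1 h) * M (pr1 h) - pr1 h * pr1 h) + M (pr1 h)"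

definition torus_isometry :: "'d \<Rightarrow> 'd \<Rightarrow> 'd" where
  "torus_isometry t y = t * y * inverse t"

lemma perp_isometry_diff: "perp_isometry M \<Longrightarrow> x \<in> perp \<Longrightarrow> y \<in> perp \<Longrightarrow> M (x - y) = M x - M y"
  by (metis add_diff_cancel diff_add_cancel diff_perp perp_isometry_def)

lemma perp_isometry_id: "perp_isometry (\<lambda>y. y)"
  by (auto simp: perp_isometry_def)

lemma perp_isometry_comp:
  assumes "perp_isometry M" "perp_isometry M'"
  shows "perp_isometry (\<lambda>y. M (M' y))"
proof -
  have "\<exists>x\<in>perp. M (M' x) = y" if "y \<in> perp" for y
    using assms that unfolding perp_isometry_def by metis
  then show ?thesis
    using assms unfolding perp_isometry_def by simp
qed

text \<open>Products of two elements of the complement lie in E and commute with t, so conjugation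
  by t preserves the bracket.\<close>

lemma torus_isometry:
  assumes "t \<in> E" "t \<noteq> 0"
  shows "perp_isometry (torus_isometry t)"
proof -
  have c: "torus_isometry t y \<in> perp" if "y \<in> perp" for y
    using assms that by (auto simp: torus_isometry_def intro: perp_mult_E E_mult_perp inverse_E)
  have "torus_isometry t (inverse t * y * t) = y" and "inverse t * y * t \<in> perp" if "y \<in> perp" for y
    using assms that by (auto simp: torus_isometry_def mult.assoc intro: perp_mult_E E_mult_perp inverse_E)
      (simp flip: mult.assoc)
  then have s: "\<exists>x\<in>perp. torus_isometry t x = y" if "y \<in> perp" for y
    using that by blast
  have m: "torus_isometry t x * torus_isometry t y = t * (x * y) * inverse t" for x y
    using assms(2) by (simp add: torus_isometry_def mult.assoc) (simp flip: mult.assoc)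
  have e: "t * z * inverse t = z" if "z \<in> E" for z
    using assms that commute_E[of t z] by (simp add: mult.assoc)
  have k: "torus_isometry t x * torus_isometry t y - torus_isometry t y * torus_isometry t x = x * y - y * x"
    if "x \<in> perp" "y \<in> perp" for x y
    unfolding m using that by (simp add: e perp_mult_perp)
  have "torus_isometry t (x + y) = torus_isometry t x + torus_isometry t y" for x y
    by (simp add: torus_isometry_def distrib_left distrib_right)
  moreover have "valD Q (torus_isometry t y) = valD Q y" for y
    unfolding torus_isometry_def by (rule D.val_conjugate[OF assms(2)])
  ultimately show ?thesis
    using c s k by (simp add: perp_isometry_def)
qed

lemma pr_lift_isometry:
  assumes "perp_isometry M"
  shows "pr0 (lift_isometry M h) = pr0 h + emb Q (1 / 2) * (M (pr1 h) * M (pr1 h) - pr1 h * pr1 h)"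
    and "pr1 (lift_isometry M h) = M (pr1 h)"
proof -
  have "M (pr1 h) \<in> perp"
    using assms pr1_in_perp by (simp add: perp_isometry_def)
  moreover from this have "pr0 h + emb Q (1 / 2) * (M (pr1 h) * M (pr1 h) - pr1 h * pr1 h) \<in> E"
    using pr1_in_perp by (intro add_E mult_E diff_E emb_E pr0_in_E perp_mult_perp)
  ultimately show "pr0 (lift_isometry M h) = pr0 h + emb Q (1 / 2) * (M (pr1 h) * M (pr1 h) - pr1 h * pr1 h)"
    "pr1 (lift_isometry M h) = M (pr1 h)"
    unfolding lift_isometry_def by (auto intro: pr_unique)
qed

lemma lift_isometry_Jset:
  assumes "perp_isometry M" and h: "h \<in> Jset"
  shows "lift_isometry M h \<in> Jset"
    and "h \<in> Jset_plus \<Longrightarrow> lift_isometry M h \<in> Jset_plus \<and> ereal r < valD Q (pr0 (lift_isometry M h) - pr0 h)"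
proof -
  have v: "valD Q (M (pr1 h)) = valD Q (pr1 h)"
    using assms pr1_in_perp by (simp add: perp_isometry_def)
  have "ereal r \<le> valD Q ((pr0 h - 1) + emb Q (1 / 2) * (M (pr1 h) * M (pr1 h) - pr1 h * pr1 h))"
    using h v by (intro D.val_add_ge half_mult_ge D.val_diff_ge[where x = "_ * _"] square_ge) (auto simp: Jset_def)
  then have 1: "ereal r \<le> valD Q (pr0 (lift_isometry M h) - 1)"
    by (simp add: pr_lift_isometry[OF assms(1)] algebra_simps)
  then show "lift_isometry M h \<in> Jset"
    using h v by (simp add: Jset_def pr_lift_isometry[OF assms(1)])
  show "lift_isometry M h \<in> Jset_plus \<and> ereal r < valD Q (pr0 (lift_isometry M h) - pr0 h)" if hp: "h \<in> Jset_plus"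
  proof -
    have "ereal r < valD Q (emb Q (1 / 2) * (M (pr1 h) * M (pr1 h) - pr1 h * pr1 h))"
      using hp v by (intro half_mult_gt D.val_diff_gt square_gt) (auto simp: Jset_plus_def)
    then show ?thesis
      using 1 hp v by (simp add: Jset_plus_def pr_lift_isometry[OF assms(1)])
  qed
qed

lemma pr0_torus_conjugate: "t \<in> E \<Longrightarrow> t \<noteq> 0 \<Longrightarrow> pr0 (t * h * inverse t) = pr0 h"
  and pr1_torus_conjugate: "t \<in> E \<Longrightarrow> t \<noteq> 0 \<Longrightarrow> pr1 (t * h * inverse t) = torus_isometry t (pr1 h)"
proof -
  assume t: "t \<in> E" "t \<noteq> 0"
  have "t * h * inverse t = t * (pr0 h + pr1 h) * inverse t"
    by simp
  also have "\<dots> = t * pr0 h * inverse t + t * pr1 h * inverse t"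
    by (simp only: distrib_left distrib_right)
  also have "t * pr0 h * inverse t = pr0 h"
    using t commute_E[OF t(1) pr0_in_E, of h] by (simp add: mult.assoc)
  finally have eq: "t * h * inverse t = pr0 h + torus_isometry t (pr1 h)"
    by (simp add: torus_isometry_def)
  have "torus_isometry t (pr1 h) \<in> perp"
    using torus_isometry[OF t] pr1_in_perp by (simp add: perp_isometry_def)
  then show "pr0 (t * h * inverse t) = pr0 h" "pr1 (t * h * inverse t) = torus_isometry t (pr1 h)"
    unfolding eq by (rule pr_unique[OF pr0_in_E])+
qed

lemma torus_conjugate_Jset: "t \<in> E \<Longrightarrow> t \<noteq> 0 \<Longrightarrow> h \<in> Jset \<Longrightarrow> t * h * inverse t \<in> Jset"
  using D.val_conjugate[of t "pr1 h"]
  by (simp add: Jset_def pr0_torus_conjugate pr1_torus_conjugate torus_isometry_def)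

text \<open>
  What is used of the representation attached to \<open>(T, \<phi>, r)\<close>: the action of the positive part of \<open>J\<close>,
  and operators \<open>S M\<close> for the isometries \<open>M\<close> of the complement of \<open>E\<close>, through which \<open>T\<close> acts.
\<close>

definition J_representation :: "('d \<Rightarrow> complex) \<Rightarrow> ('d, 'v::ab_group_add) rep \<Rightarrow> bool" where
  "J_representation \<phi> R \<longleftrightarrow>
     is_rep (Dgrp ((E - {0}) <#>\<^bsub>mult_grp\<^esub> Jset)) R \<and> irreducible_rep (Dgrp Jset) R \<and>
     (\<forall>h\<in>Jset_plus. \<forall>v\<in>rspace R. ract R h v = rscale R (\<phi> (pr0 h)) v)"

text \<open>For isometries, equality of the induced automorphisms of W.\<close>

definition isometry_cong :: "('d \<Rightarrow> 'd) \<Rightarrow> ('d \<Rightarrow> 'd) \<Rightarrow> bool" where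
  "isometry_cong M M' \<longleftrightarrow>
     (\<forall>y\<in>perp. ereal (r / 2) \<le> valD Q y \<longrightarrow> ereal (r / 2) < valD Q (M y - M' y))"

text \<open>The Weil representation pulled back to isometries of the complement. The case J = J+
  fits in with all operators equal to the identity, so later arguments need no case
  distinction.\<close>

definition weil_action ::
  "('d \<Rightarrow> complex) \<Rightarrow> ('d, 'v::ab_group_add) rep \<Rightarrow> (('d \<Rightarrow> 'd) \<Rightarrow> 'v \<Rightarrow> 'v) \<Rightarrow> bool" where
  "weil_action \<phi> R S \<longleftrightarrow>
     (\<forall>M v. perp_isometry M \<longrightarrow> v \<in> rspace R \<longrightarrow> S M v \<in> rspace R) \<and>
     (\<forall>M v w. perp_isometry M \<longrightarrow> v \<in> rspace R \<longrightarrow> w \<in> rspace R \<longrightarrow> S M (v + w) = S M v + S M w) \<and>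
     (\<forall>M c v. perp_isometry M \<longrightarrow> v \<in> rspace R \<longrightarrow> S M (rscale R c v) = rscale R c (S M v)) \<and>
     (\<forall>M h v. perp_isometry M \<longrightarrow> h \<in> Jset \<longrightarrow> v \<in> rspace R \<longrightarrow> S M (ract R h v) = ract R (lift_isometry M h) (S M v)) \<and>
     (\<forall>M M' v. perp_isometry M \<longrightarrow> perp_isometry M' \<longrightarrow> v \<in> rspace R \<longrightarrow> S (\<lambda>y. M (M' y)) v = S M (S M' v)) \<and>
     (\<forall>M M' v. perp_isometry M \<longrightarrow> perp_isometry M' \<longrightarrow> isometry_cong M M' \<longrightarrow> v \<in> rspace R \<longrightarrow> S M v = S M' v) \<and>
     (\<forall>v. v \<in> rspace R \<longrightarrow> S (\<lambda>y. y) v = v) \<and>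
     (\<forall>t v. t \<in> E - {0} \<longrightarrow> v \<in> rspace R \<longrightarrow> ract R t v = rscale R (\<phi> t) (S (torus_isometry t) v))"

lemma weil_actionI:
  assumes "\<And>M v. perp_isometry M \<Longrightarrow> v \<in> rspace R \<Longrightarrow> S M v \<in> rspace R"
    and "\<And>M v w. perp_isometry M \<Longrightarrow> v \<in> rspace R \<Longrightarrow> w \<in> rspace R \<Longrightarrow> S M (v + w) = S M v + S M w"
    and "\<And>M c v. perp_isometry M \<Longrightarrow> v \<in> rspace R \<Longrightarrow> S M (rscale R c v) = rscale R c (S M v)"
    and "\<And>M h v. perp_isometry M \<Longrightarrow> h \<in> Jset \<Longrightarrow> v \<in> rspace R \<Longrightarrow> S M (ract R h v) = ract R (lift_isometry M h) (S M v)"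
    and "\<And>M M' v. perp_isometry M \<Longrightarrow> perp_isometry M' \<Longrightarrow> v \<in> rspace R \<Longrightarrow> S (\<lambda>y. M (M' y)) v = S M (S M' v)"
    and "\<And>M M' v. perp_isometry M \<Longrightarrow> perp_isometry M' \<Longrightarrow> isometry_cong M M' \<Longrightarrow> v \<in> rspace R \<Longrightarrow> S M v = S M' v"
    and "\<And>v. v \<in> rspace R \<Longrightarrow> S (\<lambda>y. y) v = v"
    and "\<And>t v. t \<in> E - {0} \<Longrightarrow> v \<in> rspace R \<Longrightarrow> ract R t v = rscale R (\<phi> t) (S (torus_isometry t) v)"
  shows "weil_action \<phi> R S"
  unfolding weil_action_def by (intro conjI allI impI; rule assms; assumption)

lemma weil_actionD:
  assumes "weil_action \<phi> R S"
  shows "perp_isometry M \<Longrightarrow> v \<in> rspace R \<Longrightarrow> S M v \<in> rspace R"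
    and "perp_isometry M \<Longrightarrow> v \<in> rspace R \<Longrightarrow> w \<in> rspace R \<Longrightarrow> S M (v + w) = S M v + S M w"
    and "perp_isometry M \<Longrightarrow> v \<in> rspace R \<Longrightarrow> S M (rscale R c v) = rscale R c (S M v)"
    and "perp_isometry M \<Longrightarrow> h \<in> Jset \<Longrightarrow> v \<in> rspace R \<Longrightarrow> S M (ract R h v) = ract R (lift_isometry M h) (S M v)"
    and "perp_isometry M \<Longrightarrow> perp_isometry M' \<Longrightarrow> v \<in> rspace R \<Longrightarrow> S (\<lambda>y. M (M' y)) v = S M (S M' v)"
    and "perp_isometry M \<Longrightarrow> perp_isometry M' \<Longrightarrow> isometry_cong M M' \<Longrightarrow> v \<in> rspace R \<Longrightarrow> S M v = S M' v"
    and "v \<in> rspace R \<Longrightarrow> S (\<lambda>y. y) v = v"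
    and "t \<in> E - {0} \<Longrightarrow> v \<in> rspace R \<Longrightarrow> ract R t v = rscale R (\<phi> t) (S (torus_isometry t) v)"
proof -
  note w = assms[unfolded weil_action_def]
  show "perp_isometry M \<Longrightarrow> v \<in> rspace R \<Longrightarrow> S M v \<in> rspace R"
    by (rule w[THEN conjunct1, rule_format])
  show "perp_isometry M \<Longrightarrow> v \<in> rspace R \<Longrightarrow> w \<in> rspace R \<Longrightarrow> S M (v + w) = S M v + S M w"
    by (rule w[THEN conjunct2, THEN conjunct1, rule_format])
  show "perp_isometry M \<Longrightarrow> v \<in> rspace R \<Longrightarrow> S M (rscale R c v) = rscale R c (S M v)"
    by (rule w[THEN conjunct2, THEN conjunct2, THEN conjunct1, rule_format])
  show "perp_isometry M \<Longrightarrow> h \<in> Jset \<Longrightarrow> v \<in> rspace R \<Longrightarrow> S M (ract R h v) = ract R (lift_isometry M h) (S M v)"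
    by (rule w[THEN conjunct2, THEN conjunct2, THEN conjunct2, THEN conjunct1, rule_format])
  show "perp_isometry M \<Longrightarrow> perp_isometry M' \<Longrightarrow> v \<in> rspace R \<Longrightarrow> S (\<lambda>y. M (M' y)) v = S M (S M' v)"
    by (rule w[THEN conjunct2, THEN conjunct2, THEN conjunct2, THEN conjunct2, THEN conjunct1, rule_format])
  show "perp_isometry M \<Longrightarrow> perp_isometry M' \<Longrightarrow> isometry_cong M M' \<Longrightarrow> v \<in> rspace R \<Longrightarrow> S M v = S M' v"
    by (rule w[THEN conjunct2, THEN conjunct2, THEN conjunct2, THEN conjunct2, THEN conjunct2, THEN conjunct1, rule_format])
  show "v \<in> rspace R \<Longrightarrow> S (\<lambda>y. y) v = v"
    by (rule w[THEN conjunct2, THEN conjunct2, THEN conjunct2, THEN conjunct2, THEN conjunct2, THEN conjunct2, THEN conjunct1, rule_format])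
  show "t \<in> E - {0} \<Longrightarrow> v \<in> rspace R \<Longrightarrow> ract R t v = rscale R (\<phi> t) (S (torus_isometry t) v)"
    by (rule w[THEN conjunct2, THEN conjunct2, THEN conjunct2, THEN conjunct2, THEN conjunct2, THEN conjunct2, THEN conjunct2, rule_format])
qed

lemma Jset_subset_TJ: "Jset \<subseteq> (E - {0}) <#>\<^bsub>mult_grp\<^esub> Jset"
  unfolding set_mult_mult_grp by (force intro: exI[of _ 1])

lemma is_rep_subgroup: "is_rep (Dgrp H) R \<Longrightarrow> K \<subseteq> H \<Longrightarrow> is_rep (Dgrp K) R"
  by (auto simp: is_rep_def subset_eq)

lemma pr1_mult_approx:
  assumes "h \<in> Jset" "h' \<in> Jset"
  shows "ereal (r / 2) < valD Q (pr1 (h * h') - (pr1 h + pr1 h'))"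
proof -
  have "ereal (r + r / 2) \<le> valD Q ((pr0 h - 1) * pr1 h')" "ereal (r / 2 + r) \<le> valD Q (pr1 h * (pr0 h' - 1))"
    using assms valD_mult_ge[of r "pr0 h - 1" "r / 2" "pr1 h'"] valD_mult_ge[of "r / 2" "pr1 h" r "pr0 h' - 1"]
    by (simp_all add: Jset_def)
  then have "ereal (r / 2) < valD Q ((pr0 h - 1) * pr1 h' + pr1 h * (pr0 h' - 1))"
    using r_pos by (intro D.val_add_gt) (auto elim!: valD_ge_gt)
  then show ?thesis
    by (simp add: pr1_mult algebra_simps)
qed

lemma pr1_inverse_approx:
  assumes "h \<in> Jset"
  shows "ereal (r / 2) < valD Q (pr1 (inverse h) + pr1 h)"
  using pr1_mult_approx[OF assms Jset_inverse[OF assms]] Jset_neq_zero[OF assms]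
    D.val_minus[of "pr1 (inverse h) + pr1 h"] by (simp add: add.commute)

lemma Jset_plus_cosetI:
  assumes "h \<in> Jset" "h' \<in> Jset" "ereal (r / 2) < valD Q (pr1 h' - pr1 h)"
  shows "h' * inverse h \<in> Jset_plus"
proof -
  have i: "inverse h \<in> Jset"
    by (rule Jset_inverse[OF assms(1)])
  have "ereal (r / 2) < valD Q ((pr1 (h' * inverse h) - (pr1 h' + pr1 (inverse h)))
      + (pr1 (inverse h) + pr1 h) + (pr1 h' - pr1 h))"
    by (intro D.val_add_gt pr1_mult_approx pr1_inverse_approx assms i)
  then have "ereal (r / 2) < valD Q (pr1 (h' * inverse h))"
    by (simp add: algebra_simps)
  then show ?thesis
    using Jset_mult[OF assms(2) i] by (simp add: Jset_def Jset_plus_def)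
qed

section \<open>W as the quotient of a lattice in the complement\<close>

lemma subgroup_Jset: "subgroup Jset mult_grp"
  using Jset_neq_zero by (intro subgroup_mult_grpI Jset_one Jset_mult Jset_inverse) auto

lemma group_Jset: "group (Dgrp Jset)"
  by (rule subgroup.subgroup_is_group[OF subgroup_Jset group_mult_grp])

lemma inv_Jset: "h \<in> Jset \<Longrightarrow> inv\<^bsub>Dgrp Jset\<^esub> h = inverse h"
  using Jset_neq_zero Jset_inverse by (intro group.inv_equality[OF group_Jset]) auto

text \<open>Normality is reduced to commutators instead of conjugates, because commutators are what
  \<open>commutator_approx\<close> controls.\<close>

lemma normal_JsetI:
  assumes "N \<subseteq> Jset" "1 \<in> N" "\<And>x y. x \<in> N \<Longrightarrow> y \<in> N \<Longrightarrow> x * y \<in> N" "\<And>x. x \<in> N \<Longrightarrow> inverse x \<in> N"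
    and "\<And>h n. h \<in> Jset \<Longrightarrow> n \<in> N \<Longrightarrow> h * n * inverse h * inverse n \<in> N"
  shows "N \<lhd> Dgrp Jset"
proof (rule group.normal_invI[OF group_Jset])
  show "subgroup N (Dgrp Jset)"
    using assms(1-4) inv_Jset by unfold_locales auto
  fix h n
  assume "h \<in> carrier (Dgrp Jset)" "n \<in> N"
  then have h: "h \<in> Jset" and n: "n \<in> N" "n \<noteq> 0"
    using assms(1) Jset_neq_zero by auto
  have "h * n * inverse h * inverse n * n \<in> N"
    by (intro assms(3,5) h n)
  also have "h * n * inverse h * inverse n * n = h * n * inverse h"
    using n by (simp add: mult.assoc)
  finally show "h \<otimes>\<^bsub>Dgrp Jset\<^esub> n \<otimes>\<^bsub>Dgrp Jset\<^esub> inv\<^bsub>Dgrp Jset\<^esub> h \<in> N"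
    using h by (simp add: inv_Jset)
qed

lemma normal_Jset_plus: "Jset_plus \<lhd> Dgrp Jset"
  using Jset_plus_subset by (intro normal_JsetI Jset_plus_mult Jset_plus_inverse commutator_Jset_plus) auto

text \<open>Indexes the cosets of J+ by vectors near the complement part, which turns W into a
  lattice modulo its deeper part, with addition.\<close>

definition pcoset :: "'d \<Rightarrow> 'd set" where
  "pcoset y = {h \<in> Jset. ereal (r / 2) < valD Q (pr1 h - y)}"

definition perp_lattice :: "'d set" where
  "perp_lattice = {y \<in> perp. ereal (r / 2) \<le> valD Q y}"

lemma pr1_lattice: "h \<in> Jset \<Longrightarrow> pr1 h \<in> perp_lattice"
  by (simp add: perp_lattice_def Jset_def pr1_in_perp)

lemma one_plus_lattice:
  assumes "y \<in> perp_lattice"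
  shows "1 + y \<in> Jset" "pr0 (1 + y) = 1" "pr1 (1 + y) = y"
  using assms pr_unique[of 1 y] by (auto simp: perp_lattice_def Jset_def)

lemma pcoset_eq:
  assumes "h \<in> Jset"
  shows "Jset_plus #>\<^bsub>mult_grp\<^esub> h = pcoset (pr1 h)"
proof (intro equalityI subsetI)
  fix x assume "x \<in> Jset_plus #>\<^bsub>mult_grp\<^esub> h"
  then obtain n where n: "n \<in> Jset_plus" "n \<in> Jset" "x = n * h"
    using Jset_plus_subset by (auto simp: r_coset_mult_grp)
  have "ereal (r / 2) < valD Q ((pr1 (n * h) - (pr1 n + pr1 h)) + pr1 n)"
    using n by (intro D.val_add_gt pr1_mult_approx assms) (auto simp: Jset_plus_def)
  then show "x \<in> pcoset (pr1 h)"
    using n Jset_mult assms by (simp add: pcoset_def algebra_simps)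
next
  fix x assume "x \<in> pcoset (pr1 h)"
  then have "x * inverse h \<in> Jset_plus"
    using assms by (intro Jset_plus_cosetI) (auto simp: pcoset_def)
  moreover have "x = x * inverse h * h"
    using Jset_neq_zero[OF assms] by (simp add: mult.assoc)
  ultimately show "x \<in> Jset_plus #>\<^bsub>mult_grp\<^esub> h"
    unfolding r_coset_mult_grp by blast
qed

lemma carrier_W: "carrier (W_grp Q E \<sigma> r) = pcoset ` perp_lattice"
proof -
  have "carrier (W_grp Q E \<sigma> r) = (\<lambda>h. pcoset (pr1 h)) ` Jset"
    unfolding W_grp_def J_grp_eq J_plus_eq carrier_FactGroup
    by (auto simp: r_coset_Dgrp pcoset_eq simp flip: r_coset_mult_grp)
  also have "\<dots> = pcoset ` perp_lattice"
    using pr1_lattice one_plus_lattice by (force simp: image_iff)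
  finally show ?thesis .
qed

lemma pcoset_cong: "ereal (r / 2) < valD Q (y - y') \<Longrightarrow> pcoset y = pcoset y'"
proof -
  have *: "pcoset y \<subseteq> pcoset y'" if "ereal (r / 2) < valD Q (y - y')" for y y'
    using D.val_add_gt[OF _ that] by (fastforce simp: pcoset_def)
  assume "ereal (r / 2) < valD Q (y - y')"
  then show ?thesis
    using * D.val_minus_commute[of y y'] by (metis subset_antisym)
qed

lemma pcoset_eq_iff:
  assumes "y \<in> perp_lattice" "y' \<in> perp_lattice"
  shows "pcoset y = pcoset y' \<longleftrightarrow> ereal (r / 2) < valD Q (y - y')"
proof
  assume "pcoset y = pcoset y'"
  moreover have "1 + y \<in> pcoset y"
    using one_plus_lattice[OF assms(1)] by (simp add: pcoset_def)
  ultimately have "1 + y \<in> pcoset y'"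
    by simp
  then show "ereal (r / 2) < valD Q (y - y')"
    by (simp add: pcoset_def one_plus_lattice(3)[OF assms(1)])
qed (rule pcoset_cong)

lemma lattice_add: "y \<in> perp_lattice \<Longrightarrow> y' \<in> perp_lattice \<Longrightarrow> y + y' \<in> perp_lattice"
  by (simp add: perp_lattice_def add_perp D.val_add_ge)

lemma pcoset_mult:
  assumes "y \<in> perp_lattice" "y' \<in> perp_lattice"
  shows "pcoset y \<otimes>\<^bsub>W_grp Q E \<sigma> r\<^esub> pcoset y' = pcoset (y + y')"
proof -
  note y = one_plus_lattice[OF assms(1)] and y' = one_plus_lattice[OF assms(2)]
  have "pcoset y \<otimes>\<^bsub>W_grp Q E \<sigma> r\<^esub> pcoset y' =
      (Jset_plus #>\<^bsub>Dgrp Jset\<^esub> (1 + y)) <#>\<^bsub>Dgrp Jset\<^esub> (Jset_plus #>\<^bsub>Dgrp Jset\<^esub> (1 + y'))"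
    using y y' pcoset_eq[of "1 + y"] pcoset_eq[of "1 + y'"]
    unfolding W_grp_def J_grp_eq J_plus_eq mult_FactGroup r_coset_Dgrp r_coset_mult_grp by simp
  also have "\<dots> = Jset_plus #>\<^bsub>Dgrp Jset\<^esub> ((1 + y) * (1 + y'))"
    using normal.rcos_sum[OF normal_Jset_plus, of "1 + y" "1 + y'"] y y' by simp
  also have "\<dots> = pcoset (pr1 ((1 + y) * (1 + y')))"
    using pcoset_eq[OF Jset_mult[OF y(1) y'(1)]] by (simp only: r_coset_Dgrp r_coset_mult_grp)
  also have "\<dots> = pcoset (y + y')"
    using pr1_mult_approx[OF y(1) y'(1)] y y' by (intro pcoset_cong) simp
  finally show ?thesis .
qed

lemma isometry_lattice: "perp_isometry M \<Longrightarrow> y \<in> perp_lattice \<Longrightarrow> M y \<in> perp_lattice"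
  by (simp add: perp_lattice_def perp_isometry_def)

lemma lattice_perp: "y \<in> perp_lattice \<Longrightarrow> y \<in> perp"
  by (simp add: perp_lattice_def)

text \<open>The map of W induced by M. It is made extensional because elements of
  \<open>AutoGroup\<close> are, and the chosen representative is harmless by
  \<open>Phi_pcoset\<close>.\<close>

definition Phi :: "('d \<Rightarrow> 'd) \<Rightarrow> 'd set \<Rightarrow> 'd set" where
  "Phi M = (\<lambda>w\<in>carrier (W_grp Q E \<sigma> r). pcoset (M (pr1 (SOME h. h \<in> w))))"

lemma some_pcoset:
  assumes "y \<in> perp_lattice"
  shows "(SOME h. h \<in> pcoset y) \<in> Jset" "ereal (r / 2) < valD Q (pr1 (SOME h. h \<in> pcoset y) - y)"
proof -
  have "1 + y \<in> pcoset y"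
    using one_plus_lattice[OF assms] by (simp add: pcoset_def)
  then have "(SOME h. h \<in> pcoset y) \<in> pcoset y"
    by (rule someI)
  then show "(SOME h. h \<in> pcoset y) \<in> Jset" "ereal (r / 2) < valD Q (pr1 (SOME h. h \<in> pcoset y) - y)"
    by (auto simp: pcoset_def)
qed

lemma Phi_pcoset:
  assumes "perp_isometry M" "y \<in> perp_lattice"
  shows "Phi M (pcoset y) = pcoset (M y)"
proof -
  let ?x = "pr1 (SOME h. h \<in> pcoset y)"
  have "M ?x - M y = M (?x - y)"
    using perp_isometry_diff[OF assms(1) pr1_in_perp lattice_perp[OF assms(2)]] by simp
  then have "valD Q (M ?x - M y) = valD Q (?x - y)"
    using assms(1) diff_perp[OF pr1_in_perp lattice_perp[OF assms(2)]] by (simp add: perp_isometry_def)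
  then have "pcoset (M ?x) = pcoset (M y)"
    using some_pcoset(2)[OF assms(2)] by (intro pcoset_cong) simp
  then show ?thesis
    using assms(2) by (simp add: Phi_def carrier_W)
qed

lemma Phi_extensional: "Phi M \<in> extensional (carrier (W_grp Q E \<sigma> r))"
  by (simp add: Phi_def)

lemma Phi_eqI:
  assumes "f \<in> extensional (carrier (W_grp Q E \<sigma> r))" "perp_isometry M"
    and "\<And>y. y \<in> perp_lattice \<Longrightarrow> f (pcoset y) = pcoset (M y)"
  shows "f = Phi M"
  using assms by (intro extensionalityI[OF assms(1) Phi_extensional]) (auto simp: carrier_W Phi_pcoset)

lemma Phi_auto:
  assumes M: "perp_isometry M"
  shows "Phi M \<in> auto (W_grp Q E \<sigma> r)"
proof -
  have "Phi M \<in> hom (W_grp Q E \<sigma> r) (W_grp Q E \<sigma> r)"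
    using M perp_isometry_def[of M]
    by (auto simp: hom_def carrier_W Phi_pcoset pcoset_mult lattice_add isometry_lattice lattice_perp)
  moreover have "bij_betw (Phi M) (carrier (W_grp Q E \<sigma> r)) (carrier (W_grp Q E \<sigma> r))"
  proof (rule bij_betwI')
    fix w w'
    assume "w \<in> carrier (W_grp Q E \<sigma> r)" "w' \<in> carrier (W_grp Q E \<sigma> r)"
    then obtain y y' where y: "w = pcoset y" "y \<in> perp_lattice" "w' = pcoset y'" "y' \<in> perp_lattice"
      by (auto simp: carrier_W)
    have "valD Q (M (y - y')) = valD Q (y - y')"
      using M diff_perp[OF lattice_perp[OF y(2)] lattice_perp[OF y(4)]] by (simp add: perp_isometry_def)
    then have "valD Q (M y - M y') = valD Q (y - y')"
      unfolding perp_isometry_diff[OF M lattice_perp[OF y(2)] lattice_perp[OF y(4)]] .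
    then show "Phi M w = Phi M w' \<longleftrightarrow> w = w'"
      using y M by (simp add: Phi_pcoset pcoset_eq_iff isometry_lattice)
  next
    fix w assume "w \<in> carrier (W_grp Q E \<sigma> r)"
    then show "Phi M w \<in> carrier (W_grp Q E \<sigma> r)"
      using M by (auto simp: carrier_W Phi_pcoset isometry_lattice)
  next
    fix w assume "w \<in> carrier (W_grp Q E \<sigma> r)"
    then obtain y where y: "w = pcoset y" "y \<in> perp_lattice"
      by (auto simp: carrier_W)
    then obtain x where x: "x \<in> perp" "M x = y"
      using M by (auto simp: perp_isometry_def perp_lattice_def)
    then have "x \<in> perp_lattice"
      using M y by (auto simp: perp_isometry_def perp_lattice_def)
    then show "\<exists>x\<in>carrier (W_grp Q E \<sigma> r). w = Phi M x"
      using M x y by (auto simp: carrier_W Phi_pcoset intro!: bexI[of _ "pcoset x"])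
  qed
  ultimately show ?thesis
    by (simp add: auto_def Bij_def Phi_extensional)
qed

end

section \<open>The Heisenberg--Weil lift\<close>

context torus_character
begin

lemma psi_cong: "x \<in> E \<Longrightarrow> x' \<in> E \<Longrightarrow> ereal r < valD Q (x - x') \<Longrightarrow> \<psi> (X x) = \<psi> (X x')"
  using Th_cong[of x x x' x'] by (simp add: Th_diag)

lemma psi_add: "x \<in> E \<Longrightarrow> x' \<in> E \<Longrightarrow> \<psi> (X (x + x')) = \<psi> (X x) * \<psi> (X x')"
  using Th_add[of x x x' x'] by (simp add: Th_diag add_E)

lemma psi_small: "x \<in> E \<Longrightarrow> ereal r < valD Q x \<Longrightarrow> \<psi> (X x) = 1"
  using Th_small[of x x] by (simp add: Th_diag)

lemma psi_neq_zero: "\<psi> x \<noteq> 0"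
  using psi by (simp add: additive_character_def)

text \<open>An element of J+ changes the complement part of h too little to affect its square beyond
  depth r, and the cross terms in the E part are deeper than r. Only the E part of n is felt, and it
  contributes \<theta>.\<close>

lemma xi_mult_plus:
  assumes n: "n \<in> Jset_plus" and h: "h \<in> Jset"
  shows "xi (n * h) = \<theta> (iota E \<sigma> n) * xi h"
proof -
  have nJ: "n \<in> Jset"
    using n Jset_plus_subset by auto
  let ?a = "pr0 n" and ?y = "pr1 n" and ?b = "pr0 h" and ?z = "pr1 h"
  define w where "w = pr1 (n * h)"
  have wP: "w \<in> perp"
    by (simp add: w_def pr1_in_perp)
  have d: "ereal (r / 2) < valD Q (w - (?y + ?z))"
    unfolding w_def by (rule pr1_mult_approx[OF nJ h])
  have v: "ereal r \<le> valD Q (?a - 1)" "ereal (r / 2) < valD Q ?y" "ereal r \<le> valD Q (?b - 1)" "ereal (r / 2) \<le> valD Q ?z"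
    using n h by (auto simp: Jset_def Jset_plus_def)
  have "ereal (r / 2) < valD Q ((w - (?y + ?z)) + ?y)"
    by (intro D.val_add_gt d v)
  then have wz: "ereal (r / 2) < valD Q (w - ?z)"
    by (simp add: algebra_simps)
  have wv: "ereal (r / 2) \<le> valD Q w"
    using Jset_mult[OF nJ h] by (simp add: w_def Jset_def)
  have "ereal r < valD Q ((w - ?z) * w + ?z * (w - ?z))"
    by (intro D.val_add_gt square_gt wz wv v)
  then have sq: "ereal r < valD Q (w * w - ?z * ?z)"
    by (simp add: algebra_simps)
  have "ereal (r + r) \<le> valD Q ((?a - 1) * (?b - 1))"
    by (intro valD_mult_ge v)
  then have ab: "ereal r < valD Q ((?a - 1) * (?b - 1))"
    using r_pos by (auto elim!: valD_ge_gt)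
  have yz: "ereal r < valD Q (?y * ?z)"
    by (intro square_gt v)
  have mem: "?a - 1 \<in> E" "?b - 1 \<in> E" "?y * ?z \<in> E" "w * w \<in> E" "?z * ?z \<in> E" "pr0 (n * h) \<in> E"
    by (auto intro!: diff_E pr0_in_E perp_mult_perp pr1_in_perp wP)
  have mem2: "?b - 1 - emb Q (1 / 2) * (?z * ?z) \<in> E" "pr0 (n * h) - 1 - emb Q (1 / 2) * (w * w) \<in> E"
    using mem by (auto intro!: diff_E mult_E)
  have "ereal r < valD Q ((?a - 1) * (?b - 1) + ?y * ?z - emb Q (1 / 2) * (w * w - ?z * ?z))"
    by (intro D.val_diff_gt[OF D.val_add_gt[OF ab yz]] half_mult_gt sq)
  also have "(?a - 1) * (?b - 1) + ?y * ?z - emb Q (1 / 2) * (w * w - ?z * ?z) =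
      (pr0 (n * h) - 1 - emb Q (1 / 2) * (w * w)) - ((?a - 1) + (?b - 1 - emb Q (1 / 2) * (?z * ?z)))"
    by (simp add: pr0_mult algebra_simps)
  finally have "xi (n * h) = \<psi> (X ((?a - 1) + (?b - 1 - emb Q (1 / 2) * (?z * ?z))))"
    unfolding xi_def w_def[symmetric] using mem mem2 by (intro psi_cong) (auto intro: add_E)
  also have "\<dots> = \<psi> (X (?a - 1)) * xi h"
    unfolding xi_def using mem mem2 by (intro psi_add)
  finally show ?thesis
    using theta_iota[OF n] by simp
qed

abbreviation NN :: "'d set" where "NN \<equiv> N_grp Q E \<sigma> r \<theta>"
abbreviation HH :: "'d set monoid" where "HH \<equiv> H_grp Q E \<sigma> r \<theta>"
abbreviation WW :: "'d set monoid" where "WW \<equiv> W_grp Q E \<sigma> r"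

lemma N_grp_iff: "n \<in> NN \<longleftrightarrow> n \<in> Jset_plus \<and> \<theta> (iota E \<sigma> n) = 1"
  by (simp add: N_grp_def J_plus_eq)

lemma theta_iota_mult:
  "x \<in> Jset_plus \<Longrightarrow> y \<in> Jset_plus \<Longrightarrow> \<theta> (iota E \<sigma> (x * y)) = \<theta> (iota E \<sigma> x) * \<theta> (iota E \<sigma> y)"
  by (simp add: iota_mult theta_mult Jset_plus_iff)

lemma theta_one: "\<theta> (iota E \<sigma> 1) = 1"
  by (simp add: theta_iota psi_small)

lemma theta_commutator:
  assumes "h \<in> Jset" "h' \<in> Jset"
  shows "\<theta> (iota E \<sigma> (h * h' * inverse h * inverse h')) = \<psi> (X (pr1 h * pr1 h' - pr1 h' * pr1 h))"
  unfolding theta_iota[OF commutator_Jset_plus(1)[OF assms]]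
  by (rule psi_cong[OF _ _ commutator_Jset_plus(2)[OF assms]])
    (auto intro!: diff_E pr0_in_E perp_mult_perp pr1_in_perp)

text \<open>The bracket of the complement parts of an element of J and one of J+ is deeper than r,
  so \<theta> is trivial on such commutators.\<close>

lemma normal_N: "NN \<lhd> Dgrp Jset"
proof (rule normal_JsetI)
  show "inverse x \<in> NN" if "x \<in> NN" for x
    using that theta_iota_mult[of x "inverse x"] theta_one Jset_plus_inverse[of x] Jset_neq_zero[of x] Jset_plus_subset
    by (auto simp: N_grp_iff)
  show "h * n * inverse h * inverse n \<in> NN" if h: "h \<in> Jset" and n: "n \<in> NN" for h n
  proof -
    have nJ: "n \<in> Jset" "ereal (r / 2) < valD Q (pr1 n)"
      using n Jset_plus_subset by (auto simp: N_grp_iff Jset_plus_def)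
    have "\<psi> (X (pr1 h * pr1 n - pr1 n * pr1 h)) = 1"
      using nJ h by (intro psi_small diff_E perp_mult_perp pr1_in_perp D.val_diff_gt square_gt) (auto simp: Jset_def)
    then show ?thesis
      using theta_commutator[OF h nJ(1)] commutator_Jset_plus(1)[OF h nJ(1)] by (simp add: N_grp_iff)
  qed
qed (use Jset_plus_subset Jset_plus_mult theta_iota_mult theta_one in \<open>auto simp: N_grp_iff\<close>)

lemma carrier_H: "carrier HH = (\<lambda>h. NN #>\<^bsub>mult_grp\<^esub> h) ` Jset"
  by (auto simp: H_grp_def J_grp_eq carrier_FactGroup r_coset_Dgrp r_coset_mult_grp)

lemma N_cosetI: "h \<in> NN #>\<^bsub>mult_grp\<^esub> h"
  using Jset_plus_one theta_one by (force simp: r_coset_mult_grp N_grp_iff intro!: image_eqI[of _ _ 1])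

lemma one_H: "\<one>\<^bsub>HH\<^esub> = NN #>\<^bsub>mult_grp\<^esub> 1"
  by (simp add: H_grp_def r_coset_mult_grp)

lemma N_coset_some:
  assumes "h \<in> Jset"
  obtains n where "n \<in> NN" "(SOME x. x \<in> NN #>\<^bsub>mult_grp\<^esub> h) = n * h"
  using someI[of "\<lambda>x. x \<in> NN #>\<^bsub>mult_grp\<^esub> h", OF N_cosetI] by (auto simp: r_coset_mult_grp)

lemma N_coset_absorb:
  assumes "h \<in> Jset" "n \<in> NN"
  shows "NN #>\<^bsub>mult_grp\<^esub> (n * h) = NN #>\<^bsub>mult_grp\<^esub> h"
proof -
  have sub: "subgroup NN (Dgrp Jset)"
    using normal_N by (rule normal_imp_subgroup)
  have nJ: "n \<in> Jset"
    using assms(2) Jset_plus_subset by (auto simp: N_grp_iff)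
  have "NN #>\<^bsub>Dgrp Jset\<^esub> (n \<otimes>\<^bsub>Dgrp Jset\<^esub> h) = NN #>\<^bsub>Dgrp Jset\<^esub> n #>\<^bsub>Dgrp Jset\<^esub> h"
    using group.coset_mult_assoc[OF group_Jset subgroup.subset[OF sub], of n h] nJ assms(1) by simp
  also have "NN #>\<^bsub>Dgrp Jset\<^esub> n = NN"
    using group.coset_join2[OF group_Jset _ sub assms(2)] nJ by simp
  finally show ?thesis
    by (simp add: r_coset_Dgrp r_coset_mult_grp)
qed

abbreviation sp :: "'d set \<Rightarrow> 'd set \<times> int" where "sp \<equiv> special_iso Q p \<kappa> E \<sigma> r \<theta>"

text \<open>The representative picked by \<open>SOME\<close> differs from h by an element of N, on
  which \<theta> is trivial; neither coordinate notices.\<close>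

lemma special_iso_eq:
  assumes h: "h \<in> Jset"
  shows "sp (NN #>\<^bsub>mult_grp\<^esub> h) = (pcoset (pr1 h), \<kappa> (xi h))"
proof -
  obtain n where n: "n \<in> NN" "(SOME x. x \<in> NN #>\<^bsub>mult_grp\<^esub> h) = n * h"
    by (rule N_coset_some[OF h])
  have np: "n \<in> Jset_plus" "\<theta> (iota E \<sigma> n) = 1" "n \<in> Jset"
    using n Jset_plus_subset by (auto simp: N_grp_iff)
  have nh: "n * h \<in> Jset"
    using np h by (intro Jset_mult)
  have "xi (n * h) = xi h"
    using xi_mult_plus[OF np(1) h] np by simp
  moreover have "pcoset (pr1 (n * h)) = pcoset (pr1 h)"
  proof (rule pcoset_cong)
    have "ereal (r / 2) < valD Q ((pr1 (n * h) - (pr1 n + pr1 h)) + pr1 n)"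
      using np by (intro D.val_add_gt pr1_mult_approx h) (auto simp: Jset_plus_def)
    then show "ereal (r / 2) < valD Q (pr1 (n * h) - pr1 h)"
      by (simp add: algebra_simps)
  qed
  ultimately show ?thesis
    unfolding special_iso_def n(2) Let_def J_plus_eq pcoset_eq[OF nh] mu_iota[OF nh] by simp
qed

lemma kappa_inj: "z ^ p = 1 \<Longrightarrow> w ^ p = 1 \<Longrightarrow> \<kappa> z = \<kappa> w \<Longrightarrow> z = w"
  using kappa by (auto simp: iso_def mu_group_def bij_betw_def inj_on_def)

text \<open>Equal first coordinates put h and h' in one coset of J+, and equivariance of
  \<open>xi\<close> then puts their quotient into N. This allows the inverse used in the
  construction to be evaluated.\<close>

lemma special_iso_inj: "inj_on sp (carrier HH)"
proof (rule inj_onI)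
  fix x x'
  assume "x \<in> carrier HH" "x' \<in> carrier HH" and eq: "sp x = sp x'"
  then obtain h h' where h: "x = NN #>\<^bsub>mult_grp\<^esub> h" "h \<in> Jset" "x' = NN #>\<^bsub>mult_grp\<^esub> h'" "h' \<in> Jset"
    by (auto simp: carrier_H)
  have e: "pcoset (pr1 h) = pcoset (pr1 h')" "\<kappa> (xi h) = \<kappa> (xi h')"
    using eq h by (simp_all add: special_iso_eq)
  then have "ereal (r / 2) < valD Q (pr1 h - pr1 h')"
    using h pr1_lattice by (simp add: pcoset_eq_iff)
  then have n: "h * inverse h' \<in> Jset_plus"
    using h by (intro Jset_plus_cosetI)
  have hh: "h * inverse h' * h' = h"
    using Jset_neq_zero[OF h(4)] by (simp add: mult.assoc)
  have xe: "xi h = xi h'"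
    using e(2) h xi_power kappa_inj by blast
  have "xi h = \<theta> (iota E \<sigma> (h * inverse h')) * xi h'"
    using xi_mult_plus[OF n h(4)] by (simp add: hh)
  then have "\<theta> (iota E \<sigma> (h * inverse h')) = 1"
    using xe psi_neq_zero by (simp add: xi_def)
  then show "x = x'"
    using N_coset_absorb[OF h(4), of "h * inverse h'"] n h by (simp add: N_grp_iff hh)
qed

lemma special_iso_inverse: "h \<in> Jset \<Longrightarrow> inv_into (carrier HH) sp (pcoset (pr1 h), \<kappa> (xi h)) = NN #>\<^bsub>mult_grp\<^esub> h"
  using inv_into_f_f[OF special_iso_inj, of "NN #>\<^bsub>mult_grp\<^esub> h"] special_iso_eq carrier_H by auto

text \<open>The chosen representatives have complement parts within depth beyond
  \<open>r / 2\<close> of y and y', which changes the bracket only beyond depth r.\<close>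

lemma W_form_eq:
  assumes "y \<in> perp_lattice" "y' \<in> perp_lattice"
  shows "W_form \<kappa> E \<sigma> \<theta> (pcoset y) (pcoset y') = \<kappa> (\<psi> (X (y * y' - y' * y)))"
proof -
  let ?h = "SOME h. h \<in> pcoset y" and ?h' = "SOME h. h \<in> pcoset y'"
  note h = some_pcoset[OF assms(1)] and h' = some_pcoset[OF assms(2)]
  have cm: "comm mult_grp ?h ?h' = ?h * ?h' * inverse ?h * inverse ?h'"
    using Jset_neq_zero[OF h(1)] Jset_neq_zero[OF h'(1)] by (simp add: comm_def inv_mult_grp)
  have v: "ereal (r / 2) \<le> valD Q y" "ereal (r / 2) \<le> valD Q (pr1 ?h')" "ereal (r / 2) \<le> valD Q (pr1 ?h)" "ereal (r / 2) \<le> valD Q y'"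
    using assms h h' by (auto simp: perp_lattice_def Jset_def)
  have 1: "ereal r < valD Q (pr1 ?h * pr1 ?h' - y * y')"
  proof -
    have "ereal r < valD Q ((pr1 ?h - y) * pr1 ?h' + y * (pr1 ?h' - y'))"
      by (intro D.val_add_gt square_gt h h' v)
    then show ?thesis
      by (simp add: algebra_simps)
  qed
  have 2: "ereal r < valD Q (pr1 ?h' * pr1 ?h - y' * y)"
  proof -
    have "ereal r < valD Q ((pr1 ?h' - y') * pr1 ?h + y' * (pr1 ?h - y))"
      by (intro D.val_add_gt square_gt h h' v)
    then show ?thesis
      by (simp add: algebra_simps)
  qed
  have "\<psi> (X (pr1 ?h * pr1 ?h' - pr1 ?h' * pr1 ?h)) = \<psi> (X (y * y' - y' * y))"
  proof (rule psi_cong)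
    have "ereal r < valD Q ((pr1 ?h * pr1 ?h' - y * y') - (pr1 ?h' * pr1 ?h - y' * y))"
      by (intro D.val_diff_gt[OF 1 2])
    then show "ereal r < valD Q (pr1 ?h * pr1 ?h' - pr1 ?h' * pr1 ?h - (y * y' - y' * y))"
      by (simp add: algebra_simps)
  qed (use assms lattice_perp in \<open>auto intro!: diff_E perp_mult_perp pr1_in_perp\<close>)
  then show ?thesis
    unfolding W_form_def cm theta_commutator[OF h(1) h'(1)] by simp
qed

abbreviation SpW :: "('d set \<Rightarrow> 'd set) monoid" where "SpW \<equiv> Sp_group WW (W_form \<kappa> E \<sigma> \<theta>)"

lemma Phi_Sp: "perp_isometry M \<Longrightarrow> Phi M \<in> carrier SpW"
  using Phi_auto[of M]
  by (auto simp: Sp_group_def carrier_W Phi_pcoset W_form_eq isometry_lattice lattice_perp perp_isometry_def)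

lemma Phi_comp:
  assumes "perp_isometry M" "perp_isometry M'"
  shows "Phi M \<otimes>\<^bsub>SpW\<^esub> Phi M' = Phi (\<lambda>y. M (M' y))"
proof (rule Phi_eqI)
  have B: "Phi M \<in> Bij (carrier WW)" "Phi M' \<in> Bij (carrier WW)"
    using Phi_auto assms by (auto simp: auto_def)
  then have eq: "Phi M \<otimes>\<^bsub>SpW\<^esub> Phi M' = compose (carrier WW) (Phi M) (Phi M')"
    by (simp add: Sp_group_def AutoGroup_def BijGroup_def)
  show "Phi M \<otimes>\<^bsub>SpW\<^esub> Phi M' \<in> extensional (carrier WW)"
    unfolding eq by (simp add: compose_def)
  show "(Phi M \<otimes>\<^bsub>SpW\<^esub> Phi M') (pcoset y) = pcoset (M (M' y))" if "y \<in> perp_lattice" for y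
    unfolding eq using that assms by (simp add: compose_def carrier_W Phi_pcoset isometry_lattice)
qed (rule perp_isometry_comp[OF assms])

lemma Phi_id: "Phi (\<lambda>y. y) = \<one>\<^bsub>SpW\<^esub>"
  by (rule Phi_eqI[symmetric]) (auto simp: Sp_group_def AutoGroup_def BijGroup_def carrier_W perp_isometry_id)

lemma Phi_cong:
  assumes "perp_isometry M" "perp_isometry M'"
    and "isometry_cong M M'"
  shows "Phi M = Phi M'"
  using assms unfolding isometry_cong_def by (intro Phi_eqI Phi_extensional) (auto simp: Phi_pcoset perp_lattice_def intro!: pcoset_cong)

lemma conj_action_eq:
  assumes "t \<in> E" "t \<noteq> 0"
  shows "conj_action Q E \<sigma> r t = Phi (torus_isometry t)"
proof (rule Phi_eqI)
  show "conj_action Q E \<sigma> r t \<in> extensional (carrier WW)"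
    by (simp add: conj_action_def)
  show iso: "perp_isometry (torus_isometry t)"
    by (rule torus_isometry[OF assms])
  fix y assume y: "y \<in> perp_lattice"
  have i: "inverse t \<in> E" "inverse t \<noteq> 0"
    using assms by (auto intro: inverse_E)
  have *: "s * h * inverse s \<in> pcoset (torus_isometry s z)"
    if s: "s \<in> E" "s \<noteq> 0" and z: "z \<in> perp" and h: "h \<in> pcoset z" for s h z
  proof -
    have "torus_isometry s (pr1 h) - torus_isometry s z = torus_isometry s (pr1 h - z)"
      by (simp add: torus_isometry_def left_diff_distrib right_diff_distrib)
    moreover have "valD Q (torus_isometry s (pr1 h - z)) = valD Q (pr1 h - z)"
      unfolding torus_isometry_def by (rule D.val_conjugate[OF s(2)])
    ultimately show ?thesis
      using s h torus_conjugate_Jset by (simp add: pcoset_def pr1_torus_conjugate)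
  qed
  have "(\<lambda>h. t * h * inverse t) ` pcoset y = pcoset (torus_isometry t y)"
  proof (intro equalityI subsetI)
    fix x assume x: "x \<in> pcoset (torus_isometry t y)"
    have "torus_isometry t y \<in> perp"
      using iso y by (simp add: perp_isometry_def perp_lattice_def)
    from *[OF i this x] have "inverse t * x * t \<in> pcoset (torus_isometry (inverse t) (torus_isometry t y))"
      using assms by simp
    moreover have "torus_isometry (inverse t) (torus_isometry t y) = y"
      using assms by (simp add: torus_isometry_def mult.assoc) (simp flip: mult.assoc)
    moreover have "x = t * (inverse t * x * t) * inverse t"
      using assms by (simp add: mult.assoc) (simp flip: mult.assoc)
    ultimately show "x \<in> (\<lambda>h. t * h * inverse t) ` pcoset y"
      by (metis imageI)
  qed (use * assms y lattice_perp in auto)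
  then show "conj_action Q E \<sigma> r t (pcoset y) = pcoset (torus_isometry t y)"
    using y by (simp add: conj_action_def carrier_W)
qed

lemma xi_lift:
  assumes "perp_isometry M"
  shows "xi (lift_isometry M h) = xi h"
proof -
  have eq: "b + (u - v) - 1 - u = b - 1 - v" for b u v :: 'd
    by (simp add: algebra_simps)
  show ?thesis
    unfolding xi_def pr_lift_isometry[OF assms] right_diff_distrib eq ..
qed

text \<open>Translates the Heisenberg-Weil lift into statements about J and the complement, from
  which \<theta>, N and the special isomorphism have disappeared; in this form two lifts can be
  compared.\<close>

lemma heisenberg_case:
  fixes R :: "('d, 'v::ab_group_add) rep" and \<phi> :: "'d \<Rightarrow> complex"
  assumes rep: "is_rep (Dgrp ((E - {0}) <#>\<^bsub>mult_grp\<^esub> Jset)) R"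
    and phi: "\<And>h. h \<in> Jset_plus \<Longrightarrow> \<phi> (pr0 h) = \<theta> (iota E \<sigma> h)" and phi1: "\<phi> 1 = 1"
    and sc: "rscale \<tau> = rscale R" "rspace \<tau> = rspace R"
    and heis: "heisenberg_rep Q E \<sigma> r \<theta> \<tau>"
    and lift: "heisenberg_weil_lift p WW (W_form \<kappa> E \<sigma> \<theta>)
      \<lparr>rscale = rscale \<tau>, rspace = rspace \<tau>, ract = (\<lambda>y. ract \<tau> (inv_into (carrier HH) sp y))\<rparr> \<tau>S"
    and act: "\<And>t h v. t \<in> E - {0} \<Longrightarrow> h \<in> Jset \<Longrightarrow> v \<in> rspace R \<Longrightarrow>
      ract R (t * h) v = rscale R (\<phi> t) (\<tau>S (conj_action Q E \<sigma> r t) (ract \<tau> (NN #>\<^bsub>mult_grp\<^esub> h) v))"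
  shows "J_representation \<phi> R" "weil_action \<phi> R (\<lambda>M. \<tau>S (Phi M))"
proof -
  have vs: "vector_space (rscale R)"
    using rep by (simp add: is_rep_def)
  interpret V: vector_space "rscale R"
    by (rule vs)
  have Srep: "is_rep SpW \<lparr>rscale = rscale R, rspace = rspace R, ract = \<tau>S\<rparr>"
    using lift by (simp add: heisenberg_weil_lift_def sc)
  have irr: "irreducible_rep HH \<tau>"
    using heis by (simp add: heisenberg_rep_def)
  then have Hrep: "is_rep HH \<tau>"
    by (simp add: irreducible_rep_def)
  have one: "\<tau>S (Phi (\<lambda>y. y)) v = v" if "v \<in> rspace R" for v
    using Srep that by (simp add: is_rep_def Phi_id)
  have t1: "Phi (torus_isometry 1) = Phi (\<lambda>y. y)"
    using torus_isometry[of 1] r_pos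
    by (intro Phi_cong perp_isometry_id) (auto simp: isometry_cong_def torus_isometry_def)
  have cl: "ract \<tau> (NN #>\<^bsub>mult_grp\<^esub> h) v \<in> rspace R" if "h \<in> Jset" "v \<in> rspace R" for h v
    using Hrep that by (auto simp: is_rep_def carrier_H sc)
  \<comment> \<open>For t = 1 the Weil operator is that of the identity and \<phi> is 1, so J acts
    through its Heisenberg quotient.\<close>
  have RJ: "ract R h v = ract \<tau> (NN #>\<^bsub>mult_grp\<^esub> h) v" if "h \<in> Jset" "v \<in> rspace R" for h v
    using act[of 1 h v] that one[OF cl[OF that]] by (simp add: phi1 conj_action_eq t1)
  have RJrep: "is_rep (Dgrp Jset) R"
    by (rule is_rep_subgroup[OF rep Jset_subset_TJ])
  have "irreducible_rep (Dgrp Jset) R"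
    unfolding irreducible_rep_def
  proof (intro conjI allI impI)
    show "rspace R \<noteq> {0}"
      using irr by (simp add: irreducible_rep_def sc)
    fix U
    assume U: "V.subspace U \<and> U \<subseteq> rspace R \<and> (\<forall>g\<in>carrier (Dgrp Jset). ract R g ` U \<subseteq> U)"
    have "ract \<tau> (NN #>\<^bsub>mult_grp\<^esub> h) ` U \<subseteq> U" if h: "h \<in> Jset" for h
    proof -
      have "ract \<tau> (NN #>\<^bsub>mult_grp\<^esub> h) ` U = ract R h ` U"
        using U RJ[OF h] by (intro image_cong) auto
      then show ?thesis
        using U h by simp
    qed
    then have "\<forall>g\<in>carrier HH. ract \<tau> g ` U \<subseteq> U"
      by (auto simp: carrier_H)
    then show "U = {0} \<or> U = rspace R"
      using irr U by (simp add: irreducible_rep_def sc)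
  qed (rule RJrep)
  moreover have "ract R h v = rscale R (\<phi> (pr0 h)) v" if "h \<in> Jset_plus" "v \<in> rspace R" for h v
    using heis that RJ[of h v] Jset_plus_subset phi[of h] by (auto simp: heisenberg_rep_def J_plus_eq sc)
  ultimately show "J_representation \<phi> R"
    using rep by (simp add: J_representation_def)
  have eqv: "\<tau>S (Phi M) (ract R h v) = ract R (lift_isometry M h) (\<tau>S (Phi M) v)"
    if M: "perp_isometry M" and h: "h \<in> Jset" and v: "v \<in> rspace R" for M h v
  proof -
    have lh: "lift_isometry M h \<in> Jset"
      by (rule lift_isometry_Jset[OF M h])
    have mem: "(pcoset (pr1 h), \<kappa> (xi h)) \<in> carrier (sharp p WW (W_form \<kappa> E \<sigma> \<theta>))"
      using pr1_lattice[OF h] kappa_range[OF xi_power[OF h]] by (simp add: sharp_def carrier_W)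
    have "\<forall>g\<in>carrier SpW. \<forall>(w, z)\<in>carrier (sharp p WW (W_form \<kappa> E \<sigma> \<theta>)). \<forall>v\<in>rspace R.
        \<tau>S g (ract \<tau> (inv_into (carrier HH) sp (w, z)) v) = ract \<tau> (inv_into (carrier HH) sp (g w, z)) (\<tau>S g v)"
      using lift by (simp add: heisenberg_weil_lift_def sc)
    from bspec[OF this Phi_Sp[OF M], THEN bspec, OF mem] v
    have "\<tau>S (Phi M) (ract \<tau> (inv_into (carrier HH) sp (pcoset (pr1 h), \<kappa> (xi h))) v) =
        ract \<tau> (inv_into (carrier HH) sp (Phi M (pcoset (pr1 h)), \<kappa> (xi h))) (\<tau>S (Phi M) v)"
      by simp
    moreover have "Phi M (pcoset (pr1 h)) = pcoset (pr1 (lift_isometry M h))"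
      by (simp add: Phi_pcoset M pr1_lattice h pr_lift_isometry)
    moreover have "\<tau>S (Phi M) v \<in> rspace R"
      using Srep Phi_Sp[OF M] v by (simp add: is_rep_def)
    ultimately show ?thesis
      using special_iso_inverse[OF h] special_iso_inverse[OF lh] xi_lift[OF M, of h] RJ h lh v by simp
  qed
  have tact: "ract R t v = rscale R (\<phi> t) (\<tau>S (Phi (torus_isometry t)) v)" if t: "t \<in> E - {0}" and v: "v \<in> rspace R" for t v
  proof -
    have "ract \<tau> (NN #>\<^bsub>mult_grp\<^esub> 1) v = v"
      using Hrep v one_H by (simp add: is_rep_def sc)
    then show ?thesis
      using act[OF t Jset_one v] t by (simp add: conj_action_eq)
  qed
  have S1: "\<tau>S (Phi M) v \<in> rspace R" "w \<in> rspace R \<Longrightarrow> \<tau>S (Phi M) (v + w) = \<tau>S (Phi M) v + \<tau>S (Phi M) w"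
    "\<tau>S (Phi M) (rscale R c v) = rscale R c (\<tau>S (Phi M) v)"
    if "perp_isometry M" "v \<in> rspace R" for M v w c
    using Srep Phi_Sp[OF that(1)] that(2) by (simp_all add: is_rep_def)
  have S2: "\<tau>S (Phi (\<lambda>y. M (M' y))) v = \<tau>S (Phi M) (\<tau>S (Phi M') v)"
    if "perp_isometry M" "perp_isometry M'" "v \<in> rspace R" for M M' v
    using Srep Phi_Sp[OF that(1)] Phi_Sp[OF that(2)] that(3) unfolding Phi_comp[OF that(1,2), symmetric]
    by (simp add: is_rep_def)
  show "weil_action \<phi> R (\<lambda>M. \<tau>S (Phi M))"
  proof (rule weil_actionI)
    fix M M' v
    assume "perp_isometry M" "perp_isometry M'" "v \<in> rspace R"
      "isometry_cong M M'"
    then show "\<tau>S (Phi M) v = \<tau>S (Phi M') v"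
      using Phi_cong[of M M'] by simp
  qed (fact S1 S2 eqv one tact)+
qed

text \<open>When J = J+, lifting an isometry moves the E part of h only beyond depth r. The scalar
  by which h acts does not change, and identity operators satisfy the equivariance
  condition.\<close>

lemma character_case:
  fixes R :: "('d, 'v::ab_group_add) rep" and \<phi> :: "'d \<Rightarrow> complex"
  assumes rep: "is_rep (Dgrp ((E - {0}) <#>\<^bsub>mult_grp\<^esub> Jset)) R"
    and phi: "\<And>h. h \<in> Jset_plus \<Longrightarrow> \<phi> (pr0 h) = \<theta> (iota E \<sigma> h)"
    and J: "Jset = Jset_plus"
    and dim: "vector_space.dim (rscale R) (rspace R) = 1"
    and T: "\<And>t v. t \<in> E - {0} \<Longrightarrow> v \<in> rspace R \<Longrightarrow> ract R t v = rscale R (\<phi> t) v"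
    and H: "\<And>h v. h \<in> Jset \<Longrightarrow> v \<in> rspace R \<Longrightarrow> ract R h v = rscale R (\<theta> (iota E \<sigma> h)) v"
  shows "J_representation \<phi> R" "weil_action \<phi> R (\<lambda>M v. v)"
proof -
  have vs: "vector_space (rscale R)" and sub: "module.subspace (rscale R) (rspace R)"
    using rep by (simp_all add: is_rep_def)
  interpret V: vector_space "rscale R"
    by (rule vs)
  have RJrep: "is_rep (Dgrp Jset) R"
    by (rule is_rep_subgroup[OF rep Jset_subset_TJ])
  obtain b where b: "V.independent b" "b \<subseteq> rspace R" "rspace R \<subseteq> V.span b" "card b = 1"
    using V.basis_exists[of "rspace R"] dim by metis
  then obtain u where u: "b = {u}"
    by (auto simp: card_1_singleton_iff)
  then have u0: "u \<noteq> 0" "u \<in> rspace R" and span: "\<And>v. v \<in> rspace R \<Longrightarrow> \<exists>c. v = rscale R c u"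
    using b V.dependent_zero by (auto simp: V.span_singleton)
  have "irreducible_rep (Dgrp Jset) R"
    unfolding irreducible_rep_def
  proof (intro conjI allI impI)
    show "rspace R \<noteq> {0}"
      using u0 by auto
    fix U
    assume U: "V.subspace U \<and> U \<subseteq> rspace R \<and> (\<forall>g\<in>carrier (Dgrp Jset). ract R g ` U \<subseteq> U)"
    then have Us: "V.subspace U" and Ui: "U \<subseteq> rspace R"
      by simp_all
    show "U = {0} \<or> U = rspace R"
    proof (cases "U \<subseteq> {0}")
      case True
      then show ?thesis
        using V.subspace_0[OF Us] by auto
    next
      case False
      then obtain x where x: "x \<in> U" "x \<noteq> 0"
        by blast
      then obtain c where c: "x = rscale R c u"
        using span Ui by blast
      then have "c \<noteq> 0"
        using x by auto
      then have "u = rscale R (inverse c) x"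
        by (simp add: c)
      then have "u \<in> U"
        using V.subspace_scale[OF Us x(1)] by simp
      then have "rspace R \<subseteq> U"
        using span V.subspace_scale[OF Us] by force
      then show ?thesis
        using Ui by simp
    qed
  qed (rule RJrep)
  then show "J_representation \<phi> R"
    using rep H J phi by (simp add: J_representation_def)
  have "ract R h v = ract R (lift_isometry M h) v" if M: "perp_isometry M" and h: "h \<in> Jset" and v: "v \<in> rspace R" for M h v
  proof -
    have hp: "h \<in> Jset_plus" and lp: "lift_isometry M h \<in> Jset_plus" "lift_isometry M h \<in> Jset"
      using h lift_isometry_Jset[OF M h] J by auto
    have "ereal r < valD Q ((pr0 (lift_isometry M h) - 1) - (pr0 h - 1))"
      using lift_isometry_Jset(2)[OF M h hp] by simp
    then have "\<theta> (iota E \<sigma> (lift_isometry M h)) = \<theta> (iota E \<sigma> h)"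
      unfolding theta_iota[OF hp] theta_iota[OF lp(1)] by (intro psi_cong diff_E pr0_in_E one_E)
    then show ?thesis
      using H h v lp by simp
  qed
  then show "weil_action \<phi> R (\<lambda>M v. v)"
    using T by (intro weil_actionI) auto
qed

end

section \<open>Intertwiners over J\<close>

lemma is_repD:
  assumes "is_rep (Dgrp H) R"
  shows "vector_space (rscale R)" and "module.subspace (rscale R) (rspace R)"
    and "g \<in> H \<Longrightarrow> v \<in> rspace R \<Longrightarrow> ract R g v \<in> rspace R"
    and "g \<in> H \<Longrightarrow> v \<in> rspace R \<Longrightarrow> w \<in> rspace R \<Longrightarrow> ract R g (v + w) = ract R g v + ract R g w"
    and "g \<in> H \<Longrightarrow> v \<in> rspace R \<Longrightarrow> ract R g (rscale R c v) = rscale R c (ract R g v)"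
    and "v \<in> rspace R \<Longrightarrow> ract R 1 v = v"
    and "g \<in> H \<Longrightarrow> h \<in> H \<Longrightarrow> v \<in> rspace R \<Longrightarrow> ract R (g * h) v = ract R g (ract R h v)"
  using assms by (simp_all add: is_rep_def)

lemma subspaceD:
  assumes "vector_space s" "module.subspace s V"
  shows "0 \<in> V" and "x \<in> V \<Longrightarrow> y \<in> V \<Longrightarrow> x + y \<in> V" and "x \<in> V \<Longrightarrow> s c x \<in> V"
proof -
  interpret vector_space s
    by (rule assms(1))
  show "0 \<in> V" "x \<in> V \<Longrightarrow> y \<in> V \<Longrightarrow> x + y \<in> V" "x \<in> V \<Longrightarrow> s c x \<in> V"
    using assms(2) by (auto intro: subspace_0 subspace_add subspace_scale)
qed

lemma additive_sum:
  fixes f :: "'a::ab_group_add \<Rightarrow> 'b::ab_group_add"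
  assumes V: "0 \<in> V" "\<And>x y. x \<in> V \<Longrightarrow> y \<in> V \<Longrightarrow> x + y \<in> V"
    and f: "\<And>x y. x \<in> V \<Longrightarrow> y \<in> V \<Longrightarrow> f (x + y) = f x + f y"
    and g: "\<And>i. i \<in> I \<Longrightarrow> g i \<in> V"
  shows "f (\<Sum>i\<in>I. g i) = (\<Sum>i\<in>I. f (g i))" and "(\<Sum>i\<in>I. g i) \<in> V"
proof -
  have f0: "f 0 = 0"
    using f[OF V(1,1)] by simp
  have "f (\<Sum>i\<in>I. g i) = (\<Sum>i\<in>I. f (g i)) \<and> (\<Sum>i\<in>I. g i) \<in> V"
    using g
  proof (induction I rule: infinite_finite_induct)
    case (insert x F)
    then show ?case
      using V(2) f by simp
  qed (use f0 V in auto)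
  then show "f (\<Sum>i\<in>I. g i) = (\<Sum>i\<in>I. f (g i))" and "(\<Sum>i\<in>I. g i) \<in> V"
    by auto
qed

text \<open>Stated for two commuting elements because D is noncommutative; it serves the Frobenius
  congruence inside E.\<close>

lemma commuting_binomial:
  fixes a b :: "'a::ring_1"
  assumes c: "a * b = b * a"
  shows "(a + b) ^ n = (\<Sum>k\<le>n. of_nat (n choose k) * (a ^ k * b ^ (n - k)))"
proof (induction n)
  case (Suc n)
  have ca: "b * a ^ k = a ^ k * b" for k
    using power_commuting_commutes[OF c, of k] by simp
  have nb: "z * (of_nat m * x) = of_nat m * (z * x)" for m x and z :: 'a
    by (simp only: mult.assoc[symmetric] mult_of_nat_commute[of m z])
  have c1: "b * (of_nat m * (a ^ k * b ^ l)) = of_nat m * (a ^ k * b ^ Suc l)" for m k l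
    unfolding nb by (simp add: ca flip: mult.assoc)
  have c2: "a * (of_nat m * (a ^ k * b ^ l)) = of_nat m * (a ^ Suc k * b ^ l)" for m k l
    unfolding nb by (simp flip: mult.assoc)
  have "(a + b) ^ Suc n = (\<Sum>k\<le>n. of_nat (n choose k) * (a ^ Suc k * b ^ (n - k)))
      + (\<Sum>k\<le>n. of_nat (n choose k) * (a ^ k * b ^ Suc (n - k)))"
    unfolding power_Suc Suc.IH distrib_right sum_distrib_left using c1 c2 by (simp add: sum.distrib)
  \<comment> \<open>The added term \<open>k = Suc n\<close> vanishes since
    \<open>n choose Suc n\<close> is 0.\<close>
  also have "(\<Sum>k\<le>n. of_nat (n choose k) * (a ^ k * b ^ Suc (n - k))) =
      (\<Sum>k\<le>Suc n. of_nat (n choose k) * (a ^ k * b ^ (Suc n - k)))"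
    by (simp add: Suc_diff_le binomial_eq_0)
  also have "\<dots> = b ^ Suc n + (\<Sum>k\<le>n. of_nat (n choose Suc k) * (a ^ Suc k * b ^ (n - k)))"
    by (subst sum.atMost_Suc_shift) simp
  also have "(\<Sum>k\<le>n. of_nat (n choose k) * (a ^ Suc k * b ^ (n - k))) + \<dots> =
      b ^ Suc n + (\<Sum>k\<le>n. of_nat (Suc n choose Suc k) * (a ^ Suc k * b ^ (n - k)))"
    by (simp add: distrib_right sum.distrib add_ac)
  also have "\<dots> = (\<Sum>k\<le>Suc n. of_nat (Suc n choose k) * (a ^ k * b ^ (Suc n - k)))"
    by (subst sum.atMost_Suc_shift) simp
  finally show ?case .
qed simp

text \<open>The iterates of v under T satisfy a linear relation, that is, some nonzero polynomial in
  T kills v. Linear factors are split off over the complex numbers until the remaining vector is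
  nonzero. T is assumed linear on V only, so the argument stays with explicit iterates.\<close>

lemma eigenvector_exists:
  fixes s :: "complex \<Rightarrow> 'v::ab_group_add \<Rightarrow> 'v" and T :: "'v \<Rightarrow> 'v"
  assumes vs: "vector_space s" and sub: "module.subspace s V"
    and B: "finite B" "V \<subseteq> module.span s B" and ne: "v \<in> V" "v \<noteq> 0"
    and T: "\<And>x. x \<in> V \<Longrightarrow> T x \<in> V" "\<And>x y. x \<in> V \<Longrightarrow> y \<in> V \<Longrightarrow> T (x + y) = T x + T y"
      "\<And>c x. x \<in> V \<Longrightarrow> T (s c x) = s c (T x)"
  obtains c w where "w \<in> V" "w \<noteq> 0" "T w = s c w"
proof -
  interpret vector_space s
    by (rule vs)
  have V: "0 \<in> V" "x \<in> V \<Longrightarrow> y \<in> V \<Longrightarrow> x + y \<in> V" "x \<in> V \<Longrightarrow> s c x \<in> V" for x y c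
    using sub by (auto intro: subspace_0 subspace_add subspace_scale)
  define it where "it i = (T ^^ i) v" for i
  have itV: "it i \<in> V" for i
    by (induction i) (use ne T in \<open>auto simp: it_def\<close>)
  have itS: "T (it i) = it (Suc i)" for i
    by (simp add: it_def)
  \<comment> \<open>\<open>ev q\<close> is the polynomial q in T applied to v.\<close>
  define ev where "ev q = (\<Sum>i\<le>Polynomial.degree q. s (Polynomial.coeff q i) (it i))" for q
  have ev: "ev q = (\<Sum>i\<le>n. s (Polynomial.coeff q i) (it i))" if "Polynomial.degree q \<le> n" for q n
    unfolding ev_def using that by (intro sum.mono_neutral_left) (auto simp: coeff_eq_0)
  have evV: "ev q \<in> V" for q
    unfolding ev_def by (rule additive_sum(2)[of V "\<lambda>x. x"]) (use V itV in auto)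
  have T_ev: "T (ev q) = (\<Sum>i\<le>n. s (Polynomial.coeff q i) (it (Suc i)))" if "Polynomial.degree q \<le> n" for q n
  proof -
    have "T (ev q) = (\<Sum>i\<le>n. T (s (Polynomial.coeff q i) (it i)))"
      unfolding ev[OF that] by (rule additive_sum(1)[of V]) (use V T itV in auto)
    then show ?thesis
      using T itV itS by simp
  qed
  have step: "ev ([:- c, 1:] * q) = T (ev q) - s c (ev q)" for c q
  proof -
    let ?n = "Polynomial.degree q"
    have d: "Polynomial.degree ([:- c, 1:] * q) \<le> Suc ?n"
      by (rule order_trans[OF degree_mult_le]) simp
    have cf: "Polynomial.coeff ([:- c, 1:] * q) i = - c * Polynomial.coeff q i + Polynomial.coeff (pCons 0 q) i" for i
      by simp
    have "ev ([:- c, 1:] * q) = (\<Sum>i\<le>Suc ?n. s (- c * Polynomial.coeff q i) (it i)) + (\<Sum>i\<le>Suc ?n. s (Polynomial.coeff (pCons 0 q) i) (it i))"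
      unfolding ev[OF d] cf scale_left_distrib sum.distrib ..
    also have "(\<Sum>i\<le>Suc ?n. s (Polynomial.coeff (pCons 0 q) i) (it i)) = (\<Sum>i\<le>?n. s (Polynomial.coeff q i) (it (Suc i)))"
      by (subst sum.atMost_Suc_shift) simp
    also have "(\<Sum>i\<le>Suc ?n. s (- c * Polynomial.coeff q i) (it i)) = - s c (ev q)"
      using ev[of q "Suc ?n"] by (simp add: scale_sum_right sum_negf coeff_eq_0)
    finally show ?thesis
      using T_ev[of q ?n] by simp
  qed
  \<comment> \<open>After splitting off a root c, either the cofactor also kills v and the degree
    has dropped, or its value at v is an eigenvector for c.\<close>
  have main: "\<exists>c w. w \<in> V \<and> w \<noteq> 0 \<and> T w = s c w" if "q \<noteq> 0" "ev q = 0" for q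
    using that
  proof (induction "Polynomial.degree q" arbitrary: q)
    case 0
    then have "ev q = s (Polynomial.coeff q 0) v"
      by (simp add: ev_def it_def)
    moreover have "Polynomial.coeff q 0 \<noteq> 0"
      using 0 by (metis leading_coeff_0_iff)
    ultimately show ?case
      using 0 ne by simp
  next
    case (Suc n)
    then have "\<not> constant (poly q)"
      by (simp add: constant_degree)
    then obtain c where "poly q c = 0"
      using fundamental_theorem_of_algebra by blast
    then obtain q' where q': "q = [:- c, 1:] * q'"
      by (metis poly_eq_0_iff_dvd dvdE)
    with Suc have "q' \<noteq> 0" by auto
    then have "Polynomial.degree q = Suc (Polynomial.degree q')"
      unfolding q' by (subst degree_mult_eq) auto
    then have "n = Polynomial.degree q'"
      using Suc by simp
    have e: "T (ev q') - s c (ev q') = 0"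
      using Suc(4) step[of c q'] unfolding q' by simp
    show ?case
    proof (cases "ev q' = 0")
      case True
      then show ?thesis
        using Suc(1)[OF \<open>n = Polynomial.degree q'\<close> \<open>q' \<noteq> 0\<close>] by blast
    next
      case False
      then show ?thesis
        using e evV[of q'] by (intro exI[of _ c] exI[of _ "ev q'"]) simp
    qed
  qed
  \<comment> \<open>Two equal iterates give the polynomial \<open>x^i - x^j\<close>. Otherwise
    \<open>card B + 1\<close> distinct vectors in the span of B are dependent.\<close>
  obtain q where "q \<noteq> 0" "ev q = 0"
  proof (cases "inj it")
    case False
    then obtain i j where ij: "it i = it j" "i \<noteq> j"
      by (auto simp: inj_def)
    let ?q = "Polynomial.monom 1 i - Polynomial.monom (1::complex) j"
    have "Polynomial.coeff ?q i = 1"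
      using ij by simp
    then have "?q \<noteq> 0"
      by (metis coeff_0 zero_neq_one)
    have d: "Polynomial.degree ?q \<le> i + j"
      by (rule degree_diff_le) (auto intro: order_trans[OF degree_monom_le])
    have "ev ?q = (\<Sum>k\<le>i + j. (if k = i then it k else 0) - (if k = j then it k else 0))"
      unfolding ev[OF d] by (intro sum.cong) (auto simp: scale_left_diff_distrib)
    also have "\<dots> = 0"
      using ij by (simp add: sum_subtractf)
    finally show ?thesis
      using that \<open>?q \<noteq> 0\<close> by blast
  next
    case True
    let ?S = "it ` {..card B}"
    have inj: "inj_on it {..card B}"
      using True by (rule inj_on_subset) simp
    have "?S \<subseteq> span B"
      using itV B by auto
    then have "dependent ?S"
      using independent_span_bound[OF B(1), of ?S] card_image[OF inj] by auto
    then obtain u where u: "(\<Sum>x\<in>?S. s (u x) x) = 0" "\<exists>x\<in>?S. u x \<noteq> 0"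
      by (auto simp: dependent_finite)
    define q where "q = (\<Sum>i\<le>card B. Polynomial.monom (u (it i)) i)"
    have cq: "Polynomial.coeff q k = (if k \<le> card B then u (it k) else 0)" for k
      unfolding q_def coeff_sum by (simp add: if_distrib cong: if_cong)
    have "Polynomial.degree q \<le> card B"
      by (rule degree_le) (simp add: cq)
    then have "ev q = (\<Sum>i\<le>card B. s (u (it i)) (it i))"
      by (simp add: ev cq)
    also have "\<dots> = (\<Sum>x\<in>?S. s (u x) x)"
      by (simp add: sum.reindex[OF inj])
    finally have "ev q = 0"
      using u by simp
    moreover have "q \<noteq> 0"
      using u(2) cq by (metis atMost_iff coeff_0 imageE)
    ultimately show ?thesis
      using that by blast
  qed
  then show ?thesis
    using main that by blast
qed

text \<open>\<open>phi_generic\<close> is the form in which genericity is used: \<phi> is nontrivial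
  at depth r on the line of trace 0. All conditions are stable under composing \<phi> with
  conjugation, so the conjugate datum gives a second instance.\<close>

locale depth_character = torus_depth Q p E e0 \<sigma> r
  for Q :: "('f::field, 'd::division_ring) quat_alg" and p E e0 \<sigma> r +
  fixes \<phi> :: "'d \<Rightarrow> complex"
  assumes phi_mult: "\<And>s t. s \<in> E - {0} \<Longrightarrow> t \<in> E - {0} \<Longrightarrow> \<phi> (s * t) = \<phi> s * \<phi> t"
    and phi_neq_zero: "\<And>t. t \<in> E - {0} \<Longrightarrow> \<phi> t \<noteq> 0"
    and phi_add: "\<And>x y. x \<in> E \<Longrightarrow> y \<in> E \<Longrightarrow> ereal r \<le> valD Q x \<Longrightarrow> ereal r \<le> valD Q y \<Longrightarrow>
          \<phi> (1 + (x + y)) = \<phi> (1 + x) * \<phi> (1 + y)"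
    and phi_small: "\<And>x. x \<in> E \<Longrightarrow> ereal r < valD Q x \<Longrightarrow> \<phi> (1 + x) = 1"
    and phi_generic: "\<exists>f. ereal r \<le> valD Q (emb Q f * e0) \<and> \<phi> (1 + emb Q f * e0) \<noteq> 1"
begin

lemma phi_one: "\<phi> 1 = 1"
  using phi_small[of 0] by simp

lemma phi_cong:
  assumes "x \<in> E" "y \<in> E" "ereal r \<le> valD Q x" "ereal r < valD Q (y - x)"
  shows "\<phi> (1 + y) = \<phi> (1 + x)"
  using phi_add[of x "y - x"] phi_small[of "y - x"] assms by (simp add: diff_E less_imp_le)

text \<open>The commutator pairing of W, expressed by \<phi> alone so that it does not refer to a
  particular \<theta>.\<close>

definition omega :: "'d \<Rightarrow> 'd \<Rightarrow> complex" where
  "omega k y = \<phi> (1 + (y * k - k * y))"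

lemma bracket_lattice:
  assumes "k \<in> perp_lattice" "y \<in> perp_lattice"
  shows "y * k - k * y \<in> E" "ereal r \<le> valD Q (y * k - k * y)"
proof -
  show "y * k - k * y \<in> E"
    using assms lattice_perp by (auto intro!: diff_E perp_mult_perp)
  show "ereal r \<le> valD Q (y * k - k * y)"
    using assms by (intro D.val_diff_ge square_ge) (auto simp: perp_lattice_def)
qed

lemma omega_add:
  assumes "k \<in> perp_lattice" "k' \<in> perp_lattice" "y \<in> perp_lattice"
  shows "omega (k + k') y = omega k y * omega k' y"
proof -
  have "1 + (y * (k + k') - (k + k') * y) = 1 + ((y * k - k * y) + (y * k' - k' * y))"
    by (simp add: distrib_left distrib_right)
  then show ?thesis
    unfolding omega_def using bracket_lattice[OF assms(1,3)] bracket_lattice[OF assms(2,3)]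
    by (simp only: phi_add)
qed

lemma omega_cong:
  assumes "k \<in> perp_lattice" "k' \<in> perp_lattice" "y \<in> perp_lattice" "ereal (r / 2) < valD Q (k - k')"
  shows "omega k y = omega k' y"
proof -
  have yv: "ereal (r / 2) \<le> valD Q y"
    using assms by (simp add: perp_lattice_def)
  have "ereal r < valD Q (y * (k - k') - (k - k') * y)"
    by (rule D.val_diff_gt[OF square_gt(2)[OF assms(4) yv] square_gt(1)[OF assms(4) yv]])
  also have "y * (k - k') - (k - k') * y = (y * k - k * y) - (y * k' - k' * y)"
    by (simp add: algebra_simps)
  finally show ?thesis
    unfolding omega_def by (intro phi_cong bracket_lattice assms)
qed

lemma omega_trivial:
  assumes "k \<in> perp_lattice" "y \<in> perp_lattice" "ereal (r / 2) < valD Q y"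
  shows "omega k y = 1"
proof -
  have kv: "ereal (r / 2) \<le> valD Q k"
    using assms by (simp add: perp_lattice_def)
  have "ereal r < valD Q (y * k - k * y)"
    by (rule D.val_diff_gt[OF square_gt[OF assms(3) kv]])
  then show ?thesis
    unfolding omega_def by (intro phi_small bracket_lattice assms)
qed

text \<open>This is where genericity of \<open>\<phi>\<close> enters.\<close>

lemma omega_nontrivial:
  assumes y: "y \<in> perp_lattice" "\<not> ereal (r / 2) < valD Q y"
  obtains k where "k \<in> perp_lattice" "omega k y \<noteq> 1"
proof -
  obtain f where f: "ereal r \<le> valD Q (emb Q f * e0)" "\<phi> (1 + emb Q f * e0) \<noteq> 1"
    using phi_generic by blast
  have yv: "valD Q y = ereal (r / 2)" and yP: "y \<in> perp"
    using y by (auto simp: perp_lattice_def)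
  then have y0: "y \<noteq> 0"
    by auto
  define g where "g = - nrd Q y"
  have yy: "y * y = emb Q g"
    unfolding g_def by (rule perp_square[OF yP])
  have gv: "fval Q g = ereal r"
  proof -
    have "valD Q (y * y) = ereal (r / 2) + ereal (r / 2)"
      by (simp add: valD_mult yv)
    then show ?thesis
      by (simp add: yy)
  qed
  then have g0: "g \<noteq> 0"
    by auto
  \<comment> \<open>For \<open>k = y * e\<close> the bracket of y and k is \<open>2 * g * e\<close>,
    since y anticommutes with e; the factor makes this equal to \<open>emb Q f * e0\<close>. As
    \<open>2 * g\<close> has valuation exactly r, e is integral and k stays in the lattice.\<close>
  define e where "e = emb Q (f / (2 * g)) * e0"
  have eE: "e \<in> E"
    by (simp add: e_def mult_E e0_E)
  have ye: "y * e = - (e * y)"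
    unfolding e_def using perp_e0[OF yP] by (simp add: emb_left_commute mult.assoc)
  have fe: "emb Q f * e0 = emb Q (2 * g) * e"
    unfolding e_def using g0 two_neq_zero_F by (simp flip: mult.assoc emb_mult)
  have ev: "0 \<le> valD Q e"
  proof -
    have "fval Q (2 * g) = ereal r"
      by (simp add: F.val_mult fval_two gv)
    then have "ereal r \<le> ereal r + valD Q e"
      using f(1) unfolding fe valD_mult valD_emb by simp
    then show ?thesis
      by (cases "valD Q e") auto
  qed
  have "y * e \<in> perp_lattice"
    using yv ev eE yP by (auto simp: perp_lattice_def perp_mult_E intro: valD_mult_ge_left)
  moreover have "1 + (y * (y * e) - y * e * y) = 1 + emb Q f * e0"
  proof -
    have "y * e * y = - (e * (y * y))"
      by (simp add: ye mult.assoc)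
    moreover have "e * (y * y) = emb Q g * e" "y * (y * e) = emb Q g * e"
      by (simp_all add: yy emb_central flip: mult.assoc)
    moreover have "emb Q (2 * g) * e = emb Q g * e + emb Q g * e"
      unfolding mult_2 emb_add distrib_right ..
    ultimately show ?thesis
      by (simp add: fe)
  qed
  ultimately show ?thesis
    using that f(2) by (simp add: omega_def)
qed

section \<open>A finite transversal of W and orthogonality\<close>

lemma finite_pcosets: "finite (pcoset ` perp_lattice)"
proof -
  obtain n where n: "r / 2 < real n"
    using reals_Archimedean2 by blast
  obtain S where S: "finite S" "\<And>x. 0 \<le> valD Q x \<Longrightarrow> \<exists>s\<in>S. 0 \<le> valD Q s \<and> ereal (real n) \<le> valD Q (x - s)"
    using finite_residues_D[of n] by blast
  let ?c = "\<lambda>s. {h \<in> Jset. ereal (r / 2) < valD Q (pr1 h - s)}"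
  have "pcoset ` perp_lattice \<subseteq> ?c ` S"
  proof
    fix w assume "w \<in> pcoset ` perp_lattice"
    then obtain y where y: "w = pcoset y" "y \<in> perp_lattice"
      by blast
    then have "0 \<le> valD Q y"
      using r_pos by (auto simp: perp_lattice_def zero_ereal_def intro: valD_ge_mono)
    then obtain s where s: "s \<in> S" "ereal (real n) \<le> valD Q (y - s)"
      using S by blast
    then have "ereal (r / 2) < valD Q (y - s)"
      using n valD_ge_gt by blast
    then have "w = ?c s"
      using pcoset_cong[of y s] by (simp add: y(1) pcoset_def)
    then show "w \<in> ?c ` S"
      using s by blast
  qed
  then show ?thesis
    using S(1) finite_surj by blast
qed

text \<open>A representative depending only on the class of y in W; its values form the finite
  transversal over which averages are taken.\<close>

definition rp :: "'d \<Rightarrow> 'd" where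
  "rp y = (SOME y'. y' \<in> perp_lattice \<and> pcoset y' = pcoset y)"

lemma rp:
  assumes "y \<in> perp_lattice"
  shows "rp y \<in> perp_lattice" "pcoset (rp y) = pcoset y" "ereal (r / 2) < valD Q (rp y - y)"
proof -
  have "rp y \<in> perp_lattice \<and> pcoset (rp y) = pcoset y"
    unfolding rp_def by (rule someI[of _ y]) (simp add: assms)
  then show "rp y \<in> perp_lattice" "pcoset (rp y) = pcoset y" "ereal (r / 2) < valD Q (rp y - y)"
    using assms by (auto simp: pcoset_eq_iff)
qed

lemma rp_eqI: "y \<in> perp_lattice \<Longrightarrow> y' \<in> perp_lattice \<Longrightarrow> ereal (r / 2) < valD Q (y - y') \<Longrightarrow> rp y = rp y'"
  unfolding rp_def using pcoset_cong by simp

lemma rp_rp: "y \<in> perp_lattice \<Longrightarrow> rp (rp y) = rp y"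
  unfolding rp_def[of "rp y"] using rp(2) by (simp add: rp_def)

definition YY :: "'d set" where "YY = rp ` perp_lattice"

lemma finite_YY: "finite YY"
proof -
  have "YY \<subseteq> (\<lambda>w. SOME y'. y' \<in> perp_lattice \<and> pcoset y' = w) ` (pcoset ` perp_lattice)"
    by (auto simp: YY_def rp_def)
  then show ?thesis
    using finite_pcosets finite_surj by blast
qed

lemma YY_lattice: "y \<in> YY \<Longrightarrow> y \<in> perp_lattice" and rp_YY: "y \<in> YY \<Longrightarrow> rp y = y"
  using rp rp_rp by (auto simp: YY_def)

lemma zero_lattice: "0 \<in> perp_lattice"
  by (simp add: perp_lattice_def)

text \<open>Translation by k followed by \<open>rp\<close> is injective on the finite transversal,
  hence permutes it.\<close>

lemma sum_YY_shift:
  fixes g :: "'d \<Rightarrow> 'a::comm_monoid_add"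
  assumes k: "k \<in> perp_lattice" and g: "\<And>y. y \<in> perp_lattice \<Longrightarrow> g (rp y) = g y"
  shows "(\<Sum>y\<in>YY. g (y + k)) = (\<Sum>y\<in>YY. g y)"
proof -
  let ?h = "\<lambda>y. rp (y + k)"
  have inj: "inj_on ?h YY"
  proof (rule inj_onI)
    fix x y assume xy: "x \<in> YY" "y \<in> YY" "rp (x + k) = rp (y + k)"
    then have L: "x \<in> perp_lattice" "y \<in> perp_lattice"
      using YY_lattice by auto
    have "pcoset (x + k) = pcoset (y + k)"
      using rp(2)[of "x + k"] rp(2)[of "y + k"] xy(3) L k lattice_add by simp
    then have "ereal (r / 2) < valD Q (x - y)"
      using L k lattice_add by (simp add: pcoset_eq_iff)
    then have "rp x = rp y"
      using L by (intro rp_eqI)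
    then show "x = y"
      using xy rp_YY by simp
  qed
  have sub: "?h ` YY \<subseteq> YY"
    using YY_lattice k lattice_add by (auto simp: YY_def)
  have "bij_betw ?h YY YY"
    unfolding bij_betw_def using inj endo_inj_surj[OF finite_YY sub inj] by blast
  then have "(\<Sum>y\<in>YY. g (?h y)) = (\<Sum>y\<in>YY. g y)"
    by (rule sum.reindex_bij_betw)
  moreover have "g (?h y) = g (y + k)" if "y \<in> YY" for y
    using g YY_lattice[OF that] k lattice_add by blast
  ultimately show ?thesis
    by simp
qed

text \<open>Orthogonality of characters: shifting by some k0 that pairs nontrivially with y
  multiplies the sum by a number other than 1.\<close>

lemma omega_sum:
  assumes "y \<in> perp_lattice" "\<not> ereal (r / 2) < valD Q y"
  shows "(\<Sum>k\<in>YY. omega k y) = 0"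
proof -
  obtain k0 where k0: "k0 \<in> perp_lattice" "omega k0 y \<noteq> 1"
    using omega_nontrivial[OF assms] .
  have "(\<Sum>k\<in>YY. omega (k + k0) y) = (\<Sum>k\<in>YY. omega k y)"
  proof (rule sum_YY_shift[OF k0(1)])
    fix x assume "x \<in> perp_lattice"
    then show "omega (rp x) y = omega x y"
      using rp[of x] assms(1) by (intro omega_cong) auto
  qed
  moreover have "(\<Sum>k\<in>YY. omega (k + k0) y) = (\<Sum>k\<in>YY. omega k y) * omega k0 y"
    using omega_add[OF YY_lattice k0(1) assms(1)] by (simp add: sum_distrib_right)
  ultimately show ?thesis
    using k0(2) by simp
qed

section \<open>Averaging linear maps over W\<close>

definition J_linear :: "('d, 'v::ab_group_add) rep \<Rightarrow> ('d, 'w::ab_group_add) rep \<Rightarrow> ('v \<Rightarrow> 'w) \<Rightarrow> bool" where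
  "J_linear R R' A \<longleftrightarrow> (\<forall>v. v \<in> rspace R \<longrightarrow> A v \<in> rspace R') \<and>
     (\<forall>v w. v \<in> rspace R \<longrightarrow> w \<in> rspace R \<longrightarrow> A (v + w) = A v + A w) \<and>
     (\<forall>c v. v \<in> rspace R \<longrightarrow> A (rscale R c v) = rscale R' c (A v))"

definition J_hom :: "('d, 'v::ab_group_add) rep \<Rightarrow> ('d, 'w::ab_group_add) rep \<Rightarrow> ('v \<Rightarrow> 'w) \<Rightarrow> bool" where
  "J_hom R R' A \<longleftrightarrow> J_linear R R' A \<and>
     (\<forall>h v. h \<in> Jset \<longrightarrow> v \<in> rspace R \<longrightarrow> A (ract R h v) = ract R' h (A v))"

lemma J_linearD:
  assumes "J_linear R R' A"
  shows "v \<in> rspace R \<Longrightarrow> A v \<in> rspace R'"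
    and "v \<in> rspace R \<Longrightarrow> w \<in> rspace R \<Longrightarrow> A (v + w) = A v + A w"
    and "v \<in> rspace R \<Longrightarrow> A (rscale R c v) = rscale R' c (A v)"
  using assms by (simp_all add: J_linear_def)

lemma J_representationD:
  assumes "J_representation \<phi> R"
  shows "is_rep (Dgrp ((E - {0}) <#>\<^bsub>mult_grp\<^esub> Jset)) R" "is_rep (Dgrp Jset) R" "irreducible_rep (Dgrp Jset) R"
    and "h \<in> Jset_plus \<Longrightarrow> v \<in> rspace R \<Longrightarrow> ract R h v = rscale R (\<phi> (pr0 h)) v"
  using assms by (auto simp: J_representation_def irreducible_rep_def)

text \<open>Read off from the action on a nonzero vector, because \<open>pr0\<close> is not
  multiplicative.\<close>

lemma J_plus_scalars_cancel:
  assumes R: "J_representation \<phi> R" and n: "n \<in> Jset_plus" and v: "v \<in> rspace R" "v \<noteq> 0"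
  shows "\<phi> (pr0 n) * \<phi> (pr0 (inverse n)) = 1"
proof -
  note rep = is_repD[OF J_representationD(2)[OF R]]
  interpret vector_space "rscale R"
    by (rule rep(1))
  have nJ: "n \<in> Jset" "inverse n \<in> Jset" "inverse n \<in> Jset_plus" "n \<noteq> 0"
    using n Jset_plus_subset Jset_plus_inverse Jset_neq_zero by auto
  have "ract R (n * inverse n) v = rscale R (\<phi> (pr0 n)) (rscale R (\<phi> (pr0 (inverse n))) v)"
    using rep(7)[OF nJ(1,2) v(1)] J_representationD(4)[OF R] n nJ v rep(3)[OF nJ(2) v(1)] by simp
  then have "rscale R (\<phi> (pr0 n) * \<phi> (pr0 (inverse n)) - 1) v = 0"
    using rep(6)[OF v(1)] nJ by (simp add: scale_left_diff_distrib)
  then show ?thesis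
    using v(2) by simp
qed

context
  fixes R :: "('d, 'v::ab_group_add) rep" and R' :: "('d, 'w::ab_group_add) rep"
  assumes R: "J_representation \<phi> R" and R': "J_representation \<phi> R'"
begin

private lemma vsR: "vector_space (rscale R)" and vsR': "vector_space (rscale R')"
  using R R' J_representationD(2) is_repD(1) by blast+

private lemmas repR = is_repD[OF J_representationD(2)[OF R]]
private lemmas repR' = is_repD[OF J_representationD(2)[OF R']]
private lemmas sub = subspaceD[OF repR(1,2)]
private lemmas sub' = subspaceD[OF repR'(1,2)]

definition FF :: "('v \<Rightarrow> 'w) \<Rightarrow> 'd \<Rightarrow> 'v \<Rightarrow> 'w" where
  "FF B h v = ract R' h (B (ract R (inverse h) v))"

lemma FF_closed:
  assumes B: "J_linear R R' B" and h: "h \<in> Jset" and v: "v \<in> rspace R"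
  shows "FF B h v \<in> rspace R'"
  unfolding FF_def by (rule repR'(3)[OF h J_linearD(1)[OF B repR(3)[OF Jset_inverse[OF h] v]]])

text \<open>J+ acts on both spaces by the same scalars, so conjugating B by one of its elements
  changes nothing and \<open>FF\<close> depends only on the class of h in W.\<close>

lemma FF_cong:
  assumes B: "J_linear R R' B" and h: "h \<in> Jset" "h' \<in> Jset" "ereal (r / 2) < valD Q (pr1 h' - pr1 h)"
    and v: "v \<in> rspace R"
  shows "FF B h' v = FF B h v"
proof -
  interpret vector_space "rscale R'"
    by (rule vsR')
  have h0: "h \<noteq> 0" "h' \<noteq> 0"
    using h Jset_neq_zero by auto
  define n where "n = inverse h * h'"
  have i: "inverse h \<in> Jset" "inverse h' \<in> Jset"
    using h Jset_inverse by auto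
  have "n \<in> Jset"
    unfolding n_def by (intro Jset_mult i h)
  moreover have "ereal (r / 2) < valD Q ((pr1 n - (pr1 (inverse h) + pr1 h')) + (pr1 (inverse h) + pr1 h) + (pr1 h' - pr1 h))"
    unfolding n_def by (intro D.val_add_gt pr1_mult_approx pr1_inverse_approx i h)
  ultimately have n: "n \<in> Jset_plus" "n \<in> Jset" "inverse n \<in> Jset_plus" "inverse n \<in> Jset"
    using Jset_plus_inverse Jset_inverse by (auto simp: Jset_def Jset_plus_def algebra_simps)
  have hn: "h' = h * n" "inverse h' = inverse n * inverse h"
    using h0 by (simp_all add: n_def nonzero_inverse_mult_distrib mult.assoc flip: mult.assoc[of h])
  show ?thesis
  proof (cases "v = 0")
    case True
    have "FF B x 0 = 0" if "x \<in> Jset" for x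
    proof -
      have z: "ract R (inverse x) 0 = 0" "B 0 = 0" "ract R' x 0 = 0"
        using repR(4)[of "inverse x" 0 0] J_linearD(2)[OF B, of 0 0] repR'(4)[of x 0 0] that Jset_inverse sub(1) sub'(1)
        by auto
      show ?thesis
        by (simp add: FF_def z)
    qed
    then show ?thesis
      using True h by simp
  next
    case False
    let ?x = "ract R (inverse h) v"
    have xV: "?x \<in> rspace R" "B ?x \<in> rspace R'"
      using repR(3) i v J_linearD(1)[OF B] by auto
    have "FF B h' v = ract R' h (ract R' n (B (ract R (inverse n) ?x)))"
      unfolding FF_def hn(2) unfolding hn(1) repR(7)[OF n(4) i(1) v]
        repR'(7)[OF h(1) n(2) J_linearD(1)[OF B repR(3)[OF n(4) xV(1)]]] ..
    also have "\<dots> = ract R' h (rscale R' (\<phi> (pr0 n) * \<phi> (pr0 (inverse n))) (B ?x))"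
      using J_representationD(4)[OF R n(3) xV(1)] J_linearD(3)[OF B xV(1)] J_representationD(4)[OF R' n(1)] xV sub'(3)
      by simp
    finally show ?thesis
      using J_plus_scalars_cancel[OF R n(1) v False] by (simp add: FF_def)
  qed
qed

definition AA :: "('v \<Rightarrow> 'w) \<Rightarrow> 'v \<Rightarrow> 'w" where
  "AA B v = (\<Sum>y\<in>YY. FF B (1 + y) v)"

text \<open>Left multiplication by g permutes the classes over which the average runs; the deviation
  from the chosen representatives lies in J+ and is absorbed by \<open>FF_cong\<close>.\<close>

lemma J_hom_AA:
  assumes B: "J_linear R R' B"
  shows "J_hom R R' (AA B)"
proof -
  interpret V: vector_space "rscale R"
    by (rule vsR)
  interpret V': vector_space "rscale R'"
    by (rule vsR')
  have YJ: "1 + y \<in> Jset" "inverse (1 + y) \<in> Jset" if "y \<in> YY" for y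
    using one_plus_lattice[OF YY_lattice[OF that]] Jset_inverse by auto
  have cl: "FF B (1 + y) v \<in> rspace R'" if "y \<in> YY" "v \<in> rspace R" for y v
    using FF_closed[OF B YJ(1)[OF that(1)] that(2)] .
  have eqv: "AA B (ract R g v) = ract R' g (AA B v)" if g: "g \<in> Jset" and v: "v \<in> rspace R" for g v
  proof -
    have gi: "inverse g \<in> Jset" "g \<noteq> 0" "pr1 g \<in> perp_lattice"
      using g Jset_inverse Jset_neq_zero pr1_lattice by auto
    let ?w = "ract R g v"
    have w: "?w \<in> rspace R"
      using repR(3) g v by auto
    have gw: "ract R (inverse g) ?w = v"
      using repR(7)[OF gi(1) g v] repR(6)[OF v] gi by simp
    have shift: "ract R' g (FF B h v) = FF B (g * h) ?w" if h: "h \<in> Jset" for h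
    proof -
      have "h \<noteq> 0" "inverse h \<in> Jset"
        using h Jset_neq_zero Jset_inverse by auto
      then have "ract R (inverse (g * h)) ?w = ract R (inverse h) v"
        using repR(7)[OF _ gi(1) w, of "inverse h"] gi gw by (simp add: nonzero_inverse_mult_distrib)
      then show ?thesis
        using repR'(7)[OF g h] J_linearD(1)[OF B] repR(3) \<open>inverse h \<in> Jset\<close> v by (simp add: FF_def)
    qed
    have "ract R' g (AA B v) = (\<Sum>y\<in>YY. ract R' g (FF B (1 + y) v))"
      unfolding AA_def by (rule additive_sum(1)[of "rspace R'"]) (use sub' repR'(4)[OF g] cl v in auto)
    also have "\<dots> = (\<Sum>y\<in>YY. FF B (1 + (y + pr1 g)) ?w)"
    proof (rule sum.cong[OF refl])
      fix y assume y: "y \<in> YY"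
      note yl = YY_lattice[OF y]
      have l: "y + pr1 g \<in> perp_lattice"
        by (intro lattice_add yl gi)
      have "ereal (r / 2) < valD Q (pr1 (g * (1 + y)) - (pr1 g + pr1 (1 + y)))"
        by (intro pr1_mult_approx g YJ y)
      then have "ereal (r / 2) < valD Q (pr1 (g * (1 + y)) - pr1 (1 + (y + pr1 g)))"
        unfolding one_plus_lattice(3)[OF l] one_plus_lattice(3)[OF yl] by (simp only: add.commute[of y])
      then have "FF B (g * (1 + y)) ?w = FF B (1 + (y + pr1 g)) ?w"
        by (rule FF_cong[OF B one_plus_lattice(1)[OF l] Jset_mult[OF g YJ(1)[OF y]] _ w])
      then show "ract R' g (FF B (1 + y) v) = FF B (1 + (y + pr1 g)) ?w"
        using shift YJ y by simp
    qed
    also have "\<dots> = AA B ?w"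
      unfolding AA_def
    proof (rule sum_YY_shift[OF gi(3), of "\<lambda>y. FF B (1 + y) ?w"])
      fix y assume y: "y \<in> perp_lattice"
      then show "FF B (1 + rp y) ?w = FF B (1 + y) ?w"
        using rp[OF y] one_plus_lattice[OF y] one_plus_lattice[OF rp(1)[OF y]] w by (intro FF_cong[OF B]) simp_all
    qed
    finally show ?thesis ..
  qed
  have F_add: "FF B h (v + w) = FF B h v + FF B h w" if "h \<in> Jset" "v \<in> rspace R" "w \<in> rspace R" for h v w
    unfolding FF_def using that Jset_inverse[OF that(1)] repR(3,4) repR'(4) J_linearD[OF B] by simp
  have F_scale: "FF B h (rscale R c v) = rscale R' c (FF B h v)" if "h \<in> Jset" "v \<in> rspace R" for h c v
    unfolding FF_def using that Jset_inverse[OF that(1)] repR(3,5) repR'(5) J_linearD[OF B] by simp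
  show ?thesis
    unfolding J_hom_def J_linear_def
  proof (intro conjI allI impI)
    show "AA B v \<in> rspace R'" if "v \<in> rspace R" for v
      unfolding AA_def by (rule additive_sum(2)[of "rspace R'" "\<lambda>x. x"]) (use sub' cl that in auto)
    show "AA B (v + w) = AA B v + AA B w" if "v \<in> rspace R" "w \<in> rspace R" for v w
      unfolding AA_def using F_add YJ that by (simp add: sum.distrib)
    show "AA B (rscale R c v) = rscale R' c (AA B v)" if "v \<in> rspace R" for c v
      unfolding AA_def using F_scale YJ that by (simp add: V'.scale_sum_right)
  qed (rule eqv)
qed

text \<open>
  If all the averages \<open>AA (B \<circ> ract R (1 + k))\<close> vanished, summing them against the commutator
  pairing over \<open>k\<close> would isolate \<open>B\<close> itself.
\<close>

lemma J_hom_nonzero: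
  assumes B: "J_linear R R' B" and u: "u \<in> rspace R" "B u \<noteq> 0"
  obtains A v where "J_hom R R' A" "v \<in> rspace R" "A v \<noteq> 0"
proof -
  interpret V: vector_space "rscale R"
    by (rule vsR)
  interpret V': vector_space "rscale R'"
    by (rule vsR')
  define Bk where "Bk k v = B (ract R (1 + k) v)" for k v
  have kJ: "1 + k \<in> Jset" "inverse (1 + k) \<in> Jset" "1 + k \<noteq> 0" if "k \<in> perp_lattice" for k
    using one_plus_lattice[OF that] Jset_inverse Jset_neq_zero by auto
  have Bk: "J_linear R R' (Bk k)" if "k \<in> perp_lattice" for k
    unfolding J_linear_def Bk_def using kJ[OF that] repR(3,4,5) J_linearD[OF B] by simp
  \<comment> \<open>Carrying \<open>1 + k\<close> past the inverse of \<open>1 + y\<close> produces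
    a commutator, which lies in J+ and acts by the scalar \<open>omega k y\<close>.\<close>
  have key: "FF (Bk k) (1 + y) (ract R (inverse (1 + k)) u) = rscale R' (omega k y) (FF B (1 + y) u)"
    if k: "k \<in> perp_lattice" and y: "y \<in> perp_lattice" for k y
  proof -
    let ?h = "1 + y" and ?g = "1 + k"
    note g = kJ[OF k] and h = kJ[OF y]
    define c where "c = ?g * inverse ?h * inverse ?g * inverse (inverse ?h)"
    have cp: "c \<in> Jset_plus"
      unfolding c_def by (rule commutator_Jset_plus(1)[OF g(1) h(2)])
    have capprox: "ereal r < valD Q (pr0 c - 1 - (k * pr1 (inverse ?h) - pr1 (inverse ?h) * k))"
      using commutator_Jset_plus(2)[OF g(1) h(2)] one_plus_lattice(3)[OF k] by (simp add: c_def)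
    have inv: "ereal (r / 2) < valD Q (pr1 (inverse ?h) + y)"
      using pr1_inverse_approx[OF h(1)] one_plus_lattice(3)[OF y] by simp
    have kv: "ereal (r / 2) \<le> valD Q k"
      using k by (simp add: perp_lattice_def)
    have "ereal r < valD Q ((pr0 c - 1 - (k * pr1 (inverse ?h) - pr1 (inverse ?h) * k))
        + (k * (pr1 (inverse ?h) + y) - (pr1 (inverse ?h) + y) * k))"
      by (intro D.val_add_gt D.val_diff_gt[of _ "k * _"] capprox square_gt inv kv)
    also have "(pr0 c - 1 - (k * pr1 (inverse ?h) - pr1 (inverse ?h) * k))
        + (k * (pr1 (inverse ?h) + y) - (pr1 (inverse ?h) + y) * k) = (pr0 c - 1) - (y * k - k * y)"
      by (simp add: algebra_simps)
    finally have "\<phi> (1 + (pr0 c - 1)) = \<phi> (1 + (y * k - k * y))"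
      by (intro phi_cong bracket_lattice k y diff_E pr0_in_E one_E)
    then have pc: "\<phi> (pr0 c) = omega k y"
      by (simp add: omega_def)
    have gh: "?g * inverse ?h * inverse ?g = c * inverse ?h"
      using h by (simp add: c_def mult.assoc)
    have cJ: "c \<in> Jset"
      using cp Jset_plus_subset by blast
    have "ract R ?g (ract R (inverse ?h) (ract R (inverse ?g) u)) = ract R c (ract R (inverse ?h) u)"
      unfolding repR(7)[OF g(1) h(2) repR(3)[OF g(2) u(1)], symmetric]
        repR(7)[OF Jset_mult[OF g(1) h(2)] g(2) u(1), symmetric] gh repR(7)[OF cJ h(2) u(1)] ..
    also have "\<dots> = rscale R (omega k y) (ract R (inverse ?h) u)"
      using J_representationD(4)[OF R cp] repR(3) h u(1) pc by simp
    finally show ?thesis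
      using J_linearD[OF B] repR(3) repR'(5) h u(1) by (simp add: FF_def Bk_def)
  qed
  have "\<exists>k\<in>YY. AA (Bk k) (ract R (inverse (1 + k)) u) \<noteq> 0"
  proof (rule ccontr)
    assume "\<not> ?thesis"
    then have "(\<Sum>k\<in>YY. \<Sum>y\<in>YY. rscale R' (omega k y) (FF B (1 + y) u)) = 0"
      using key YY_lattice by (simp add: AA_def)
    then have "(\<Sum>y\<in>YY. rscale R' (\<Sum>k\<in>YY. omega k y) (FF B (1 + y) u)) = 0"
      by (subst (asm) sum.swap) (simp add: V'.scale_sum_left)
    \<comment> \<open>Orthogonality leaves only the class of 0, which is represented in
      \<open>YY\<close> by \<open>rp 0\<close> rather than by 0 itself.\<close>
    moreover have "rscale R' (\<Sum>k\<in>YY. omega k y) (FF B (1 + y) u) =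
        (if y = rp 0 then rscale R' (of_nat (card YY)) (B u) else 0)" if y: "y \<in> YY" for y
    proof (cases "y = rp 0")
      case True
      have v: "ereal (r / 2) < valD Q y"
        using rp(3)[OF zero_lattice] True by simp
      then have "(\<Sum>k\<in>YY. omega k y) = of_nat (card YY)"
        using omega_trivial[OF YY_lattice YY_lattice[OF y]] by simp
      moreover have "FF B (1 + y) u = FF B 1 u"
        using kJ[OF YY_lattice[OF y]] v one_plus_lattice(3)[OF YY_lattice[OF y]] u(1)
        by (intro FF_cong[OF B]) simp_all
      moreover have "FF B 1 u = B u"
        using repR(6) repR'(6) J_linearD(1)[OF B] u(1) by (simp add: FF_def)
      ultimately show ?thesis
        using True by simp
    next
      case False
      have "\<not> ereal (r / 2) < valD Q y"
      proof
        assume "ereal (r / 2) < valD Q y"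
        then have "rp y = rp 0"
          using YY_lattice[OF y] zero_lattice by (intro rp_eqI) simp_all
        then show False
          using False rp_YY[OF y] by simp
      qed
      then show ?thesis
        using omega_sum[OF YY_lattice[OF y]] False by simp
    qed
    moreover have "rp 0 \<in> YY"
      using zero_lattice by (simp add: YY_def)
    ultimately have "rscale R' (of_nat (card YY)) (B u) = 0"
      using finite_YY by simp
    moreover have "card YY \<noteq> 0"
      using finite_YY \<open>rp 0 \<in> YY\<close> by auto
    ultimately show False
      using u(2) by simp
  qed
  then show thesis
    using that J_hom_AA Bk YY_lattice u(1) repR(3) kJ(2) by metis
qed

text \<open>Schur's argument: the kernel and the image are invariant, and one nonzero value excludes
  the bad alternatives.\<close>

lemma J_hom_bij:
  assumes A: "J_hom R R' A" and v: "v \<in> rspace R" "A v \<noteq> 0"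
  shows "bij_betw A (rspace R) (rspace R')"
proof -
  interpret V: vector_space "rscale R"
    by (rule vsR)
  interpret V': vector_space "rscale R'"
    by (rule vsR')
  have Al: "J_linear R R' A" and Ah: "\<And>h v. h \<in> Jset \<Longrightarrow> v \<in> rspace R \<Longrightarrow> A (ract R h v) = ract R' h (A v)"
    using A by (auto simp: J_hom_def)
  note Ad = J_linearD[OF Al]
  have A0: "A 0 = 0"
    using Ad(2)[of 0 0] sub(1) by simp
  have z': "ract R' h 0 = 0" if "h \<in> Jset" for h
    using repR'(4)[OF that sub'(1) sub'(1)] by simp
  let ?K = "{x \<in> rspace R. A x = 0}"
  have "V.subspace ?K"
    unfolding V.subspace_def using sub Ad A0 by simp
  moreover have "\<forall>g\<in>carrier (Dgrp Jset). ract R g ` ?K \<subseteq> ?K"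
    using repR(3) Ah z' by auto
  ultimately have "?K = {0} \<or> ?K = rspace R"
    using J_representationD(3)[OF R] unfolding irreducible_rep_def by blast
  then have K: "?K = {0}"
    using v by auto
  have inj: "inj_on A (rspace R)"
  proof (rule inj_onI)
    fix x y assume xy: "x \<in> rspace R" "y \<in> rspace R" "A x = A y"
    have d: "x - y \<in> rspace R"
      by (rule V.subspace_diff[OF repR(2) xy(1,2)])
    then have "x - y \<in> ?K"
      using Ad(2)[OF d xy(2)] xy(3) by simp
    then show "x = y"
      using K by auto
  qed
  let ?I = "A ` rspace R"
  have "V'.subspace ?I"
    unfolding V'.subspace_def
  proof (intro conjI allI ballI)
    show "0 \<in> ?I"
      using A0 sub(1) by force
    show "x + y \<in> ?I" if "x \<in> ?I" "y \<in> ?I" for x y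
      using that Ad(2) sub(2) by (force simp flip: Ad(2))
    show "rscale R' c x \<in> ?I" if "x \<in> ?I" for c x
      using that Ad(3) sub(3) by (force simp flip: Ad(3))
  qed
  moreover have "?I \<subseteq> rspace R'"
    using Ad(1) by auto
  moreover have "\<forall>g\<in>carrier (Dgrp Jset). ract R' g ` ?I \<subseteq> ?I"
    using repR(3) by (force simp flip: Ah)
  ultimately have "?I = {0} \<or> ?I = rspace R'"
    using J_representationD(3)[OF R'] unfolding irreducible_rep_def by blast
  then have "?I = rspace R'"
    using v by auto
  with inj show ?thesis
    by (simp add: bij_betw_def)
qed

text \<open>The uniqueness half of the Stone-von Neumann theorem. Averaging starts from a rank one
  map that sends some v to a nonzero v'.\<close>

lemma J_iso_exists: obtains A where "J_hom R R' A" "bij_betw A (rspace R) (rspace R')"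
proof -
  interpret V: vector_space "rscale R"
    by (rule vsR)
  interpret V': vector_space "rscale R'"
    by (rule vsR')
  have c: "vector_space ((*) :: complex \<Rightarrow> complex \<Rightarrow> complex)"
    by unfold_locales (simp_all add: algebra_simps)
  interpret P: vector_space_pair "rscale R" "(*) :: complex \<Rightarrow> complex \<Rightarrow> complex"
    by (intro vector_space_pair.intro vsR c)
  have ex: "\<exists>v\<in>rspace R. v \<noteq> 0" "\<exists>v\<in>rspace R'. v \<noteq> 0"
    using J_representationD(3)[OF R] J_representationD(3)[OF R'] sub(1) sub'(1) by (auto simp: irreducible_rep_def)
  then obtain v v' where v: "v \<in> rspace R" "v \<noteq> 0" and v': "v' \<in> rspace R'" "v' \<noteq> 0"
    by blast
  have "V.independent {v}"
    using v(2) by simp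
  then obtain l where l: "Vector_Spaces.linear (rscale R) (*) l" "l v = (1::complex)"
    using P.linear_independent_extend[of "{v}" "\<lambda>_. 1"] by auto
  interpret l: Vector_Spaces.linear "rscale R" "(*) :: complex \<Rightarrow> complex \<Rightarrow> complex" l
    by (rule l(1))
  let ?B = "\<lambda>x. rscale R' (l x) v'"
  have "J_linear R R' ?B"
    unfolding J_linear_def using sub'(3)[OF v'(1)] by (simp add: l.add l.scale V'.scale_left_distrib)
  moreover have "?B v \<noteq> 0"
    using v' l(2) by simp
  ultimately obtain A w where "J_hom R R' A" "w \<in> rspace R" "A w \<noteq> 0"
    using J_hom_nonzero v(1) by blast
  then show thesis
    using J_hom_bij that by blast
qed

end

end

section \<open>Compatibility with the torus\<close>

context depth_character
begin

text \<open>The translates of one vector by a transversal of J+ already span, because J+ acts by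
  scalars and so their span is invariant under J. The finiteness is what provides eigenvalues in
  \<open>schur_scalar\<close>.\<close>

lemma finite_span:
  assumes R: "J_representation \<phi> R"
  obtains B where "finite B" "rspace R \<subseteq> module.span (rscale R) B"
proof -
  note rep = is_repD[OF J_representationD(2)[OF R]]
  interpret V: vector_space "rscale R"
    by (rule rep(1))
  obtain v where v: "v \<in> rspace R" "v \<noteq> 0"
    using J_representationD(3)[OF R] subspaceD(1)[OF rep(1,2)] by (auto simp: irreducible_rep_def)
  let ?B = "(\<lambda>y. ract R (1 + y) v) ` YY"
  have YJ: "1 + y \<in> Jset" if "y \<in> YY" for y
    using one_plus_lattice[OF YY_lattice[OF that]] by simp
  have BV: "?B \<subseteq> rspace R"
    using rep(3) YJ v by auto
  then have sV: "V.span ?B \<subseteq> rspace R"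
    using rep(2) by (rule V.span_minimal)
  have inv: "ract R g x \<in> V.span ?B" if g: "g \<in> Jset" and x: "x \<in> V.span ?B" for g x
  proof -
    let ?U = "{x \<in> rspace R. ract R g x \<in> V.span ?B}"
    have "ract R g 0 = 0"
      using rep(4)[OF g, of 0 0] subspaceD(1)[OF rep(1,2)] by simp
    then have "V.subspace ?U"
      unfolding V.subspace_def using subspaceD[OF rep(1,2)] rep(4,5)[OF g]
      by (simp add: V.span_zero V.span_add V.span_scale)
    moreover have "?B \<subseteq> ?U"
    proof
      fix b assume "b \<in> ?B"
      then obtain y where y: "y \<in> YY" "b = ract R (1 + y) v"
        by blast
      let ?h = "g * (1 + y)" and ?y' = "rp (pr1 (g * (1 + y)))"
      have h: "?h \<in> Jset"
        by (intro Jset_mult g YJ y)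
      note l = pr1_lattice[OF h]
      have y': "?y' \<in> YY"
        using l by (simp add: YY_def)
      define n where "n = ?h * inverse (1 + ?y')"
      have "ereal (r / 2) < valD Q (pr1 ?h - ?y')"
        using rp(3)[OF l] D.val_minus_commute[of "pr1 ?h" ?y'] by (simp only:)
      then have n: "n \<in> Jset_plus"
        unfolding n_def using YJ[OF y'] one_plus_lattice(3)[OF YY_lattice[OF y']] h
        by (intro Jset_plus_cosetI) (simp_all only:)
      then have nJ: "n \<in> Jset"
        using Jset_plus_subset by blast
      have hn: "?h = n * (1 + ?y')"
        using Jset_neq_zero[OF YJ[OF y']] by (simp add: n_def mult.assoc)
      have "ract R g b = ract R ?h v"
        unfolding y(2) by (rule rep(7)[OF g YJ[OF y(1)] v(1), symmetric])
      also have "\<dots> = ract R n (ract R (1 + ?y') v)"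
        using rep(7)[OF nJ YJ[OF y'] v(1)] hn by simp
      also have "\<dots> = rscale R (\<phi> (pr0 n)) (ract R (1 + ?y') v)"
        by (rule J_representationD(4)[OF R n rep(3)[OF YJ[OF y'] v(1)]])
      also have "\<dots> \<in> V.span ?B"
        using y' by (intro V.span_scale V.span_base) blast
      finally show "b \<in> ?U"
        using rep(3)[OF YJ[OF y(1)] v(1)] y(2) by simp
    qed
    ultimately have "V.span ?B \<subseteq> ?U"
      by (intro V.span_minimal)
    then show ?thesis
      using x by blast
  qed
  have "V.span ?B = {0} \<or> V.span ?B = rspace R"
    using J_representationD(3)[OF R] sV inv V.subspace_span[of ?B] unfolding irreducible_rep_def by auto
  moreover have "V.span ?B \<noteq> {0}"
  proof
    assume s: "V.span ?B = {0}"
    have y: "rp 0 \<in> YY"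
      using zero_lattice by (simp add: YY_def)
    then have "ract R (1 + rp 0) v \<in> V.span ?B"
      by (intro V.span_base) blast
    then have z: "ract R (1 + rp 0) v = 0"
      using s by simp
    note j = YJ[OF y] Jset_inverse[OF YJ[OF y]] Jset_neq_zero[OF YJ[OF y]]
    have "v = ract R (inverse (1 + rp 0)) (ract R (1 + rp 0) v)"
      using rep(7)[OF j(2) j(1) v(1)] rep(6)[OF v(1)] j(3) by simp
    also have "\<dots> = 0"
      unfolding z using rep(4)[OF j(2), of 0 0] subspaceD(1)[OF rep(1,2)] by simp
    finally show False
      using v(2) by simp
  qed
  ultimately have "rspace R \<subseteq> V.span ?B"
    by blast
  then show thesis
    using that finite_YY by blast
qed

text \<open>Subtracting an eigenvalue makes C non-injective, and a non-injective intertwiner of an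
  irreducible representation is 0.\<close>

lemma schur_scalar:
  assumes R: "J_representation \<phi> R" and C: "J_hom R R C"
  obtains c where "\<And>v. v \<in> rspace R \<Longrightarrow> C v = rscale R c v"
proof -
  note rep = is_repD[OF J_representationD(2)[OF R]]
  note subW = subspaceD[OF rep(1,2)]
  interpret V: vector_space "rscale R"
    by (rule rep(1))
  have Cl: "J_linear R R C" and Ch: "\<And>h v. h \<in> Jset \<Longrightarrow> v \<in> rspace R \<Longrightarrow> C (ract R h v) = ract R h (C v)"
    using C by (auto simp: J_hom_def)
  note Cd = J_linearD[OF Cl]
  obtain v where v: "v \<in> rspace R" "v \<noteq> 0"
    using J_representationD(3)[OF R] subW(1) by (auto simp: irreducible_rep_def)
  obtain B where B: "finite B" "rspace R \<subseteq> V.span B"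
    using finite_span[OF R] .
  obtain c w where w: "w \<in> rspace R" "w \<noteq> 0" "C w = rscale R c w"
    by (rule eigenvector_exists[OF rep(1,2) B v Cd])
  let ?D = "\<lambda>x. C x + rscale R (- c) x"
  have "J_hom R R ?D"
    unfolding J_hom_def J_linear_def
  proof (intro conjI allI impI)
    fix x assume x: "x \<in> rspace R"
    then show "?D x \<in> rspace R"
      by (intro subW Cd)
    show "?D (x + y) = ?D x + ?D y" if "y \<in> rspace R" for y
      using Cd(2)[OF x that] by (simp add: V.scale_right_distrib)
    show "?D (rscale R k x) = rscale R k (?D x)" for k
      unfolding Cd(3)[OF x] V.scale_right_distrib by (simp add: mult.commute)
    show "?D (ract R h x) = ract R h (?D x)" if h: "h \<in> Jset" for h
      unfolding Ch[OF h x] rep(4)[OF h Cd(1)[OF x] subW(3)[OF x]] rep(5)[OF h x] ..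
  qed
  then have D: "J_hom R R ?D" .
  have Dw: "?D w = ?D 0"
    using w Cd(3)[OF subW(1), of 0] by simp
  have "?D x = 0" if x: "x \<in> rspace R" for x
  proof (rule ccontr)
    assume "?D x \<noteq> 0"
    then have "inj_on ?D (rspace R)"
      using J_hom_bij[OF R R D x] by (simp add: bij_betw_def)
    then have "w = 0"
      using Dw w(1) subW(1) by (rule inj_onD)
    then show False
      using w(2) by simp
  qed
  then have "C x = rscale R c x" if "x \<in> rspace R" for x
    using that by (simp add: eq_neg_iff_add_eq_0[symmetric])
  then show thesis
    by (rule that)
qed

text \<open>Injectivity is a consequence of preserving the valuation, which is infinite only at
  0.\<close>

lemma perp_isometry_inverse:
  assumes M: "perp_isometry M"
  obtains M' where "perp_isometry M'" "\<And>y. y \<in> perp \<Longrightarrow> M (M' y) = y" "\<And>y. y \<in> perp \<Longrightarrow> M' (M y) = y"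
proof -
  have inj: "x = y" if "x \<in> perp" "y \<in> perp" "M x = M y" for x y
  proof -
    have "valD Q (x - y) = valD Q (M (x - y))"
      using M diff_perp that by (simp add: perp_isometry_def)
    then show ?thesis
      using perp_isometry_diff[OF M that(1,2)] that(3) valD_infinity[of "x - y"] by simp
  qed
  define M' where "M' y = (SOME x. x \<in> perp \<and> M x = y)" for y
  have M': "M' y \<in> perp \<and> M (M' y) = y" if "y \<in> perp" for y
  proof -
    have "\<exists>x. x \<in> perp \<and> M x = y"
      using M that unfolding perp_isometry_def by blast
    then show ?thesis
      unfolding M'_def by (rule someI_ex)
  qed
  have M'M: "M' (M y) = y" if "y \<in> perp" for y
    using M' M that inj unfolding perp_isometry_def by blast
  have Md: "M (x + y) = M x + M y" "M x * M y - M y * M x = x * y - y * x" if "x \<in> perp" "y \<in> perp" for x y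
    using M that by (auto simp: perp_isometry_def)
  have Mp: "M y \<in> perp" "valD Q (M y) = valD Q y" if "y \<in> perp" for y
    using M that by (auto simp: perp_isometry_def)
  have "perp_isometry M'"
    unfolding perp_isometry_def
  proof (intro conjI ballI)
    fix y assume y: "y \<in> perp"
    show "M' y \<in> perp" "valD Q (M' y) = valD Q y"
      using M'[OF y] Mp(2)[of "M' y"] by auto
    show "\<exists>x\<in>perp. M' x = y"
      using M'M[OF y] Mp(1)[OF y] by blast
    fix x assume x: "x \<in> perp"
    show "M' (x + y) = M' x + M' y"
      using inj[of "M' (x + y)" "M' x + M' y"] M' x y Md(1)[of "M' x" "M' y"] by (simp add: add_perp)
    show "M' x * M' y - M' y * M' x = x * y - y * x"
      using Md(2)[of "M' x" "M' y"] M'[OF x] M'[OF y] by simp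
  qed
  then show thesis
    using that M' M'M by blast
qed

lemma lift_isometry_inverse:
  assumes "perp_isometry M" "perp_isometry M'" "\<And>y. y \<in> perp \<Longrightarrow> M (M' y) = y"
  shows "lift_isometry M (lift_isometry M' h) = h"
proof -
  let ?y = "pr1 h"
  have "lift_isometry M (lift_isometry M' h) =
      pr0 h + emb Q (1 / 2) * (M' ?y * M' ?y - ?y * ?y) + emb Q (1 / 2) * (?y * ?y - M' ?y * M' ?y) + ?y"
    unfolding lift_isometry_def[of M] pr_lift_isometry[OF assms(2)] assms(3)[OF pr1_in_perp] ..
  also have "\<dots> = pr0 h + ?y"
    by (simp add: right_diff_distrib)
  finally show ?thesis
    by simp
qed

text \<open>The scalar c by which A fails to commute with the Weil operators of M. It is kept as a
  relation, since its existence depends on Schur's lemma.\<close>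

definition ratio :: "('d, 'v::ab_group_add) rep \<Rightarrow> ('d, 'w::ab_group_add) rep \<Rightarrow>
   (('d \<Rightarrow> 'd) \<Rightarrow> 'v \<Rightarrow> 'v) \<Rightarrow> (('d \<Rightarrow> 'd) \<Rightarrow> 'w \<Rightarrow> 'w) \<Rightarrow> ('v \<Rightarrow> 'w) \<Rightarrow> ('d \<Rightarrow> 'd) \<Rightarrow> complex \<Rightarrow> bool" where
  "ratio R R' S S' A M c \<longleftrightarrow> (\<forall>v\<in>rspace R. S' M (A v) = rscale R' c (A (S M v)))"

text \<open>Says that the comparison character has order dividing p at M. The set of such M is
  closed under composition, so it can be tested on generators.\<close>

definition ratio_torsion :: "('d, 'v::ab_group_add) rep \<Rightarrow> ('d, 'w::ab_group_add) rep \<Rightarrow>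
   (('d \<Rightarrow> 'd) \<Rightarrow> 'v \<Rightarrow> 'v) \<Rightarrow> (('d \<Rightarrow> 'd) \<Rightarrow> 'w \<Rightarrow> 'w) \<Rightarrow> ('v \<Rightarrow> 'w) \<Rightarrow> ('d \<Rightarrow> 'd) \<Rightarrow> bool" where
  "ratio_torsion R R' S S' A M \<longleftrightarrow> perp_isometry M \<and> (\<forall>c. ratio R R' S S' A M c \<longrightarrow> c ^ p = 1)"

section \<open>Comparison of two Weil actions\<close>

context
  fixes R :: "('d, 'v::ab_group_add) rep" and R' :: "('d, 'w::ab_group_add) rep"
    and S :: "('d \<Rightarrow> 'd) \<Rightarrow> 'v \<Rightarrow> 'v" and S' :: "('d \<Rightarrow> 'd) \<Rightarrow> 'w \<Rightarrow> 'w" and A :: "'v \<Rightarrow> 'w"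
  assumes R: "J_representation \<phi> R" and R': "J_representation \<phi> R'"
    and S: "weil_action \<phi> R S" and S': "weil_action \<phi> R' S'"
    and A: "J_hom R R' A" and Abij: "bij_betw A (rspace R) (rspace R')"
begin

private lemmas repRW = is_repD[OF J_representationD(2)[OF R]]
private lemmas repRW' = is_repD[OF J_representationD(2)[OF R']]
private lemmas subW = subspaceD[OF repRW(1,2)]
private lemmas subW' = subspaceD[OF repRW'(1,2)]
private lemmas Sd = weil_actionD[OF S]
private lemmas S'd = weil_actionD[OF S']

private lemma Al: "J_linear R R' A" and Ah: "h \<in> Jset \<Longrightarrow> v \<in> rspace R \<Longrightarrow> A (ract R h v) = ract R' h (A v)"
  using A by (auto simp: J_hom_def)

private lemmas Ad = J_linearD[OF Al]

text \<open>The operator \<open>A^-1 S'(M) A S(M^-1)\<close> commutes with J, because the lift of M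
  undoes that of its inverse; Schur's lemma makes it a scalar.\<close>

lemma ratio_exists:
  assumes M: "perp_isometry M"
  obtains c where "ratio R R' S S' A M c"
proof -
  interpret V: vector_space "rscale R"
    by (rule repRW(1))
  interpret V': vector_space "rscale R'"
    by (rule repRW'(1))
  obtain M' where M': "perp_isometry M'" "\<And>y. y \<in> perp \<Longrightarrow> M (M' y) = y" "\<And>y. y \<in> perp \<Longrightarrow> M' (M y) = y"
    by (rule perp_isometry_inverse[OF M]) blast
  define I where "I = inv_into (rspace R) A"
  have I: "I w \<in> rspace R" "A (I w) = w" if "w \<in> rspace R'" for w
    using Abij that by (auto simp: I_def bij_betw_def inv_into_into f_inv_into_f)
  have IA: "I (A v) = v" if "v \<in> rspace R" for v
    using Abij that by (auto simp: I_def bij_betw_def)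
  have Ieq: "I w = v" if "v \<in> rspace R" "A v = w" for v w
    using IA that by blast
  define C where "C v = I (S' M (A (S M' v)))" for v
  have CV: "S' M (A (S M' v)) \<in> rspace R'" if "v \<in> rspace R" for v
    by (intro S'd(1) Ad(1) Sd(1) M M' that)
  have C: "C v \<in> rspace R" "A (C v) = S' M (A (S M' v))" if "v \<in> rspace R" for v
    using I[OF CV[OF that]] by (auto simp: C_def)
  have "J_hom R R C"
    unfolding J_hom_def J_linear_def
  proof (intro conjI allI impI)
    fix v assume v: "v \<in> rspace R"
    show "C v \<in> rspace R"
      by (rule C[OF v])
    show "C (v + w) = C v + C w" if w: "w \<in> rspace R" for w
    proof -
      have "A (C v + C w) = S' M (A (S M' (v + w)))"
        by (simp only: Ad(2)[OF C(1)[OF v] C(1)[OF w]] C(2)[OF v] C(2)[OF w] Sd(2)[OF M'(1) v w]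
            Ad(2)[OF Sd(1)[OF M'(1) v] Sd(1)[OF M'(1) w]]
            S'd(2)[OF M Ad(1)[OF Sd(1)[OF M'(1) v]] Ad(1)[OF Sd(1)[OF M'(1) w]]])
      then show ?thesis
        unfolding C_def[of "v + w"] using subW(2)[OF C(1)[OF v] C(1)[OF w]] by (intro Ieq)
    qed
    show "C (rscale R k v) = rscale R k (C v)" for k
    proof -
      have "A (rscale R k (C v)) = S' M (A (S M' (rscale R k v)))"
        by (simp only: Ad(3)[OF C(1)[OF v]] C(2)[OF v] Sd(3)[OF M'(1) v] Ad(3)[OF Sd(1)[OF M'(1) v]]
            S'd(3)[OF M Ad(1)[OF Sd(1)[OF M'(1) v]]])
      then show ?thesis
        unfolding C_def[of "rscale R k v"] using subW(3)[OF C(1)[OF v]] by (intro Ieq)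
    qed
    show "C (ract R h v) = ract R h (C v)" if h: "h \<in> Jset" for h
    proof -
      have l: "lift_isometry M' h \<in> Jset"
        by (rule lift_isometry_Jset(1)[OF M'(1) h])
      have "S' M (A (S M' (ract R h v))) = ract R' h (S' M (A (S M' v)))"
        by (simp only: Sd(4)[OF M'(1) h v] Ah[OF l Sd(1)[OF M'(1) v]]
            S'd(4)[OF M l Ad(1)[OF Sd(1)[OF M'(1) v]]] lift_isometry_inverse[OF M M'(1,2)])
      also have "\<dots> = A (ract R h (C v))"
        by (simp only: Ah[OF h C(1)[OF v]] C(2)[OF v])
      finally show ?thesis
        unfolding C_def[of "ract R h v"] using repRW(3)[OF h C(1)[OF v]] by (intro Ieq) simp_all
    qed
  qed
  then obtain c where c: "\<And>v. v \<in> rspace R \<Longrightarrow> C v = rscale R c v"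
    by (rule schur_scalar[OF R]) blast
  have "ratio R R' S S' A M c"
    unfolding ratio_def
  proof
    fix v assume v: "v \<in> rspace R"
    have "S M' (S M v) = S (\<lambda>y. M' (M y)) v"
      by (rule Sd(5)[OF M'(1) M v, symmetric])
    \<comment> \<open>\<open>M' (M y) = y\<close> is known on the complement only, so the operators
      are identified through \<open>isometry_cong\<close> and not as operators of equal
      functions.\<close>
    also have "\<dots> = S (\<lambda>y. y) v"
      by (rule Sd(6)[OF perp_isometry_comp[OF M'(1) M] perp_isometry_id _ v]) (simp add: isometry_cong_def M'(3))
    finally have SS: "S M' (S M v) = v"
      using Sd(7)[OF v] by simp
    have "A (C (S M v)) = S' M (A v)"
      using C(2)[OF Sd(1)[OF M v]] by (simp only: SS)
    then show "S' M (A v) = rscale R' c (A (S M v))"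
      using c[OF Sd(1)[OF M v]] Ad(3)[OF Sd(1)[OF M v]] by simp
  qed
  then show thesis
    by (rule that)
qed

lemma ratio_comp:
  assumes M: "perp_isometry M" "ratio R R' S S' A M c" and M': "perp_isometry M'" "ratio R R' S S' A M' c'"
  shows "ratio R R' S S' A (\<lambda>y. M (M' y)) (c * c')"
  unfolding ratio_def
proof
  interpret V': vector_space "rscale R'"
    by (rule repRW'(1))
  fix v assume v: "v \<in> rspace R"
  have "S' (\<lambda>y. M (M' y)) (A v) = S' M (rscale R' c' (A (S M' v)))"
    using S'd(5)[OF M(1) M'(1) Ad(1)[OF v]] M'(2) v by (simp add: ratio_def)
  also have "\<dots> = rscale R' c' (rscale R' c (A (S M (S M' v))))"
    using S'd(3)[OF M(1) Ad(1)[OF Sd(1)[OF M'(1) v]]] M(2) Sd(1)[OF M'(1) v] by (simp add: ratio_def)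
  finally show "S' (\<lambda>y. M (M' y)) (A v) = rscale R' (c * c') (A (S (\<lambda>y. M (M' y)) v))"
    using Sd(5)[OF M(1) M'(1) v] by (simp add: mult.commute)
qed

lemma ratio_cong:
  assumes "perp_isometry M" "perp_isometry M'" "isometry_cong M M'" "ratio R R' S S' A M c"
  shows "ratio R R' S S' A M' c"
  using assms(4) Sd(6)[OF assms(1-3)] S'd(6)[OF assms(1-3) Ad(1)] by (simp add: ratio_def)

lemma ratio_id: "ratio R R' S S' A (\<lambda>y. y) 1"
proof -
  interpret V': vector_space "rscale R'"
    by (rule repRW'(1))
  show ?thesis
    using Sd(7) S'd(7)[OF Ad(1)] by (simp add: ratio_def)
qed

lemma ratio_unique:
  assumes M: "perp_isometry M" and c: "ratio R R' S S' A M c" "ratio R R' S S' A M c'"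
  shows "c = c'"
proof -
  interpret V': vector_space "rscale R'"
    by (rule repRW'(1))
  obtain v where v: "v \<in> rspace R" "v \<noteq> 0"
    using J_representationD(3)[OF R] subW(1) by (auto simp: irreducible_rep_def)
  obtain M' where M': "perp_isometry M'" "\<And>y. y \<in> perp \<Longrightarrow> M (M' y) = y" "\<And>y. y \<in> perp \<Longrightarrow> M' (M y) = y"
    by (rule perp_isometry_inverse[OF M]) blast
  let ?u = "S M' v"
  have u: "?u \<in> rspace R"
    by (rule Sd(1)[OF M'(1) v(1)])
  have "S M ?u = S (\<lambda>y. y) v"
    using Sd(5)[OF M M'(1) v(1)] Sd(6)[OF perp_isometry_comp[OF M M'(1)] perp_isometry_id _ v(1)] M'(2)
    by (simp add: isometry_cong_def)
  then have "S M ?u = v"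
    using Sd(7)[OF v(1)] by simp
  moreover have "S' M (A ?u) = rscale R' c (A (S M ?u))" "S' M (A ?u) = rscale R' c' (A (S M ?u))"
    using c u unfolding ratio_def by blast+
  ultimately have eq: "rscale R' c (A v) = rscale R' c' (A v)"
    by metis
  have "A 0 = 0"
    using Ad(2)[OF subW(1) subW(1)] by simp
  then have "A v \<noteq> 0"
    using Abij v subW(1) by (auto simp: bij_betw_def inj_on_def)
  then show ?thesis
    using eq by simp
qed

lemma ratio_torsion_comp:
  assumes "ratio_torsion R R' S S' A M" "ratio_torsion R R' S S' A M'"
  shows "ratio_torsion R R' S S' A (\<lambda>y. M (M' y))"
  unfolding ratio_torsion_def
proof (intro conjI allI impI)
  have M: "perp_isometry M" "perp_isometry M'"
    using assms by (auto simp: ratio_torsion_def)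
  then show i: "perp_isometry (\<lambda>y. M (M' y))"
    by (rule perp_isometry_comp)
  fix c assume c: "ratio R R' S S' A (\<lambda>y. M (M' y)) c"
  obtain a b where ab: "ratio R R' S S' A M a" "ratio R R' S S' A M' b"
    using ratio_exists M by metis
  then have "c = a * b"
    using ratio_unique[OF i c] ratio_comp M by blast
  then show "c ^ p = 1"
    using assms ab by (simp add: ratio_torsion_def power_mult_distrib)
qed

lemma torus_isometry_power:
  assumes "t \<in> E" "t \<noteq> 0" "ratio R R' S S' A (torus_isometry t) c"
  shows "ratio R R' S S' A (torus_isometry (t ^ n)) (c ^ n)"
proof (induction n)
  case 0
  have "isometry_cong (\<lambda>y. y) (torus_isometry 1)"
    using r_pos by (simp add: isometry_cong_def torus_isometry_def)
  then show ?case
    using ratio_cong[OF perp_isometry_id torus_isometry[of 1] _ ratio_id] by simp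
next
  case (Suc n)
  have "torus_isometry (t ^ Suc n) = (\<lambda>y. torus_isometry t (torus_isometry (t ^ n) y))"
    using assms(2) by (simp add: torus_isometry_def fun_eq_iff nonzero_inverse_mult_distrib mult.assoc)
  then show ?case
    using ratio_comp[OF torus_isometry[OF assms(1,2)] assms(3) torus_isometry[of "t ^ n"] Suc] assms
    by (simp add: power_E)
qed

end

text \<open>Coordinates on the complement, for unramified \<open>E\<close>: there \<open>e0\<close> may be taken to be a unit.\<close>

definition cc :: "'f \<Rightarrow> 'f \<Rightarrow> 'd" where "cc x z = emb Q x + emb Q z * e0"

lemma cc_E: "cc x z \<in> E"
  by (simp add: cc_def add_E mult_E e0_E)

lemma cc_add: "cc x z + cc x' z' = cc (x + x') (z + z')"
  by (simp add: cc_def emb_add distrib_right)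

lemma cc_diff: "cc x z - cc x' z' = cc (x - x') (z - z')"
  by (simp add: cc_def left_diff_distrib)

lemma cc_conj: "qconj Q (cc x z) = cc x (- z)"
  unfolding cc_def qconj_coords by simp

lemma cc_mult: "cc x z * cc x' z' = cc (x * x' + disc * (z * z')) (x * z' + z * x')"
proof -
  have "emb Q z * e0 * emb Q x' = emb Q (z * x') * e0"
    by (simp add: emb_mult mult.assoc emb_central[of x' e0, symmetric])
  moreover have "emb Q z * e0 * (emb Q z' * e0) = emb Q (disc * (z * z'))"
  proof -
    have "emb Q z * e0 * (emb Q z' * e0) = emb Q z * (emb Q z' * (e0 * e0))"
      by (simp only: mult.assoc emb_left_commute[of e0])
    then show ?thesis
      unfolding e0_square by (simp only: emb_mult[symmetric] mult.assoc mult.commute mult.left_commute)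
  qed
  moreover have "emb Q x * (emb Q z' * e0) = emb Q (x * z') * e0"
    by (simp add: emb_mult mult.assoc)
  ultimately show ?thesis
    by (simp add: cc_def distrib_left distrib_right emb_add emb_mult[symmetric])
qed

lemma cc_eq_iff: "cc x z = cc x' z' \<longleftrightarrow> x = x' \<and> z = z'"
proof
  assume "cc x z = cc x' z'"
  then have eq: "emb Q (z - z') * e0 = emb Q (x' - x)"
    by (simp add: cc_def left_diff_distrib algebra_simps)
  have "z = z'"
  proof (rule ccontr)
    assume "z \<noteq> z'"
    then have "e0 = inverse (emb Q (z - z')) * (emb Q (z - z') * e0)"
      by (simp flip: mult.assoc)
    also have "\<dots> = emb Q (inverse (z - z') * (x' - x))"
      by (simp only: eq emb_inverse emb_mult)
    finally show False
      using e0_not_scalar by blast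
  qed
  then show "x = x' \<and> z = z'"
    using eq by simp
qed simp

definition re0 :: "'d \<Rightarrow> 'f" where "re0 a = (SOME x. \<exists>z. a = cc x z)"
definition im0 :: "'d \<Rightarrow> 'f" where "im0 a = (SOME z. \<exists>x. a = cc x z)"

lemma re0_cc [simp]: "re0 (cc x z) = x" and im0_cc [simp]: "im0 (cc x z) = z"
  by (simp_all add: re0_def im0_def cc_eq_iff)

lemma cc_cases:
  assumes "a \<in> E" obtains x z where "a = cc x z"
  using E_cases[OF assms] unfolding cc_def by blast

text \<open>The F-linear map of the complement with matrix (a b; c d) in the coordinates
  \<open>\<sigma> * (x + z * e0)\<close>.\<close>

definition mm :: "'f \<Rightarrow> 'f \<Rightarrow> 'f \<Rightarrow> 'f \<Rightarrow> 'd \<Rightarrow> 'd" where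
  "mm a b c d y = \<sigma> * cc (a * re0 (inverse \<sigma> * y) + b * im0 (inverse \<sigma> * y))
                         (c * re0 (inverse \<sigma> * y) + d * im0 (inverse \<sigma> * y))"

lemma sigma_cancel [simp]: "inverse \<sigma> * (\<sigma> * a) = a"
  using sigma_neq_zero by (simp flip: mult.assoc)

lemma mm_cc: "mm a b c d (\<sigma> * cc x z) = \<sigma> * cc (a * x + b * z) (c * x + d * z)"
  by (simp add: mm_def)

lemma mm_comp: "mm a b c d (mm a' b' c' d' y) = mm (a * a' + b * c') (a * b' + b * d') (c * a' + d * c') (c * b' + d * d') y"
  unfolding mm_def[of a' b' c' d'] mm_cc unfolding mm_def by (simp add: algebra_simps)

lemma perp_cc_cases:
  assumes "y \<in> perp" obtains x z where "y = \<sigma> * cc x z"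
proof -
  have "inverse \<sigma> * y \<in> E"
    using assms by (intro perp_mult_perp inverse_perp sigma_perp)
  then obtain x z where "inverse \<sigma> * y = cc x z"
    by (rule cc_cases)
  then have "y = \<sigma> * cc x z"
    using sigma_neq_zero by (metis mult.assoc mult_1 right_inverse)
  then show thesis
    by (rule that)
qed

lemma mm_id: "y \<in> perp \<Longrightarrow> mm 1 0 0 1 y = y"
  by (erule perp_cc_cases) (simp add: mm_cc)

text \<open>In these coordinates the bracket is the determinant times a fixed factor, so matrices of
  determinant 1 preserve it.\<close>

lemma bracket_cc:
  "\<sigma> * cc x z * (\<sigma> * cc x' z') - \<sigma> * cc x' z' * (\<sigma> * cc x z) = \<sigma> * \<sigma> * cc 0 (2 * (x * z' - z * x'))"
proof -
  have *: "\<sigma> * cc x z * (\<sigma> * cc x' z') = \<sigma> * \<sigma> * (cc x (- z) * cc x' z')" for x z x' z'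
  proof -
    have "cc x z * \<sigma> = \<sigma> * cc x (- z)"
      using sigma_commute[OF cc_E[of x z]] by (simp add: cc_conj)
    then have "\<sigma> * (cc x z * \<sigma>) * cc x' z' = \<sigma> * (\<sigma> * cc x (- z)) * cc x' z'"
      by (simp only:)
    then show ?thesis
      by (simp only: mult.assoc)
  qed
  show ?thesis
    unfolding * right_diff_distrib[symmetric] cc_mult cc_diff by (simp add: algebra_simps)
qed

section \<open>SL_2 on the complement and Frobenius on residues\<close>

context
  assumes e0_unit: "valD Q e0 = 0"
begin

lemma fval_disc: "fval Q disc = 0"
  using valD_mult[of e0 e0] by (simp add: e0_square e0_unit)

text \<open>With \<open>e0\<close> a unit, cancellation between x and \<open>z * e0\<close> would
  make \<open>disc / (c * c)\<close> congruent to 1 for some c, hence disc a square, and E would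
  have zero divisors.\<close>

lemma valD_cc: "valD Q (cc x z) = min (fval Q x) (fval Q z)"
proof -
  have e: "valD Q (emb Q z * e0) = fval Q z"
    by (simp add: valD_mult e0_unit)
  consider "fval Q x < fval Q z" | "fval Q z < fval Q x" | "fval Q x = fval Q z"
    by (meson linorder_less_linear)
  then show ?thesis
  proof cases
    case 1
    then show ?thesis
      using D.val_add_eq[of "emb Q x" "emb Q z * e0"] by (simp add: e cc_def min_def less_imp_le)
  next
    case 2
    then show ?thesis
      using D.val_add_eq[of "emb Q z * e0" "emb Q x"] by (auto simp: e cc_def min_def add.commute)
  next
    case 3
    show ?thesis
    proof (cases "z = 0")
      case True
      then show ?thesis
        by (simp add: cc_def)
    next
      case False
      then obtain n where n: "fval Q z = ereal n"
        using F.val_real by blast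
      define c where "c = x / z"
      have c: "fval Q c = 0"
        unfolding c_def divide_inverse F.val_mult F.val_inverse[OF False] 3 n by (simp add: zero_ereal_def)
      then have c0: "c \<noteq> 0"
        by auto
      have int: "0 \<le> valD Q (cc c 1)" "0 \<le> valD Q (cc c (- 1))"
        unfolding cc_def by (intro D.val_add_ge; simp add: c valD_mult e0_unit emb_one)+
      have "\<not> 0 < valD Q (cc c 1)"
      proof
        assume "0 < valD Q (cc c 1)"
        then have "0 < valD Q (cc c 1 * cc c (- 1))"
          using int by (simp add: valD_mult add_pos_nonneg)
        also have "cc c 1 * cc c (- 1) = emb Q (c * c - disc)"
          unfolding cc_mult by (simp add: cc_def)
        finally have pos: "0 < fval Q (c * c - disc)"
          by (simp del: emb_diff)
        have "fval Q (inverse (c * c)) = 0"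
          using c0 F.val_inverse[of "c * c"] by (simp add: F.val_mult c)
        then have "0 < fval Q (inverse (c * c) * (disc - c * c))"
          using pos F.val_minus_commute[of disc "c * c"] by (simp add: F.val_mult)
        also have "inverse (c * c) * (disc - c * c) = disc / (c * c) - 1"
          using c0 by (simp add: field_simps)
        finally obtain y where "y * y = disc / (c * c)"
          by (rule square_unit)
        then have "(c * y) * (c * y) = disc"
          using c0 by (simp add: field_simps)
        then have "cc (c * y) 1 * cc (c * y) (- 1) = 0"
          unfolding cc_mult by (simp add: cc_def)
        then have "cc (c * y) 1 = cc 0 0 \<or> cc (c * y) (- 1) = cc 0 0"
          by (simp add: cc_def)
        then show False
          unfolding cc_eq_iff by simp
      qed
      then have "valD Q (cc c 1) = 0"
        using int by simp
      moreover have "cc x z = emb Q z * cc c 1"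
        using False by (simp add: cc_def c_def distrib_left emb_one flip: emb_mult)
      ultimately show ?thesis
        by (simp add: valD_mult 3)
    qed
  qed
qed

text \<open>An integral matrix does not lower valuations, and its inverse is integral too because
  the determinant is 1; so valuations are preserved.\<close>

lemma mm_isometry:
  assumes int: "0 \<le> fval Q a" "0 \<le> fval Q b" "0 \<le> fval Q c" "0 \<le> fval Q d" and det: "a * d - b * c = 1"
  shows "perp_isometry (mm a b c d)"
proof -
  have le: "min (fval Q x) (fval Q z) \<le> fval Q (a * x + b * z)" if "0 \<le> fval Q a" "0 \<le> fval Q b" for a b x z
    using that by (intro F.val_add_ge) (auto simp: F.val_mult min_le_iff_disj intro: add_increasing)
  have inv: "mm d (- b) (- c) a (mm a b c d y) = y" "mm a b c d (mm d (- b) (- c) a y) = y" if "y \<in> perp" for y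
    using that det mm_id by (simp_all add: mm_comp mult.commute)
  have val_le: "valD Q y \<le> valD Q (mm a b c d y)"
    if "y \<in> perp" "0 \<le> fval Q a" "0 \<le> fval Q b" "0 \<le> fval Q c" "0 \<le> fval Q d" for y a b c d
    using that le by (elim perp_cc_cases) (simp add: mm_cc valD_mult valD_cc add_mono)
  have P: "mm a b c d y \<in> perp" for a b c d y
    unfolding mm_def by (intro perp_mult_E sigma_perp cc_E)
  show ?thesis
    unfolding perp_isometry_def
  proof (intro conjI ballI)
    fix y assume y: "y \<in> perp"
    show "mm a b c d y \<in> perp"
      by (rule P)
    show "valD Q (mm a b c d y) = valD Q y"
      using val_le[OF y int] val_le[OF P[of a b c d y], of d "- b" "- c" a] int inv(1)[OF y] by simp
    show "\<exists>x\<in>perp. mm a b c d x = y"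
      using inv(2)[OF y] P by blast
    fix x assume x: "x \<in> perp"
    obtain u v where u: "x = \<sigma> * cc u v"
      using x by (rule perp_cc_cases)
    obtain u' v' where u': "y = \<sigma> * cc u' v'"
      using y by (rule perp_cc_cases)
    show "mm a b c d (x + y) = mm a b c d x + mm a b c d y"
      unfolding u u' distrib_left[symmetric] cc_add mm_cc by (simp add: algebra_simps)
    have "(a * u + b * v) * (c * u' + d * v') - (c * u + d * v) * (a * u' + b * v') = (a * d - b * c) * (u * v' - v * u')"
      by (simp add: algebra_simps)
    then show "mm a b c d x * mm a b c d y - mm a b c d y * mm a b c d x = x * y - y * x"
      unfolding u u' mm_cc bracket_cc by (simp add: det)
  qed
qed

text \<open>On \<open>\<sigma> E\<close> conjugation by t is multiplication by the norm one element
  \<open>u = qconj t / t\<close>. Its matrix in the basis 1, \<open>e0\<close> has determinant the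
  norm of u, and its entries are integral because u is a unit.\<close>

lemma torus_isometry_mm:
  assumes t: "t \<in> E" "t \<noteq> 0"
  obtains a b where "0 \<le> fval Q a" "0 \<le> fval Q b" "a * a - disc * b * b = 1"
    "\<And>y. y \<in> perp \<Longrightarrow> torus_isometry t y = mm a (disc * b) b a y"
proof -
  define u where "u = qconj Q t * inverse t"
  have "u \<in> E"
    using t by (simp add: u_def mult_E qconj_E inverse_E)
  then obtain a b where u: "u = cc a b"
    by (rule cc_cases)
  obtain n where "valD Q t = ereal n"
    using D.val_real t by blast
  then have "valD Q u = 0"
    using t by (simp add: u_def valD_mult D.val_inverse zero_ereal_def)
  then have int: "0 \<le> fval Q a" "0 \<le> fval Q b"
    unfolding u valD_cc by (simp_all add: min_def split: if_splits)
  have "u * qconj Q u = qconj Q t * (inverse t * qconj Q (inverse t)) * t"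
    by (simp add: u_def qconj_mult mult.assoc)
  also have "inverse t * qconj Q (inverse t) = qconj Q (inverse t) * inverse t"
    by (intro commute_E qconj_E inverse_E t)
  also have "qconj Q t * (qconj Q (inverse t) * inverse t) * t = qconj Q (inverse t * t) * (inverse t * t)"
    by (simp only: qconj_mult mult.assoc)
  also have "\<dots> = 1"
    using t by simp
  finally have "cc (a * a - disc * b * b) 0 = cc 1 0"
    unfolding u cc_conj cc_mult by (simp add: cc_def emb_one algebra_simps)
  then have "a * a - disc * b * b = 1"
    unfolding cc_eq_iff by simp
  moreover have "torus_isometry t y = mm a (disc * b) b a y" if y: "y \<in> perp" for y
  proof -
    obtain x z where xz: "y = \<sigma> * cc x z"
      using y by (rule perp_cc_cases)
    have "t * \<sigma> = \<sigma> * qconj Q t"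
      using sigma_commute[OF t(1)] by simp
    then have "torus_isometry t y = \<sigma> * (qconj Q t * (cc x z * inverse t))"
      by (simp add: torus_isometry_def xz flip: mult.assoc)
    also have "cc x z * inverse t = inverse t * cc x z"
      by (intro commute_E cc_E inverse_E t)
    finally have "torus_isometry t y = \<sigma> * (cc a b * cc x z)"
      by (simp add: u_def mult.assoc flip: u)
    then show ?thesis
      unfolding xz mm_cc cc_mult by (simp add: mult.assoc add.commute)
  qed
  ultimately show thesis
    using that int by blast
qed

text \<open>The inner binomial coefficients are divisible by p, so the p-th power of
  \<open>a - b\<close> is congruent to \<open>a ^ p - b ^ p\<close>, and a unit has unit
  powers.\<close>

lemma frobenius_injective:
  assumes a: "a \<in> E" "0 \<le> valD Q a" and b: "b \<in> E" "0 \<le> valD Q b" and ab: "0 < valD Q (a ^ p - b ^ p)"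
  shows "0 < valD Q (a - b)"
proof -
  let ?c = "a - b"
  have cv: "0 \<le> valD Q ?c"
    using a b by (intro D.val_diff_ge)
  have pw: "0 \<le> valD Q (x ^ n)" if "0 \<le> valD Q x" for x n
    using that by (induction n) (auto simp: valD_mult)
  have comm: "?c * b = b * ?c"
    using a b by (intro commute_E diff_E)
  let ?t = "\<lambda>k. of_nat (p choose k) * (?c ^ k * b ^ (p - k))"
  have pp: "0 < p"
    using prime_gt_0_nat[OF prime_p] .
  have "a ^ p = (\<Sum>k\<le>p. ?t k)"
    using commuting_binomial[OF comm, of p] by simp
  also have "\<dots> = ?t 0 + (\<Sum>k\<in>{1..<p}. ?t k) + ?t p"
  proof -
    have "{..p} = insert 0 (insert p {1..<p})"
      using pp by auto
    then show ?thesis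
      using pp by (simp add: add_ac)
  qed
  finally have eq: "?c ^ p = (a ^ p - b ^ p) - (\<Sum>k\<in>{1..<p}. ?t k)"
    by (simp add: algebra_simps)
  have small: "0 < valD Q (?t k)" if "k \<in> {1..<p}" for k
  proof -
    have "p dvd p choose k"
      using that prime_p by (intro dvd_choose_prime) auto
    then obtain m where m: "p choose k = p * m"
      by (elim dvdE)
    have "0 < valD Q (of_nat p)"
      using p_residue valD_emb[of "of_nat p"] by (simp add: emb_of_nat)
    then have "0 < valD Q (of_nat (p choose k))"
      unfolding m of_nat_mult valD_mult using D.val_of_nat_nonneg[of m] by (intro add_pos_nonneg)
    moreover have "0 \<le> valD Q (?c ^ k * b ^ (p - k))"
      unfolding valD_mult using pw cv b by (intro add_nonneg_nonneg)
    ultimately show ?thesis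
      unfolding valD_mult[of "of_nat _"] by (intro add_pos_nonneg)
  qed
  have sum_pos: "0 < valD Q (\<Sum>k\<in>K. g k)" if "\<And>k. k \<in> K \<Longrightarrow> 0 < valD Q (g k)" for K :: "nat set" and g
    using that by (induction K rule: infinite_finite_induct) (auto intro: D.val_add_gt)
  have "0 < valD Q (\<Sum>k\<in>{1..<p}. ?t k)"
    by (rule sum_pos[OF small])
  then have pos: "0 < valD Q (?c ^ p)"
    unfolding eq by (intro D.val_diff_gt ab)
  show ?thesis
  proof (rule ccontr)
    assume "\<not> 0 < valD Q ?c"
    then have "valD Q ?c = 0"
      using cv by simp
    then show False
      using pos D.val_power_unit[of ?c p] by simp
  qed
qed

text \<open>Among the iterated p-th powers of u two coincide modulo the maximal ideal, as residues
  are finite; injectivity of Frobenius carries the coincidence back to u itself.\<close>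

lemma frobenius_period:
  assumes u: "u \<in> E" "0 \<le> valD Q u"
  obtains n where "0 < n" "0 < valD Q (u ^ (p ^ n) - u)"
proof -
  have pw: "0 \<le> valD Q (u ^ n)" for n
    using u by (induction n) (auto simp: valD_mult)
  obtain S where S: "finite S" "\<And>x. 0 \<le> valD Q x \<Longrightarrow> \<exists>s\<in>S. 0 \<le> valD Q s \<and> ereal (real 1) \<le> valD Q (x - s)"
    using finite_residues_D[of 1] by blast
  define f where "f i = (SOME s. s \<in> S \<and> ereal 1 \<le> valD Q (u ^ (p ^ i) - s))" for i :: nat
  have f: "f i \<in> S \<and> ereal 1 \<le> valD Q (u ^ (p ^ i) - f i)" for i
    unfolding f_def by (rule someI_ex) (use S(2)[OF pw] in auto)
  have "\<not> inj f"
  proof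
    assume "inj f"
    then have "infinite (range f)"
      by (simp add: finite_image_iff)
    moreover have "range f \<subseteq> S"
      using f by auto
    ultimately show False
      using S(1) finite_subset by blast
  qed
  then obtain i j where "f i = f j" "i \<noteq> j"
    by (auto simp: inj_def)
  then obtain i m where m: "f i = f (i + m)" "0 < m"
    by (metis less_imp_add_positive linorder_neqE_nat)
  have f1: "ereal 1 \<le> valD Q (u ^ (p ^ i) - f i)" and f2: "ereal 1 \<le> valD Q (u ^ (p ^ (i + m)) - f i)"
    using f[of i] f[of "i + m"] m by simp_all
  have "ereal 1 \<le> valD Q ((u ^ (p ^ i) - f i) - (u ^ (p ^ (i + m)) - f i))"
    by (rule D.val_diff_ge[OF f1 f2])
  then have "0 < valD Q (u ^ (p ^ i) - u ^ (p ^ (i + m)))"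
    using valD_ge_gt[of 1 _ 0] by (simp flip: zero_ereal_def)
  \<comment> \<open>The exponents keep the shape of index 0 so that the descent can run by induction
    on i.\<close>
  then have "0 < valD Q (u ^ (p ^ 0) - u ^ (p ^ (0 + m)))"
  proof (induction i)
    case (Suc i)
    have "u ^ p ^ Suc k = (u ^ p ^ k) ^ p" for k
      by (simp add: power_mult mult.commute flip: power_mult)
    then show ?case
      using Suc frobenius_injective[of "u ^ (p ^ i)" "u ^ (p ^ (i + m))"] u pw by (simp add: power_E)
  qed
  then have "0 < valD Q (u ^ (p ^ m) - u)"
    using D.val_minus_commute[of u "u ^ (p ^ m)"] by simp
  then show thesis
    using that m(2) by blast
qed

text \<open>Any isomorphism over J is made to respect T. Its comparison scalars have order dividing
  p on unipotent maps, hence on all integral matrices of determinant 1, and T acts through such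
  matrices. No uniqueness of the Weil lift is invoked.\<close>

lemma weil_intertwiner:
  fixes R :: "('d, 'v::ab_group_add) rep" and R' :: "('d, 'w::ab_group_add) rep"
  assumes R: "J_representation \<phi> R" and R': "J_representation \<phi> R'"
    and S: "weil_action \<phi> R S" and S': "weil_action \<phi> R' S'"
  obtains A where "J_hom R R' A" "bij_betw A (rspace R) (rspace R')"
    "\<And>t v. t \<in> E - {0} \<Longrightarrow> v \<in> rspace R \<Longrightarrow> A (ract R t v) = ract R' t (A v)"
proof -
  obtain A where A: "J_hom R R' A" "bij_betw A (rspace R) (rspace R')"
    using J_iso_exists[OF R R'] .
  note ctx = R R' S S' A
  let ?ratio = "ratio R R' S S' A"
  let ?tors = "ratio_torsion R R' S S' A"
  have id: "isometry_cong M M'" if "\<And>y. y \<in> perp \<Longrightarrow> M y = M' y" for M M'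
    using that by (simp add: isometry_cong_def)
  have torsI: "?tors M" if M: "perp_isometry M" and M': "?tors M'" and eq: "\<And>y. y \<in> perp \<Longrightarrow> M y = M' y" for M M'
    using M M' ratio_cong[OF ctx M _ id[OF eq]] by (auto simp: ratio_torsion_def)
  have i01: "0 \<le> fval Q 0" "0 \<le> fval Q 1" "0 \<le> fval Q (- 1)"
    by simp_all
  have near: "isometry_cong (mm 1 x w 1) (\<lambda>y. y)" if x: "0 < fval Q x" and w: "0 < fval Q w" for x w
    unfolding isometry_cong_def
  proof (intro ballI impI)
    fix y assume y: "y \<in> perp" "ereal (r / 2) \<le> valD Q y"
    obtain a b where ab: "y = \<sigma> * cc a b"
      using y(1) by (rule perp_cc_cases)
    have "mm 1 x w 1 y - y = \<sigma> * cc (x * b) (w * a)"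
      unfolding ab mm_cc right_diff_distrib[symmetric] cc_diff by simp
    then have v: "valD Q (mm 1 x w 1 y - y) = valD Q \<sigma> + min (fval Q x + fval Q b) (fval Q w + fval Q a)"
      by (simp add: valD_mult valD_cc F.val_mult)
    have y': "ereal (r / 2) \<le> valD Q \<sigma> + min (fval Q a) (fval Q b)"
      using y(2) unfolding ab by (simp add: valD_mult valD_cc)
    obtain s where s: "valD Q \<sigma> = ereal s"
      by (rule valD_sigma)
    have "ereal (r / 2) < ereal s + (fval Q x + fval Q b)" "ereal (r / 2) < ereal s + (fval Q w + fval Q a)"
      using y' x w F.val_not_MInfty[of x] F.val_not_MInfty[of w] unfolding s
      by (cases "fval Q a"; cases "fval Q b"; cases "fval Q x"; cases "fval Q w"; simp add: min_def split: if_splits)+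
    then show "ereal (r / 2) < valD Q (mm 1 x w 1 y - y)"
      unfolding v s by (simp add: min_def)
  qed
  \<comment> \<open>The p-th power of the unipotent map has off-diagonal entries divisible by p and
    so acts trivially on W, which forces the p-th power of its scalar to be 1.\<close>
  have unip: "?tors (mm 1 x w 1)" if x: "0 \<le> fval Q x" and w: "0 \<le> fval Q w" and xw: "x = 0 \<or> w = 0" for x w
    unfolding ratio_torsion_def
  proof (intro conjI allI impI)
    have iso: "perp_isometry (mm 1 (of_nat n * x) (of_nat n * w) 1)" for n
      using x w xw F.val_of_nat_nonneg[of n] by (intro mm_isometry) (auto simp: F.val_mult)
    then show "perp_isometry (mm 1 x w 1)"
      by (metis mult_1 of_nat_1)
    fix c assume c: "?ratio (mm 1 x w 1) c"
    have "?ratio (mm 1 (of_nat n * x) (of_nat n * w) 1) (c ^ n)" for n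
    proof (induction n)
      case 0
      show ?case
        using ratio_cong[OF ctx perp_isometry_id iso[of 0] id ratio_id[OF ctx]] mm_id by simp
    next
      case (Suc n)
      have "(\<lambda>y. mm 1 x w 1 (mm 1 (of_nat n * x) (of_nat n * w) 1 y)) = mm 1 (of_nat (Suc n) * x) (of_nat (Suc n) * w) 1"
        using xw by (auto simp: mm_comp algebra_simps)
      then show ?case
        using ratio_comp[OF ctx _ c iso Suc] iso[of 1] by simp
    qed
    from this[of p] have "?ratio (\<lambda>y. y) (c ^ p)"
    proof (cases "x = 0 \<and> w = 0")
      case True
      have "?ratio (mm 1 0 0 1) (c ^ p) \<Longrightarrow> ?ratio (\<lambda>y. y) (c ^ p)"
        by (rule ratio_cong[OF ctx _ perp_isometry_id id]) (use iso[of 0] mm_id in auto)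
      then show "?ratio (mm 1 (of_nat p * x) (of_nat p * w) 1) (c ^ p) \<Longrightarrow> ?ratio (\<lambda>y. y) (c ^ p)"
        using True by simp
    next
      case False
      have "0 < fval Q (of_nat p * x)" "0 < fval Q (of_nat p * w)"
        unfolding F.val_mult using x w p_residue by (auto intro: add_pos_nonneg)
      then show "?ratio (mm 1 (of_nat p * x) (of_nat p * w) 1) (c ^ p) \<Longrightarrow> ?ratio (\<lambda>y. y) (c ^ p)"
        using ratio_cong[OF ctx iso perp_isometry_id near] by blast
    qed
    then show "c ^ p = 1"
      using ratio_unique[OF ctx perp_isometry_id _ ratio_id[OF ctx]] by blast
  qed
  have inv_int: "0 \<le> fval Q (x / c)" if "0 \<le> fval Q x" "fval Q c = 0" for x c
  proof -
    have "c \<noteq> 0"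
      using that(2) by auto
    then show ?thesis
      using that F.val_inverse[of c] unfolding divide_inverse F.val_mult by simp
  qed
  \<comment> \<open>With a unit c the matrix is upper times lower times upper unipotent, the two
    upper entries being \<open>(a - 1) / c\<close> and \<open>(d - 1) / c\<close>.\<close>
  have SL2_unit: "?tors (mm a b c d)"
    if int: "0 \<le> fval Q a" "0 \<le> fval Q b" "0 \<le> fval Q c" "0 \<le> fval Q d" and det: "a * d - b * c = 1" and c: "fval Q c = 0"
    for a b c d
  proof -
    have c0: "c \<noteq> 0"
      using c by auto
    have x: "0 \<le> fval Q ((a - 1) / c)" "0 \<le> fval Q ((d - 1) / c)"
      using int c by (auto intro!: inv_int F.val_diff_ge)
    have b: "b = (a * d - 1) / c"
      using det c0 by (simp add: field_simps)
    have e2: "(a * (c * d) - c) / (c * c) = (a * d - 1) / c"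
      using c0 by (simp add: frac_eq_eq) (simp add: algebra_simps)
    have "mm a b c d = (\<lambda>y. mm 1 ((a - 1) / c) 0 1 (mm 1 0 c 1 (mm 1 ((d - 1) / c) 0 1 y)))"
      using c0 by (simp add: mm_comp fun_eq_iff b, simp add: field_simps, simp add: e2)
    then show ?thesis
      using ratio_torsion_comp[OF ctx unip ratio_torsion_comp[OF ctx unip unip]] x int i01 by simp
  qed
  \<comment> \<open>If c is not a unit, the determinant makes a one; adding the first row to the
    second gives the unit \<open>c + a\<close> and costs one unipotent factor.\<close>
  have SL2: "?tors (mm a b c d)"
    if int: "0 \<le> fval Q a" "0 \<le> fval Q b" "0 \<le> fval Q c" "0 \<le> fval Q d" and det: "a * d - b * c = 1"
    for a b c d
  proof (cases "fval Q c = 0")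
    case True
    then show ?thesis
      using SL2_unit int det by blast
  next
    case False
    then have cpos: "0 < fval Q c"
      using int by simp
    have "fval Q a = 0"
    proof (rule ccontr)
      assume "fval Q a \<noteq> 0"
      then have "0 < fval Q (a * d)" "0 < fval Q (b * c)"
        using int cpos unfolding F.val_mult by (auto intro: add_pos_nonneg add_nonneg_pos)
      then have "0 < fval Q (a * d - b * c)"
        by (rule F.val_diff_gt)
      then show False
        by (simp add: det)
    qed
    then have ca: "fval Q (c + a) = 0"
      using F.val_add_eq[of a c] cpos by (simp add: add.commute)
    have "?tors (mm a b (c + a) (d + b))"
      using int ca det by (intro SL2_unit F.val_add_ge) (auto simp: algebra_simps)
    moreover have "?tors (mm 1 0 (- 1) 1)"
      using i01 by (intro unip) auto
    moreover have "mm a b c d = (\<lambda>y. mm 1 0 (- 1) 1 (mm a b (c + a) (d + b) y))"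
      by (simp add: mm_comp fun_eq_iff)
    ultimately show ?thesis
      using ratio_torsion_comp[OF ctx] by simp
  qed
  have torus: "?ratio (torus_isometry t) 1" if t: "t \<in> E" "t \<noteq> 0" for t
  proof -
    have iso: "perp_isometry (torus_isometry t)"
      by (rule torus_isometry[OF t])
    obtain c where c: "?ratio (torus_isometry t) c"
      using ratio_exists[OF ctx iso] .
    obtain a b where ab: "0 \<le> fval Q a" "0 \<le> fval Q b" "a * a - disc * b * b = 1"
      "\<And>y. y \<in> perp \<Longrightarrow> torus_isometry t y = mm a (disc * b) b a y"
      by (rule torus_isometry_mm[OF t]) blast
    have "?tors (mm a (disc * b) b a)"
      using ab(1-3) fval_disc by (intro SL2) (auto simp: F.val_mult)
    then have "?tors (torus_isometry t)"
      by (rule torsI[OF iso _ ab(4)])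
    then have cp: "c ^ p = 1"
      using c by (simp add: ratio_torsion_def)
    \<comment> \<open>On the complement t acts as right multiplication by u, so powers of t act by
      powers of u, and periodicity of u under Frobenius passes to t even if t is not a unit.\<close>
    define u where "u = qconj Q t * inverse t"
    have uE: "u \<in> E"
      using t by (simp add: u_def mult_E qconj_E inverse_E)
    obtain k where "valD Q t = ereal k"
      using D.val_real t by blast
    then have uv: "valD Q u = 0"
      using t by (simp add: u_def valD_mult D.val_inverse zero_ereal_def)
    have tor_eq: "torus_isometry s y = y * (qconj Q s * inverse s)" if "s \<in> E" "y \<in> perp" for s y
      using perp_commute'[OF that(2,1)] by (simp add: torus_isometry_def mult.assoc)
    have ucomm: "qconj Q t * inverse t = inverse t * qconj Q t"
      by (intro commute_E qconj_E inverse_E t)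
    have upow: "qconj Q (t ^ n) * inverse (t ^ n) = u ^ n" for n
    proof (induction n)
      case (Suc n)
      have "qconj Q (t ^ Suc n) * inverse (t ^ Suc n) = qconj Q (t ^ n) * (qconj Q t * inverse t) * inverse (t ^ n)"
        by (simp add: qconj_mult power_commutes mult.assoc nonzero_inverse_mult_distrib t flip: power_Suc2)
          (metis power_commutes power_inverse mult.assoc)
      also have "\<dots> = u * (qconj Q (t ^ n) * inverse (t ^ n))"
        using commute_E[OF qconj_E[OF power_E[OF t(1), of n]] uE] by (simp add: u_def[symmetric] mult.assoc)
      finally show ?case
        using Suc by simp
    qed simp
    obtain n where n: "0 < n" "0 < valD Q (u ^ (p ^ n) - u)"
      using frobenius_period[OF uE] uv by auto
    have tn: "t ^ (p ^ n) \<in> E" "t ^ (p ^ n) \<noteq> 0"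
      using t by (auto intro: power_E)
    have "isometry_cong (torus_isometry (t ^ (p ^ n))) (torus_isometry t)"
      unfolding isometry_cong_def
    proof (intro ballI impI)
      fix y assume y: "y \<in> perp" "ereal (r / 2) \<le> valD Q y"
      have "torus_isometry (t ^ (p ^ n)) y - torus_isometry t y = y * (u ^ (p ^ n) - u)"
        unfolding tor_eq[OF tn(1) y(1)] tor_eq[OF t(1) y(1)] upow by (simp add: u_def right_diff_distrib)
      then show "ereal (r / 2) < valD Q (torus_isometry (t ^ (p ^ n)) y - torus_isometry t y)"
        using D.val_mult_gt(2)[of 0 "u ^ (p ^ n) - u" "r / 2" y] n(2) y(2) by (simp flip: zero_ereal_def)
    qed
    then have "?ratio (torus_isometry t) (c ^ (p ^ n))"
      using ratio_cong[OF ctx torus_isometry[OF tn] iso] torus_isometry_power[OF ctx t c] by blast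
    \<comment> \<open>As n is positive, p divides the exponent. The same number is also the scalar
      of t, whose action on W agrees with that of \<open>t ^ (p ^ n)\<close>.\<close>
    moreover have "c ^ (p ^ n) = 1"
      using n(1) cp by (cases n) (simp_all add: power_mult)
    ultimately show ?thesis
      by simp
  qed
  have "A (ract R t v) = ract R' t (A v)" if t: "t \<in> E - {0}" and v: "v \<in> rspace R" for t v
  proof -
    interpret V': vector_space "rscale R'"
      by (rule is_repD(1)[OF J_representationD(2)[OF R']])
    have Al: "J_linear R R' A"
      using A by (simp add: J_hom_def)
    have iso: "perp_isometry (torus_isometry t)"
      using torus_isometry t by simp
    have "S' (torus_isometry t) (A v) = A (S (torus_isometry t) v)"
      using torus[of t] t v by (simp add: ratio_def)
    then show ?thesis
      using weil_actionD(8)[OF S' t J_linearD(1)[OF Al v]] weil_actionD(8)[OF S t v]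
        J_linearD(3)[OF Al weil_actionD(1)[OF S iso v]] by simp
  qed
  then show thesis
    using that A by blast
qed

end

end

section \<open>Mackey theory\<close>

context tame_quaternion_algebra
begin

lemma OD_units_iff: "z \<in> OD_units Q \<longleftrightarrow> valD Q z = 0"
proof
  assume "z \<in> OD_units Q"
  then obtain w where w: "0 \<le> valD Q z" "0 \<le> valD Q w" "z * w = 1"
    unfolding OD_units_def OD_def by (auto simp: valD_nonneg_iff)
  have "valD Q z + valD Q w = 0"
    using valD_mult[of z w] w(3) valD_one by simp
  then show "valD Q z = 0"
    using w by (cases "valD Q z"; cases "valD Q w") auto
next
  assume z: "valD Q z = 0"
  then have z0: "z \<noteq> 0"
    by auto
  have "valD Q (inverse z) = 0"
    by (simp add: D.val_inverse[OF z0] z)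
  then show "z \<in> OD_units Q"
    using z z0 unfolding OD_units_def OD_def by (auto simp: valD_nonneg_iff[symmetric] intro!: exI[of _ "inverse z"])
qed

lemma Dfil_iff: "g \<in> Dfil Q t \<longleftrightarrow> ereal t \<le> valD Q (g - 1)"
  by (simp add: Dfil_def)

lemma Dfil_unit: "0 < t \<Longrightarrow> g \<in> Dfil Q t \<Longrightarrow> valD Q g = 0"
  using D.val_sub_one_pos_imp_val_zero[of g] less_le_trans[of 0 "ereal t" "valD Q (g - 1)"] by (simp add: Dfil_iff)

lemma Dfil_mult:
  assumes "0 < t" "g \<in> Dfil Q t" "h \<in> Dfil Q t"
  shows "g * h \<in> Dfil Q t"
proof -
  have "valD Q (g * (h - 1)) = valD Q (h - 1)"
    by (simp add: valD_mult Dfil_unit[OF assms(1,2)])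
  then have "ereal t \<le> valD Q (g * (h - 1) + (g - 1))"
    using assms by (intro D.val_add_ge) (auto simp: Dfil_iff)
  then show ?thesis
    by (simp add: Dfil_iff right_diff_distrib)
qed

lemma Dfil_conjugate:
  assumes "g \<noteq> 0" "x \<in> Dfil Q t"
  shows "g * x * inverse g \<in> Dfil Q t"
proof -
  have "g * x * inverse g - 1 = g * (x - 1) * inverse g"
    using assms by (simp add: right_diff_distrib left_diff_distrib)
  then show ?thesis
    using assms D.val_conjugate[OF assms(1), of "x - 1"] by (simp add: Dfil_iff)
qed

lemma Dfil_conjugate': "g \<noteq> 0 \<Longrightarrow> x \<in> Dfil Q t \<Longrightarrow> inverse g * x * g \<in> Dfil Q t"
  using Dfil_conjugate[of "inverse g" x t] by simp

lemma Dfil_inverse: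
  assumes "0 < t" "g \<in> Dfil Q t"
  shows "inverse g \<in> Dfil Q t"
proof -
  have v: "valD Q g = 0"
    by (rule Dfil_unit[OF assms])
  then have g0: "g \<noteq> 0"
    by auto
  have "inverse g - 1 = - (inverse g * (g - 1))"
    using g0 by (simp add: right_diff_distrib)
  then show ?thesis
    using assms(2) by (simp add: Dfil_iff valD_mult D.val_inverse[OF g0] v)
qed

lemma Dfil_one [simp]: "1 \<in> Dfil Q t"
  by (simp add: Dfil_iff)

lemma Dfil_antimono: "t \<le> u \<Longrightarrow> Dfil Q u \<subseteq> Dfil Q t"
  using order_trans[of "ereal t" "ereal u"] by (auto simp: Dfil_iff)

lemma subgroup_OD_units: "subgroup (OD_units Q) mult_grp"
proof (rule subgroup_mult_grpI)
  show "inverse x \<in> OD_units Q" if "x \<in> OD_units Q" for x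
    using that D.val_inverse[of x] by (cases "x = 0") (auto simp: OD_units_iff)
qed (auto simp: OD_units_iff valD_mult)

text \<open>An integral residue that is close enough to a unit is itself a unit, so the finite
  residue system restricts to units.\<close>

lemma finite_cosets:
  assumes "0 < t"
  obtains F where "finite F" "F \<subseteq> OD_units Q" "\<And>g. g \<in> OD_units Q \<Longrightarrow> \<exists>b\<in>F. g * inverse b \<in> Dfil Q t"
proof -
  obtain n where n: "t < real n"
    using reals_Archimedean2 by blast
  obtain S where S: "finite S"
    "\<And>x. 0 \<le> valD Q x \<Longrightarrow> \<exists>s\<in>S. 0 \<le> valD Q s \<and> ereal (real n) \<le> valD Q (x - s)"
    using finite_residues_D[of n] by blast
  have "\<exists>b\<in>S \<inter> OD_units Q. g * inverse b \<in> Dfil Q t" if g: "g \<in> OD_units Q" for g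
  proof -
    have gv: "valD Q g = 0"
      using g by (simp add: OD_units_iff)
    obtain b where b: "b \<in> S" "ereal (real n) \<le> valD Q (g - b)"
      using S(2)[of g] gv by auto
    have "ereal 0 < ereal (real n)"
      using n assms by simp
    then have "0 < valD Q (g - b)"
      using b(2) less_le_trans by (metis zero_ereal_def)
    then have bv: "valD Q b = 0"
      using D.val_add_eq[of g "- (g - b)"] D.val_minus[of "g - b"] gv by simp
    then have b0: "b \<noteq> 0"
      by auto
    have "g * inverse b - 1 = (g - b) * inverse b"
      using b0 by (simp add: left_diff_distrib)
    then have "valD Q (g * inverse b - 1) = valD Q (g - b)"
      by (simp add: valD_mult D.val_inverse[OF b0] bv)
    moreover have "ereal t \<le> ereal (real n)"
      using n by simp
    ultimately have "g * inverse b \<in> Dfil Q t"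
      using b(2) order_trans[of "ereal t" "ereal (real n)" "valD Q (g - b)"] by (simp add: Dfil_iff)
    then show ?thesis
      using b(1) bv by (auto simp: OD_units_iff)
  qed
  then show thesis
    using S(1) by (intro that[of "S \<inter> OD_units Q"]) auto
qed

lemma ind_is_rep:
  fixes R :: "('d, 'v::ab_group_add) rep"
  assumes G: "subgroup G mult_grp" and H: "H \<subseteq> G" and R: "is_rep (Dgrp H) R"
  shows "is_rep (Dgrp G) (ind Q G H R)"
proof -
  note rep = is_repD[OF R]
  note sub = subspaceD[OF rep(1,2)]
  interpret V: vector_space "rscale R"
    by (rule rep(1))
  have vs: "vector_space (rscale (ind Q G H R))"
    unfolding ind_def by unfold_locales (auto simp: fun_eq_iff V.scale_right_distrib V.scale_left_distrib)
  interpret W: vector_space "rscale (ind Q G H R)"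
    by (rule vs)
  have Gm: "x * y \<in> G" "1 \<in> G" if "x \<in> G" "y \<in> G" for x y
    using subgroup.m_closed[OF G, of x y] subgroup.one_closed[OF G] that by simp_all
  have G0: "x \<noteq> 0" if "x \<in> G" for x
    using subgroup.subset[OF G] that by auto
  have Gi: "inverse x \<in> G" if "x \<in> G" for x
    using subgroup.m_inv_closed[OF G that] inv_mult_grp[OF G0[OF that]] by simp
  have r0: "ract R h 0 = 0" if "h \<in> H" for h
    using rep(4)[OF that sub(1) sub(1)] by simp
  have "W.subspace (rspace (ind Q G H R))"
    unfolding W.subspace_def
  proof (intro conjI ballI allI)
    show "0 \<in> rspace (ind Q G H R)"
      using sub(1) r0 by (auto simp: ind_def intro!: exI[of _ 1])
    fix f assume f: "f \<in> rspace (ind Q G H R)"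
    then obtain n where n: "0 < n" "\<And>g k. g \<in> G \<Longrightarrow> k \<in> G \<Longrightarrow> k \<in> Dfil Q (real n) \<Longrightarrow> f (g * k) = f g"
      by (auto simp: ind_def)
    show "f + f' \<in> rspace (ind Q G H R)" if f': "f' \<in> rspace (ind Q G H R)" for f'
    proof -
      obtain n' where n': "0 < n'" "\<And>g k. g \<in> G \<Longrightarrow> k \<in> G \<Longrightarrow> k \<in> Dfil Q (real n') \<Longrightarrow> f' (g * k) = f' g"
        using f' by (auto simp: ind_def)
      have "(f + f') (g * k) = (f + f') g" if "g \<in> G" "k \<in> G" "k \<in> Dfil Q (real (max n n'))" for g k
        using n(2)[of g k] n'(2)[of g k] that subsetD[OF Dfil_antimono that(3), of "real n"]
          subsetD[OF Dfil_antimono that(3), of "real n'"] by simp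
      moreover have "0 < max n n'"
        using n(1) by simp
      moreover have "\<forall>h\<in>H. \<forall>g\<in>G. (f + f') (h * g) = ract R h ((f + f') g)"
        using f f' rep(4) by (simp add: ind_def)
      ultimately show ?thesis
        using f f' sub(2) by (auto simp: ind_def)
    qed
    show "rscale (ind Q G H R) c f \<in> rspace (ind Q G H R)" for c
    proof -
      have "\<forall>h\<in>H. \<forall>g\<in>G. rscale R c (f (h * g)) = ract R h (rscale R c (f g))"
        using f rep(5) by (simp add: ind_def)
      then show ?thesis
        using f sub(3) n by (auto simp: ind_def)
    qed
  qed
  moreover have "ract (ind Q G H R) g f \<in> rspace (ind Q G H R)"
    if g: "g \<in> G" and f: "f \<in> rspace (ind Q G H R)" for g f
  proof -
    obtain n where n: "0 < n" "\<And>x k. x \<in> G \<Longrightarrow> k \<in> G \<Longrightarrow> k \<in> Dfil Q (real n) \<Longrightarrow> f (x * k) = f x"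
      using f by (auto simp: ind_def)
    have fG: "f x = 0" if "x \<notin> G" for x
      using f that by (simp add: ind_def)
    have fV: "f x \<in> rspace R" if "x \<in> G" for x
      using f that by (simp add: ind_def)
    have fe: "f (h * x) = ract R h (f x)" if "h \<in> H" "x \<in> G" for h x
      using f that by (simp add: ind_def)
    have out: "x * g \<notin> G" if "x \<notin> G" for x
    proof
      assume "x * g \<in> G"
      then have "x * g * inverse g \<in> G"
        by (rule Gm(1)[OF _ Gi[OF g]])
      then show False
        using that G0[OF g] by (simp add: mult.assoc)
    qed
    \<comment> \<open>Translation by g replaces k by a conjugate, and the filtration subgroups are
      normal, so the same n works.\<close>
    have sm: "f (x * k * g) = f (x * g)" if x: "x \<in> G" and k: "k \<in> G" "k \<in> Dfil Q (real n)" for x k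
    proof -
      have "x * k * g = x * g * (inverse g * k * g)"
        using G0[OF g] by (simp add: mult.assoc) (simp flip: mult.assoc)
      moreover have "inverse g * k * g \<in> G"
        by (intro Gm(1) Gi g k)
      moreover have "inverse g * k * g \<in> Dfil Q (real n)"
        by (rule Dfil_conjugate'[OF G0[OF g] k(2)])
      ultimately show ?thesis
        using n(2)[of "x * g" "inverse g * k * g"] Gm x g by simp
    qed
    have "f (h * x * g) = ract R h (f (x * g))" if "h \<in> H" "x \<in> G" for h x
      using fe[OF that(1), of "x * g"] Gm[OF that(2) g] by (simp add: mult.assoc)
    then show ?thesis
      unfolding ind_def using fG fV out sm Gm g n(1) by auto
  qed
  ultimately show ?thesis
    unfolding is_rep_def using vs by (simp add: ind_def fun_eq_iff mult.assoc)
qed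

end

section \<open>Intertwining, and the groups T D_s and T_0 D_s\<close>

context depth_character
begin

abbreviation TT :: "'d set" where "TT \<equiv> E - {0}"
abbreviation Gs :: "'d set" where "Gs \<equiv> Dfil Q (r / 2)"
abbreviation OU :: "'d set" where "OU \<equiv> OD_units Q"
abbreviation HT :: "'d set" where "HT \<equiv> TT <#>\<^bsub>mult_grp\<^esub> Gs"
abbreviation H0 :: "'d set" where "H0 \<equiv> (TT \<inter> OU) <#>\<^bsub>mult_grp\<^esub> Gs"

text \<open>
  Write \<open>g = a (1 + w)\<close>.  Conjugation by \<open>1 + w\<close> moves a suitable \<open>1 + e1\<close> (if \<open>val w \<le> 0\<close>) or
  \<open>1 + w e1\<close> (if \<open>0 < val w < r / 2\<close>), with \<open>e1\<close> a multiple of \<open>e0\<close>, by the prescribed element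
  \<open>emb f * e0\<close> on which \<open>\<phi>\<close> is nontrivial.
\<close>

lemma intertwining_one_plus:
  assumes w: "w \<in> perp" "w \<noteq> 0" "\<not> ereal (r / 2) \<le> valD Q w"
  obtains x where "x \<in> Jset_plus" "(1 + w) * x * inverse (1 + w) \<in> Jset_plus"
    "\<phi> (pr0 ((1 + w) * x * inverse (1 + w))) \<noteq> \<phi> (pr0 x)"
proof -
  obtain f where f: "ereal r \<le> valD Q (emb Q f * e0)" "\<phi> (1 + emb Q f * e0) \<noteq> 1"
    using phi_generic by blast
  define e where "e = emb Q f * e0"
  define \<omega> where "\<omega> = - nrd Q w"
  have ww: "w * w = emb Q \<omega>"
    unfolding \<omega>_def by (rule perp_square[OF w(1)])
  have \<omega>0: "\<omega> \<noteq> 0"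
    using w(2) by (simp add: \<omega>_def)
  obtain v where v: "valD Q w = ereal v"
    using D.val_real[OF w(2)] .
  have vr: "v < r / 2"
    using w(3) v by simp
  have \<omega>v: "fval Q \<omega> = ereal (2 * v)"
  proof -
    have "valD Q (w * w) = ereal (2 * v)"
      by (simp add: valD_mult v)
    then show ?thesis
      by (simp add: ww)
  qed
  \<comment> \<open>The norm of \<open>1 + w\<close>; it turns the inverse of \<open>1 + w\<close>
    into \<open>1 - w\<close> up to a scalar.\<close>
  define c where "c = 1 - \<omega>"
  have cc: "(1 + w) * (1 - w) = emb Q c"
    using ww by (simp add: c_def algebra_simps emb_one)
  have vp: "valD Q (1 + w) = min 0 (ereal v)" "valD Q (1 - w) = min 0 (ereal v)"
    using valD_sum_perp[of 1 w] valD_sum_perp[of 1 "- w"] w(1) v by (auto simp: minus_perp)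
  have cv: "fval Q c = ereal (2 * min 0 v)"
  proof -
    have "valD Q (emb Q c) = min 0 (ereal v) + min 0 (ereal v)"
      by (simp only: cc[symmetric] valD_mult vp)
    then show ?thesis
      by (auto simp: min_def zero_ereal_def)
  qed
  then have c0: "c \<noteq> 0"
    by auto
  have inv: "inverse (1 + w) = (1 - w) * emb Q (inverse c)"
  proof (rule inverse_unique)
    show "(1 + w) * ((1 - w) * emb Q (inverse c)) = 1"
      using c0 by (simp add: cc emb_one flip: mult.assoc emb_mult)
  qed
  \<comment> \<open>The factor makes \<open>emb Q (2 * \<omega> / c) * e1\<close> equal to e. In
    both cases below this multiple is the change that conjugation causes in the E part.\<close>
  define e1 where "e1 = emb Q (c / (2 * \<omega>)) * e"
  have eE: "e \<in> E" "e1 \<in> E"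
    by (simp_all add: e_def e1_def mult_E e0_E)
  have we: "w * e1 = - (e1 * w)"
  proof -
    define k where "k = c / (2 * \<omega>) * f"
    have "e1 = emb Q k * e0"
      by (simp only: e1_def e_def k_def emb_mult mult.assoc)
    then have "w * e1 = emb Q k * (w * e0)" "e1 * w = emb Q k * (e0 * w)"
      by (simp_all only: emb_left_commute mult.assoc)
    then show ?thesis
      by (simp only: perp_e0[OF w(1)] mult_minus_right)
  qed
  have e1e: "emb Q (2 * \<omega> / c) * e1 = e"
    unfolding e1_def using c0 \<omega>0 two_neq_zero_F by (simp add: emb_one flip: mult.assoc emb_mult)
  have e1v: "ereal (r + 2 * min 0 v - 2 * v) \<le> valD Q e1"
  proof -
    have "2 * \<omega> \<noteq> 0"
      using \<omega>0 two_neq_zero_F by simp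
    moreover have "fval Q (2 * \<omega>) = ereal (2 * v)"
      by (simp add: F.val_mult fval_two \<omega>v)
    ultimately have "fval Q (c / (2 * \<omega>)) = ereal (2 * min 0 v - 2 * v)"
      unfolding divide_inverse[of c] F.val_mult[of c] using F.val_inverse[of "2 * \<omega>"] cv by simp
    then have "ereal (2 * min 0 v - 2 * v + r) \<le> valD Q e1"
      unfolding e1_def e_def using f(1) by (intro valD_mult_ge) simp_all
    then show ?thesis
      by (simp add: algebra_simps)
  qed
  have we1w: "w * e1 * w = - (emb Q \<omega> * e1)"
  proof -
    have "w * e1 * w = - (e1 * (w * w))"
      by (simp add: we mult.assoc)
    then show ?thesis
      by (simp add: ww emb_central)
  qed
  have half: "emb Q (inverse c) * emb Q (\<omega> + 1) = emb Q (2 * \<omega> / c) + 1"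
  proof -
    have "inverse c * (\<omega> + 1) = 2 * \<omega> / c + 1"
      using c0 by (simp add: field_simps) (simp add: c_def)
    then have "emb Q (inverse c * (\<omega> + 1)) = emb Q (2 * \<omega> / c + 1)"
      by (simp only:)
    then show ?thesis
      by (simp only: emb_mult emb_add emb_one)
  qed
  have w1: "1 + w \<noteq> 0"
    using vp(1) by (auto simp: min_def zero_ereal_def split: if_splits)
  \<comment> \<open>If \<open>v \<le> 0\<close>, e1 has depth r and \<open>1 + e1\<close> lies in
    J+. If \<open>0 < v\<close>, only depth \<open>r - 2 * v\<close> is known for e1, but
    \<open>w * e1\<close> has depth \<open>r - v\<close>, more than \<open>r / 2\<close> because
    \<open>v < r / 2\<close>.\<close>
  consider "v \<le> 0" | "0 < v"
    by linarith
  then show thesis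
  proof cases
    case 1
    let ?x = "1 + e1"
    have "(1 + w) * e1 * (1 - w) = e1 + w * e1 - e1 * w - w * e1 * w"
      by (simp add: distrib_right right_diff_distrib)
    also have "\<dots> = emb Q (\<omega> + 1) * e1 - 2 * (e1 * w)"
      unfolding we1w unfolding we by (simp add: emb_add distrib_right emb_one mult_2)
    finally have "(1 + w) * e1 * inverse (1 + w) = (emb Q (\<omega> + 1) * e1 - 2 * (e1 * w)) * emb Q (inverse c)"
      unfolding inv by (simp flip: mult.assoc)
    also have "\<dots> = (emb Q (2 * \<omega> / c) * e1 + e1) + - (emb Q (2 / c) * (e1 * w))"
    proof -
      have "emb Q (inverse c) * 2 = emb Q (2 / c)"
        by (simp add: divide_inverse mult.commute emb_mult emb_two)
      then show ?thesis
        unfolding emb_central[of "inverse c", symmetric]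
        by (simp add: right_diff_distrib distrib_right half flip: mult.assoc)
    qed
    finally have conj: "(1 + w) * ?x * inverse (1 + w) = (1 + (e1 + e)) + - (emb Q (2 / c) * (e1 * w))"
    proof -
      assume a: "(1 + w) * e1 * inverse (1 + w) = (emb Q (2 * \<omega> / c) * e1 + e1) + - (emb Q (2 / c) * (e1 * w))"
      have "(1 + w) * ?x * inverse (1 + w) = 1 + (1 + w) * e1 * inverse (1 + w)"
        by (simp only: distrib_left[of "1 + w" 1] distrib_right[of "1 + w" "(1 + w) * e1"] mult_1_right right_inverse[OF w1])
      then show ?thesis
        unfolding a e1e by (simp only: add_ac)
    qed
    have m: "1 + (e1 + e) \<in> E" "- (emb Q (2 / c) * (e1 * w)) \<in> perp"
      using eE w by (auto intro!: add_E minus_perp E_mult_perp)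
    have e1r: "ereal r \<le> valD Q e1" and er: "ereal r \<le> valD Q e"
      using e1v 1 f(1) by (simp_all add: e_def min_def split: if_splits)
    have "fval Q (2 / c) = ereal (- 2 * v)"
      using F.val_inverse[OF c0] cv 1 unfolding divide_inverse F.val_mult fval_two by simp
    then have "ereal (- 2 * v + (r + v)) \<le> valD Q (emb Q (2 / c) * (e1 * w))"
      using e1r v by (intro valD_mult_ge) (simp_all)
    then have "ereal (r / 2) < valD Q (emb Q (2 / c) * (e1 * w))"
      using 1 r_pos by (auto elim!: valD_ge_gt)
    then have "(1 + w) * ?x * inverse (1 + w) \<in> Jset_plus"
      unfolding Jset_plus_def conj using pr_unique[OF m] D.val_add_ge[OF e1r er] by simp
    moreover have "?x \<in> Jset_plus"
      using eE e1r by (simp add: Jset_plus_def pr0_add pr1_add)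
    moreover have "\<phi> (pr0 ((1 + w) * ?x * inverse (1 + w))) \<noteq> \<phi> (pr0 ?x)"
    proof -
      have "pr0 ?x = 1 + e1"
        using eE by (simp add: pr0_add)
      moreover have "\<phi> (1 + (e1 + e)) = \<phi> (1 + e1) * \<phi> (1 + e)"
        by (rule phi_add[OF eE(2,1) e1r er])
      moreover have "1 + e1 \<in> E - {0}"
        using eE valD_near_one[of r "1 + e1"] e1r r_pos by (auto intro: add_E)
      ultimately show ?thesis
        unfolding conj pr_unique(1)[OF m] using phi_neq_zero f(2) by (simp add: e_def)
    qed
    ultimately show thesis
      using that by blast
  next
    case 2
    let ?y = "w * e1" and ?x = "1 + w * e1"
    have cu: "fval Q c = 0"
      using cv 2 by simp
    have "(1 + w) * ?y * (1 - w) = w * e1 + w * w * e1 - w * e1 * w - w * (w * e1 * w)"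
      by (simp add: distrib_right right_diff_distrib mult.assoc)
    also have "\<dots> = emb Q (\<omega> + 1) * (w * e1) + emb Q (2 * \<omega>) * e1"
    proof -
      have 1: "w * - (emb Q \<omega> * e1) = - (emb Q \<omega> * (w * e1))"
        by (simp add: emb_left_commute)
      have 2: "emb Q (2 * \<omega>) * e1 = emb Q \<omega> * e1 + emb Q \<omega> * e1"
        by (simp only: mult_2 emb_add distrib_right)
      have 3: "emb Q (\<omega> + 1) * (w * e1) = emb Q \<omega> * (w * e1) + w * e1"
        by (simp only: emb_add distrib_right emb_one mult_1_left)
      show ?thesis
        unfolding we1w ww 1 2 3 by (simp only: diff_minus_eq_add add_ac)
    qed
    finally have "(1 + w) * ?y * inverse (1 + w) = (emb Q (\<omega> + 1) * (w * e1) + emb Q (2 * \<omega>) * e1) * emb Q (inverse c)"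
      unfolding inv by (simp flip: mult.assoc)
    also have "\<dots> = e + emb Q ((\<omega> + 1) / c) * (w * e1)"
    proof -
      have "emb Q (inverse c) * emb Q (2 * \<omega>) * e1 = e"
        unfolding e1e[symmetric] emb_mult[symmetric] by (simp only: divide_inverse mult.commute[of "inverse c"])
      moreover have "emb Q (inverse c) * emb Q (\<omega> + 1) = emb Q ((\<omega> + 1) / c)"
        unfolding emb_mult[symmetric] by (simp only: divide_inverse mult.commute[of "inverse c"])
      ultimately show ?thesis
        unfolding emb_central[of "inverse c", symmetric] distrib_left by (simp add: add.commute flip: mult.assoc)
    qed
    finally have a: "(1 + w) * ?y * inverse (1 + w) = e + emb Q ((\<omega> + 1) / c) * (w * e1)" .
    have "(1 + w) * ?x * inverse (1 + w) = 1 + (1 + w) * ?y * inverse (1 + w)"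
      by (simp only: distrib_left[of "1 + w" 1] distrib_right[of "1 + w" "(1 + w) * ?y"] mult_1_right right_inverse[OF w1])
    then have conj: "(1 + w) * ?x * inverse (1 + w) = (1 + e) + emb Q ((\<omega> + 1) / c) * (w * e1)"
      unfolding a by (simp add: add.assoc)
    have m: "1 + e \<in> E" "emb Q ((\<omega> + 1) / c) * (w * e1) \<in> perp" "w * e1 \<in> perp"
      using eE(1) E_mult_perp[OF emb_E perp_mult_E[OF w(1) eE(2)]] perp_mult_E[OF w(1) eE(2)]
      by (auto intro: add_E)
    have er: "ereal r \<le> valD Q e"
      using f(1) by (simp add: e_def)
    have "ereal (v + (r + 2 * min 0 v - 2 * v)) \<le> valD Q (w * e1)"
      using v e1v by (intro valD_mult_ge) simp_all
    then have yv: "ereal (r / 2) < valD Q (w * e1)"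
      using 2 vr by (auto elim!: valD_ge_gt)
    have "0 \<le> fval Q (\<omega> + 1)"
      using \<omega>v 2 by (intro F.val_add_ge) simp_all
    then have "0 \<le> fval Q ((\<omega> + 1) / c)"
      unfolding divide_inverse F.val_mult F.val_inverse[OF c0] cu by simp
    then have "ereal (r / 2) < valD Q (emb Q ((\<omega> + 1) / c) * (w * e1))"
      using yv by - (rule valD_mult_gt_right, simp_all)
    then have "(1 + w) * ?x * inverse (1 + w) \<in> Jset_plus"
      unfolding Jset_plus_def conj using pr_unique[OF m(1,2)] er by simp
    moreover have "?x \<in> Jset_plus"
      using m(3) yv by (simp add: Jset_plus_def pr0_add pr1_add)
    moreover have "\<phi> (pr0 ((1 + w) * ?x * inverse (1 + w))) \<noteq> \<phi> (pr0 ?x)"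
      unfolding conj pr_unique(1)[OF m(1,2)] using f(2) m(3) phi_one by (simp add: e_def pr0_add)
    ultimately show thesis
      using that by blast
  qed
qed

text \<open>Conjugation by T preserves J+ and the E part, so a nonzero E part of g can be factored
  out, leaving some \<open>1 + w\<close>. If the E part is 0, conjugation by g is the nontrivial
  automorphism of E and sends \<open>1 + e\<close> to \<open>1 - e\<close>.\<close>

lemma intertwining:
  assumes g: "g \<noteq> 0" "g \<notin> HT"
  obtains x where "x \<in> Jset_plus" "g * x * inverse g \<in> Jset_plus" "\<phi> (pr0 (g * x * inverse g)) \<noteq> \<phi> (pr0 x)"
proof -
  let ?a = "pr0 g" and ?b = "pr1 g"
  have gab: "g = ?a + ?b"
    by simp
  have aE: "?a \<in> E" and bP: "?b \<in> perp"
    by (simp_all add: pr0_in_E pr1_in_perp)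
  show thesis
  proof (cases "?a = 0")
    case True
    then have gP: "g \<in> perp"
      using gab bP by simp
    obtain f where f: "ereal r \<le> valD Q (emb Q f * e0)" "\<phi> (1 + emb Q f * e0) \<noteq> 1"
      using phi_generic by blast
    \<comment> \<open>Passing from e to \<open>- e\<close> shifts by \<open>- 2 * e\<close>, so half
      of the prescribed element is taken, with the opposite sign.\<close>
    define e where "e = emb Q (- f / 2) * e0"
    have ef: "- e + - e = emb Q f * e0"
    proof -
      have "f / 2 + f / 2 = f"
        using two_neq_zero_F by (simp add: field_simps)
      then have "emb Q (f / 2) * e0 + emb Q (f / 2) * e0 = emb Q f * e0"
        by (simp only: distrib_right[symmetric] emb_add[symmetric])
      then show ?thesis
        by (simp add: e_def)
    qed
    have eE: "e \<in> E" "- e \<in> E"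
      by (auto simp: e_def intro!: mult_E e0_E minus_E)
    have ev: "ereal r \<le> valD Q e"
    proof -
      have "e = - (emb Q (1 / 2) * (emb Q f * e0))"
        by (simp add: e_def flip: mult.assoc emb_mult)
      then show ?thesis
        using half_mult_ge[OF f(1)] by simp
    qed
    have cj: "g * (1 + e) * inverse g = 1 + - e"
    proof -
      have "g * e = - (e * g)"
        unfolding e_def using perp_e0[OF gP] by (simp add: emb_left_commute mult.assoc)
      then have "g * (1 + e) = (1 + - e) * g"
        by (simp add: distrib_left left_diff_distrib)
      then show ?thesis
        using g(1) by (simp add: mult.assoc)
    qed
    have "\<phi> (1 + (- e + - e + e)) = \<phi> (1 + (- e + - e)) * \<phi> (1 + e)"
    proof (rule phi_add)
      show "ereal r \<le> valD Q (- e + - e)"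
        unfolding ef by (rule f(1))
    qed (use eE ev in \<open>auto intro: add_E diff_E\<close>)
    then have "\<phi> (1 + - e) = \<phi> (1 + emb Q f * e0) * \<phi> (1 + e)"
      unfolding ef[symmetric] by simp
    moreover have "1 + e \<in> E - {0}"
      using eE valD_near_one[of r "1 + e"] ev r_pos by (auto intro: add_E)
    ultimately have "\<phi> (pr0 (g * (1 + e) * inverse g)) \<noteq> \<phi> (pr0 (1 + e))"
      unfolding cj using f(2) phi_neq_zero eE by (simp add: pr0_add pr0_diff)
    moreover have "1 + e \<in> Jset_plus" "g * (1 + e) * inverse g \<in> Jset_plus"
      unfolding cj using eE ev by (simp_all add: Jset_plus_def pr0_add pr1_add pr0_diff pr1_diff)
    ultimately show thesis
      by (intro that)
  next
    case False
    define w where "w = inverse ?a * ?b"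
    have wP: "w \<in> perp"
      by (simp add: w_def E_mult_perp inverse_E aE bP)
    have gw: "g = ?a * (1 + w)"
      unfolding w_def using False by (simp add: distrib_left flip: mult.assoc)
    have nin: "1 + w \<notin> Gs"
    proof
      assume "1 + w \<in> Gs"
      then have "g \<in> HT"
        unfolding set_mult_mult_grp using gw aE False by blast
      then show False
        using g by simp
    qed
    have wv: "\<not> ereal (r / 2) \<le> valD Q w"
      using nin by (simp add: Dfil_iff)
    have w0: "w \<noteq> 0"
      using wv by auto
    obtain x where x: "x \<in> Jset_plus" "(1 + w) * x * inverse (1 + w) \<in> Jset_plus"
      "\<phi> (pr0 ((1 + w) * x * inverse (1 + w))) \<noteq> \<phi> (pr0 x)"
      using intertwining_one_plus[OF wP w0 wv] .
    have w1: "1 + w \<noteq> 0"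
      using g(1) gw by auto
    let ?z = "(1 + w) * x * inverse (1 + w)"
    have gx: "g * x * inverse g = ?a * ?z * inverse ?a"
    proof -
      have "g * x * inverse g = (?a * (1 + w)) * x * inverse (?a * (1 + w))"
        by (simp flip: gw)
      then show ?thesis
        using False w1 by (simp add: nonzero_inverse_mult_distrib mult.assoc)
    qed
    have "pr0 (g * x * inverse g) = pr0 ?z"
      unfolding gx by (rule pr0_torus_conjugate[OF aE False])
    moreover have "g * x * inverse g \<in> Jset_plus"
      using x(2) D.val_conjugate[OF False, of "pr1 ?z"] unfolding gx
      by (simp add: Jset_plus_def pr0_torus_conjugate[OF aE False] pr1_torus_conjugate[OF aE False] torus_isometry_def)
    ultimately show thesis
      using that[OF x(1)] x(3) by simp
  qed
qed

lemma Jset_subset_Gs: "Jset \<subseteq> Gs"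
  using Jset_near_one by (auto simp: Dfil_iff)

lemma Gs_pos: "0 < r / 2"
  using r_pos by simp

text \<open>The E part of an element of D_s is a unit in T; once it is factored out, the rest is 1
  plus an element of the complement and lies in J.\<close>

lemma HT_eq_TJ: "HT = TT <#>\<^bsub>mult_grp\<^esub> Jset"
proof (intro equalityI subsetI)
  fix x assume "x \<in> HT"
  then obtain t y where x: "x = t * y" "t \<in> E" "t \<noteq> 0" "y \<in> Gs"
    by (auto simp: set_mult_mult_grp)
  let ?a = "pr0 y" and ?b = "pr1 y"
  have v: "ereal (r / 2) \<le> valD Q (y - 1)"
    using x by (simp add: Dfil_iff)
  have "ereal (r / 2) \<le> valD Q (?a - 1)" and bv: "ereal (r / 2) \<le> valD Q ?b"
    using valD_pr0(1)[OF v] valD_pr1(1)[OF v] by (simp_all add: pr0_diff pr1_diff)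
  then have a: "valD Q ?a = 0" "?a \<noteq> 0"
    using valD_near_one[OF _ Gs_pos, of ?a] by auto
  have m: "inverse ?a * ?b \<in> perp"
    by (simp add: E_mult_perp inverse_E pr0_in_E pr1_in_perp)
  have "ereal (r / 2) \<le> valD Q (inverse ?a * ?b)"
    using bv by (simp add: valD_mult D.val_inverse[OF a(2)] a(1))
  then have "1 + inverse ?a * ?b \<in> Jset"
    using pr_unique[OF one_E m] by (simp add: Jset_def)
  moreover have "x = t * ?a * (1 + inverse ?a * ?b)"
  proof -
    have "?a * (1 + inverse ?a * ?b) = y"
      using a(2) by (simp add: distrib_left flip: mult.assoc)
    then show ?thesis
      by (simp only: x(1) mult.assoc)
  qed
  moreover have "t * ?a \<in> TT"
    using x a by (simp add: mult_E pr0_in_E)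
  ultimately show "x \<in> TT <#>\<^bsub>mult_grp\<^esub> Jset"
    unfolding set_mult_mult_grp by blast
next
  fix x assume "x \<in> TT <#>\<^bsub>mult_grp\<^esub> Jset"
  then show "x \<in> HT"
    unfolding set_mult_mult_grp using Jset_subset_Gs by blast
qed

lemma HT_I: "t \<in> TT \<Longrightarrow> y \<in> Gs \<Longrightarrow> t * y \<in> HT"
  unfolding set_mult_mult_grp by blast

lemma HT_mult:
  assumes "x \<in> HT" "y \<in> HT"
  shows "x * y \<in> HT"
proof -
  obtain t a where x: "x = t * a" "t \<in> TT" "a \<in> Gs"
    using assms(1) unfolding set_mult_mult_grp by blast
  obtain u b where y: "y = u * b" "u \<in> TT" "b \<in> Gs"
    using assms(2) unfolding set_mult_mult_grp by blast
  have "x * y = (t * u) * ((inverse u * a * u) * b)"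
    using y(2) unfolding x(1) y(1) by (simp add: mult.assoc) (simp flip: mult.assoc)
  moreover have "(inverse u * a * u) * b \<in> Gs"
    using x y by (intro Dfil_mult[OF Gs_pos] Dfil_conjugate') auto
  ultimately show ?thesis
    using HT_I[of "t * u"] x y mult_E by auto
qed

lemma HT_inverse:
  assumes "x \<in> HT"
  shows "inverse x \<in> HT"
proof -
  obtain t a where x: "x = t * a" "t \<in> TT" "a \<in> Gs"
    using assms unfolding set_mult_mult_grp by blast
  have a0: "a \<noteq> 0"
    using Dfil_unit[OF Gs_pos x(3)] by auto
  have "inverse x = inverse t * (t * inverse a * inverse t)"
    using x(2) a0 unfolding x(1) by (simp add: nonzero_inverse_mult_distrib mult.assoc flip: mult.assoc[of "inverse t" t])
  moreover have "t * inverse a * inverse t \<in> Gs"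
    using x by (intro Dfil_conjugate Dfil_inverse[OF Gs_pos]) auto
  ultimately show ?thesis
    using HT_I[of "inverse t"] x by (auto intro: inverse_E)
qed

lemma HT_neq_zero: "x \<in> HT \<Longrightarrow> x \<noteq> 0"
  using Dfil_unit[OF Gs_pos, of 0] by (auto simp: set_mult_mult_grp)

lemma H0_eq: "H0 = HT \<inter> OU"
proof (intro equalityI subsetI)
  fix x assume "x \<in> H0"
  then show "x \<in> HT \<inter> OU"
    using Dfil_unit[OF Gs_pos] by (auto simp: set_mult_mult_grp OD_units_iff valD_mult)
next
  fix x assume "x \<in> HT \<inter> OU"
  then obtain t y where x: "x = t * y" "t \<in> TT" "y \<in> Gs" "valD Q x = 0"
    by (auto simp: set_mult_mult_grp OD_units_iff)
  then have "valD Q t = 0"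
    using Dfil_unit[OF Gs_pos, of y] by (simp add: valD_mult)
  then show "x \<in> H0"
    using x by (auto simp: set_mult_mult_grp OD_units_iff)
qed

lemma Gs_subset_H0: "Gs \<subseteq> H0"
  unfolding set_mult_mult_grp using Dfil_unit[OF Gs_pos] by (force simp: OD_units_iff intro: exI[of _ 1])

lemma OU_mult: "x \<in> OU \<Longrightarrow> y \<in> OU \<Longrightarrow> x * y \<in> OU"
  and OU_inverse: "x \<in> OU \<Longrightarrow> inverse x \<in> OU"
  and OU_neq_zero: "x \<in> OU \<Longrightarrow> x \<noteq> 0"
  and OU_one [simp]: "1 \<in> OU"
  using D.val_inverse[of x] by (cases "x = 0"; auto simp: OD_units_iff valD_mult)+

lemma H0_mult: "x \<in> H0 \<Longrightarrow> y \<in> H0 \<Longrightarrow> x * y \<in> H0"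
  unfolding H0_eq using HT_mult OU_mult by blast

lemma H0_inverse: "x \<in> H0 \<Longrightarrow> inverse x \<in> H0"
  unfolding H0_eq using HT_inverse OU_inverse by blast

lemma H0_subset_OU: "H0 \<subseteq> OU"
  unfolding H0_eq by blast

text \<open>What Mackey theory uses of \<open>\<rho>(\<Psi>)\<close>; \<open>\<eta>\<close> is the twisting character.\<close>

definition inducible :: "('d \<Rightarrow> complex) \<Rightarrow> ('d \<Rightarrow> complex) \<Rightarrow> ('d, 'v::ab_group_add) rep \<Rightarrow> bool" where
  "inducible \<eta> \<phi>' R \<longleftrightarrow> is_rep (Dgrp HT) R \<and> rspace R \<noteq> {0} \<and>
     (\<forall>U. module.subspace (rscale R) U \<and> U \<subseteq> rspace R \<and> (\<forall>g\<in>H0. ract R g ` U \<subseteq> U) \<longrightarrow> U = {0} \<or> U = rspace R) \<and>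
     (\<forall>h\<in>Jset_plus. \<forall>v\<in>rspace R. ract R h v = rscale R (\<eta> h * \<phi>' (pr0 h)) v) \<and>
     (\<exists>n::nat. 0 < n \<and> Dfil Q (real n) \<subseteq> Gs \<and> (\<forall>k\<in>Dfil Q (real n). \<forall>v\<in>rspace R. ract R k v = v))"

text \<open>Scalars do not change invariant subspaces and J lies in \<open>H0\<close>, so
  irreducibility over J carries over to the twisted representation of \<open>H0\<close>.\<close>

lemma inducible_twist:
  fixes R :: "('d, 'v::ab_group_add) rep"
  assumes R: "J_representation \<phi>' R"
    and eta: "quasi_character Q Dunits \<eta>"
    and small: "\<And>x. x \<in> E \<Longrightarrow> ereal r < valD Q x \<Longrightarrow> \<phi>' (1 + x) = 1"
  shows "inducible \<eta> \<phi>' (twist \<eta> R)"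
proof -
  note rep = is_repD[OF R[unfolded J_representation_def, THEN conjunct1, folded HT_eq_TJ]]
  note repJ = is_repD[of Jset R]
  note sub = subspaceD[OF rep(1,2)]
  interpret V: vector_space "rscale R"
    by (rule rep(1))
  have em: "\<eta> (x * y) = \<eta> x * \<eta> y" if "x \<noteq> 0" "y \<noteq> 0" for x y
    using eta that hom_mult[of \<eta> "Dgrp Dunits" mult_grp x y] by (simp add: quasi_character_def)
  have en: "\<eta> x \<noteq> 0" if "x \<noteq> 0" for x
    using eta that by (auto simp: quasi_character_def hom_def Pi_def)
  have e1: "\<eta> 1 = 1"
    using em[of 1 1] en[of 1] by simp
  have tw: "ract (twist \<eta> R) g v = rscale R (\<eta> g) (ract R g v)" "rscale (twist \<eta> R) = rscale R"
    "rspace (twist \<eta> R) = rspace R" for g v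
    by (simp_all add: twist_def)
  have c1: "is_rep (Dgrp HT) (twist \<eta> R)"
    unfolding is_rep_def tw using rep sub em HT_neq_zero e1
    by (auto simp: V.scale_right_distrib mult.commute)
  have c2: "rspace R \<noteq> {0}"
    using R by (simp add: J_representation_def irreducible_rep_def)
  have c3: "U = {0} \<or> U = rspace R"
    if U: "V.subspace U" "U \<subseteq> rspace R" "\<forall>g\<in>H0. ract (twist \<eta> R) g ` U \<subseteq> U" for U
  proof -
    have "ract R g u \<in> U" if g: "g \<in> Jset" and u: "u \<in> U" for g u
    proof -
      have "ract (twist \<eta> R) g u \<in> U"
        using U(3) g u Jset_subset_Gs Gs_subset_H0 by blast
      then have "rscale R (inverse (\<eta> g)) (rscale R (\<eta> g) (ract R g u)) \<in> U"
        unfolding tw by (rule V.subspace_scale[OF U(1)])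
      then show ?thesis
        using en[OF Jset_neq_zero[OF g]] by simp
    qed
    then show ?thesis
      using R U(1,2) by (auto simp: J_representation_def irreducible_rep_def)
  qed
  have c4: "ract (twist \<eta> R) h v = rscale R (\<eta> h * \<phi>' (pr0 h)) v" if "h \<in> Jset_plus" "v \<in> rspace R" for h v
    using R that by (simp add: J_representation_def tw)
  have c5: "\<exists>n::nat. 0 < n \<and> Dfil Q (real n) \<subseteq> Gs \<and> (\<forall>k\<in>Dfil Q (real n). \<forall>v\<in>rspace R. ract (twist \<eta> R) k v = v)"
  proof -
    obtain m :: nat where m: "0 < m" "\<forall>g\<in>Dunits \<inter> Dfil Q (real m). \<eta> g = 1"
      using eta by (auto simp: quasi_character_def)
    obtain l :: nat where l: "r < real l"
      using reals_Archimedean2 by blast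
    \<comment> \<open>Deep enough for the twisting character to be trivial and for the E part to lie
      beyond depth r, where \<phi>' is trivial.\<close>
    let ?n = "max m l"
    have "Dfil Q (real ?n) \<subseteq> Gs"
      using l r_pos by (intro Dfil_antimono) auto
    moreover have "ract (twist \<eta> R) k v = v" if k: "k \<in> Dfil Q (real ?n)" and v: "v \<in> rspace R" for k v
    proof -
      have kl: "ereal (real l) \<le> valD Q (k - 1)" "k \<in> Dfil Q (real m)"
        using k Dfil_antimono[of "real l" "real ?n"] Dfil_antimono[of "real m" "real ?n"] by (auto simp: Dfil_iff)
      then have kr: "ereal r < valD Q (k - 1)"
        using l by (auto elim: valD_ge_gt)
      have p: "ereal r < valD Q (pr0 k - 1)" "ereal r < valD Q (pr1 k)"
        using valD_pr0(2)[OF kr] valD_pr1(2)[OF kr] by (simp_all add: pr0_diff pr1_diff)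
      have kp: "k \<in> Jset_plus"
        using p r_pos by (auto simp: Jset_plus_def elim: valD_gt_mono)
      have "k \<noteq> 0"
        using kp Jset_plus_subset Jset_neq_zero by blast
      then have "\<eta> k = 1"
        using m(2) kl(2) by auto
      moreover have "\<phi>' (pr0 k) = 1"
        using small[of "pr0 k - 1"] p(1) by (simp add: diff_E pr0_in_E)
      ultimately show ?thesis
        using R kp v by (simp add: tw J_representation_def)
    qed
    moreover have "0 < ?n"
      using m(1) by simp
    ultimately show ?thesis
      by blast
  qed
  show ?thesis
    unfolding inducible_def
  proof (intro conjI allI impI ballI)
    show "U = {0} \<or> U = rspace (twist \<eta> R)"
      if "module.subspace (rscale (twist \<eta> R)) U \<and> U \<subseteq> rspace (twist \<eta> R) \<and> (\<forall>g\<in>H0. ract (twist \<eta> R) g ` U \<subseteq> U)" for U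
      using c3[of U] that by (simp add: tw(2,3))
  qed (use c1 c2 c4 c5 in \<open>simp_all add: tw(2,3)\<close>)
qed

end

section \<open>Irreducibility of the induced representation\<close>

context depth_character
begin

lemma inducibleD:
  fixes R :: "('d, 'v::ab_group_add) rep"
  assumes "inducible \<eta> \<phi>' R"
  shows "is_rep (Dgrp HT) R" and "rspace R \<noteq> {0}"
    and "module.subspace (rscale R) U \<Longrightarrow> U \<subseteq> rspace R \<Longrightarrow> (\<And>g u. g \<in> H0 \<Longrightarrow> u \<in> U \<Longrightarrow> ract R g u \<in> U) \<Longrightarrow>
      U = {0} \<or> U = rspace R"
    and "h \<in> Jset_plus \<Longrightarrow> v \<in> rspace R \<Longrightarrow> ract R h v = rscale R (\<eta> h * \<phi>' (pr0 h)) v"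
    and "\<exists>n::nat. 0 < n \<and> Dfil Q (real n) \<subseteq> Gs \<and> (\<forall>k\<in>Dfil Q (real n). \<forall>v\<in>rspace R. ract R k v = v)"
proof -
  note d = assms[unfolded inducible_def]
  show "is_rep (Dgrp HT) R" "rspace R \<noteq> {0}"
    using d by blast+
  show "U = {0} \<or> U = rspace R"
    if "module.subspace (rscale R) U" "U \<subseteq> rspace R" "\<And>g u. g \<in> H0 \<Longrightarrow> u \<in> U \<Longrightarrow> ract R g u \<in> U" for U
  proof -
    have "\<forall>g\<in>H0. ract R g ` U \<subseteq> U"
      using that(3) by blast
    then show ?thesis
      using d that(1,2) by blast
  qed
  show "ract R h v = rscale R (\<eta> h * \<phi>' (pr0 h)) v" if "h \<in> Jset_plus" "v \<in> rspace R" for h v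
    using d that by blast
  show "\<exists>n::nat. 0 < n \<and> Dfil Q (real n) \<subseteq> Gs \<and> (\<forall>k\<in>Dfil Q (real n). \<forall>v\<in>rspace R. ract R k v = v)"
    using d by blast
qed

lemma ind_simps [simp]:
  "ract (ind Q G H R) g f = (\<lambda>x. f (x * g))" "rscale (ind Q G H R) c f = (\<lambda>x. rscale R c (f x))"
  by (simp_all add: ind_def)

text \<open>Smoothness is automatic: a deep filtration subgroup acts trivially through R, and since
  it is normal, left equivariance turns this into invariance on the right.\<close>

lemma ind_space_iff:
  fixes R :: "('d, 'v::ab_group_add) rep"
  assumes R: "inducible \<eta> \<phi>' R" and H: "Gs \<subseteq> H" and G: "subgroup G mult_grp"
  shows "f \<in> rspace (ind Q G H R) \<longleftrightarrow> (\<forall>g. g \<notin> G \<longrightarrow> f g = 0) \<and> (\<forall>g\<in>G. f g \<in> rspace R) \<and>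
    (\<forall>h\<in>H. \<forall>g\<in>G. f (h * g) = ract R h (f g))" (is "_ \<longleftrightarrow> ?A \<and> ?B \<and> ?C")
proof -
  obtain n :: nat where n: "0 < n" "Dfil Q (real n) \<subseteq> Gs" "\<And>k v. k \<in> Dfil Q (real n) \<Longrightarrow> v \<in> rspace R \<Longrightarrow> ract R k v = v"
    using inducibleD(5)[OF R] by blast
  have "f (g * k) = f g" if B: ?B and C: ?C and g: "g \<in> G" and k: "k \<in> G \<inter> Dfil Q (real n)" for g k
  proof -
    have g0: "g \<noteq> 0"
      using subgroup.subset[OF G] g by auto
    have c: "g * k * inverse g \<in> Dfil Q (real n)"
      using k by (intro Dfil_conjugate[OF g0]) simp
    have "f (g * k) = f ((g * k * inverse g) * g)"
      using g0 by (simp add: mult.assoc)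
    also have "\<dots> = ract R (g * k * inverse g) (f g)"
      using C c n(2) H g by blast
    finally show ?thesis
      using n(3)[OF c] B g by simp
  qed
  then have "?B \<and> ?C \<Longrightarrow> \<exists>n::nat. 0 < n \<and> (\<forall>g\<in>G. \<forall>k\<in>G \<inter> Dfil Q (real n). f (g * k) = f g)"
    using n(1) by blast
  then show ?thesis
    by (auto simp: ind_def)
qed

lemma subgroup_nonzero: "subgroup {x::'d. x \<noteq> 0} mult_grp"
  by (rule subgroup_mult_grpI) auto

lemma Gs_subset_HT: "Gs \<subseteq> HT"
  using Gs_subset_H0 unfolding H0_eq by blast

lemmas ind_OU_iff = ind_space_iff[OF _ Gs_subset_H0 subgroup_OD_units]
lemmas ind_D_iff = ind_space_iff[OF _ Gs_subset_HT subgroup_nonzero]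

lemma ind_OU_rep:
  fixes R :: "('d, 'v::ab_group_add) rep"
  assumes R: "inducible \<eta> \<phi>' R"
  shows "is_rep (Dgrp OU) (ind Q OU H0 R)"
  by (intro ind_is_rep subgroup_OD_units H0_subset_OU is_rep_subgroup[OF inducibleD(1)[OF R]]) (simp add: H0_eq)

lemma ind_D_rep:
  fixes R :: "('d, 'v::ab_group_add) rep"
  assumes R: "inducible \<eta> \<phi>' R"
  shows "is_rep (Dgrp {x. x \<noteq> 0}) (ind Q {x. x \<noteq> 0} HT R)"
  by (intro ind_is_rep subgroup_nonzero inducibleD(1)[OF R]) (use HT_neq_zero in blast)

text \<open>The copy of R inside the induced representation, as functions supported on
  \<open>H0\<close>.\<close>

definition delta :: "('d, 'v::ab_group_add) rep \<Rightarrow> 'v \<Rightarrow> 'd \<Rightarrow> 'v" where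
  "delta R v = (\<lambda>x. if x \<in> H0 then ract R x v else 0)"

lemma H0_subset_HT: "x \<in> H0 \<Longrightarrow> x \<in> HT"
  unfolding H0_eq by blast

lemma H0_cancel: "h \<in> H0 \<Longrightarrow> h * x \<in> H0 \<longleftrightarrow> x \<in> H0"
  using H0_mult[of h x] H0_mult[OF H0_inverse, of h "h * x"] HT_neq_zero[OF H0_subset_HT, of h]
  by (auto simp flip: mult.assoc)

lemma H0_cancel_right: "h \<in> H0 \<Longrightarrow> x * h \<in> H0 \<longleftrightarrow> x \<in> H0"
  using H0_mult[of x h] H0_mult[of "x * h", OF _ H0_inverse, of h] HT_neq_zero[OF H0_subset_HT, of h]
  by (auto simp: mult.assoc)

context
  fixes R :: "('d, 'v::ab_group_add) rep" and \<eta> \<phi>'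
  assumes R: "inducible \<eta> \<phi>' R"
begin

lemma ract_zero: "h \<in> HT \<Longrightarrow> ract R h 0 = 0"
  using is_repD(4)[OF inducibleD(1)[OF R], of h 0 0] subspaceD(1)[OF is_repD(1,2)[OF inducibleD(1)[OF R]]] by simp

lemma delta_mem: "v \<in> rspace R \<Longrightarrow> delta R v \<in> rspace (ind Q OU H0 R)"
proof -
  note rep = is_repD[OF inducibleD(1)[OF R]]
  assume v: "v \<in> rspace R"
  have "delta R v (h * g) = ract R h (delta R v g)" if "h \<in> H0" for h g
    using rep(7)[OF H0_subset_HT H0_subset_HT v, of h g] that ract_zero[OF H0_subset_HT[OF that]]
    by (simp add: delta_def H0_cancel)
  moreover have "delta R v g \<in> rspace R" for g
    using rep(3)[OF H0_subset_HT v, of g] subspaceD(1)[OF rep(1,2)] by (simp add: delta_def)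
  moreover have "delta R v g = 0" if "g \<notin> OU" for g
    using that H0_subset_OU by (auto simp: delta_def)
  ultimately show ?thesis
    unfolding ind_OU_iff[OF R] by blast
qed

lemma delta_shift:
  assumes "h \<in> H0" "v \<in> rspace R"
  shows "delta R v (x * h) = delta R (ract R h v) x"
  using is_repD(7)[OF inducibleD(1)[OF R] H0_subset_HT H0_subset_HT assms(2), of x h] assms(1)
  by (simp add: delta_def H0_cancel_right)

lemma ind_eq_zero_iff:
  assumes f: "f \<in> rspace (ind Q OU H0 R)" and h: "h \<in> H0" and g: "g \<in> OU"
  shows "f (h * g) = 0 \<longleftrightarrow> f g = 0"
proof -
  have e: "f (h * g) = ract R h (f g)" if "h \<in> H0" "g \<in> OU" for h g
    using f that unfolding ind_OU_iff[OF R] by blast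
  have "f g = ract R (inverse h) (f (h * g))"
    using e[OF H0_inverse[OF h], of "h * g"] OU_mult[of h g] h g H0_subset_OU HT_neq_zero[OF H0_subset_HT[OF h]]
    by (auto simp flip: mult.assoc)
  then show ?thesis
    using e[OF h g] ract_zero[OF H0_subset_HT[OF h]] ract_zero[OF H0_subset_HT[OF H0_inverse[OF h]]] by auto
qed

end

text \<open>
  A nonzero invariant subspace contains a function supported on a single coset \<open>H0 a\<close>: if \<open>f\<close> does
  not vanish at \<open>a\<close> and \<open>b\<close> in distinct cosets, then \<open>f\<close> minus a multiple of a translate of \<open>f\<close>
  by some \<open>a\<^sup>-\<^sup>1 x a\<close> vanishes at \<open>a\<close> but not at \<open>b\<close>.
\<close>

lemma ind_irreducible:
  fixes R :: "('d, 'v::ab_group_add) rep"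
  assumes R: "inducible \<eta> \<phi> R" and em: "\<And>x y. x \<noteq> 0 \<Longrightarrow> y \<noteq> 0 \<Longrightarrow> \<eta> (x * y) = \<eta> x * \<eta> y"
    and en: "\<And>x. x \<noteq> 0 \<Longrightarrow> \<eta> x \<noteq> 0"
  shows "irreducible_rep (Dgrp OU) (ind Q OU H0 R)"
proof -
  let ?I = "ind Q OU H0 R"
  note D = inducibleD[OF R]
  note rep = is_repD[OF D(1)]
  note sub = subspaceD[OF rep(1,2)]
  note I = ind_OU_iff[OF R]
  note z = ind_eq_zero_iff[OF R]
  interpret V: vector_space "rscale R"
    by (rule rep(1))
  have Irep: "is_rep (Dgrp OU) ?I"
    by (rule ind_OU_rep[OF R])
  interpret W: vector_space "rscale ?I"
    by (rule is_repD(1)[OF Irep])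
  obtain F where F: "finite F" "F \<subseteq> OU" "\<And>g. g \<in> OU \<Longrightarrow> \<exists>b\<in>F. g * inverse b \<in> Gs"
    using finite_cosets[OF Gs_pos] by blast
  have Fcoset: "\<exists>b\<in>F. g * inverse b \<in> H0 \<and> f b \<noteq> 0" if f: "f \<in> rspace ?I" and g: "g \<in> OU" "f g \<noteq> 0" for f g
  proof -
    obtain b where b: "b \<in> F" "g * inverse b \<in> H0"
      using F(3)[OF g(1)] Gs_subset_H0 by blast
    have "g = (g * inverse b) * b"
      using OU_neq_zero[of b] b(1) F(2) by (auto simp: mult.assoc)
    then show ?thesis
      using z[OF f b(2), of b] b F(2) g(2) by (metis subsetD)
  qed
  \<comment> \<open>Measures the support by representatives of the cosets of D_s. Several may lie in
    one coset of \<open>H0\<close>; only finiteness and descent matter.\<close>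
  define N where "N f = {b \<in> F. f b \<noteq> 0}" for f :: "'d \<Rightarrow> 'v"
  have Nfin: "finite (N f)" for f
    using F(1) by (simp add: N_def)
  have N_empty: "f = 0" if f: "f \<in> rspace ?I" and e: "N f = {}" for f
  proof
    fix g show "f g = 0 g"
    proof (cases "g \<in> OU")
      case True
      then show ?thesis
        using Fcoset[OF f True] e by (auto simp: N_def)
    next
      case False
      then show ?thesis
        using f unfolding I by simp
    qed
  qed
  \<comment> \<open>\<eta> has commutative values, so it is constant on conjugacy classes and drops
    out when scalars are compared.\<close>
  have econj: "\<eta> (g * x * inverse g) = \<eta> x" if "g \<noteq> 0" "x \<noteq> 0" for g x
    using em[of "g * x" "inverse g"] em[of g x] em[of g "inverse g"] em[of 1 1] en[of 1] that by simp
  have "U = {0} \<or> U = rspace ?I"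
    if U: "W.subspace U" "U \<subseteq> rspace ?I" and inv: "\<And>g f. g \<in> OU \<Longrightarrow> f \<in> U \<Longrightarrow> (\<lambda>x. f (x * g)) \<in> U" for U
  proof -
    have single: "\<exists>f\<in>U. \<exists>a\<in>OU. f a \<noteq> 0 \<and> (\<forall>b\<in>N f. b * inverse a \<in> H0)" if "f \<in> U" "f \<noteq> 0" for f
      using that
    proof (induction "card (N f)" arbitrary: f rule: less_induct)
      case less
      have fI: "f \<in> rspace ?I"
        using less.prems U(2) by blast
      have fe: "f (h * g) = ract R h (f g)" if "h \<in> H0" "g \<in> OU" for h g
        using fI that unfolding I by blast
      obtain a where a: "a \<in> F" "f a \<noteq> 0"
        using N_empty[OF fI] less.prems(2) by (auto simp: N_def)
      have aO: "a \<in> OU"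
        using a F(2) by blast
      have a0: "a \<noteq> 0"
        by (rule OU_neq_zero[OF aO])
      show ?case
      proof (cases "\<forall>b\<in>N f. b * inverse a \<in> H0")
        case True
        then show ?thesis
          using less.prems(1) aO a(2) by blast
      next
        case False
        then obtain b where b: "b \<in> F" "f b \<noteq> 0" "b * inverse a \<notin> H0"
          by (auto simp: N_def)
        have bO: "b \<in> OU"
          using b F(2) by blast
        let ?g = "b * inverse a"
        have gO: "?g \<in> OU"
          by (intro OU_mult OU_inverse aO bO)
        have gn: "?g \<notin> HT"
          using b(3) gO unfolding H0_eq by blast
        obtain x where x: "x \<in> Jset_plus" "?g * x * inverse ?g \<in> Jset_plus"
          "\<phi> (pr0 (?g * x * inverse ?g)) \<noteq> \<phi> (pr0 x)"
          using intertwining[OF OU_neq_zero[OF gO] gn] .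
        have x0: "x \<noteq> 0"
          using x(1) Jset_plus_subset Jset_neq_zero by blast
        have JH: "y \<in> H0" if "y \<in> Jset_plus" for y
          using that Jset_plus_subset Jset_subset_Gs Gs_subset_H0 by blast
        \<comment> \<open>Right translation by this element is seen at a as left multiplication by
          x, and at b as left multiplication by its conjugate under
          \<open>b * inverse a\<close>.\<close>
        let ?k = "inverse a * x * a" and ?c = "\<eta> x * \<phi> (pr0 x)"
        have kO: "?k \<in> OU"
          using JH[OF x(1)] H0_subset_OU by (intro OU_mult OU_inverse aO) blast
        have kG: "?k \<in> Gs"
          using x(1) Jset_plus_subset Jset_subset_Gs by (intro Dfil_conjugate'[OF a0]) blast
        define f' where "f' = (\<lambda>y. f (y * ?k)) - rscale ?I ?c f"
        have f'U: "f' \<in> U"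
          unfolding f'_def by (intro W.subspace_diff[OF U(1)] W.subspace_scale[OF U(1)] inv[OF kO] less.prems(1))
        have f'I: "f' \<in> rspace ?I"
          using f'U U(2) by blast
        have f'_apply: "f' y = f (y * ?k) - rscale R ?c (f y)" for y
          by (simp add: f'_def)
        have "f (a * ?k) = f (x * a)"
          using a0 by (simp flip: mult.assoc)
        also have "\<dots> = rscale R ?c (f a)"
          using fe[OF JH[OF x(1)] aO] D(4)[OF x(1), of "f a"] fI aO unfolding I by simp
        finally have fa: "f' a = 0"
          by (simp add: f'_apply)
        have vb: "f b \<in> rspace R"
          using fI bO unfolding I by blast
        have "b * ?k = (?g * x * inverse ?g) * b"
          using a0 OU_neq_zero[OF bO] by (simp add: nonzero_inverse_mult_distrib mult.assoc)
        then have "f (b * ?k) = rscale R (\<eta> x * \<phi> (pr0 (?g * x * inverse ?g))) (f b)"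
          using fe[OF JH[OF x(2)] bO] D(4)[OF x(2) vb] econj[OF OU_neq_zero[OF gO] x0] by simp
        then have "f' b = rscale R (\<eta> x * \<phi> (pr0 (?g * x * inverse ?g)) - ?c) (f b)"
          unfolding f'_apply V.scale_left_diff_distrib by simp
        moreover have "\<eta> x * \<phi> (pr0 (?g * x * inverse ?g)) - ?c \<noteq> 0"
          using x(3) en[OF x0] by simp
        ultimately have fb: "f' b \<noteq> 0"
          using b(2) V.scale_eq_0_iff by simp
        \<comment> \<open>The translating element lies in the normal subgroup D_s, so translation
          does not enlarge the support.\<close>
        have sup: "f y \<noteq> 0" if y: "y \<in> OU" "f' y \<noteq> 0" for y
        proof
          assume 0: "f y = 0"
          have "y * ?k = (y * ?k * inverse y) * y"
            using OU_neq_zero[OF y(1)] by (simp add: mult.assoc)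
          moreover have "y * ?k * inverse y \<in> H0"
            using Dfil_conjugate[OF OU_neq_zero[OF y(1)] kG] Gs_subset_H0 by blast
          ultimately have "f (y * ?k) = 0"
            using z[OF fI _ y(1)] 0 by metis
          then show False
            using y(2) 0 by (simp add: f'_apply)
        qed
        have "N f' \<subset> N f"
          using sup F(2) fa a by (auto simp: N_def)
        then have "card (N f') < card (N f)"
          by (rule psubset_card_mono[OF Nfin])
        moreover have "f' \<noteq> 0"
          using fb by auto
        ultimately show ?thesis
          using less.hyps f'U by blast
      qed
    qed
    show ?thesis
    proof (cases "U \<subseteq> {0}")
      case True
      then show ?thesis
        using W.subspace_0[OF U(1)] by blast
    next
      case False
      then obtain f a where f: "f \<in> U" "a \<in> OU" "f a \<noteq> 0" "\<forall>b\<in>N f. b * inverse a \<in> H0"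
        using single by blast
      have fI: "f \<in> rspace ?I"
        using f(1) U(2) by blast
      have fe: "f (h * g) = ract R h (f g)" if "h \<in> H0" "g \<in> OU" for h g
        using fI that unfolding I by blast
      have fa: "f a \<in> rspace R"
        using fI f(2) unfolding I by blast
      have a0: "a \<noteq> 0"
        by (rule OU_neq_zero[OF f(2)])
      \<comment> \<open>The single coset of the support is moved to \<open>H0\<close> by a
        translation, which puts a function of the form \<open>delta\<close> into U.\<close>
      have "f (y * a) = delta R (f a) y" for y
      proof (cases "y \<in> H0")
        case True
        then show ?thesis
          using fe f(2) by (simp add: delta_def)
      next
        case n: False
        have "f (y * a) = 0"
        proof (rule ccontr)
          assume nz: "f (y * a) \<noteq> 0"
          then have yO: "y * a \<in> OU"
            using fI unfolding I by blast
          obtain b where b: "b \<in> F" "y * a * inverse b \<in> H0" "f b \<noteq> 0"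
            using Fcoset[OF fI yO nz] by blast
          have "b * inverse a \<in> H0"
            using f(4) b by (simp add: N_def)
          then have "(y * a * inverse b) * (b * inverse a) \<in> H0"
            by (rule H0_mult[OF b(2)])
          moreover have "(y * a * inverse b) * (b * inverse a) = y"
          proof -
            have "(y * a * inverse b) * (b * inverse a) = y * (a * ((inverse b * b) * inverse a))"
              by (simp only: mult.assoc)
            moreover have "b \<noteq> 0"
              using b(1) F(2) OU_neq_zero[of b] by blast
            ultimately show ?thesis
              using a0 by simp
          qed
          ultimately show False
            using n by simp
        qed
        then show ?thesis
          using n by (simp add: delta_def)
      qed
      then have da: "delta R (f a) \<in> U"
        using inv[OF f(2,1)] by simp
      \<comment> \<open>An \<open>H0\<close>-stable subspace of R that contains the nonzero vector
        \<open>f a\<close>, hence all of R.\<close>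
      let ?V = "{v \<in> rspace R. delta R v \<in> U}"
      have dadd: "delta R (v + w) = delta R v + delta R w" if "v \<in> rspace R" "w \<in> rspace R" for v w
        using that rep(4)[OF H0_subset_HT] by (auto simp: delta_def fun_eq_iff)
      have dscale: "delta R (rscale R c v) = rscale ?I c (delta R v)" if "v \<in> rspace R" for c v
        using that rep(5)[OF H0_subset_HT] by (auto simp: delta_def fun_eq_iff)
      have d0: "delta R 0 = 0"
        using ract_zero[OF R H0_subset_HT] by (auto simp: delta_def fun_eq_iff)
      have "V.subspace ?V"
        unfolding V.subspace_def using sub d0 dadd dscale W.subspace_0[OF U(1)] W.subspace_add[OF U(1)] W.subspace_scale[OF U(1)]
        by auto
      moreover have "ract R g v \<in> ?V" if "g \<in> H0" "v \<in> ?V" for g v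
      proof -
        have "delta R (ract R g v) = (\<lambda>x. delta R v (x * g))"
          using delta_shift[OF R that(1)] that(2) by auto
        then show ?thesis
          using inv[of g "delta R v"] that rep(3)[OF H0_subset_HT[OF that(1)]] H0_subset_OU by auto
      qed
      ultimately have "?V = {0} \<or> ?V = rspace R"
        by (intro D(3)) auto
      then have deltaU: "delta R v \<in> U" if "v \<in> rspace R" for v
        using da fa f(3) that by blast
      \<comment> \<open>Translates of \<open>delta\<close> functions lie in U; subtracting one
        removes a coset from the support of f.\<close>
      have "f \<in> U" if "f \<in> rspace ?I" for f
        using that
      proof (induction "card (N f)" arbitrary: f rule: less_induct)
        case less
        show ?case
        proof (cases "N f = {}")
          case True
          then show ?thesis
            using N_empty[OF less.prems] W.subspace_0[OF U(1)] by simp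
        next
          case False
          then obtain b where b: "b \<in> F" "f b \<noteq> 0"
            by (auto simp: N_def)
          have bO: "b \<in> OU"
            using b F(2) by blast
          have b0: "b \<noteq> 0"
            by (rule OU_neq_zero[OF bO])
          have fb: "f b \<in> rspace R"
            using less.prems bO unfolding I by blast
          let ?d = "\<lambda>x. delta R (f b) (x * inverse b)"
          have dU: "?d \<in> U"
            by (rule inv[OF OU_inverse[OF bO] deltaU[OF fb]])
          have d: "?d y = (if y * inverse b \<in> H0 then f y else 0)" for y
          proof -
            have "f y = ract R (y * inverse b) (f b)" if "y * inverse b \<in> H0"
            proof -
              have "f ((y * inverse b) * b) = ract R (y * inverse b) (f b)"
                using less.prems that bO unfolding I by blast
              then show ?thesis
                using b0 by (simp add: mult.assoc)
            qed
            then show ?thesis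
              by (simp add: delta_def)
          qed
          have "f - ?d \<in> rspace ?I"
            using dU U(2) by (intro W.subspace_diff[OF is_repD(2)[OF Irep]] less.prems) blast
          moreover have "N (f - ?d) \<subset> N f"
          proof -
            have "b * inverse b \<in> H0"
              using b0 Gs_subset_H0 by auto
            then have "b \<notin> N (f - ?d)"
              using d[of b] by (simp add: N_def)
            moreover have "N (f - ?d) \<subseteq> N f"
              using d by (auto simp: N_def split: if_splits)
            moreover have "b \<in> N f"
              using b by (simp add: N_def)
            ultimately show ?thesis
              by blast
          qed
          ultimately have "f - ?d \<in> U"
            using less.hyps[OF psubset_card_mono[OF Nfin]] by blast
          then have "(f - ?d) + ?d \<in> U"
            by (rule W.subspace_add[OF U(1) _ dU])
          then show ?thesis
            by simp
        qed
      qed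
      then show ?thesis
        using U(2) by blast
    qed
  qed
  moreover have "rspace ?I \<noteq> {0}"
  proof -
    obtain v where v: "v \<in> rspace R" "v \<noteq> 0"
      using D(2) sub(1) by blast
    have "delta R v 1 = v"
      using rep(6)[OF v(1)] subsetD[OF Gs_subset_H0 Dfil_one] by (simp add: delta_def)
    then have "delta R v \<noteq> 0"
      using v(2) by auto
    then show ?thesis
      using delta_mem[OF R v(1)] by blast
  qed
  ultimately show ?thesis
    unfolding irreducible_rep_def using Irep by (simp add: image_subset_iff)
qed

end

section \<open>Conjugation by \<sigma> and inequivalence\<close>

context depth_character
begin

definition cj :: "'d \<Rightarrow> 'd" where "cj z = inverse \<sigma> * z * \<sigma>"
definition cj' :: "'d \<Rightarrow> 'd" where "cj' z = \<sigma> * z * inverse \<sigma>"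

lemma cj_simps [simp]:
  "cj (cj' z) = z" "cj' (cj z) = z" "cj 1 = 1" "cj (x * y) = cj x * cj y" "cj (x + y) = cj x + cj y"
  "cj (x - y) = cj x - cj y" "cj (emb Q a) = emb Q a" "valD Q (cj z) = valD Q z" "valD Q (cj' z) = valD Q z"
  "cj z = 0 \<longleftrightarrow> z = 0" "cj (inverse z) = inverse (cj z)"
proof -
  note s0 = sigma_neq_zero
  have c: "inverse \<sigma> * (\<sigma> * a) = a" "\<sigma> * (inverse \<sigma> * a) = a" for a
    using s0 by (simp_all flip: mult.assoc)
  show "cj (cj' z) = z" "cj' (cj z) = z" "cj 1 = 1" "cj (x * y) = cj x * cj y" "cj (x + y) = cj x + cj y"
    "cj (x - y) = cj x - cj y"
    using s0 by (simp_all add: cj_def cj'_def mult.assoc c distrib_left distrib_right left_diff_distrib right_diff_distrib)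
  show "cj (emb Q a) = emb Q a"
    unfolding cj_def by (simp only: mult.assoc emb_central[of a \<sigma>] c)
  show "valD Q (cj z) = valD Q z" "valD Q (cj' z) = valD Q z"
    using D.val_conjugate[of "inverse \<sigma>" z] D.val_conjugate[of \<sigma> z] s0 by (simp_all add: cj_def cj'_def)
  show "cj z = 0 \<longleftrightarrow> z = 0"
    using s0 by (simp add: cj_def)
  show "cj (inverse z) = inverse (cj z)"
    using s0 by (cases "z = 0") (simp_all add: cj_def nonzero_inverse_mult_distrib mult.assoc)
qed

lemma cj_E: "z \<in> E \<Longrightarrow> cj z = qconj Q z"
  unfolding cj_def by (rule sigma_conjugate)

lemma cj_perp: "y \<in> perp \<Longrightarrow> cj y \<in> perp" and cj'_perp: "y \<in> perp \<Longrightarrow> cj' y \<in> perp"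
  unfolding cj_def cj'_def
  by (simp_all add: mult.assoc E_mult_perp perp_mult_E perp_mult_perp inverse_perp sigma_perp)

lemma cj_pr: "pr0 (cj z) = qconj Q (pr0 z)" "pr1 (cj z) = cj (pr1 z)"
proof -
  have "cj z = cj (pr0 z) + cj (pr1 z)"
    by (simp flip: cj_simps(5))
  then show "pr0 (cj z) = qconj Q (pr0 z)" "pr1 (cj z) = cj (pr1 z)"
    using pr_unique[OF qconj_E[OF pr0_in_E] cj_perp[OF pr1_in_perp], of z z] by (simp_all add: cj_E[OF pr0_in_E])
qed

lemma cj_Jset [simp]: "cj z \<in> Jset \<longleftrightarrow> z \<in> Jset" and cj_Jset_plus [simp]: "cj z \<in> Jset_plus \<longleftrightarrow> z \<in> Jset_plus"
proof -
  have "valD Q (qconj Q (pr0 z) - 1) = valD Q (pr0 z - 1)"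
    using valD_qconj[of "pr0 z - 1"] cj_E[OF diff_E[OF pr0_in_E one_E], of z] cj_E[OF pr0_in_E, of z] by simp
  then show "cj z \<in> Jset \<longleftrightarrow> z \<in> Jset" "cj z \<in> Jset_plus \<longleftrightarrow> z \<in> Jset_plus"
    by (simp_all add: Jset_def Jset_plus_def cj_pr)
qed

lemma cj_OU [simp]: "cj z \<in> OU \<longleftrightarrow> z \<in> OU"
  by (simp add: OD_units_iff)

lemma cj_Gs [simp]: "cj z \<in> Gs \<longleftrightarrow> z \<in> Gs"
  using cj_simps(6)[of z 1] cj_simps(8)[of "z - 1"] by (simp add: Dfil_iff)

lemma cj_TT: "z \<in> TT \<Longrightarrow> cj z \<in> TT"
  by (simp add: cj_E qconj_E)

lemma cj_HT: "z \<in> HT \<Longrightarrow> cj z \<in> HT" and cj'_HT: "z \<in> HT \<Longrightarrow> cj' z \<in> HT"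
proof -
  show "cj z \<in> HT" if z: "z \<in> HT" for z
  proof -
    obtain t y where x: "z = t * y" "t \<in> TT" "y \<in> Gs"
      using z unfolding set_mult_mult_grp by blast
    have "cj t * cj y \<in> HT"
      using x by (intro HT_I cj_TT) simp_all
    then show ?thesis
      by (simp add: x(1))
  qed
  assume "z \<in> HT"
  then obtain t y where x: "z = t * y" "t \<in> TT" "y \<in> Gs"
    unfolding set_mult_mult_grp by blast
  have "cj' t = qconj Q t"
    using conj_element x(2) by (simp add: conj_element_def cj'_def)
  moreover have "cj' t * cj' y = cj' z"
    using cj_simps(4)[of "cj' t" "cj' y"] cj_simps(2)[of "cj' t * cj' y"] by (simp add: x(1))
  moreover have "cj' y \<in> Gs"
    using cj_Gs[of "cj' y"] x(3) by simp
  moreover have "qconj Q t \<in> TT"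
    using x(2) by (simp add: qconj_E)
  ultimately show "cj' z \<in> HT"
    using HT_I by metis
qed

lemma cj'_H0: "z \<in> H0 \<Longrightarrow> cj' z \<in> H0"
  unfolding H0_eq using cj'_HT by (auto simp: OD_units_iff)

text \<open>Conjugation sends \<open>e0\<close> to \<open>- e0\<close>, so the witness of genericity
  changes sign. Everything proved for \<phi> becomes available for the conjugate character.\<close>

lemma conj_depth_character: "depth_character Q p E e0 \<sigma> r (\<lambda>z. \<phi> (qconj Q z))"
proof unfold_locales
  have q1: "qconj Q (1 + x) = 1 + qconj Q x" for x
    by (simp add: qconj_add)
  show "\<phi> (qconj Q (s * t)) = \<phi> (qconj Q s) * \<phi> (qconj Q t)" if "s \<in> E - {0}" "t \<in> E - {0}" for s t
    using that phi_mult[of "qconj Q t" "qconj Q s"] by (simp add: qconj_mult qconj_E)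
  show "\<phi> (qconj Q t) \<noteq> 0" if "t \<in> E - {0}" for t
    using that by (intro phi_neq_zero) (simp add: qconj_E)
  show "\<phi> (qconj Q (1 + (x + y))) = \<phi> (qconj Q (1 + x)) * \<phi> (qconj Q (1 + y))"
    if "x \<in> E" "y \<in> E" "ereal r \<le> valD Q x" "ereal r \<le> valD Q y" for x y
    using that phi_add[of "qconj Q x" "qconj Q y"] by (simp add: q1 qconj_add qconj_E)
  show "\<phi> (qconj Q (1 + x)) = 1" if "x \<in> E" "ereal r < valD Q x" for x
    using that phi_small[of "qconj Q x"] by (simp add: q1 qconj_E)
  obtain f where f: "ereal r \<le> valD Q (emb Q f * e0)" "\<phi> (1 + emb Q f * e0) \<noteq> 1"
    using phi_generic by blast
  have m: "qconj Q (1 + emb Q (- f) * e0) = 1 + emb Q f * e0"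
    unfolding q1 qconj_mult by (simp add: e0_pure emb_central)
  have "valD Q (emb Q (- f) * e0) = valD Q (emb Q f * e0)"
    by simp
  then show "\<exists>f. ereal r \<le> valD Q (emb Q f * e0) \<and> \<phi> (qconj Q (1 + emb Q f * e0)) \<noteq> 1"
    using f m by metis
qed

text \<open>An isomorphism sends a \<open>delta\<close> function to a function on which J+ acts by
  the same scalars. Evaluated at a point a where this is nonzero, it shows that conjugation by
  \<open>\<sigma> * a\<close> never changes \<phi> on elements of J+ that stay in J+, against
  \<open>intertwining\<close>.\<close>

lemma ind_not_iso:
  fixes R :: "('d, 'v::ab_group_add) rep" and R' :: "('d, 'w::ab_group_add) rep"
  assumes R: "inducible \<eta> \<phi> R" and R': "inducible \<eta> (\<lambda>z. \<phi> (qconj Q z)) R'"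
    and em: "\<And>x y. x \<noteq> 0 \<Longrightarrow> y \<noteq> 0 \<Longrightarrow> \<eta> (x * y) = \<eta> x * \<eta> y" and en: "\<And>x. x \<noteq> 0 \<Longrightarrow> \<eta> x \<noteq> 0"
    and sigma: "\<And>a. a \<in> OU \<Longrightarrow> \<sigma> * a \<notin> HT"
  shows "\<not> rep_iso (Dgrp OU) (ind Q OU H0 R) (ind Q OU H0 R')"
proof
  let ?I = "ind Q OU H0 R" and ?I' = "ind Q OU H0 R'"
  assume "rep_iso (Dgrp OU) ?I ?I'"
  then obtain P where P: "bij_betw P (rspace ?I) (rspace ?I')"
    "\<And>c f. f \<in> rspace ?I \<Longrightarrow> P (rscale ?I c f) = rscale ?I' c (P f)"
    "\<And>g f. g \<in> OU \<Longrightarrow> f \<in> rspace ?I \<Longrightarrow> P (ract ?I g f) = ract ?I' g (P f)"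
    unfolding rep_iso_def by auto
  note rep = is_repD[OF inducibleD(1)[OF R]] and rep' = is_repD[OF inducibleD(1)[OF R']]
  interpret V: vector_space "rscale R"
    by (rule rep(1))
  interpret V': vector_space "rscale R'"
    by (rule rep'(1))
  have JH: "y \<in> H0" if "y \<in> Jset_plus" for y
    using that Jset_plus_subset Jset_subset_Gs Gs_subset_H0 by blast
  obtain v where v: "v \<in> rspace R" "v \<noteq> 0"
    using inducibleD(2)[OF R] subspaceD(1)[OF rep(1,2)] by blast
  let ?f = "delta R v"
  have f: "?f \<in> rspace ?I"
    by (rule delta_mem[OF R v(1)])
  have z: "(\<lambda>x. 0) \<in> rspace ?I"
    unfolding ind_OU_iff[OF R] using V.subspace_0[OF rep(2)] ract_zero[OF R H0_subset_HT] by simp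
  have P0: "P (\<lambda>x. 0) = (\<lambda>x. 0)"
    using P(2)[OF z, of 0] by simp
  have "?f 1 = v"
    using rep(6)[OF v(1)] subsetD[OF Gs_subset_H0 Dfil_one] by (simp add: delta_def)
  then have "?f \<noteq> (\<lambda>x. 0)"
    using v(2) by metis
  then have "P ?f \<noteq> (\<lambda>x. 0)"
    using P(1) P0 f z by (metis bij_betw_imp_inj_on inj_onD)
  then obtain a where na: "P ?f a \<noteq> 0"
    by blast
  have g: "P ?f \<in> rspace ?I'"
    using P(1) f by (rule bij_betwE[THEN bspec])
  have a: "a \<in> OU"
    using g na unfolding ind_OU_iff[OF R'] by blast
  have a0: "a \<noteq> 0"
    by (rule OU_neq_zero[OF a])
  have va: "P ?f a \<in> rspace R'"
    using g a unfolding ind_OU_iff[OF R'] by blast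
  have key: "P ?f (a * x) = rscale R' (\<eta> x * \<phi> (pr0 x)) (P ?f a)" if x: "x \<in> Jset_plus" for x
  proof -
    have "ract ?I x ?f = rscale ?I (\<eta> x * \<phi> (pr0 x)) ?f"
      using delta_shift[OF R JH[OF x] v(1)] inducibleD(4)[OF R x v(1)] rep(5)[OF H0_subset_HT v(1)]
      by (auto simp: delta_def fun_eq_iff)
    then have "ract ?I' x (P ?f) = rscale ?I' (\<eta> x * \<phi> (pr0 x)) (P ?f)"
      using P(2)[OF f] P(3)[OF _ f, of x] JH[OF x] H0_subset_OU by auto
    then show ?thesis
      by (simp add: fun_eq_iff)
  qed
  have s0: "\<sigma> * a \<noteq> 0"
    using a0 sigma_neq_zero by simp
  obtain x where x: "x \<in> Jset_plus" "\<sigma> * a * x * inverse (\<sigma> * a) \<in> Jset_plus"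
    "\<phi> (pr0 (\<sigma> * a * x * inverse (\<sigma> * a))) \<noteq> \<phi> (pr0 x)"
    using intertwining[OF s0 sigma[OF a]] .
  let ?y = "a * x * inverse a"
  have x0: "x \<noteq> 0"
    using x(1) Jset_plus_subset Jset_neq_zero by blast
  have sy: "\<sigma> * a * x * inverse (\<sigma> * a) = cj' ?y"
    using a0 sigma_neq_zero by (simp add: cj'_def nonzero_inverse_mult_distrib mult.assoc)
  have y: "?y \<in> Jset_plus"
    using x(2) cj_Jset_plus[of "cj' ?y"] unfolding sy cj_simps(1) by simp
  have py: "qconj Q (pr0 ?y) = pr0 (cj' ?y)"
    using cj_pr(1)[of "cj' ?y"] unfolding cj_simps(1) by simp
  have "\<eta> ?y = \<eta> x"
    using em[of "a * x" "inverse a"] em[of a x] em[of a "inverse a"] em[of 1 1] en[of 1] a0 x0 by simp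
  moreover have "P ?f (?y * a) = ract R' ?y (P ?f a)"
    using g JH[OF y] a unfolding ind_OU_iff[OF R'] by blast
  moreover have "?y * a = a * x"
    using a0 by (simp add: mult.assoc)
  ultimately have "rscale R' (\<eta> x * \<phi> (pr0 x)) (P ?f a) = rscale R' (\<eta> x * \<phi> (pr0 (cj' ?y))) (P ?f a)"
    using key[OF x(1)] inducibleD(4)[OF R' y va] py by simp
  then have "\<phi> (pr0 x) = \<phi> (pr0 (cj' ?y))"
    using na en[OF x0] by simp
  then show False
    using x(3) unfolding sy by simp
qed

section \<open>Compact induction and restriction to the units\<close>

lemma D_apply:
  fixes R :: "('d, 'v::ab_group_add) rep"
  assumes R: "inducible \<eta> \<phi>' R" and f: "f \<in> rspace (ind Q {x. x \<noteq> 0} HT R)"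
  shows "g \<noteq> 0 \<Longrightarrow> f g \<in> rspace R" "h \<in> HT \<Longrightarrow> g \<noteq> 0 \<Longrightarrow> f (h * g) = ract R h (f g)" "f 0 = 0"
proof -
  note d = f[unfolded ind_D_iff[OF R]]
  show "f g \<in> rspace R" if "g \<noteq> 0"
    using bspec[OF d[THEN conjunct2, THEN conjunct1], of g] that by simp
  show "f (h * g) = ract R h (f g)" if "h \<in> HT" "g \<noteq> 0"
    using bspec[OF bspec[OF d[THEN conjunct2, THEN conjunct2] that(1)], of g] that(2) by simp
  show "f 0 = 0"
    using d[THEN conjunct1] by simp
qed

text \<open>Finitely many double cosets, together with finitely many cosets of D_s in the units,
  cover D by \<open>HT\<close> times a finite set, which is compact; so the support condition is
  always satisfied.\<close>

lemma cind_eq_ind: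
  fixes R :: "('d, 'v::ab_group_add) rep"
  assumes R: "inducible \<eta> \<phi>' R" and X: "finite X" "0 \<notin> X"
    and cover: "\<And>g. g \<noteq> 0 \<Longrightarrow> \<exists>t\<in>TT. \<exists>x\<in>X. \<exists>k\<in>OU. g = t * x * k"
  shows "cind Q Dunits HT R = ind Q {x. x \<noteq> 0} HT R"
proof -
  obtain F where F: "finite F" "F \<subseteq> OU" "\<And>g. g \<in> OU \<Longrightarrow> \<exists>b\<in>F. g * inverse b \<in> Gs"
    using finite_cosets[OF Gs_pos] by blast
  let ?C = "(\<lambda>(x, b). x * b) ` (X \<times> F)"
  have "openin (Dtop Q) UNIV"
    by (simp add: openin_Dtop)
  then have "topspace (Dtop Q) = UNIV"
    using openin_subset by blast
  then have C: "compactin (Dtop Q) ?C" "?C \<subseteq> {x. x \<noteq> 0}"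
    using F X OU_neq_zero by (auto intro!: finite_imp_compactin)
  have *: "g \<in> HT <#>\<^bsub>mult_grp\<^esub> ?C" if g: "g \<noteq> 0" for g
  proof -
    obtain t x k where tk: "t \<in> TT" "x \<in> X" "k \<in> OU" "g = t * x * k"
      using cover[OF g] by blast
    obtain b where b: "b \<in> F" "k * inverse b \<in> Gs"
      using F(3)[OF tk(3)] by blast
    have n: "x \<noteq> 0" "b \<noteq> 0"
      using tk(2) X(2) b(1) F(2) OU_neq_zero by auto
    have "g = (t * (x * (k * inverse b) * inverse x)) * (x * b)"
      using n by (simp add: tk(4) mult.assoc) (simp flip: mult.assoc)
    moreover have "t * (x * (k * inverse b) * inverse x) \<in> HT"
      by (intro HT_I tk(1) Dfil_conjugate n b(2))
    moreover have "x * b \<in> ?C"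
      using tk(2) b(1) by force
    ultimately show ?thesis
      unfolding set_mult_mult_grp by blast
  qed
  have "\<exists>C. compactin (Dtop Q) C \<and> C \<subseteq> {x. x \<noteq> 0} \<and> {g. f g \<noteq> 0} \<subseteq> HT <#>\<^bsub>mult_grp\<^esub> C"
    if f: "f \<in> rspace (ind Q {x. x \<noteq> 0} HT R)" for f
  proof -
    have "g \<in> HT <#>\<^bsub>mult_grp\<^esub> ?C" if "f g \<noteq> 0" for g
      using * D_apply(3)[OF R f] that by (cases "g = 0") auto
    then show ?thesis
      using C by (intro exI[of _ ?C]) auto
  qed
  then have "{f \<in> rspace (ind Q {x. x \<noteq> 0} HT R).
      \<exists>C. compactin (Dtop Q) C \<and> C \<subseteq> {x. x \<noteq> 0} \<and> {g. f g \<noteq> 0} \<subseteq> HT <#>\<^bsub>mult_grp\<^esub> C} = rspace (ind Q {x. x \<noteq> 0} HT R)"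
    by blast
  then show ?thesis
    by (simp add: cind_def)
qed

text \<open>The equivariant extension from the units to T times the units, by 0 elsewhere. Two
  choices of t differ by an element of \<open>H0\<close>, so the choice is immaterial on functions
  in the induced space.\<close>

definition extend :: "('d, 'v::ab_group_add) rep \<Rightarrow> ('d \<Rightarrow> 'v) \<Rightarrow> 'd \<Rightarrow> 'v" where
  "extend R f g = (if \<exists>t\<in>TT. inverse t * g \<in> OU
     then let t = SOME t. t \<in> TT \<and> inverse t * g \<in> OU in ract R t (f (inverse t * g)) else 0)"

definition restr :: "('d \<Rightarrow> 'v::ab_group_add) \<Rightarrow> 'd \<Rightarrow> 'v" where
  "restr f g = (if g \<in> OU then f g else 0)"

lemma TT_HT: "t \<in> TT \<Longrightarrow> t \<in> HT"
  using HT_I[OF _ Dfil_one] by fastforce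

lemma extend_eq:
  fixes R :: "('d, 'v::ab_group_add) rep"
  assumes R: "inducible \<eta> \<phi>' R" and f: "f \<in> rspace (ind Q OU H0 R)" and t: "t \<in> TT" and k: "k \<in> OU"
  shows "extend R f (t * k) = ract R t (f k)"
proof -
  let ?P = "\<lambda>u. u \<in> TT \<and> inverse u * (t * k) \<in> OU"
  define u where "u = (SOME u. ?P u)"
  have P: "?P t"
    using t k by (simp flip: mult.assoc)
  then have u: "?P u"
    unfolding u_def by (rule someI)
  have ut: "inverse u * t \<in> TT"
    using u t by (simp add: mult_E inverse_E)
  have "inverse u * t = (inverse u * (t * k)) * inverse k"
    using OU_neq_zero[OF k] by (simp add: mult.assoc)
  then have "inverse u * t \<in> OU"
    using OU_mult OU_inverse k u by simp
  then have h: "inverse u * t \<in> H0"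
    using TT_HT[OF ut] unfolding H0_eq by blast
  have fk: "f k \<in> rspace R"
    using f k unfolding ind_OU_iff[OF R] by blast
  have "f (inverse u * (t * k)) = ract R (inverse u * t) (f k)"
    using f h k unfolding ind_OU_iff[OF R] by (simp flip: mult.assoc)
  moreover have "ract R u (ract R (inverse u * t) (f k)) = ract R t (f k)"
    using is_repD(7)[OF inducibleD(1)[OF R] TT_HT TT_HT[OF ut] fk, of u] u by (simp flip: mult.assoc)
  moreover have "extend R f (t * k) = ract R u (f (inverse u * (t * k)))"
    unfolding extend_def u_def Let_def using P by auto
  ultimately show ?thesis
    by simp
qed

lemma extend_outside: "(\<And>t k. t \<in> TT \<Longrightarrow> k \<in> OU \<Longrightarrow> g \<noteq> t * k) \<Longrightarrow> extend R f g = 0"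
proof -
  assume a: "\<And>t k. t \<in> TT \<Longrightarrow> k \<in> OU \<Longrightarrow> g \<noteq> t * k"
  have "\<not> (\<exists>t\<in>TT. inverse t * g \<in> OU)"
  proof
    assume "\<exists>t\<in>TT. inverse t * g \<in> OU"
    then obtain t where t: "t \<in> TT" "inverse t * g \<in> OU"
      by blast
    then show False
      using a[OF t] by (simp flip: mult.assoc)
  qed
  then show ?thesis
    by (simp add: extend_def)
qed

lemma extend_mem:
  fixes R :: "('d, 'v::ab_group_add) rep"
  assumes R: "inducible \<eta> \<phi>' R" and f: "f \<in> rspace (ind Q OU H0 R)"
  shows "extend R f \<in> rspace (ind Q {x. x \<noteq> 0} HT R)"
proof -
  note rep = is_repD[OF inducibleD(1)[OF R]]
  have fV: "f k \<in> rspace R" if "k \<in> OU" for k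
    using f that unfolding ind_OU_iff[OF R] by blast
  have "extend R f 0 = 0"
    using OU_neq_zero by (intro extend_outside) auto
  moreover have "extend R f g \<in> rspace R" for g
  proof (cases "\<exists>t\<in>TT. \<exists>k\<in>OU. g = t * k")
    case True
    then obtain t k where g: "t \<in> TT" "k \<in> OU" "g = t * k"
      by blast
    show ?thesis
      unfolding g(3) extend_eq[OF R f g(1,2)] by (rule rep(3)[OF TT_HT[OF g(1)] fV[OF g(2)]])
  next
    case False
    then have "extend R f g = 0"
      by (intro extend_outside) blast
    then show ?thesis
      using subspaceD(1)[OF rep(1,2)] by simp
  qed
  moreover have "extend R f (h * g) = ract R h (extend R f g)" if h: "h \<in> HT" for h g
  proof -
    obtain t y where ty: "h = t * y" "t \<in> TT" "y \<in> Gs"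
      using h unfolding set_mult_mult_grp by blast
    have yv: "y \<in> H0" "y \<noteq> 0" "y \<in> OU"
      using ty(3) Gs_subset_H0 H0_subset_OU OU_neq_zero by blast+
    show ?thesis
    proof (cases "\<exists>u\<in>TT. \<exists>k\<in>OU. g = u * k")
      case True
      then obtain u k where uk: "u \<in> TT" "k \<in> OU" "g = u * k"
        by blast
      have u0: "u \<noteq> 0"
        using uk(1) by simp
      let ?y = "inverse u * y * u"
      have y: "?y \<in> H0" "?y \<in> HT"
        using Dfil_conjugate'[OF u0 ty(3)] Gs_subset_H0 H0_subset_HT by blast+
      have tu: "t * u \<in> TT"
        using ty(2) uk(1) by (simp add: mult_E)
      have "h * g = (t * u) * (?y * k)"
        using u0 by (simp add: ty(1) uk(3) mult.assoc) (simp flip: mult.assoc)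
      then have "extend R f (h * g) = ract R (t * u) (f (?y * k))"
        using extend_eq[OF R f tu OU_mult] y(1) H0_subset_OU uk(2) by auto
      also have "f (?y * k) = ract R ?y (f k)"
        using f y(1) uk(2) unfolding ind_OU_iff[OF R] by blast
      also have "ract R (t * u) (ract R ?y (f k)) = ract R (t * u * ?y) (f k)"
        using rep(7)[OF TT_HT[OF tu] y(2) fV[OF uk(2)]] by simp
      also have "t * u * ?y = h * u"
        using u0 by (simp add: ty(1) mult.assoc) (simp flip: mult.assoc)
      also have "ract R (h * u) (f k) = ract R h (extend R f g)"
        using rep(7)[OF h TT_HT[OF uk(1)] fV[OF uk(2)]] extend_eq[OF R f uk(1,2)] uk(3) by simp
      finally show ?thesis .
    next
      case False
      have t0: "t \<noteq> 0"
        using ty(2) by simp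
      \<comment> \<open>T times the units is stable under left multiplication by \<open>HT\<close>,
        because D_s can be carried past T into the units.\<close>
      have "h * g \<noteq> u * k" if u: "u \<in> TT" "k \<in> OU" for u k
      proof
        assume e: "h * g = u * k"
        let ?u = "inverse t * u"
        have u': "?u \<in> TT"
          using u ty(2) by (simp add: mult_E inverse_E)
        have "g = inverse y * (inverse t * (h * g))"
          using t0 yv(2) by (simp add: ty(1) mult.assoc) (simp flip: mult.assoc)
        also have "\<dots> = ?u * ((inverse ?u * inverse y * ?u) * k)"
          using u' t0 unfolding e by (simp add: mult.assoc) (simp flip: mult.assoc)
        finally have g: "g = ?u * ((inverse ?u * inverse y * ?u) * k)" .
        have "inverse ?u * inverse y * ?u \<in> Gs"
          using u' by (intro Dfil_conjugate' Dfil_inverse[OF Gs_pos ty(3)]) simp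
        then have "inverse ?u * inverse y * ?u \<in> OU"
          using Gs_subset_H0 H0_subset_OU by blast
        then have "(inverse ?u * inverse y * ?u) * k \<in> OU"
          by (rule OU_mult[OF _ u(2)])
        then show False
          using False g u' by blast
      qed
      moreover have "g \<noteq> u * k" if "u \<in> TT" "k \<in> OU" for u k
        using False that by blast
      ultimately show ?thesis
        using extend_outside[of "h * g" R f] extend_outside[of g R f] ract_zero[OF R h] by simp
    qed
  qed
  ultimately show ?thesis
    unfolding ind_D_iff[OF R] by simp
qed

lemma restr_mem:
  fixes R :: "('d, 'v::ab_group_add) rep"
  assumes R: "inducible \<eta> \<phi>' R" and f: "f \<in> rspace (ind Q {x. x \<noteq> 0} HT R)"
  shows "restr f \<in> rspace (ind Q OU H0 R)"
  using f OU_neq_zero H0_subset_HT H0_subset_OU OU_mult unfolding ind_D_iff[OF R] ind_OU_iff[OF R]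
  by (auto simp: restr_def)

lemma restr_extend:
  fixes R :: "('d, 'v::ab_group_add) rep"
  assumes R: "inducible \<eta> \<phi>' R" and f: "f \<in> rspace (ind Q OU H0 R)"
  shows "restr (extend R f) = f"
proof
  fix g
  have "1 \<in> TT"
    by simp
  then have "extend R f g = f g" if "g \<in> OU"
    using extend_eq[OF R f \<open>1 \<in> TT\<close> that] is_repD(6)[OF inducibleD(1)[OF R], of "f g"] f that
    unfolding ind_OU_iff[OF R] by simp
  then show "restr (extend R f) g = f g"
    using f unfolding ind_OU_iff[OF R] by (simp add: restr_def)
qed

text \<open>With a single double coset a function is determined by its values on the units, so
  \<open>restr\<close> and \<open>extend\<close> are inverse to each other.\<close>

lemma restriction_ramified:
  fixes R :: "('d, 'v::ab_group_add) rep"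
  assumes R: "inducible \<eta> \<phi>' R" and cover: "\<And>g. g \<noteq> 0 \<Longrightarrow> \<exists>t\<in>TT. \<exists>k\<in>OU. g = t * k"
  shows "rep_iso (Dgrp OU) (cind Q Dunits HT R) (ind Q OU H0 R)"
proof -
  let ?C = "ind Q {x. x \<noteq> 0} HT R"
  have eq: "cind Q Dunits HT R = ?C"
    using cover by (intro cind_eq_ind[OF R, of "{1}"]) auto
  have "bij_betw restr (rspace ?C) (rspace (ind Q OU H0 R))"
  proof (rule bij_betw_byWitness[of _ "extend R"])
    show "\<forall>f\<in>rspace ?C. extend R (restr f) = f"
    proof (intro ballI ext)
      fix f g assume f: "f \<in> rspace ?C"
      show "extend R (restr f) g = f g"
      proof (cases "g = 0")
        case True
        then show ?thesis
          using D_apply(3)[OF R extend_mem[OF R restr_mem[OF R f]]] D_apply(3)[OF R f] by simp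
      next
        case False
        then obtain t k where g: "t \<in> TT" "k \<in> OU" "g = t * k"
          using cover by blast
        then show ?thesis
          using extend_eq[OF R restr_mem[OF R f] g(1,2)] D_apply(2)[OF R f TT_HT[OF g(1)] OU_neq_zero[OF g(2)]]
          by (simp add: restr_def)
      qed
    qed
  qed (auto simp: restr_extend[OF R] restr_mem[OF R] extend_mem[OF R])
  moreover have "restr (\<lambda>x. f (x * g)) = (\<lambda>x. restr f (x * g))" if "g \<in> OU" for f :: "'d \<Rightarrow> 'v" and g
    using OU_mult[OF _ that] OU_mult[OF _ OU_inverse[OF that]] OU_neq_zero[OF that]
    by (auto simp: restr_def fun_eq_iff mult.assoc) (metis mult.assoc mult.right_neutral right_inverse)+
  moreover have "is_rep (Dgrp OU) ?C"
    using OU_neq_zero by (intro is_rep_subgroup[OF ind_D_rep[OF R]]) blast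
  moreover have "rscale R c 0 = 0" for c
  proof -
    interpret V: vector_space "rscale R"
      by (rule is_repD(1)[OF inducibleD(1)[OF R]])
    show ?thesis
      by simp
  qed
  ultimately show ?thesis
    unfolding rep_iso_def eq using ind_OU_rep[OF R]
    by (intro conjI exI[of _ restr]) (auto simp: restr_def fun_eq_iff)
qed

end

section \<open>Two double cosets: the unramified restriction\<close>

context depth_character
begin

lemma cj'_mult: "cj' (x * y) = cj' x * cj' y"
  using cj_simps(4)[of "cj' x" "cj' y"] cj_simps(2)[of "cj' x * cj' y"] by simp

text \<open>A function is determined by its restrictions to the units and to the units shifted by
  the inverse of \<sigma>. The second one is equivariant for the \<sigma>-conjugate of R, which A
  identifies with R'.\<close>

lemma restriction_unramified:
  fixes R :: "('d, 'v::ab_group_add) rep" and R' :: "('d, 'w::ab_group_add) rep"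
  assumes R: "inducible \<eta> \<phi>1 R" and R': "inducible \<eta> \<phi>2 R'"
    and A: "bij_betw A (rspace R) (rspace R')"
      "\<And>v w. v \<in> rspace R \<Longrightarrow> w \<in> rspace R \<Longrightarrow> A (v + w) = A v + A w"
      "\<And>c v. v \<in> rspace R \<Longrightarrow> A (rscale R c v) = rscale R' c (A v)"
      "\<And>g v. g \<in> H0 \<Longrightarrow> v \<in> rspace R \<Longrightarrow> A (ract R (cj g) v) = ract R' g (A v)"
    and cover: "\<And>g. g \<noteq> 0 \<Longrightarrow> (\<exists>t\<in>TT. \<exists>k\<in>OU. g = t * k) \<or> (\<exists>t\<in>TT. \<exists>k\<in>OU. g = t * inverse \<sigma> * k)"
    and sep: "\<And>t. t \<in> TT \<Longrightarrow> valD Q t \<noteq> valD Q \<sigma>"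
  shows "rep_iso (Dgrp OU) (cind Q Dunits HT R) (rep_sum (ind Q OU H0 R) (ind Q OU H0 R'))"
proof -
  let ?C = "ind Q {x. x \<noteq> 0} HT R" and ?I = "ind Q OU H0 R" and ?I' = "ind Q OU H0 R'"
  note rep = is_repD[OF inducibleD(1)[OF R]] and rep' = is_repD[OF inducibleD(1)[OF R']]
  note sub = subspaceD[OF rep(1,2)] and sub' = subspaceD[OF rep'(1,2)]
  note Da = D_apply[OF R]
  interpret V: vector_space "rscale R"
    by (rule rep(1))
  interpret V': vector_space "rscale R'"
    by (rule rep'(1))
  have s0: "inverse \<sigma> \<noteq> 0"
    using sigma_neq_zero by simp
  have A0: "A 0 = 0"
    using A(2)[OF sub(1) sub(1)] by simp
  have AV: "A v \<in> rspace R'" if "v \<in> rspace R" for v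
    using bij_betwE[OF A(1)] that by blast
  have eq: "cind Q Dunits HT R = ?C"
  proof (rule cind_eq_ind[OF R, of "{1, inverse \<sigma>}"])
    show "\<exists>t\<in>TT. \<exists>x\<in>{1, inverse \<sigma>}. \<exists>k\<in>OU. g = t * x * k" if "g \<noteq> 0" for g
      using cover[OF that] by auto
  qed (use s0 in auto)
  define second where "second f g = (if g \<in> OU then A (f (inverse \<sigma> * g)) else 0)" for f :: "'d \<Rightarrow> 'v" and g
  have sn: "inverse \<sigma> * g \<noteq> 0" if "g \<in> OU" for g
    using OU_neq_zero[OF that] s0 by simp
  have sec_mem: "second f \<in> rspace ?I'" if f: "f \<in> rspace ?C" for f
  proof -
    have "second f (h * g) = ract R' h (second f g)" if h: "h \<in> H0" and g: "g \<in> OU" for h g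
    proof -
      have "inverse \<sigma> * (h * g) = cj h * (inverse \<sigma> * g)"
        unfolding cj_def using sigma_neq_zero by (simp add: mult.assoc) (simp flip: mult.assoc)
      then have "f (inverse \<sigma> * (h * g)) = ract R (cj h) (f (inverse \<sigma> * g))"
        using Da(2)[OF f cj_HT[OF H0_subset_HT[OF h]] sn[OF g]] by simp
      moreover have "h * g \<in> OU"
        using OU_mult[OF _ g] h H0_subset_OU by blast
      ultimately show ?thesis
        using A(4)[OF h Da(1)[OF f sn[OF g]]] g by (simp add: second_def)
    qed
    moreover have "second f g \<in> rspace R'" for g
      using AV[OF Da(1)[OF f sn]] sub'(1) by (simp add: second_def)
    moreover have "second f g = 0" if "g \<notin> OU" for g
      using that by (simp add: second_def)
    ultimately show ?thesis
      unfolding ind_OU_iff[OF R'] by blast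
  qed
  have inj: "f = f'" if f: "f \<in> rspace ?C" "f' \<in> rspace ?C" and e: "restr f = restr f'" "second f = second f'" for f f'
  proof
    fix g
    consider "g = 0" | t k where "t \<in> TT" "k \<in> OU" "g = t * k" | t k where "t \<in> TT" "k \<in> OU" "g = t * inverse \<sigma> * k"
      using cover by blast
    then show "f g = f' g"
    proof cases
      case 1
      then show ?thesis
        using Da(3)[OF f(1)] Da(3)[OF f(2)] by simp
    next
      case 2
      then have "f k = f' k"
        using fun_cong[OF e(1), of k] by (simp add: restr_def)
      then show ?thesis
        using Da(2)[OF f(1) TT_HT[OF 2(1)] OU_neq_zero[OF 2(2)]] Da(2)[OF f(2) TT_HT[OF 2(1)] OU_neq_zero[OF 2(2)]]
        unfolding 2(3) by simp
    next
      case 3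
      then have "A (f (inverse \<sigma> * k)) = A (f' (inverse \<sigma> * k))"
        using fun_cong[OF e(2), of k] by (simp add: second_def)
      then have "f (inverse \<sigma> * k) = f' (inverse \<sigma> * k)"
        using bij_betw_imp_inj_on[OF A(1)] Da(1)[OF f(1) sn[OF 3(2)]] Da(1)[OF f(2) sn[OF 3(2)]] by (auto dest: inj_onD)
      then show ?thesis
        using Da(2)[OF f(1) TT_HT[OF 3(1)] sn[OF 3(2)]] Da(2)[OF f(2) TT_HT[OF 3(1)] sn[OF 3(2)]]
        unfolding 3(3) mult.assoc by simp
    qed
  qed
  have surj: "\<exists>f\<in>rspace ?C. f1 = restr f \<and> f2 = second f" if f1: "f1 \<in> rspace ?I" and f2: "f2 \<in> rspace ?I'" for f1 f2
  proof -
    let ?B = "inv_into (rspace R) A"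
    have B: "?B w \<in> rspace R" "A (?B w) = w" if "w \<in> rspace R'" for w
      using that A(1) by (auto simp: bij_betw_def inv_into_into f_inv_into_f)
    have BA: "?B (A v) = v" if "v \<in> rspace R" for v
      using that A(1) by (simp add: bij_betw_def inv_into_f_f)
    have f2V: "f2 g \<in> rspace R'" if "g \<in> OU" for g
      using f2 that unfolding ind_OU_iff[OF R'] by blast
    have cO: "cj' k \<in> OU" if "k \<in> OU" for k
      using that by (simp add: OD_units_iff)
    \<comment> \<open>Pulled back through A and conjugation by \<sigma>, so that the extension
      translated by \<sigma> has second component f2.\<close>
    define f3 where "f3 k = (if k \<in> OU then ?B (f2 (cj' k)) else 0)" for k
    have "f3 (h * k) = ract R h (f3 k)" if h: "h \<in> H0" and k: "k \<in> OU" for h k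
    proof -
      have hk: "h * k \<in> OU"
        using OU_mult[OF _ k] h H0_subset_OU by blast
      have "f2 (cj' (h * k)) = ract R' (cj' h) (f2 (cj' k))"
        using f2 cj'_H0[OF h] cO[OF k] unfolding ind_OU_iff[OF R'] cj'_mult by blast
      also have "\<dots> = A (ract R h (?B (f2 (cj' k))))"
        using A(4)[OF cj'_H0[OF h] B(1)[OF f2V[OF cO[OF k]]]] B(2)[OF f2V[OF cO[OF k]]] by simp
      finally show ?thesis
        using hk k BA rep(3)[OF H0_subset_HT[OF h] B(1)[OF f2V[OF cO[OF k]]]] by (simp add: f3_def)
    qed
    moreover have "f3 k \<in> rspace R" for k
      using B(1)[OF f2V[OF cO]] sub(1) by (simp add: f3_def)
    moreover have "f3 k = 0" if "k \<notin> OU" for k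
      using that by (simp add: f3_def)
    ultimately have f3: "f3 \<in> rspace ?I"
      unfolding ind_OU_iff[OF R] by blast
    \<comment> \<open>The translated extension is supported on the second double coset, so each
      summand accounts for one component.\<close>
    let ?f = "extend R f1 + (\<lambda>y. extend R f3 (y * \<sigma>))"
    have "(\<lambda>y. extend R f3 (y * \<sigma>)) \<in> rspace ?C"
      using is_repD(3)[OF ind_D_rep[OF R] _ extend_mem[OF R f3], of \<sigma>] sigma_neq_zero by simp
    then have m: "?f \<in> rspace ?C"
      by (rule subspaceD(2)[OF is_repD(1,2)[OF ind_D_rep[OF R]] extend_mem[OF R f1]])
    have ext_O: "extend R f g = f g" if "f \<in> rspace ?I" "g \<in> OU" for f g
      using fun_cong[OF restr_extend[OF R that(1)], of g] that(2) by (simp add: restr_def)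
    \<comment> \<open>Elements of T times the units have valuations of T, which \<open>sep\<close>
      keeps apart from that of \<sigma>.\<close>
    have out1: "extend R f (g * \<sigma>) = 0" if g: "g \<in> OU" for f :: "'d \<Rightarrow> 'v" and g
    proof (rule extend_outside)
      fix t k assume t: "t \<in> TT" "k \<in> OU"
      show "g * \<sigma> \<noteq> t * k"
      proof
        assume "g * \<sigma> = t * k"
        then have "valD Q (g * \<sigma>) = valD Q (t * k)"
          by simp
        then show False
          using sep[OF t(1)] g t(2) by (simp add: valD_mult OD_units_iff)
      qed
    qed
    have out2: "extend R f (inverse \<sigma> * g) = 0" if g: "g \<in> OU" for f :: "'d \<Rightarrow> 'v" and g
    proof (rule extend_outside)
      fix t k assume t: "t \<in> TT" "k \<in> OU"
      show "inverse \<sigma> * g \<noteq> t * k"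
      proof
        assume "inverse \<sigma> * g = t * k"
        then have "valD Q (inverse \<sigma> * g) = valD Q (t * k)"
          by simp
        then have v: "- valD Q \<sigma> = valD Q t"
          using g t D.val_inverse[OF sigma_neq_zero] by (simp add: valD_mult OD_units_iff)
        have "valD Q (inverse t) = - valD Q t"
          using D.val_inverse[of t] t(1) by simp
        then have "valD Q (inverse t) = valD Q \<sigma>"
          unfolding v[symmetric] by simp
        moreover have "inverse t \<in> TT"
          using t(1) by (simp add: inverse_E)
        ultimately show False
          using sep by blast
      qed
    qed
    have "f1 = restr ?f"
    proof
      fix g show "f1 g = restr ?f g"
        using f1 ext_O[OF f1] out1 unfolding ind_OU_iff[OF R] by (simp add: restr_def)
    qed
    moreover have "f2 = second ?f"
    proof
      fix g show "f2 g = second ?f g"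
      proof (cases "g \<in> OU")
        case True
        then have c: "cj g \<in> OU"
          by simp
        have "?f (inverse \<sigma> * g) = f3 (cj g)"
          using out2[OF True] ext_O[OF f3 c] by (simp add: cj_def)
        then show ?thesis
          using True c B(2)[OF f2V[OF True]] by (simp add: second_def f3_def)
      next
        case False
        then show ?thesis
          using f2 unfolding ind_OU_iff[OF R'] by (simp add: second_def)
      qed
    qed
    ultimately show ?thesis
      using m by blast
  qed
  have "is_rep (Dgrp OU) ?C"
    using OU_neq_zero by (intro is_rep_subgroup[OF ind_D_rep[OF R]]) blast
  moreover have "is_rep (Dgrp OU) (rep_sum ?I ?I')"
  proof -
    note i = is_repD[OF ind_OU_rep[OF R]] and i' = is_repD[OF ind_OU_rep[OF R']]
    note si = subspaceD[OF i(1,2)] and si' = subspaceD[OF i'(1,2)]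
    have vs: "vector_space (rscale (rep_sum ?I ?I'))"
      by unfold_locales (auto simp: rep_sum_def fun_eq_iff V.scale_right_distrib V.scale_left_distrib
        V'.scale_right_distrib V'.scale_left_distrib)
    interpret W: vector_space "rscale (rep_sum ?I ?I')"
      by (rule vs)
    have "W.subspace (rspace (rep_sum ?I ?I'))"
      unfolding W.subspace_def using si si' by (auto simp: rep_sum_def zero_prod_def)
    then show ?thesis
      unfolding is_rep_def using vs i(3-7) i'(3-7) by (auto simp: rep_sum_def mult.assoc fun_eq_iff)
  qed
  moreover have "bij_betw (\<lambda>f. (restr f, second f)) (rspace ?C) (rspace (rep_sum ?I ?I'))"
  proof (rule bij_betwI')
    show "((restr f, second f) = (restr f', second f')) = (f = f')" if "f \<in> rspace ?C" "f' \<in> rspace ?C" for f f'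
      using inj[OF that] by auto
    show "(restr f, second f) \<in> rspace (rep_sum ?I ?I')" if "f \<in> rspace ?C" for f
      using restr_mem[OF R that] sec_mem[OF that] by (simp add: rep_sum_def)
    show "\<exists>f\<in>rspace ?C. y = (restr f, second f)" if "y \<in> rspace (rep_sum ?I ?I')" for y
      using that surj by (cases y) (auto simp: rep_sum_def)
  qed
  moreover have "restr (f + f') = restr f + restr f'" for f f' :: "'d \<Rightarrow> 'v"
    by (auto simp: restr_def)
  moreover have "second (f + f') = second f + second f'" if "f \<in> rspace ?C" "f' \<in> rspace ?C" for f f'
    using A(2)[OF Da(1)[OF that(1) sn] Da(1)[OF that(2) sn]] by (auto simp: second_def)
  moreover have "restr (\<lambda>x. rscale R c (f x)) = (\<lambda>x. rscale R c (restr f x))" for c and f :: "'d \<Rightarrow> 'v"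
    by (auto simp: restr_def)
  moreover have "second (\<lambda>x. rscale R c (f x)) = (\<lambda>x. rscale R' c (second f x))" if "f \<in> rspace ?C" for c f
    using A(3)[OF Da(1)[OF that sn]] by (auto simp: second_def)
  moreover have O: "x * g \<in> OU \<longleftrightarrow> x \<in> OU" if "g \<in> OU" for x g
    using that by (auto simp: OD_units_iff valD_mult)
  moreover have "restr (\<lambda>x. f (x * g)) = (\<lambda>x. restr f (x * g))" if "g \<in> OU" for f :: "'d \<Rightarrow> 'v" and g
    using O[OF that] by (auto simp: restr_def)
  moreover have "second (\<lambda>x. f (x * g)) = (\<lambda>x. second f (x * g))" if "g \<in> OU" for f :: "'d \<Rightarrow> 'v" and g
    using O[OF that] by (auto simp: second_def mult.assoc)
  ultimately show ?thesis
    unfolding rep_iso_def eq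
    by (intro conjI exI[of _ "\<lambda>f. (restr f, second f)"]) (simp_all add: rep_sum_def)
qed

definition conj_rep :: "('d, 'v::ab_group_add) rep \<Rightarrow> ('d, 'v) rep" where
  "conj_rep R = R\<lparr>ract := (\<lambda>g. ract R (cj g))\<rparr>"

lemma conj_rep_simps [simp]:
  "rscale (conj_rep R) = rscale R" "rspace (conj_rep R) = rspace R" "ract (conj_rep R) g = ract R (cj g)"
  by (simp_all add: conj_rep_def)

lemma conj_J_representation:
  fixes R :: "('d, 'v::ab_group_add) rep"
  assumes R: "J_representation \<phi> R"
  shows "J_representation (\<lambda>z. \<phi> (qconj Q z)) (conj_rep R)"
proof -
  have HTrep: "is_rep (Dgrp HT) R" and irr: "irreducible_rep (Dgrp Jset) R"
    and J: "\<And>h v. h \<in> Jset_plus \<Longrightarrow> v \<in> rspace R \<Longrightarrow> ract R h v = rscale R (\<phi> (pr0 h)) v"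
    using R unfolding J_representation_def HT_eq_TJ by blast+
  have conj: "is_rep (Dgrp H) (conj_rep R)" if H: "is_rep (Dgrp H) R" and c: "\<And>h. h \<in> H \<Longrightarrow> cj h \<in> H" for H
  proof -
    note h = is_repD[OF H]
    show ?thesis
      unfolding is_rep_def using h(1,2) h(3-5)[OF c] h(6) h(7)[OF c c] by simp
  qed
  have "irreducible_rep (Dgrp Jset) (conj_rep R)"
    unfolding irreducible_rep_def
  proof (intro conjI allI impI)
    show "is_rep (Dgrp Jset) (conj_rep R)"
      using irr by (intro conj) (simp_all add: irreducible_rep_def)
    show "rspace (conj_rep R) \<noteq> {0}"
      using irr by (simp add: irreducible_rep_def)
    fix U assume U: "module.subspace (rscale (conj_rep R)) U \<and> U \<subseteq> rspace (conj_rep R) \<and>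
      (\<forall>g\<in>carrier (Dgrp Jset). ract (conj_rep R) g ` U \<subseteq> U)"
    have "ract R g ` U \<subseteq> U" if "g \<in> Jset" for g
    proof -
      have "cj' g \<in> Jset"
        using that cj_Jset[of "cj' g"] by simp
      moreover have "\<forall>h\<in>Jset. ract R (cj h) ` U \<subseteq> U"
        using U by simp
      ultimately have "ract R (cj (cj' g)) ` U \<subseteq> U"
        by (rule bspec[rotated])
      then show ?thesis
        by simp
    qed
    then show "U = {0} \<or> U = rspace (conj_rep R)"
      using irr U unfolding irreducible_rep_def by simp
  qed
  moreover have "ract (conj_rep R) h v = rscale (conj_rep R) (\<phi> (qconj Q (pr0 h))) v"
    if "h \<in> Jset_plus" "v \<in> rspace R" for h v
    using J[of "cj h" v] that by (simp add: cj_pr)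
  ultimately show ?thesis
    unfolding J_representation_def HT_eq_TJ[symmetric] using conj[OF HTrep cj_HT] by simp
qed

text \<open>Isometries have to be conjugated by \<sigma> along with J. For the isometry of t this
  gives that of \<open>qconj t\<close>, which matches the conjugated character.\<close>

lemma conj_weil_action:
  fixes R :: "('d, 'v::ab_group_add) rep"
  assumes S: "weil_action \<phi> R S"
  shows "weil_action (\<lambda>z. \<phi> (qconj Q z)) (conj_rep R) (\<lambda>M. S (\<lambda>y. cj (M (cj' y))))"
proof -
  note W = weil_actionD[OF S]
  have cj'_add: "cj' (x + y) = cj' x + cj' y" for x y
    using cj_simps(2)[of "cj' x + cj' y"] by simp
  have iso: "perp_isometry (\<lambda>y. cj (M (cj' y)))" if M: "perp_isometry M" for M
  proof -
    have m: "\<And>y. y \<in> perp \<Longrightarrow> M y \<in> perp \<and> valD Q (M y) = valD Q y" "\<And>y. y \<in> perp \<Longrightarrow> \<exists>x\<in>perp. M x = y"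
      "\<And>x y. x \<in> perp \<Longrightarrow> y \<in> perp \<Longrightarrow> M (x + y) = M x + M y \<and> M x * M y - M y * M x = x * y - y * x"
      using M unfolding perp_isometry_def by blast+
    have "\<exists>x\<in>perp. cj (M (cj' x)) = y" if y: "y \<in> perp" for y
    proof -
      obtain x where "x \<in> perp" "M x = cj' y"
        using m(2)[OF cj'_perp[OF y]] by blast
      then show ?thesis
        by (intro bexI[of _ "cj x"]) (simp_all add: cj_perp)
    qed
    moreover have "cj (M (cj' x)) * cj (M (cj' y)) - cj (M (cj' y)) * cj (M (cj' x)) = x * y - y * x"
      if "x \<in> perp" "y \<in> perp" for x y
    proof -
      have "cj (M (cj' x) * M (cj' y) - M (cj' y) * M (cj' x)) = cj (cj' x * cj' y - cj' y * cj' x)"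
        using m(3)[OF cj'_perp[OF that(1)] cj'_perp[OF that(2)]] by simp
      then show ?thesis
        by simp
    qed
    ultimately show ?thesis
      unfolding perp_isometry_def using m(1,3) by (auto simp: cj_perp cj'_perp cj'_add)
  qed
  have lift: "lift_isometry (\<lambda>y. cj (M (cj' y))) (cj h) = cj (lift_isometry M h)" for M h
    by (simp add: lift_isometry_def cj_pr cj_E[OF pr0_in_E])
  show ?thesis
  proof (rule weil_actionI)
    show "S (\<lambda>y. cj (M (cj' y))) (ract (conj_rep R) h v) =
        ract (conj_rep R) (lift_isometry M h) (S (\<lambda>y. cj (M (cj' y))) v)"
      if "perp_isometry M" "h \<in> Jset" "v \<in> rspace (conj_rep R)" for M h v
      using W(4)[OF iso[OF that(1)], of "cj h" v] that by (simp add: lift)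
    show "S (\<lambda>y. cj (M (M' (cj' y)))) v = S (\<lambda>y. cj (M (cj' y))) (S (\<lambda>y. cj (M' (cj' y))) v)"
      if "perp_isometry M" "perp_isometry M'" "v \<in> rspace (conj_rep R)" for M M' v
      using W(5)[OF iso[OF that(1)] iso[OF that(2)], of v] that by simp
    show "S (\<lambda>y. cj (M (cj' y))) v = S (\<lambda>y. cj (M' (cj' y))) v"
      if "perp_isometry M" "perp_isometry M'" "isometry_cong M M'" "v \<in> rspace (conj_rep R)" for M M' v
    proof (rule W(6)[OF iso[OF that(1)] iso[OF that(2)]])
      show "isometry_cong (\<lambda>y. cj (M (cj' y))) (\<lambda>y. cj (M' (cj' y)))"
        using that(3) by (auto simp: isometry_cong_def cj'_perp simp flip: cj_simps(6))
    qed (use that in simp)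
    show "ract (conj_rep R) t v =
        rscale (conj_rep R) (\<phi> (qconj Q t)) (S (\<lambda>y. cj (torus_isometry t (cj' y))) v)"
      if "t \<in> E - {0}" "v \<in> rspace (conj_rep R)" for t v
    proof -
      have t: "qconj Q t \<in> E - {0}" "cj t = qconj Q t"
        using that(1) by (simp_all add: qconj_E cj_E)
      have "(\<lambda>y. cj (torus_isometry t (cj' y))) = torus_isometry (qconj Q t)"
        by (simp add: torus_isometry_def t(2) fun_eq_iff)
      then show ?thesis
        using W(8)[OF t(1), of v] that(2) t(2) by simp
    qed
  qed (use W(1,2,3)[OF iso] W(7) in simp_all)
qed

lemma quasi_character_D:
  assumes "quasi_character Q Dunits \<eta>"
  shows "x \<noteq> 0 \<Longrightarrow> y \<noteq> 0 \<Longrightarrow> \<eta> (x * y) = \<eta> x * \<eta> y" and "x \<noteq> 0 \<Longrightarrow> \<eta> x \<noteq> 0"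
  using assms by (auto simp: quasi_character_def hom_def Pi_def)

lemma ramified_restriction:
  fixes R :: "('d, 'v::ab_group_add) rep"
  assumes R: "J_representation \<phi> R" and eta: "quasi_character Q Dunits \<eta>"
    and cover: "\<And>g. g \<noteq> 0 \<Longrightarrow> \<exists>t\<in>TT. \<exists>k\<in>OU. g = t * k"
  shows "rep_iso (Dgrp OU) (cind Q Dunits HT (twist \<eta> R)) (ind Q OU H0 (twist \<eta> R)) \<and>
    irreducible_rep (Dgrp OU) (ind Q OU H0 (twist \<eta> R))"
proof -
  have "inducible \<eta> \<phi> (twist \<eta> R)"
    by (rule inducible_twist[OF R eta phi_small])
  then show ?thesis
    using restriction_ramified cover ind_irreducible quasi_character_D[OF eta] by blast
qed

text \<open>The intertwiner is found before twisting, between the \<sigma>-conjugate of R and R',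
  both belonging to the conjugate character. Twisting does not disturb it because \<eta> is
  invariant under conjugation by \<sigma>.\<close>

lemma unramified_restriction:
  fixes R :: "('d, 'v::ab_group_add) rep" and R' :: "('d, 'w::ab_group_add) rep"
  assumes R: "J_representation \<phi> R" and R': "J_representation (\<lambda>z. \<phi> (qconj Q z)) R'"
    and S: "weil_action \<phi> R S" and S': "weil_action (\<lambda>z. \<phi> (qconj Q z)) R' S'"
    and eta: "quasi_character Q Dunits \<eta>" and e0_unit: "valD Q e0 = 0"
    and cover: "\<And>g. g \<noteq> 0 \<Longrightarrow> (\<exists>t\<in>TT. \<exists>k\<in>OU. g = t * k) \<or> (\<exists>t\<in>TT. \<exists>k\<in>OU. g = t * inverse \<sigma> * k)"
    and sep: "\<And>t. t \<in> TT \<Longrightarrow> valD Q t \<noteq> valD Q \<sigma>"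
  shows "rep_iso (Dgrp OU) (cind Q Dunits HT (twist \<eta> R))
      (rep_sum (ind Q OU H0 (twist \<eta> R)) (ind Q OU H0 (twist \<eta> R'))) \<and>
    irreducible_rep (Dgrp OU) (ind Q OU H0 (twist \<eta> R)) \<and>
    irreducible_rep (Dgrp OU) (ind Q OU H0 (twist \<eta> R')) \<and>
    \<not> rep_iso (Dgrp OU) (ind Q OU H0 (twist \<eta> R)) (ind Q OU H0 (twist \<eta> R'))"
proof -
  let ?\<phi>' = "\<lambda>z. \<phi> (qconj Q z)"
  note em = quasi_character_D[OF eta]
  have I: "inducible \<eta> \<phi> (twist \<eta> R)"
    by (rule inducible_twist[OF R eta phi_small])
  have I': "inducible \<eta> ?\<phi>' (twist \<eta> R')"
    by (rule inducible_twist[OF R' eta depth_character.phi_small[OF conj_depth_character]])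
  have cR: "J_representation ?\<phi>' (conj_rep R)"
    by (rule conj_J_representation[OF R])
  obtain A where A: "J_hom (conj_rep R) R' A" "bij_betw A (rspace (conj_rep R)) (rspace R')"
    "\<And>t v. t \<in> E - {0} \<Longrightarrow> v \<in> rspace (conj_rep R) \<Longrightarrow> A (ract (conj_rep R) t v) = ract R' t (A v)"
    using depth_character.weil_intertwiner[OF conj_depth_character e0_unit cR R' conj_weil_action[OF S] S'] by blast
  have Al: "J_linear (conj_rep R) R' A"
    and Ah: "\<And>h v. h \<in> Jset \<Longrightarrow> v \<in> rspace (conj_rep R) \<Longrightarrow> A (ract (conj_rep R) h v) = ract R' h (A v)"
    using A(1) by (auto simp: J_hom_def)
  have HTrep: "is_rep (Dgrp HT) (conj_rep R)" "is_rep (Dgrp HT) R'"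
    using cR R' unfolding J_representation_def HT_eq_TJ by blast+
  have Jrep: "is_rep (Dgrp Jset) (conj_rep R)"
    using cR by (simp add: J_representation_def irreducible_rep_def)
  have JHT: "h \<in> HT" if "h \<in> Jset" for h
    using that Jset_subset_Gs Gs_subset_HT by blast
  have AH: "A (ract R (cj g) v) = ract R' g (A v)" if g: "g \<in> HT" and v: "v \<in> rspace R" for g v
  proof -
    obtain t h where th: "g = t * h" "t \<in> TT" "h \<in> Jset"
      using g unfolding HT_eq_TJ unfolding set_mult_mult_grp by blast
    have v': "v \<in> rspace (conj_rep R)"
      using v by simp
    have "A (ract (conj_rep R) g v) = A (ract (conj_rep R) t (ract (conj_rep R) h v))"
      unfolding th(1) by (simp only: is_repD(7)[OF HTrep(1) TT_HT[OF th(2)] JHT[OF th(3)] v'])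
    also have "\<dots> = ract R' t (ract R' h (A v))"
      by (simp only: A(3)[OF th(2) is_repD(3)[OF Jrep th(3) v']] Ah[OF th(3) v'])
    also have "\<dots> = ract R' g (A v)"
      unfolding th(1) by (rule is_repD(7)[OF HTrep(2) TT_HT[OF th(2)] JHT[OF th(3)] J_linearD(1)[OF Al v'], symmetric])
    finally show ?thesis
      by simp
  qed
  have ecj: "\<eta> (cj g) = \<eta> g" if "g \<noteq> 0" for g
    using em(1)[of "inverse \<sigma> * g" \<sigma>] em(1)[of "inverse \<sigma>" g] em(1)[of "inverse \<sigma>" \<sigma>] em(1)[of 1 1] em(2)[of 1]
      that sigma_neq_zero by (simp add: cj_def)
  have Rrep: "ract R (cj g) v \<in> rspace R" if "g \<in> HT" "v \<in> rspace R" for g v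
    using is_repD(3)[OF HTrep(1) that(1), of v] that(2) by simp
  have iso: "rep_iso (Dgrp OU) (cind Q Dunits HT (twist \<eta> R))
      (rep_sum (ind Q OU H0 (twist \<eta> R)) (ind Q OU H0 (twist \<eta> R')))"
  proof (rule restriction_unramified[OF I I' _ _ _ _ cover sep])
    show "bij_betw A (rspace (twist \<eta> R)) (rspace (twist \<eta> R'))"
      using A(2) by (simp add: twist_def)
    show "A (v + w) = A v + A w" if "v \<in> rspace (twist \<eta> R)" "w \<in> rspace (twist \<eta> R)" for v w
      using J_linearD(2)[OF Al, of v w] that by (simp add: twist_def)
    show "A (rscale (twist \<eta> R) c v) = rscale (twist \<eta> R') c (A v)" if "v \<in> rspace (twist \<eta> R)" for c v
      using J_linearD(3)[OF Al, of v c] that by (simp add: twist_def)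
    show "A (ract (twist \<eta> R) (cj g) v) = ract (twist \<eta> R') g (A v)" if g: "g \<in> H0" and v: "v \<in> rspace (twist \<eta> R)" for g v
    proof -
      have gH: "g \<in> HT" and v': "v \<in> rspace R"
        using H0_subset_HT[OF g] v by (simp_all add: twist_def)
      show ?thesis
        using J_linearD(3)[OF Al, of "ract R (cj g) v" "\<eta> g"] Rrep[OF gH v'] AH[OF gH v'] ecj[OF HT_neq_zero[OF gH]]
        by (simp add: twist_def)
    qed
  qed
  have sig: "\<sigma> * a \<notin> HT" if a: "a \<in> OU" for a
  proof
    assume "\<sigma> * a \<in> HT"
    then obtain t y where ty: "\<sigma> * a = t * y" "t \<in> TT" "y \<in> Gs"
      unfolding set_mult_mult_grp by blast
    have "valD Q (\<sigma> * a) = valD Q (t * y)"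
      by (simp add: ty(1))
    then show False
      using sep[OF ty(2)] a Dfil_unit[OF Gs_pos ty(3)] by (simp add: valD_mult OD_units_iff)
  qed
  have "irreducible_rep (Dgrp OU) (ind Q OU H0 (twist \<eta> R'))"
    by (rule depth_character.ind_irreducible[OF conj_depth_character I' em])
  moreover have "irreducible_rep (Dgrp OU) (ind Q OU H0 (twist \<eta> R))"
    by (rule ind_irreducible[OF I em])
  moreover have "\<not> rep_iso (Dgrp OU) (ind Q OU H0 (twist \<eta> R)) (ind Q OU H0 (twist \<eta> R'))"
    by (rule ind_not_iso[OF I I' em sig])
  ultimately show ?thesis
    using iso by blast
qed

end

section \<open>The decomposition\<close>

text \<open>A valuation \<open>n / 2\<close> is lowered by the integer \<open>n div 2\<close> with a
  scalar of F, leaving 0 or 1/2.\<close>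

lemma (in tame_quaternion_algebra) normalized_pure:
  assumes E: "quadratic_subfield Q E"
  obtains e where "e \<in> E" "e \<noteq> 0" "qconj Q e = - e" "0 \<le> valD Q e" "valD Q e \<le> ereal (1 / 2)"
proof -
  obtain e where e: "e \<in> E" "e \<noteq> 0" "qconj Q e = - e"
    using quadratic_subfield_pure[OF E] .
  obtain n :: int where n: "valD Q e = ereal (of_int n / 2)"
    using valD_half_int[OF e(2)] .
  define q m where "q = n div 2" and "m = n mod 2"
  have nq: "n = 2 * q + m" and m: "m = 0 \<or> m = 1"
    by (auto simp: q_def m_def)
  obtain x where x: "x \<noteq> 0" "fval Q x = ereal (of_int (- q))"
    using F.val_all_ints[of "- q"] by blast
  let ?e = "emb Q x * e"
  have v: "valD Q ?e = ereal (of_int m / 2)"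
    by (simp add: valD_mult x(2) n nq add_divide_distrib)
  have "0 \<le> valD Q ?e" "valD Q ?e \<le> ereal (1 / 2)"
    using m by (auto simp: v)
  moreover have "?e \<in> E" "qconj Q ?e = - ?e" "?e \<noteq> 0"
    using e x quadratic_subfield_closed(1,3)[OF E] by (simp_all add: qconj_mult emb_central)
  ultimately show thesis
    by (intro that)
qed

section \<open>From the given data to the abstract hypotheses\<close>

context torus_depth
begin

text \<open>The construction of R carries its own \<sigma>, here s, which may differ from that of
  the context. The earlier results are instantiated at s; their conclusions involve only notions
  built from E, \<open>e0\<close> and r, on which both agree.\<close>

lemma rho_tilde_representation:
  fixes R :: "('d, 'v::ab_group_add) rep"
  assumes kappa: "\<kappa> \<in> iso (mu_group p) (integer_mod_group p)" and psi: "additive_character Q \<psi>"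
    and psiE: "extends_character Q \<psi> E (\<psi>ext E)"
    and rho: "is_rho_tilde Q p \<kappa> \<psi> \<psi>ext (E - {0}) \<phi> r R" and phi1: "\<phi> 1 = 1"
  obtains S where "J_representation \<phi> R" "weil_action \<phi> R S"
proof -
  have tf: "torus_field (E - {0}) = E"
    using zero_E by (auto simp: torus_field_def)
  obtain s X \<theta> where s: "conj_element Q E s" and X: "realizes Q \<psi> E \<phi> r X"
    and th: "phiE_hat Q (\<psi>ext E) E s r X \<theta>"
    and rep: "is_rep (Dgrp ((E - {0}) <#>\<^bsub>mult_grp\<^esub> J_grp Q E s r)) R"
    and alt: "if JE Q E s r = JE_plus Q E s r then
           vector_space.dim (rscale R) (rspace R) = 1 \<and>
           (\<forall>t\<in>E - {0}. \<forall>v\<in>rspace R. ract R t v = rscale R (\<phi> t) v) \<and>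
           (\<forall>h\<in>J_grp Q E s r. \<forall>v\<in>rspace R. ract R h v = rscale R (\<theta> (iota E s h)) v)
         else
           \<exists>\<tau> \<tau>S.
             rscale \<tau> = rscale R \<and> rspace \<tau> = rspace R \<and>
             heisenberg_rep Q E s r \<theta> \<tau> \<and>
             heisenberg_weil_lift p (W_grp Q E s r) (W_form \<kappa> E s \<theta>)
               \<lparr>rscale = rscale \<tau>, rspace = rspace \<tau>,
                ract = (\<lambda>y. ract \<tau>
                  (inv_into (carrier (H_grp Q E s r \<theta>)) (special_iso Q p \<kappa> E s r \<theta>) y))\<rparr> \<tau>S \<and>
             (\<forall>t\<in>E - {0}. \<forall>h\<in>J_grp Q E s r. \<forall>v\<in>rspace R.
                ract R (t * h) v =
                rscale R (\<phi> t)
                  (\<tau>S (conj_action Q E s r t) (ract \<tau> (N_grp Q E s r \<theta> #>\<^bsub>mult_grp\<^esub> h) v)))"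
    using rho unfolding is_rho_tilde_def tf Let_def by (elim exE conjE) (rule that)
  obtain XE where XE: "extends_scalars Q E X XE"
    and th2: "\<And>a d. mat2 a 0 0 d \<in> torusE Q E r \<Longrightarrow> \<theta> (mat2 a 0 0 d) = \<psi>ext E (XE (mat2 (a - 1) 0 0 (d - 1)))"
    and th1: "\<theta> \<in> hom ((GL2 E)\<lparr>carrier := JE_plus Q E s r\<rparr>) mult_grp"
    and th3: "\<And>t u. t > r / 2 \<Longrightarrow> u \<in> root_pos Q E s t \<union> root_neg Q E s t \<Longrightarrow> \<theta> u = 1"
    using th unfolding phiE_hat_def by blast
  have Xs: "0 < fval Q (X x)" if "x \<in> E" "ereal r < valD Q x" for x
    using X that by (simp add: realizes_def)
  interpret C: torus_character Q p E e0 s r \<kappa> \<psi> "\<psi>ext E" X XE \<theta>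
    by unfold_locales (assumption | rule quadratic e0_E e0_neq_zero e0_pure s r_pos e0_val kappa psi psiE Xs th1 XE th2 th3)+
  have phi: "\<phi> (pr0 h) = \<theta> (iota E s h)" if h: "h \<in> Jset_plus" for h
  proof -
    have "ereal r \<le> valD Q (pr0 h - 1)" "pr0 h - 1 \<in> E"
      using h by (simp_all add: Jset_plus_def diff_E pr0_in_E)
    then have "\<phi> (1 + (pr0 h - 1)) = \<psi> (X (pr0 h - 1))"
      using X unfolding realizes_def by blast
    then show ?thesis
      using C.theta_iota[OF h] by simp
  qed
  have rep': "is_rep (Dgrp ((E - {0}) <#>\<^bsub>mult_grp\<^esub> Jset)) R"
    using rep unfolding C.J_grp_eq .
  show thesis
  proof (cases "JE Q E s r = JE_plus Q E s r")
    case True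
    have J: "Jset = Jset_plus"
      unfolding C.J_grp_eq[symmetric] C.J_plus_eq[symmetric] J_grp_def J_plus_def True ..
    have a: "vector_space.dim (rscale R) (rspace R) = 1"
      "\<And>t v. t \<in> E - {0} \<Longrightarrow> v \<in> rspace R \<Longrightarrow> ract R t v = rscale R (\<phi> t) v"
      "\<And>h v. h \<in> Jset \<Longrightarrow> v \<in> rspace R \<Longrightarrow> ract R h v = rscale R (\<theta> (iota E s h)) v"
      using alt unfolding C.J_grp_eq if_P[OF True] by blast+
    show thesis
      using that C.character_case[OF rep' phi J a] by blast
  next
    case False
    obtain \<tau> \<tau>S where t: "rscale \<tau> = rscale R" "rspace \<tau> = rspace R" "heisenberg_rep Q E s r \<theta> \<tau>"
      "heisenberg_weil_lift p (W_grp Q E s r) (W_form \<kappa> E s \<theta>)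
               \<lparr>rscale = rscale \<tau>, rspace = rspace \<tau>,
                ract = (\<lambda>y. ract \<tau>
                  (inv_into (carrier (H_grp Q E s r \<theta>)) (special_iso Q p \<kappa> E s r \<theta>) y))\<rparr> \<tau>S"
      and a: "\<And>t h v. t \<in> E - {0} \<Longrightarrow> h \<in> Jset \<Longrightarrow> v \<in> rspace R \<Longrightarrow>
        ract R (t * h) v = rscale R (\<phi> t)
                  (\<tau>S (conj_action Q E s r t) (ract \<tau> (N_grp Q E s r \<theta> #>\<^bsub>mult_grp\<^esub> h) v))"
      using alt unfolding C.J_grp_eq if_not_P[OF False] by blast
    show thesis
      by (rule that[OF C.heisenberg_case[OF rep' phi phi1 t a]])
  qed
qed

text \<open>Genericity fixes the valuation of \<open>X e0\<close> through E-linearity, since the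
  antidiagonal element is \<open>e0\<close> up to the factor \<open>e0\<close>. Hence X maps the
  multiples of \<open>e0\<close> of depth r onto the integers of F, where \<psi> is
  nontrivial.\<close>

lemma datum_depth_character:
  assumes qc: "quasi_character Q (E - {0}) \<phi>" and hd: "has_depth Q (E - {0}) \<phi> r"
    and psi: "additive_character Q \<psi>" and gen: "generic_character Q \<psi> (E - {0}) \<phi> r"
  shows "depth_character Q p E e0 \<sigma> r \<phi>"
proof unfold_locales
  have tf: "torus_field (E - {0}) = E"
    using zero_E by (auto simp: torus_field_def)
  obtain X XE where X: "realizes Q \<psi> E \<phi> r X" and XE: "extends_scalars Q E X XE"
    and v: "valD Q (XE (mat2 1 0 0 (- 1))) = ereal (- r)"
    using gen unfolding generic_character_def tf by blast
  have Xr: "\<phi> (1 + x) = \<psi> (X x)" if "x \<in> E" "ereal r \<le> valD Q x" for x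
    using X that by (simp add: realizes_def)
  show "\<phi> (s * t) = \<phi> s * \<phi> t" if "s \<in> E - {0}" "t \<in> E - {0}" for s t
    using qc that by (auto simp: quasi_character_def hom_def)
  show "\<phi> t \<noteq> 0" if "t \<in> E - {0}" for t
    using qc that by (auto simp: quasi_character_def hom_def Pi_def)
  show "\<phi> (1 + (x + y)) = \<phi> (1 + x) * \<phi> (1 + y)"
    if xy: "x \<in> E" "y \<in> E" "ereal r \<le> valD Q x" "ereal r \<le> valD Q y" for x y
  proof -
    have "X (x + y) = X x + X y"
      using X xy by (simp add: realizes_def)
    then show ?thesis
      using Xr[of "x + y"] Xr[of x] Xr[of y] xy psi add_E[OF xy(1,2)] D.val_add_ge[OF xy(3,4)]
      by (simp add: additive_character_def)
  qed
  show "\<phi> (1 + x) = 1" if x: "x \<in> E" "ereal r < valD Q x" for x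
  proof -
    have "1 + x \<in> E - {0}"
      using x(1) less_imp_le[OF x(2)] valD_near_one[of r "1 + x"] r_pos by (auto intro: add_E)
    then show ?thesis
      using hd x by (simp add: has_depth_def Dfil_plus_def)
  qed
  have XE_scale: "\<forall>c\<in>E. \<forall>a\<in>E. \<forall>d\<in>E. XE (mat2 (c * a) 0 0 (c * d)) = c * XE (mat2 a 0 0 d)"
    using XE by (simp add: extends_scalars_def)
  have "XE (mat2 (e0 * 1) 0 0 (e0 * - 1)) = e0 * XE (mat2 1 0 0 (- 1))"
    by (rule XE_scale[rule_format, OF e0_E one_E minus_E[OF one_E]])
  moreover have "XE (mat2 e0 0 0 (qconj Q e0)) = emb Q (X e0)"
    using XE e0_E unfolding extends_scalars_def by blast
  ultimately have "emb Q (X e0) = e0 * XE (mat2 1 0 0 (- 1))"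
    by (simp add: e0_pure)
  then have "fval Q (X e0) = valD Q e0 + ereal (- r)"
    using valD_emb[of "X e0"] by (simp add: valD_mult v)
  moreover obtain a where a: "valD Q e0 = ereal a"
    using D.val_real[OF e0_neq_zero] .
  ultimately have Xv: "fval Q (X e0) = ereal (a - r)"
    by simp
  then have X0: "X e0 \<noteq> 0"
    by auto
  obtain x where x: "0 \<le> fval Q x" "\<psi> x \<noteq> 1"
    using psi by (auto simp: additive_character_def)
  \<comment> \<open>Chosen so that X maps \<open>emb Q ?f * e0\<close> to x; the valuation of
    \<open>X e0\<close> puts this element at depth at least r.\<close>
  let ?f = "x * inverse (X e0)"
  have "ereal (0 + (r - a)) \<le> fval Q ?f"
    using x(1) F.val_mult_ge[of "ereal 0" x "ereal (r - a)" "inverse (X e0)"]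
    by (simp add: F.val_inverse[OF X0] Xv zero_ereal_def)
  then have "ereal (r - a + a) \<le> valD Q (emb Q ?f * e0)"
    using D.val_mult_ge[of "ereal (r - a)" "emb Q ?f" "ereal a" e0] a by simp
  then have r: "ereal r \<le> valD Q (emb Q ?f * e0)"
    by simp
  have "X (emb Q ?f * e0) = ?f * X e0"
    using X e0_E unfolding realizes_def by blast
  also have "\<dots> = x"
    using X0 by (simp add: mult.assoc)
  finally have "X (emb Q ?f * e0) = x" .
  then have "\<phi> (1 + emb Q ?f * e0) = \<psi> x"
    using Xr[OF _ r] e0_E by (simp add: mult_E)
  then show "\<exists>f. ereal r \<le> valD Q (emb Q f * e0) \<and> \<phi> (1 + emb Q f * e0) \<noteq> 1"
    using r x(2) by metis
qed

end

section \<open>Double cosets of T and the units\<close>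

context quaternion_torus
begin

lemma unramified_torus_val:
  assumes "unramified Q (E - {0})" "t \<in> E - {0}"
  obtains n :: int where "valD Q t = ereal (of_int n)"
proof -
  have "valD Q t \<in> fval Q ` (UNIV - {0})"
    using assms unfolding unramified_def by blast
  then obtain x where x: "x \<noteq> 0" "valD Q t = fval Q x"
    by auto
  then show thesis
    using F.val_int[OF x(1)] that by auto
qed

text \<open>If \<sigma> had integral valuation, so would E and its complement, and then all nonzero
  elements of D by \<open>valD_eq_min\<close>; but \<open>qj\<close> has valuation 1/2.\<close>

lemma unramified_sigma_val:
  assumes U: "unramified Q (E - {0})"
  shows "valD Q \<sigma> \<noteq> ereal (of_int n)"
proof
  assume s: "valD Q \<sigma> = ereal (of_int n)"
  define I where "I = insert \<infinity> (range (\<lambda>m::int. ereal (of_int m)))"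
  have IE: "valD Q z \<in> I" if z: "z \<in> E" for z
  proof (cases "z = 0")
    case False
    then have "z \<in> E - {0}"
      using z by simp
    then obtain m :: int where "valD Q z = ereal (of_int m)"
      using unramified_torus_val[OF U] by blast
    then show ?thesis
      by (simp add: I_def)
  qed (simp add: I_def)
  have IP: "valD Q y \<in> I" if y: "y \<in> perp" for y
  proof -
    have "y * inverse \<sigma> \<in> E"
      by (intro perp_mult_perp y inverse_perp sigma_perp)
    then have i: "valD Q (y * inverse \<sigma>) \<in> I"
      by (rule IE)
    have "valD Q y = valD Q (y * inverse \<sigma>) + valD Q \<sigma>"
      unfolding valD_mult[symmetric] using sigma_neq_zero by (simp add: mult.assoc)
    then show ?thesis
      using i unfolding s by (auto simp: I_def simp flip: of_int_add)
  qed
  have "ereal (1 / 2) = min (valD Q (pr0 (qj Q))) (valD Q (pr1 (qj Q)))"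
    by (rule trans[OF valD_qj[symmetric] valD_eq_min])
  moreover have "valD Q (pr0 (qj Q)) \<in> I" "valD Q (pr1 (qj Q)) \<in> I"
    by (rule IE[OF pr0_in_E], rule IP[OF pr1_in_perp])
  ultimately have "ereal (1 / 2) \<in> I"
    by (simp add: min_def split: if_splits)
  then obtain m :: int where "ereal (1 / 2) = ereal (of_int m)"
    by (auto simp: I_def)
  then have "1 = 2 * m"
    by (simp add: field_simps)
  then show False
    by presburger
qed

lemma unit_quotient:
  assumes "t \<noteq> 0" "valD Q t = valD Q g"
  shows "inverse t * g \<in> OD_units Q"
proof -
  obtain a where "valD Q t = ereal a"
    using D.val_real[OF assms(1)] .
  then have "valD Q (inverse t * g) = 0"
    using assms D.val_inverse[OF assms(1)] by (simp add: valD_mult zero_ereal_def)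
  then show ?thesis
    by (simp add: OD_units_iff)
qed

lemma scalar_of_val:
  obtains t where "t \<in> E - {0}" "valD Q t = ereal (of_int n)"
proof -
  obtain x where "x \<noteq> 0" "fval Q x = ereal (of_int n)"
    using F.val_all_ints[of n] by blast
  then show thesis
    by (intro that[of "emb Q x"]) simp_all
qed

text \<open>T times the units contains all elements of integral valuation. The inverse of \<sigma>
  has half-integral valuation and accounts for the others.\<close>

lemma unramified_cover:
  assumes U: "unramified Q (E - {0})" and g: "g \<noteq> 0"
  shows "(\<exists>t\<in>E - {0}. \<exists>k\<in>OD_units Q. g = t * k) \<or> (\<exists>t\<in>E - {0}. \<exists>k\<in>OD_units Q. g = t * inverse \<sigma> * k)"
proof -
  obtain n :: int where n: "valD Q g = ereal (of_int n / 2)"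
    using valD_half_int[OF g] .
  obtain m :: int where m: "valD Q (inverse \<sigma>) = ereal (of_int m / 2)"
    using valD_half_int[of "inverse \<sigma>"] sigma_neq_zero by auto
  have "valD Q \<sigma> = ereal (- (of_int m / 2))"
    using m D.val_inverse[of "inverse \<sigma>"] sigma_neq_zero by simp
  then have odd_m: "odd m"
    using unramified_sigma_val[OF U, of "- (m div 2)"] by (auto elim!: evenE)
  show ?thesis
  proof (cases "even n")
    case True
    obtain t where t: "t \<in> E - {0}" "valD Q t = ereal (of_int (n div 2))"
      using scalar_of_val[of "n div 2"] .
    have "inverse t * g \<in> OD_units Q"
      using True n t by (intro unit_quotient) (auto elim!: evenE)
    moreover have "g = t * (inverse t * g)"
      using t(1) by (simp flip: mult.assoc)
    ultimately show ?thesis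
      using t(1) by blast
  next
    case False
    then have "even (n - m)"
      using odd_m by simp
    then obtain l where l: "n - m = 2 * l" ..
    then have nm: "real_of_int n = real_of_int m + 2 * real_of_int l"
      by (metis add_diff_cancel_left' add.commute diff_add_cancel of_int_add of_int_mult of_int_numeral)
    obtain t where t: "t \<in> E - {0}" "valD Q t = ereal (of_int l)"
      using scalar_of_val[of l] .
    have "inverse (t * inverse \<sigma>) * g \<in> OD_units Q"
      using t sigma_neq_zero by (intro unit_quotient) (simp_all add: valD_mult m n nm add_divide_distrib)
    moreover have "g = (t * inverse \<sigma>) * (inverse (t * inverse \<sigma>) * g)"
      using t(1) sigma_neq_zero by (simp flip: mult.assoc)
    ultimately show ?thesis
      using t(1) by blast
  qed
qed

text \<open>Ramification puts an element of half-integral valuation into E, so T meets every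
  valuation of D.\<close>

lemma ramified_cover:
  assumes U: "ramified Q (E - {0})" and g: "g \<noteq> 0"
  shows "\<exists>t\<in>E - {0}. \<exists>k\<in>OD_units Q. g = t * k"
proof -
  have "fval Q ` (UNIV - {0}) \<subseteq> valD Q ` (E - {0})"
  proof
    fix v assume "v \<in> fval Q ` (UNIV - {0})"
    then obtain x where "x \<noteq> 0" "v = valD Q (emb Q x)"
      by auto
    then show "v \<in> valD Q ` (E - {0})"
      by (intro image_eqI[of _ _ "emb Q x"]) simp_all
  qed
  then have "\<not> valD Q ` (E - {0}) \<subseteq> fval Q ` (UNIV - {0})"
    using U unfolding unramified_def by (meson equalityI)
  then obtain v where v: "v \<in> valD Q ` (E - {0})" "v \<notin> fval Q ` (UNIV - {0})"
    by (meson subsetI)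
  obtain u where "v = valD Q u" and u: "u \<in> E - {0}"
    using v(1) by (rule imageE)
  then have u: "u \<in> E - {0}" "valD Q u \<notin> fval Q ` (UNIV - {0})"
    using v(2) by simp_all
  obtain m :: int where m: "valD Q u = ereal (of_int m / 2)"
    using valD_half_int[of u] u(1) by blast
  have odd_m: "odd m"
  proof
    assume "even m"
    then obtain l where "m = 2 * l" ..
    moreover obtain x where "x \<noteq> 0" "fval Q x = ereal (of_int l)"
      using F.val_all_ints[of l] by blast
    ultimately show False
      using u(2) m by (auto intro!: image_eqI[of _ _ x])
  qed
  obtain n :: int where n: "valD Q g = ereal (of_int n / 2)"
    using valD_half_int[OF g] .
  obtain t where t: "t \<in> E - {0}" "valD Q t = valD Q g"
  proof (cases "even n")
    case True
    then obtain l where "n = 2 * l" ..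
    then show thesis
      using scalar_of_val[of l] that n by auto
  next
    case False
    then have "even (n - m)"
      using odd_m by simp
    then obtain l where "n - m = 2 * l" ..
    then have "n = m + 2 * l"
      by simp
    then have nm: "real_of_int n = real_of_int m + 2 * real_of_int l"
      by simp
    obtain t where t: "t \<in> E - {0}" "valD Q t = ereal (of_int l)"
      using scalar_of_val[of l] .
    show thesis
      by (rule that[of "t * u"]) (use t u(1) in \<open>simp_all add: mult_E valD_mult m n nm add_divide_distrib\<close>)
  qed
  have "inverse t * g \<in> OD_units Q" "g = t * (inverse t * g)"
    using unit_quotient[of t g] t by (simp_all flip: mult.assoc)
  then show ?thesis
    using t(1) by blast
qed

end

theorem proposition7p4:
  fixes Q :: "('f::field, 'd::division_ring) quat_alg"
    and p :: nat
    and \<kappa> :: "complex \<Rightarrow> int"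
    and \<psi> :: "'f \<Rightarrow> complex"
    and \<psi>ext :: "'d set \<Rightarrow> 'd \<Rightarrow> complex"
    and \<Psi> :: "'d datum"
    and R :: "('d, 'v::ab_group_add) rep"
    and Rbar :: "('d, 'w::ab_group_add) rep"
  assumes "quaternion_division_algebra Q"
    and "prime p" and "p \<noteq> 2" and "0 < fval Q (of_nat p)"
    and "\<kappa> \<in> iso (mu_group p) (integer_mod_group p)"
    and "additive_character Q \<psi>"
    and "\<And>E. quadratic_subfield Q E \<Longrightarrow> extends_character Q \<psi> E (\<psi>ext E)"
    and "is_datum Q \<psi> \<Psi>"
    and "is_rho Q p \<kappa> \<psi> \<psi>ext \<Psi> R"
  shows "(unramified Q (torus \<Psi>) \<longrightarrow> is_rho Q p \<kappa> \<psi> \<psi>ext (conj_datum Q \<Psi>) Rbar \<longrightarrow>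
            rep_iso (Dgrp (OD_units Q)) (pi_rep Q \<Psi> R)
              (rep_sum (ind Q (OD_units Q) (T0Ds Q \<Psi>) R)
                       (ind Q (OD_units Q) (T0Ds Q \<Psi>) Rbar)) \<and>
            irreducible_rep (Dgrp (OD_units Q)) (ind Q (OD_units Q) (T0Ds Q \<Psi>) R) \<and>
            irreducible_rep (Dgrp (OD_units Q)) (ind Q (OD_units Q) (T0Ds Q \<Psi>) Rbar) \<and>
            \<not> rep_iso (Dgrp (OD_units Q))
                 (ind Q (OD_units Q) (T0Ds Q \<Psi>) R) (ind Q (OD_units Q) (T0Ds Q \<Psi>) Rbar)) \<and>
         (ramified Q (torus \<Psi>) \<longrightarrow>
            rep_iso (Dgrp (OD_units Q)) (pi_rep Q \<Psi> R)
              (ind Q (OD_units Q) (T0Ds Q \<Psi>) R) \<and>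
            irreducible_rep (Dgrp (OD_units Q)) (ind Q (OD_units Q) (T0Ds Q \<Psi>) R))"
proof -
  interpret A: tame_quaternion_algebra Q p
    using assms(1-4) by (simp add: tame_quaternion_algebra_def tame_quaternion_algebra_axioms_def)
  note datum = assms(8)[unfolded is_datum_def]
  obtain E where E: "quadratic_subfield Q E" and T: "torus \<Psi> = E - {0}"
    using datum unfolding maximal_torus_def by blast
  have r: "0 < depth \<Psi>" and eta: "quasi_character Q Dunits (twisting \<Psi>)"
    and qc: "quasi_character Q (E - {0}) (qchar \<Psi>)" "has_depth Q (E - {0}) (qchar \<Psi>) (depth \<Psi>)"
    and gen: "generic_character Q \<psi> (E - {0}) (qchar \<Psi>) (depth \<Psi>)"
    using datum unfolding T by blast+
  obtain e0 where e0: "e0 \<in> E" "e0 \<noteq> 0" "qconj Q e0 = - e0" "0 \<le> valD Q e0" "valD Q e0 \<le> ereal (1 / 2)"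
    using A.normalized_pure[OF E] .
  obtain R0 where R0: "is_rho_tilde Q p \<kappa> \<psi> \<psi>ext (E - {0}) (qchar \<Psi>) (depth \<Psi>) R0" "R = twist (twisting \<Psi>) R0"
    using assms(9) unfolding is_rho_def T by blast
  have "0 \<in> E"
    using E unfolding quadratic_subfield_def by (metis diff_self rangeI subsetD)
  then have tf: "torus_field (E - {0}) = E"
    by (auto simp: torus_field_def)
  \<comment> \<open>The data of the theorem contain no \<sigma>. The one hidden in R serves, also
    for Rbar, whose own choice is absorbed by \<open>rho_tilde_representation\<close>.\<close>
  obtain \<sigma> where \<sigma>: "conj_element Q E \<sigma>"
    using R0(1) unfolding is_rho_tilde_def tf Let_def by blast
  interpret B: torus_depth Q p E e0 \<sigma> "depth \<Psi>"
    by unfold_locales (rule E e0 \<sigma> r)+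
  interpret C: depth_character Q p E e0 \<sigma> "depth \<Psi>" "qchar \<Psi>"
    by (rule B.datum_depth_character[OF qc assms(6) gen])
  obtain S where R1: "B.J_representation (qchar \<Psi>) R0" "B.weil_action (qchar \<Psi>) R0 S"
    using B.rho_tilde_representation[OF assms(5,6) assms(7)[OF E] R0(1) C.phi_one] .
  have eqs: "pi_rep Q \<Psi> R = cind Q Dunits C.HT R" "T0Ds Q \<Psi> = C.H0"
    by (simp_all only: pi_rep_def TDs_def T0Ds_def T)
  show ?thesis
    unfolding eqs T
  proof (intro conjI[OF impI[OF impI] impI])
    assume U: "unramified Q (E - {0})" and "is_rho Q p \<kappa> \<psi> \<psi>ext (conj_datum Q \<Psi>) Rbar"
    then obtain R0' where R0': "is_rho_tilde Q p \<kappa> \<psi> \<psi>ext (E - {0}) (\<lambda>z. qchar \<Psi> (qconj Q z)) (depth \<Psi>) R0'"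
      "Rbar = twist (twisting \<Psi>) R0'"
      unfolding is_rho_def conj_datum_def by (auto simp: T)
    obtain S' where R1': "B.J_representation (\<lambda>z. qchar \<Psi> (qconj Q z)) R0'"
      "B.weil_action (\<lambda>z. qchar \<Psi> (qconj Q z)) R0' S'"
      by (rule B.rho_tilde_representation[OF assms(5,6) assms(7)[OF E] R0'(1)]) (simp_all add: C.phi_one)
    \<comment> \<open>An unramified E has integral valuations, and the normalisation of
      \<open>e0\<close> then leaves only 0; the coordinates on the complement require
      \<open>e0\<close> to be a unit.\<close>
    obtain n :: int where n: "valD Q e0 = ereal (of_int n)"
      using B.unramified_torus_val[OF U, of e0] e0 by blast
    then have "0 \<le> real_of_int n" "real_of_int n \<le> 1 / 2"
      using e0(4,5) by simp_all
    then have "n = 0"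
      by linarith
    then have u: "valD Q e0 = 0"
      by (simp add: n)
    have sep: "valD Q t \<noteq> valD Q \<sigma>" if "t \<in> E - {0}" for t
      using B.unramified_torus_val[OF U that] B.unramified_sigma_val[OF U] by metis
    show "rep_iso (Dgrp (OD_units Q)) (cind Q Dunits C.HT R)
          (rep_sum (ind Q (OD_units Q) C.H0 R) (ind Q (OD_units Q) C.H0 Rbar)) \<and>
        irreducible_rep (Dgrp (OD_units Q)) (ind Q (OD_units Q) C.H0 R) \<and>
        irreducible_rep (Dgrp (OD_units Q)) (ind Q (OD_units Q) C.H0 Rbar) \<and>
        \<not> rep_iso (Dgrp (OD_units Q)) (ind Q (OD_units Q) C.H0 R) (ind Q (OD_units Q) C.H0 Rbar)"
      unfolding R0(2) R0'(2)
      by (rule C.unramified_restriction[OF R1(1) R1'(1) R1(2) R1'(2) eta u B.unramified_cover[OF U] sep])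
  next
    assume U: "ramified Q (E - {0})"
    show "rep_iso (Dgrp (OD_units Q)) (cind Q Dunits C.HT R) (ind Q (OD_units Q) C.H0 R) \<and>
        irreducible_rep (Dgrp (OD_units Q)) (ind Q (OD_units Q) C.H0 R)"
      unfolding R0(2) by (rule C.ramified_restriction[OF R1(1) eta B.ramified_cover[OF U]])
  qed
qed

end
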